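(* Let $\Omega=\mathbb R^d$ or $\mathbb T^d$. Suppose the initial distribution $f\in L^1(\Omega)$ (a probability density) and the interaction $K\in L^\infty_\delta(\Omega^2)$. Let $(g^i_j)_{i\ge0,j\ge1}$ be the family described in the context and set, for $i\ge0$, $j\ge1$, $$f^i_j:=\sum_{\pi\vdash[j]}\ \sum_{\substack{(i_P)_{P\in\pi}\\ \sum i_P=i}}\ \prod_{P\in\pi}g^{i_P}_P .$$ Then $$\partial_tf^i_j-\Delta f^i_j=-\sum_{k=1}^j\nabla_{x_k}\cdot\int K(x_k,x_* )f^i_{j+1}(x,x_* )\,dx_*-\sum_{k,\ell=1}^j\nabla_{x_k}\cdot\big(K(x_k,x_\ell)f^{i-1}_j\big)+j\sum_{k=1}^j\nabla_{x_k}\cdot\int K(x_k,x_* )f^{i-1}_{j+1}(x,x_* )\,dx_*,$$ with the convention $f^{-1}_j=0$, and the initial data are $f^0_j(0,\cdot)=f^{\otimes j}$ and $f^i_j(0,\cdot)=0$ for $i\ge1$. In particular $f^0_j=\rho^{\otimes j}$, where $\rho$ is the unique solution of the McKean--Vlasov equation $$\partial_t\rho-\Delta\rho+\nabla\cdot\Big(\int K(x,x_* )\rho(t,x_* )\,dx_*\,\rho(t,x)\Big)=0,\qquad\rho(0,\cdot)=f.$$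
   Context: $K:\Omega^2\to\mathbb R^d$ is given together with its values on the diagonal, and $\|K\|_{L^\infty_\delta(\Omega^2)}:=\|K(x,y)\|_{L^\infty(\Omega^2)}+\|K(x,x)\|_{L^\infty(\Omega)}$; $K\in L^\infty_\delta(\Omega^2)$ means this is finite. $\pi\vdash A$ means $\pi$ is a partition of the set $A$; the inner sum is over all choices of integers $i_P\ge0$, $P\in\pi$, with $\sum_{P\in\pi}i_P=i$. Notation. $[j]=\{1,\dots,j\}$; $*$ is an index distinct from all integers; $A-B$ is set difference. The functions $g^i_j$ are exchangeable, and for a finite index set $P$, $g^i_P(x)=g^i_{|P|}((x_p)_{p\in P})$. For $F:\Omega^P\to\mathbb R$ and $k,\ell\in P-\{*\}$, $S_{k,\ell}F:=\nabla_{x_k}\cdot(K(x_k,x_\ell)F)$; if $*\in P$ then $H_kF:=\nabla_{x_k}\cdot\int K(x_k,x_* )F\,dx_*$, a function of $(x_p)_{p\in P-\{*\}}$. Conventions: $g^{-1}_j=0$, $g^i_0=0$. The family $g^i_j$: it is the unique family of exchangeable functions $g^i_j\in C^0_{loc}([0,\infty),L^1(\Omega^j))$ with $g^i_j=0$ whenever $j>i+1$, with $g^0_1(0,\cdot)=f$ and $g^i_j(0,\cdot)=0$ for $(i,j)\neq(0,1)$, solving the following hierarchy. For $i\ge1$, $j\ge1$: $$\begin{aligned} &\partial_t g^i_j-\Delta g^i_j+\sum_{k=1}^jH_k\big(g^0_{\{k\}}g^i_{[j]\cup\{*\}-\{k\}}\big)+\sum_{k=1}^jH_k\big(g^i_{[j]}g^0_{\{*\}}\big)\\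 &=-\sum_{k=1}^jH_kg^i_{[j]\cup\{*\}}-\sum_{k=1}^j\sum_{W\subseteq[j]-\{k\}}\sum_{m=1}^{i-1}H_k\big(g^m_{W\cup\{k\}}g^{i-m}_{[j]\cup\{*\}-W-\{k\}}\big)\\ &\quad+j\sum_{k=1}^jH_kg^{i-1}_{[j]\cup\{*\}}+\sum_{k=1}^j\sum_{W\subseteq[j]-\{k\}}(j-1-|W|)\sum_{m=0}^{i-1}H_k\big(g^m_{W\cup\{k,*\}}g^{i-1-m}_{[j]-\{k\}-W}\big)\\ &\quad+j\sum_{k=1}^j\sum_{W\subseteq[j]-\{k\}}\sum_{m=0}^{i-1}H_k\big(g^m_{W\cup\{k\}}g^{i-1-m}_{[j]\cup\{*\}-W-\{k\}}\big)\\ &\quad+\sum_{k=1}^j\sum_{W\subseteq[j]-\{k\}}\sum_{R\subseteq[j]-\{k\}-W}(j-1-|W|-|R|)\sum_{m=0}^{i-1}\sum_{n=0}^{i-1-m}H_k\big(g^m_{W\cup\{k\}}g^n_{R\cup\{*\}}g^{i-1-m-n}_{[j]-R-W-\{k\}}\big)\\ &\quad-\sum_{k,\ell=1}^jS_{k,\ell}g^{i-1}_j-\sum_{\substack{k,\ell=1\\k\ne\ell}}^j\sum_{W\subseteq[j]-\{k,\ell\}}\sum_{m=0}^{i-1}S_{k,\ell}\big(g^m_{W\cup\{k\}}g^{i-1-m}_{[j]-\{k\}-W}\big). \end{aligned}$$ For $i=0$, $j\ge1$: $$\partial_tg^0_j-\Delta g^0_j=-\sum_{k=1}^jH_kg^0_{[j]\cup\{*\}}-\sum_{k=1}^j\sum_{W\subseteq[j]-\{k\}}H_k\big(g^0_{W\cup\{k\}}g^0_{[j]\cup\{*\}-W-\{k\}}\big).$$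 (Existence and uniqueness of this family may be assumed.) All equations are understood in the mild sense: $\partial_th-\Delta h=\nabla\cdot G$ means $h(t)=\Phi_t*h(0)+\int_0^t\nabla\Phi_{t-s}*G(s)\,ds$, with $\Phi$ the heat kernel. *)

theory Defs
  imports "HOL-Probability.Probability"
begin

text \<open>
  The torus is represented by its fundamental domain \<open>[0,1)\<^sup>d\<close>, carrying Lebesgue measure; a
  function on the torus is a function on this cube. The group structure of the torus enters
  only through convolutions, and there only through the periodised heat kernel, so the
  differences of points below can be formed in \<open>\<real>\<^sup>d\<close>.
\<close>

datatype domain = Whole_Space | Torus

fun omega :: "domain \<Rightarrow> (real^'d) measure" where
  "omega Whole_Space = lborel"
| "omega Torus = restrict_space lborel {x. \<forall>i. 0 \<le> x $ i \<and> x $ i < 1}"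

definition gauss :: "real \<Rightarrow> real^'d \<Rightarrow> real" where
  "gauss t z = (4 * pi * t) powr (- real CARD('d) / 2) * exp (- (norm z)\<^sup>2 / (4 * t))"

fun heat :: "domain \<Rightarrow> real \<Rightarrow> real^'d \<Rightarrow> real" where
  "heat Whole_Space t z = gauss t z"
| "heat Torus t z = (\<Sum>\<^sub>\<infinity>n\<in>(UNIV :: (int^'d) set). gauss t (z + (\<chi> i. of_int (n $ i))))"

text \<open>
  Particles are labelled by \<open>1, \<dots>, j\<close>, so that a point of \<open>\<Omega>\<^sup>j\<close> is a function on \<open>{1..j}\<close>
  and the label \<open>0\<close> is free to play the role of the extra index \<open>*\<close>.
\<close>

definition omega_pow :: "domain \<Rightarrow> nat \<Rightarrow> (nat \<Rightarrow> real^'d) measure" where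
  "omega_pow \<Omega> j = (\<Pi>\<^sub>M k\<in>{1..j}. omega \<Omega>)"

abbreviation (input) star :: nat where
  "star \<equiv> 0"

definition heat_pow :: "domain \<Rightarrow> nat \<Rightarrow> real \<Rightarrow> (nat \<Rightarrow> real^'d) \<Rightarrow> real" where
  "heat_pow \<Omega> j t z = (\<Prod>k\<in>{1..j}. heat \<Omega> t (z k))"

definition gradient :: "(real^'d \<Rightarrow> real) \<Rightarrow> real^'d \<Rightarrow> real^'d" where
  "gradient F z = (\<chi> i. frechet_derivative F (at z) (axis i 1))"

definition grad_heat_pow ::
    "domain \<Rightarrow> nat \<Rightarrow> real \<Rightarrow> nat \<Rightarrow> (nat \<Rightarrow> real^'d) \<Rightarrow> real^'d" where
  "grad_heat_pow \<Omega> j t k z = gradient (\<lambda>v. heat_pow \<Omega> j t (z(k := v))) (z k)"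

text \<open>
  An element of \<open>L\<^sup>1(\<Omega>\<^sup>j)\<close> is given by an arbitrary Borel representative, and equalities in
  \<open>L\<^sup>1(\<Omega>\<^sup>j)\<close> are stated as almost everywhere equalities, separately at each time.
\<close>

definition C0_L1 :: "domain \<Rightarrow> nat \<Rightarrow> (real \<Rightarrow> (nat \<Rightarrow> real^'d) \<Rightarrow> real) \<Rightarrow> bool" where
  "C0_L1 \<Omega> j h \<longleftrightarrow>
     (\<forall>t\<ge>0. integrable (omega_pow \<Omega> j) (h t)) \<and>
     (\<forall>t\<ge>0. ((\<lambda>s. \<integral>x. \<bar>h s x - h t x\<bar> \<partial>omega_pow \<Omega> j) \<longlongrightarrow> 0) (at t within {0..}))"

definition Linf_delta_norm :: "domain \<Rightarrow> (real^'d \<Rightarrow> real^'d \<Rightarrow> real^'d) \<Rightarrow> ennreal" where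
  "Linf_delta_norm \<Omega> K =
     esssup (omega \<Omega> \<Otimes>\<^sub>M omega \<Omega>) (\<lambda>(x, y). ennreal (norm (K x y)))
     + esssup (omega \<Omega>) (\<lambda>x. ennreal (norm (K x x)))"

definition Linf_delta :: "domain \<Rightarrow> (real^'d \<Rightarrow> real^'d \<Rightarrow> real^'d) \<Rightarrow> bool" where
  "Linf_delta \<Omega> K \<longleftrightarrow>
     (\<lambda>(x, y). K x y) \<in> borel_measurable (omega \<Omega> \<Otimes>\<^sub>M omega \<Omega>) \<and> Linf_delta_norm \<Omega> K < \<infinity>"

text \<open>
  \<open>mild_solution \<Omega> j h G\<close> states \<open>\<partial>\<^sub>t h - \<Delta> h = \<nabla> \<cdot> G = \<Sum>\<^sub>k \<nabla>\<^bsub>x\<^sub>k\<^esub> \<cdot> G\<^sub>k\<close> on \<open>\<Omega>\<^sup>j\<close> in the mild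
  sense, where \<open>G t k\<close> is the component of the flux for the \<open>k\<close>-th particle. The initial value
  is \<open>h 0\<close>. For \<open>s < t\<close>, the value at \<open>x\<close> of the convolution \<open>\<nabla>\<Phi>\<^bsub>t-s\<^esub> * G(s)\<close> does not depend on
  the representative of \<open>G(s)\<close>, so the time integral can be taken pointwise in \<open>x\<close>. The
  integrability clauses say that the integrals in the formula exist.
\<close>

definition duhamel ::
    "domain \<Rightarrow> nat \<Rightarrow> (real \<Rightarrow> nat \<Rightarrow> (nat \<Rightarrow> real^'d) \<Rightarrow> real^'d)
      \<Rightarrow> real \<Rightarrow> (nat \<Rightarrow> real^'d) \<Rightarrow> real \<Rightarrow> real" where
  "duhamel \<Omega> j G t x s =
     (\<Sum>k\<in>{1..j}. \<integral>y. grad_heat_pow \<Omega> j (t - s) k (\<lambda>l. x l - y l) \<bullet> G s k y \<partial>omega_pow \<Omega> j)"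

definition mild_solution ::
    "domain \<Rightarrow> nat \<Rightarrow> (real \<Rightarrow> (nat \<Rightarrow> real^'d) \<Rightarrow> real)
      \<Rightarrow> (real \<Rightarrow> nat \<Rightarrow> (nat \<Rightarrow> real^'d) \<Rightarrow> real^'d) \<Rightarrow> bool" where
  "mild_solution \<Omega> j h G \<longleftrightarrow>
     (\<forall>t\<ge>0. integrable (omega_pow \<Omega> j) (h t)) \<and>
     (\<forall>t\<ge>0. \<forall>k\<in>{1..j}. integrable (omega_pow \<Omega> j) (G t k)) \<and>
     (\<forall>t>0. AE x in omega_pow \<Omega> j.
        set_integrable lborel {0..<t} (duhamel \<Omega> j G t x) \<and>
        h t x = (\<integral>y. heat_pow \<Omega> j t (\<lambda>l. x l - y l) * h 0 y \<partial>omega_pow \<Omega> j)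
                + (LINT s:{0..<t}|lborel. duhamel \<Omega> j G t x s))"

text \<open>
  \<open>block g i P t\<close> is \<open>g\<^sup>i\<^sub>P(t, \<cdot>)\<close>, including the convention \<open>g\<^sup>i\<^sub>0 = 0\<close>. The variables
  \<open>(x\<^sub>p)\<close>, \<open>p \<in> P\<close>, are inserted in increasing order of \<open>p\<close>; for exchangeable \<open>g\<close> the
  order is irrelevant.
\<close>

definition block ::
    "(nat \<Rightarrow> nat \<Rightarrow> real \<Rightarrow> (nat \<Rightarrow> real^'d) \<Rightarrow> real)
      \<Rightarrow> nat \<Rightarrow> nat set \<Rightarrow> real \<Rightarrow> (nat \<Rightarrow> real^'d) \<Rightarrow> real" where
  "block g i P t x =
     (if P = {} then 0
      else g i (card P) t (\<lambda>n\<in>{1..card P}. x (sorted_list_of_set P ! (n - 1))))"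

text \<open>
  The vector fields whose divergences in \<open>x\<^sub>k\<close> are \<open>S\<^bsub>k,l\<^esub> F\<close> and \<open>H\<^sub>k F\<close>.
\<close>

definition S_flux ::
    "(real^'d \<Rightarrow> real^'d \<Rightarrow> real^'d) \<Rightarrow> nat \<Rightarrow> nat
      \<Rightarrow> ((nat \<Rightarrow> real^'d) \<Rightarrow> real) \<Rightarrow> (nat \<Rightarrow> real^'d) \<Rightarrow> real^'d" where
  "S_flux K k l F x = F x *\<^sub>R K (x k) (x l)"

definition H_flux ::
    "domain \<Rightarrow> (real^'d \<Rightarrow> real^'d \<Rightarrow> real^'d) \<Rightarrow> nat
      \<Rightarrow> ((nat \<Rightarrow> real^'d) \<Rightarrow> real) \<Rightarrow> (nat \<Rightarrow> real^'d) \<Rightarrow> real^'d" where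
  "H_flux \<Omega> K k F x = (\<integral>y. F (x(star := y)) *\<^sub>R K (x k) y \<partial>omega \<Omega>)"

text \<open>
  The \<open>k\<close>-th component of the flux in the equation for \<open>g\<^sup>i\<^sub>j\<close> at a fixed time, with \<open>\<gamma> i P\<close>
  standing for \<open>g\<^sup>i\<^sub>P\<close>. In the second equation the first two terms are those which
  belong to the linearised operator on the left-hand side, hence their sign.
\<close>

fun hierarchy_flux ::
    "domain \<Rightarrow> (real^'d \<Rightarrow> real^'d \<Rightarrow> real^'d) \<Rightarrow> (nat \<Rightarrow> nat set \<Rightarrow> (nat \<Rightarrow> real^'d) \<Rightarrow> real)
      \<Rightarrow> nat \<Rightarrow> nat \<Rightarrow> nat \<Rightarrow> (nat \<Rightarrow> real^'d) \<Rightarrow> real^'d" where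
  "hierarchy_flux \<Omega> K \<gamma> 0 j k x =
     - H_flux \<Omega> K k (\<gamma> 0 ({1..j} \<union> {star})) x
     - (\<Sum>W\<in>Pow ({1..j} - {k}).
          H_flux \<Omega> K k (\<lambda>z. \<gamma> 0 (W \<union> {k}) z * \<gamma> 0 ({1..j} \<union> {star} - W - {k}) z) x)"
| "hierarchy_flux \<Omega> K \<gamma> (Suc i') j k x = (let i = Suc i' in
     - H_flux \<Omega> K k (\<lambda>z. \<gamma> 0 {k} z * \<gamma> i ({1..j} \<union> {star} - {k}) z) x
     - H_flux \<Omega> K k (\<lambda>z. \<gamma> i {1..j} z * \<gamma> 0 {star} z) x
     - H_flux \<Omega> K k (\<gamma> i ({1..j} \<union> {star})) x
     - (\<Sum>W\<in>Pow ({1..j} - {k}). \<Sum>m\<in>{1..i - 1}.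
          H_flux \<Omega> K k (\<lambda>z. \<gamma> m (W \<union> {k}) z * \<gamma> (i - m) ({1..j} \<union> {star} - W - {k}) z) x)
     + real j *\<^sub>R H_flux \<Omega> K k (\<gamma> (i - 1) ({1..j} \<union> {star})) x
     + (\<Sum>W\<in>Pow ({1..j} - {k}). (real j - 1 - real (card W)) *\<^sub>R (\<Sum>m\<in>{0..i - 1}.
          H_flux \<Omega> K k (\<lambda>z. \<gamma> m (W \<union> {k, star}) z * \<gamma> (i - 1 - m) ({1..j} - {k} - W) z) x))
     + real j *\<^sub>R (\<Sum>W\<in>Pow ({1..j} - {k}). \<Sum>m\<in>{0..i - 1}.
          H_flux \<Omega> K k
            (\<lambda>z. \<gamma> m (W \<union> {k}) z * \<gamma> (i - 1 - m) ({1..j} \<union> {star} - W - {k}) z) x)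
     + (\<Sum>W\<in>Pow ({1..j} - {k}). \<Sum>R\<in>Pow ({1..j} - {k} - W).
          (real j - 1 - real (card W) - real (card R)) *\<^sub>R
          (\<Sum>m\<in>{0..i - 1}. \<Sum>n\<in>{0..i - 1 - m}.
             H_flux \<Omega> K k
               (\<lambda>z. \<gamma> m (W \<union> {k}) z * \<gamma> n (R \<union> {star}) z
                    * \<gamma> (i - 1 - m - n) ({1..j} - R - W - {k}) z) x))
     - (\<Sum>l\<in>{1..j}. S_flux K k l (\<gamma> (i - 1) {1..j}) x)
     - (\<Sum>l\<in>{1..j} - {k}. \<Sum>W\<in>Pow ({1..j} - {k, l}). \<Sum>m\<in>{0..i - 1}.
          S_flux K k l (\<lambda>z. \<gamma> m (W \<union> {k}) z * \<gamma> (i - 1 - m) ({1..j} - {k} - W) z) x))"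

definition exchangeable ::
    "domain \<Rightarrow> nat \<Rightarrow> ((nat \<Rightarrow> real^'d) \<Rightarrow> real) \<Rightarrow> bool" where
  "exchangeable \<Omega> j F \<longleftrightarrow>
     (\<forall>\<sigma>. \<sigma> permutes {1..j} \<longrightarrow> (AE x in omega_pow \<Omega> j. F (x \<circ> \<sigma>) = F x))"

definition hierarchy_family ::
    "domain \<Rightarrow> (real^'d \<Rightarrow> real^'d \<Rightarrow> real^'d) \<Rightarrow> (real^'d \<Rightarrow> real)
      \<Rightarrow> (nat \<Rightarrow> nat \<Rightarrow> real \<Rightarrow> (nat \<Rightarrow> real^'d) \<Rightarrow> real) \<Rightarrow> bool" where
  "hierarchy_family \<Omega> K f g \<longleftrightarrow>
     (\<forall>i. \<forall>j\<ge>1.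
        C0_L1 \<Omega> j (g i j) \<and>
        (\<forall>t\<ge>0. exchangeable \<Omega> j (g i j t)) \<and>
        (j > i + 1 \<longrightarrow> (\<forall>t\<ge>0. AE x in omega_pow \<Omega> j. g i j t x = 0)) \<and>
        (AE x in omega_pow \<Omega> j. g i j 0 x = (if i = 0 \<and> j = 1 then f (x 1) else 0)) \<and>
        mild_solution \<Omega> j (g i j)
          (\<lambda>t. hierarchy_flux \<Omega> K (\<lambda>m P. block g m P t) i j))"

text \<open>
  The multi-indices \<open>(i\<^sub>P)\<close> are extensional functions on \<open>\<pi>\<close>, so that
  each is counted once.
\<close>

definition f_family ::
    "(nat \<Rightarrow> nat \<Rightarrow> real \<Rightarrow> (nat \<Rightarrow> real^'d) \<Rightarrow> real)
      \<Rightarrow> nat \<Rightarrow> nat \<Rightarrow> real \<Rightarrow> (nat \<Rightarrow> real^'d) \<Rightarrow> real" where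
  "f_family g i j t x =
     (\<Sum>\<pi>\<in>{\<pi>. partition_on {1..j} \<pi>}.
        \<Sum>a\<in>{a \<in> \<pi> \<rightarrow>\<^sub>E UNIV. (\<Sum>P\<in>\<pi>. a P) = i}. \<Prod>P\<in>\<pi>. block g (a P) P t x)"

text \<open>\<open>f_pred g i j\<close> is \<open>f\<^bsup>i-1\<^esup>\<^sub>j\<close>, with the convention \<open>f\<^bsup>-1\<^esup>\<^sub>j = 0\<close>.\<close>

definition f_pred ::
    "(nat \<Rightarrow> nat \<Rightarrow> real \<Rightarrow> (nat \<Rightarrow> real^'d) \<Rightarrow> real)
      \<Rightarrow> nat \<Rightarrow> nat \<Rightarrow> real \<Rightarrow> (nat \<Rightarrow> real^'d) \<Rightarrow> real" where
  "f_pred g i j t x = (if i = 0 then 0 else f_family g (i - 1) j t x)"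

text \<open>Functions on \<open>\<Omega>\<close> are read as functions on \<open>\<Omega>\<^sup>1\<close>.\<close>

definition McKean_Vlasov_solution ::
    "domain \<Rightarrow> (real^'d \<Rightarrow> real^'d \<Rightarrow> real^'d) \<Rightarrow> (real^'d \<Rightarrow> real)
      \<Rightarrow> (real \<Rightarrow> real^'d \<Rightarrow> real) \<Rightarrow> bool" where
  "McKean_Vlasov_solution \<Omega> K f \<rho> \<longleftrightarrow>
     C0_L1 \<Omega> 1 (\<lambda>t x. \<rho> t (x 1)) \<and>
     (AE x in omega \<Omega>. \<rho> 0 x = f x) \<and>
     mild_solution \<Omega> 1 (\<lambda>t x. \<rho> t (x 1))
       (\<lambda>t k x. - (\<rho> t (x 1) *\<^sub>R (\<integral>y. \<rho> t y *\<^sub>R K (x 1) y \<partial>omega \<Omega>)))"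

end

theory Submission
  imports Defs "HOL-Computational_Algebra.Formal_Power_Series"
begin

text \<open>
  A mild solution \<open>h\<close> with flux \<open>G\<close> is characterised pointwise: for every \<open>x\<close>, the function
  \<open>s \<mapsto> \<integral> \<Phi>\<^bsub>t-s\<^esub>(x - y) h(s, y) dy\<close> on \<open>[0, t)\<close> has derivative \<open>(\<nabla>\<Phi>\<^bsub>t-s\<^esub> * G(s))(x)\<close> and tends to \<open>h(t, x)\<close>
  as \<open>s \<rightarrow> t\<close>, for almost every \<open>x\<close>. Since the heat kernel of \<open>\<Omega>\<^sup>j\<close> is a product, tensor products of
  solutions are then handled by Leibniz' rule, and \<open>f\<^sup>i\<^sub>j\<close> solves a mild equation whose flux replaces, in
  each product over the blocks of a partition, one factor by its flux.

  With \<open>\<gamma>\<^sub>P = \<Sum>\<^sub>i g\<^sup>i\<^sub>P X\<^sup>i\<close> the family \<open>f\<close> becomes the partition sum \<open>\<Sum>\<^sub>\<pi> \<Prod>\<^sub>P \<gamma>\<^sub>P\<close> over power series, and the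
  hierarchy becomes one polynomial expression in \<open>\<gamma>\<close>, a multiplication by \<open>X\<close> taking the place of the shift from
  \<open>i - 1\<close> to \<open>i\<close>. Summing this expression over the partitions amounts to distinguishing the block that
  contains \<open>k\<close> and those that contain \<open>*\<close> or \<open>\<ell>\<close>; the weights \<open>j - 1 - |W| - |R|\<close> count the labels outside of
  these blocks.

  Uniqueness for the McKean--Vlasov equation follows from \<open>\<integral> |\<nabla>\<Phi>\<^sub>t| \<le> C t\<^bsup>-1/2\<^esup>\<close>, which makes the difference of
  two solutions a contraction on short time intervals.
\<close>

subsection \<open>Continuous curves in \<open>L\<^sup>1\<close>\<close>

text \<open>A mild equation holds only after integration in time and outside a null set that depends
  on the time, so it offers no product rule. Before the final time the kernel at time
  \<open>t - s\<close> is bounded and continuous and the flux is a continuous curve in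
  \<open>L1\<close>; hence the convolved solution is differentiable in \<open>s\<close> at every
  point, and null sets survive only in the limit of \<open>s\<close> to \<open>t\<close>. The price
  is that continuity in \<open>L1\<close> has to be carried along for every flux.

  The hierarchy is a single polynomial because blocks of order 0 with two or more labels vanish: in
  the full sum over \<open>m = 0, ..., i\<close> the extreme terms then reduce to the two terms of
  the linearised operator. The weights are absorbed by a count: each label lies in exactly one
  block, so weighting a block by its size and summing over all choices of the block multiplies the
  partition sum by the number of labels. Together with the explicit factor \<open>j\<close> this
  leaves the coefficient \<open>j\<close> in the equation for \<open>f\<close>.

  The constant in the gradient bound is 2 to the power \<open>d / 2\<close>, the cost of dominating
  the gradient of the kernel at time \<open>t\<close> by the kernel at time
  \<open>2 * t\<close>.\<close>

definition cont_L1 ::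
    "'a measure \<Rightarrow> (real \<Rightarrow> 'a \<Rightarrow> 'b::{banach, second_countable_topology}) \<Rightarrow> bool" where
  "cont_L1 N h \<longleftrightarrow>
     (\<forall>t\<ge>0. integrable N (h t)) \<and>
     (\<forall>t\<ge>0. ((\<lambda>s. \<integral>x. norm (h s x - h t x) \<partial>N) \<longlongrightarrow> 0) (at t within {0..}))"

lemma cont_L1_integrable: "cont_L1 N h \<Longrightarrow> 0 \<le> t \<Longrightarrow> integrable N (h t)"
  by (simp add: cont_L1_def)

lemma cont_L1_tendsto:
  "cont_L1 N h \<Longrightarrow> 0 \<le> t \<Longrightarrow> ((\<lambda>s. \<integral>x. norm (h s x - h t x) \<partial>N) \<longlongrightarrow> 0) (at t within {0..})"
  by (simp add: cont_L1_def)

text \<open>Any map of curves that is Lipschitz in the \<open>L1\<close> norms preserves continuity.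
  Multiplication by a bounded field, relabelling and integrating out the label \<open>star\<close>
  are all handled by naming one constant \<open>B\<close>.\<close>

lemma cont_L1_compare:
  assumes h: "cont_L1 N h" and int: "\<And>t. 0 \<le> t \<Longrightarrow> integrable N' (h' t)"
    and le: "\<And>s t. 0 \<le> s \<Longrightarrow> 0 \<le> t \<Longrightarrow>
      (\<integral>x. norm (h' s x - h' t x) \<partial>N') \<le> B * (\<integral>x. norm (h s x - h t x) \<partial>N)"
  shows "cont_L1 N' h'"
  unfolding cont_L1_def
proof (intro conjI allI impI)
  fix t :: real assume t: "0 \<le> t"
  show "integrable N' (h' t)" using int t by simp
  have "((\<lambda>s. B * (\<integral>x. norm (h s x - h t x) \<partial>N)) \<longlongrightarrow> B * 0) (at t within {0..})"
    by (intro tendsto_intros cont_L1_tendsto h t)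
  then show "((\<lambda>s. \<integral>x. norm (h' s x - h' t x) \<partial>N') \<longlongrightarrow> 0) (at t within {0..})"
    unfolding mult_zero_right
    by (rule Lim_null_comparison[rotated]) (simp add: eventually_at_filter le t)
qed

text \<open>Continuity of the norm yields a bound on compact time intervals, which makes the Duhamel
  integral absolutely convergent and supplies a constant in the uniqueness proof.\<close>

lemma cont_L1_norm_continuous:
  assumes h: "cont_L1 N h"
  shows "continuous_on {0..} (\<lambda>t. \<integral>x. norm (h t x) \<partial>N)"
  unfolding continuous_on_def
proof safe
  fix t :: real assume t: "0 \<le> t"
  have "norm ((\<integral>x. norm (h s x) \<partial>N) - (\<integral>x. norm (h t x) \<partial>N)) \<le> (\<integral>x. norm (h s x - h t x) \<partial>N)"
    if s: "0 \<le> s" for s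
  proof -
    have i: "integrable N (h s)" "integrable N (h t)" using h s t by (auto simp: cont_L1_def)
    then have "(\<integral>x. norm (h s x) \<partial>N) - (\<integral>x. norm (h t x) \<partial>N) = (\<integral>x. norm (h s x) - norm (h t x) \<partial>N)"
      by simp
    also have "norm \<dots> \<le> (\<integral>x. norm (norm (h s x) - norm (h t x)) \<partial>N)"
      by (rule integral_norm_bound)
    also have "\<dots> \<le> (\<integral>x. norm (h s x - h t x) \<partial>N)"
      using i by (intro integral_mono) (auto simp: norm_triangle_ineq3)
    finally show ?thesis .
  qed
  then have "\<forall>\<^sub>F s in at t within {0..}. norm ((\<integral>x. norm (h s x) \<partial>N) - (\<integral>x. norm (h t x) \<partial>N))
      \<le> (\<integral>x. norm (h s x - h t x) \<partial>N)"
    by (auto simp: eventually_at_filter)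
  from Lim_null_comparison[OF this cont_L1_tendsto[OF h t]]
  show "((\<lambda>t. \<integral>x. norm (h t x) \<partial>N) \<longlongrightarrow> (\<integral>x. norm (h t x) \<partial>N)) (at t within {0..})"
    by (simp add: Lim_null[symmetric])
qed

lemma tendsto_zero_atLeast_comparison:
  fixes d :: "real \<Rightarrow> real"
  assumes "\<And>s. 0 \<le> s \<Longrightarrow> 0 \<le> d s" "\<And>s. 0 \<le> s \<Longrightarrow> d s \<le> e s" "(e \<longlongrightarrow> 0) (at t within {0..})"
  shows "(d \<longlongrightarrow> 0) (at t within {0..})"
  using assms(3)
  by (rule Lim_null_comparison[rotated]) (simp add: eventually_at_filter assms)

lemma cont_L1_add:
  assumes "cont_L1 N h" "cont_L1 N h'"
  shows "cont_L1 N (\<lambda>t x. h t x + h' t x)"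
  unfolding cont_L1_def
proof (intro conjI allI impI)
  fix t :: real assume t: "0 \<le> t"
  show "integrable N (\<lambda>x. h t x + h' t x)" using assms t by (auto simp: cont_L1_def)
  have "((\<lambda>s. (\<integral>x. norm (h s x - h t x) \<partial>N) + (\<integral>x. norm (h' s x - h' t x) \<partial>N)) \<longlongrightarrow> 0 + 0)
      (at t within {0..})"
    by (intro tendsto_intros cont_L1_tendsto assms t)
  then have lim: "((\<lambda>s. (\<integral>x. norm (h s x - h t x) \<partial>N) + (\<integral>x. norm (h' s x - h' t x) \<partial>N)) \<longlongrightarrow> 0)
      (at t within {0..})"
    by simp
  have le: "(\<integral>x. norm (h s x + h' s x - (h t x + h' t x)) \<partial>N)
      \<le> (\<integral>x. norm (h s x - h t x) \<partial>N) + (\<integral>x. norm (h' s x - h' t x) \<partial>N)" if "0 \<le> s" for s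
  proof -
    have i: "integrable N (h s)" "integrable N (h t)" "integrable N (h' s)" "integrable N (h' t)"
      using assms that t by (auto simp: cont_L1_def)
    have "(\<integral>x. norm (h s x + h' s x - (h t x + h' t x)) \<partial>N)
      \<le> (\<integral>x. norm (h s x - h t x) + norm (h' s x - h' t x) \<partial>N)"
    proof (rule integral_mono)
      show "norm (h s x + h' s x - (h t x + h' t x)) \<le> norm (h s x - h t x) + norm (h' s x - h' t x)" for x
        by (rule norm_diff_triangle_ineq)
    qed (intro integrable_norm Bochner_Integration.integrable_diff Bochner_Integration.integrable_add i)+
    also have "\<dots> = (\<integral>x. norm (h s x - h t x) \<partial>N) + (\<integral>x. norm (h' s x - h' t x) \<partial>N)"
      by (intro Bochner_Integration.integral_add integrable_norm Bochner_Integration.integrable_diff i)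
    finally show ?thesis .
  qed
  show "((\<lambda>s. \<integral>x. norm (h s x + h' s x - (h t x + h' t x)) \<partial>N) \<longlongrightarrow> 0) (at t within {0..})"
    by (rule tendsto_zero_atLeast_comparison[OF _ le lim]) (rule Bochner_Integration.integral_nonneg norm_ge_zero | assumption)+
qed

lemma cont_L1_zero [simp]: "cont_L1 N (\<lambda>t x. 0)"
  by (simp add: cont_L1_def)

lemma cont_L1_sum:
  "(\<And>a. a \<in> A \<Longrightarrow> cont_L1 N (h a)) \<Longrightarrow> cont_L1 N (\<lambda>t x. \<Sum>a\<in>A. h a t x)"
  by (induction A rule: infinite_finite_induct) (auto intro: cont_L1_add)

lemma cont_L1_scaleR:
  assumes "cont_L1 N h" shows "cont_L1 N (\<lambda>t x. c *\<^sub>R h t x)"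
  by (rule cont_L1_compare[OF assms, where B = "\<bar>c\<bar>"])
    (auto simp: cont_L1_integrable[OF assms] simp flip: scaleR_diff_right)

lemma cont_L1_minus:
  assumes "cont_L1 N h" shows "cont_L1 N (\<lambda>t x. - h t x)"
  using cont_L1_scaleR[OF assms, of "-1"] by simp

lemma cont_L1_diff:
  assumes "cont_L1 N h" "cont_L1 N h'" shows "cont_L1 N (\<lambda>t x. h t x - h' t x)"
  using cont_L1_add[OF assms(1) cont_L1_minus[OF assms(2)]] by simp

lemma cont_L1_bounded_image:
  assumes h: "cont_L1 N h" and meas: "\<And>t. 0 \<le> t \<Longrightarrow> (\<lambda>x. h t x *\<^sub>R k x) \<in> borel_measurable N"
    and b: "AE x in N. norm (k x) \<le> B"
  shows "cont_L1 N (\<lambda>t x. h t x *\<^sub>R k x)"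
proof (rule cont_L1_compare[OF h, where B = B])
  show i: "integrable N (\<lambda>x. h t x *\<^sub>R k x)" if t: "0 \<le> t" for t
  proof (rule Bochner_Integration.integrable_bound[where f = "\<lambda>x. B *\<^sub>R h t x"])
    show "AE x in N. norm (h t x *\<^sub>R k x) \<le> norm (B *\<^sub>R h t x)"
      using b
    proof eventually_elim
      case (elim x)
      then have "norm (h t x *\<^sub>R k x) \<le> \<bar>h t x\<bar> * \<bar>B\<bar>" by (simp add: mult_left_mono)
      then show ?case by (simp add: mult.commute)
    qed
  qed (use t meas h in \<open>auto simp: cont_L1_def\<close>)
  fix s t :: real assume st: "0 \<le> s" "0 \<le> t"
  have "(\<integral>x. norm (h s x *\<^sub>R k x - h t x *\<^sub>R k x) \<partial>N) \<le> (\<integral>x. B * norm (h s x - h t x) \<partial>N)"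
  proof (rule integral_mono_AE)
    show "AE x in N. norm (h s x *\<^sub>R k x - h t x *\<^sub>R k x) \<le> B * norm (h s x - h t x)"
      using b
    proof eventually_elim
      case (elim x)
      have "norm (h s x *\<^sub>R k x - h t x *\<^sub>R k x) = \<bar>h s x - h t x\<bar> * norm (k x)"
        by (simp flip: scaleR_diff_left)
      also have "\<dots> \<le> \<bar>h s x - h t x\<bar> * B" using elim by (simp add: mult_left_mono)
      finally show ?case by (simp add: mult.commute)
    qed
  qed (use i st h in \<open>auto simp: cont_L1_def\<close>)
  then show "(\<integral>x. norm (h s x *\<^sub>R k x - h t x *\<^sub>R k x) \<partial>N) \<le> B * (\<integral>x. norm (h s x - h t x) \<partial>N)"
    by simp
qed

text \<open>Freezing the time at the points of a grid gives countably many measurable pieces, and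
  continuity in \<open>s\<close> recovers the function as the mesh tends to 0.\<close>

lemma caratheodory_measurable:
  fixes f :: "real \<Rightarrow> 'a \<Rightarrow> 'b::{second_countable_topology, real_normed_vector}"
  assumes meas: "\<And>s. s \<in> {0..<t} \<Longrightarrow> f s \<in> borel_measurable N"
    and cont: "\<And>x. x \<in> space N \<Longrightarrow> continuous_on {0..<t} (\<lambda>s. f s x)"
  shows "(\<lambda>z. indicator {0..<t} (fst z) *\<^sub>R f (fst z) (snd z)) \<in> borel_measurable (lborel \<Otimes>\<^sub>M N)"
proof (rule borel_measurable_LIMSEQ_metric)
  \<comment> \<open>\<open>q n (r n s)\<close> is \<open>s\<close> rounded down to the grid of mesh
    \<open>1 / Suc n\<close>. Rounding down cannot leave \<open>{0..<t}\<close>, whereas rounding up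
    might reach \<open>t\<close>, where nothing is assumed about \<open>f\<close>.\<close>
  define q where "q n i = real_of_int i / real (Suc n)" for n i
  define r where "r n s = \<lfloor>real (Suc n) * s\<rfloor>" for n s
  \<comment> \<open>The guard replaces \<open>f\<close> by 0 at grid points outside the interval,
    where \<open>f\<close> need not be measurable; for \<open>s\<close> in the interval the rounded
    time always passes it.\<close>
  define F where "F n z = (indicator {0..<t} (fst z) *\<^sub>R
     (if q n (r n (fst z)) \<in> {0..<t} then f (q n (r n (fst z))) (snd z) else 0) :: 'b)" for n z
  show "F n \<in> borel_measurable (lborel \<Otimes>\<^sub>M N)" for n
  proof -
    have "(\<lambda>z. (\<lambda>i z. indicator {0..<t} (fst z) *\<^sub>R
       (if q n i \<in> {0..<t} then f (q n i) (snd z) else 0)) (r n (fst z)) z)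
      \<in> borel_measurable (lborel \<Otimes>\<^sub>M N)"
    proof (rule measurable_compose_countable)
      fix i
      have [measurable]: "(if q n i \<in> {0..<t} then (\<lambda>z. f (q n i) (snd z)) else (\<lambda>_. 0)) \<in> borel_measurable (lborel \<Otimes>\<^sub>M N)"
        using measurable_compose[OF measurable_snd meas, of "q n i"] by auto
      have "(\<lambda>z. indicator {0..<t} (fst z) *\<^sub>R (if q n i \<in> {0..<t} then (\<lambda>z. f (q n i) (snd z)) else (\<lambda>_. 0)) z)
       \<in> borel_measurable (lborel \<Otimes>\<^sub>M N)"
        by measurable
      then show "(\<lambda>z. indicator {0..<t} (fst z) *\<^sub>R (if q n i \<in> {0..<t} then f (q n i) (snd z) else 0))
       \<in> borel_measurable (lborel \<Otimes>\<^sub>M N)"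
        by (cases "q n i \<in> {0..<t}") (simp_all only: if_True if_False)
    qed (simp add: r_def)
    then show ?thesis unfolding F_def[abs_def] by simp
  qed
  fix z assume z: "z \<in> space (lborel \<Otimes>\<^sub>M N :: (real \<times> 'a) measure)"
  obtain s x where zz: "z = (s, x)" by (cases z)
  with z have x: "x \<in> space N" by (auto simp: space_pair_measure)
  show "(\<lambda>n. F n z) \<longlonglongrightarrow> indicator {0..<t} (fst z) *\<^sub>R f (fst z) (snd z)"
  proof (cases "s \<in> {0..<t}")
    case True
    have b: "s - inverse (real (Suc n)) \<le> q n (r n s)" "q n (r n s) \<le> s" for n
    proof -
      have "real (Suc n) * s - 1 \<le> real_of_int (r n s)" "real_of_int (r n s) \<le> real (Suc n) * s"
        unfolding r_def by linarith+
      note this[THEN divide_right_mono, of "real (Suc n)"]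
      moreover have "(real (Suc n) * s - 1) / real (Suc n) = s - inverse (real (Suc n))"
        "real (Suc n) * s / real (Suc n) = s"
        by (simp_all add: diff_divide_distrib inverse_eq_divide del: of_nat_Suc)
      ultimately show "s - inverse (real (Suc n)) \<le> q n (r n s)" "q n (r n s) \<le> s"
        unfolding q_def by (simp_all del: of_nat_Suc)
    qed
    have qin: "q n (r n s) \<in> {0..<t}" for n
    proof -
      have "0 \<le> q n (r n s)" using True by (simp add: q_def r_def)
      then show ?thesis using b(2)[of n] True by auto
    qed
    have lim0: "(\<lambda>n. s - inverse (real (Suc n))) \<longlonglongrightarrow> s"
      using tendsto_diff[OF tendsto_const LIMSEQ_inverse_real_of_nat, of s] by (simp only: diff_zero)
    have lim: "(\<lambda>n. q n (r n s)) \<longlonglongrightarrow> s"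
      by (rule tendsto_sandwich[OF always_eventually always_eventually lim0 tendsto_const]; intro allI b)
    have "((\<lambda>s. f s x) \<circ> (\<lambda>n. q n (r n s))) \<longlonglongrightarrow> f s x"
      using cont[OF x, unfolded continuous_on_sequentially, rule_format, of s "\<lambda>n. q n (r n s)"] True qin lim
      by blast
    then have "(\<lambda>n. f (q n (r n s)) x) \<longlonglongrightarrow> f s x" unfolding comp_def .
    then show ?thesis using True qin by (simp add: F_def zz)
  qed (simp add: F_def zz)
qed

text \<open>The singularity at \<open>s = t\<close> is integrable: the antiderivative
  \<open>- 2 * C * sqrt (t - s)\<close> is continuous up to \<open>t\<close>, so differentiability
  in the interior suffices. The factor \<open>sqrt (t - a)\<close> is the smallness behind
  uniqueness.\<close>

lemma nn_integral_inverse_sqrt: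
  fixes C :: real
  assumes "a \<le> t" "0 \<le> C"
  shows "(\<integral>\<^sup>+s. ennreal (indicator {a..<t} s * (C / sqrt (t - s))) \<partial>lborel) = ennreal (2 * C * sqrt (t - a))"
proof (rule nn_integral_has_integral_lborel)
  have "((\<lambda>s. C / sqrt (t - s)) has_integral - 2 * C * sqrt (t - t) - (- 2 * C * sqrt (t - a))) {a..t}"
  proof (rule fundamental_theorem_of_calculus_interior[OF assms(1)])
    fix s assume s: "s \<in> {a<..<t}"
    have "((\<lambda>s. - 2 * C * sqrt (t - s)) has_real_derivative C / sqrt (t - s)) (at s)"
      using s by (auto intro!: derivative_eq_intros simp: field_simps)
    then show "((\<lambda>s. - 2 * C * sqrt (t - s)) has_vector_derivative C / sqrt (t - s)) (at s)"
      by (simp add: has_real_derivative_iff_has_vector_derivative)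
  qed (auto intro!: continuous_intros)
  then have "((\<lambda>s. C / sqrt (t - s)) has_integral 2 * C * sqrt (t - a)) {a..t}" by simp
  then have "((\<lambda>s. C / sqrt (t - s)) has_integral 2 * C * sqrt (t - a)) {a..<t}"
    by (rule has_integral_spike_set_eq[THEN iffD1, rotated 2])
      (rule negligible_subset[of "{t}"]; auto)+
  then have "((\<lambda>s. if s \<in> {a..<t} then C / sqrt (t - s) else 0) has_integral 2 * C * sqrt (t - a)) UNIV"
    by (simp only: has_integral_restrict_UNIV)
  moreover have "(\<lambda>s. if s \<in> {a..<t} then C / sqrt (t - s) else 0) = (\<lambda>s. indicator {a..<t} s * (C / sqrt (t - s)))"
    by (auto simp: indicator_def)
  ultimately show "((\<lambda>s. indicator {a..<t} s * (C / sqrt (t - s))) has_integral 2 * C * sqrt (t - a)) UNIV"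
    by simp
qed (use assms in \<open>auto simp: indicator_def\<close>)

subsection \<open>Mild equations and evolutions for abstract heat kernels\<close>

definition conv :: "'p measure \<Rightarrow> (real \<Rightarrow> 'p \<Rightarrow> 'p \<Rightarrow> real) \<Rightarrow> real \<Rightarrow> ('p \<Rightarrow> real) \<Rightarrow> 'p \<Rightarrow> real" where
  "conv N P t h x = (\<integral>y. P t x y * h y \<partial>N)"

text \<open>The integrand of Duhamel's formula: the flux at time \<open>s\<close> paired with the
  gradient kernel of the remaining time \<open>t - s\<close>.\<close>

definition flow :: "'p measure \<Rightarrow> ('k \<Rightarrow> real \<Rightarrow> 'p \<Rightarrow> 'p \<Rightarrow> 'v::euclidean_space) \<Rightarrow> 'k set \<Rightarrow>
    (real \<Rightarrow> 'k \<Rightarrow> 'p \<Rightarrow> 'v) \<Rightarrow> real \<Rightarrow> 'p \<Rightarrow> real \<Rightarrow> real" where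
  "flow N Q I G t x s = (\<Sum>k\<in>I. \<integral>y. Q k (t - s) x y \<bullet> G s k y \<partial>N)"

definition duhamel_eq where
  "duhamel_eq N P Q I h G t x \<longleftrightarrow>
     set_integrable lborel {0..<t} (flow N Q I G t x) \<and>
     h t x = conv N P t (h 0) x + (LINT s:{0..<t}|lborel. flow N Q I G t x s)"

text \<open>The derivative is taken within \<open>{0..<t}\<close>, so \<open>s = 0\<close> is
  included one-sidedly and the initial value enters as the value of the convolution there. The
  derivative clause is demanded at every point, the limit clause only almost everywhere: convolution
  erases null sets as long as \<open>s < t\<close>.\<close>

definition evolution where
  "evolution N P Q I h G \<longleftrightarrow>
     (\<forall>t>0. \<forall>x\<in>space N. \<forall>s\<in>{0..<t}.
        ((\<lambda>s. conv N P (t - s) (h s) x) has_real_derivative flow N Q I G t x s) (at s within {0..<t})) \<and>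
     (\<forall>t>0. AE x in N. ((\<lambda>s. conv N P (t - s) (h s) x) \<longlongrightarrow> h t x) (at_left t))"

text \<open>\<open>P\<close> is the kernel and \<open>Q k\<close> its gradient in the particle
  \<open>k\<close>, but the only relation between them is \<open>Q_semigroup\<close>. The mass
  bounds integrate over the first argument, the one that remains after convolution, and thereby
  bound convolutions in \<open>L1\<close>. Boundedness is required for times away from 0 only; the
  statements at every single point rest on it.\<close>

locale heat_kernels = sigma_finite_measure N
  for N :: "'p measure" +
  fixes P :: "real \<Rightarrow> 'p \<Rightarrow> 'p \<Rightarrow> real"
    and Q :: "'k \<Rightarrow> real \<Rightarrow> 'p \<Rightarrow> 'p \<Rightarrow> 'v::euclidean_space"
    and I :: "'k set" and C :: real
  assumes finite_I: "finite I" and C_nonneg: "0 \<le> C"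
    and P_measurable: "0 < t \<Longrightarrow> (\<lambda>(x, y). P t x y) \<in> borel_measurable (N \<Otimes>\<^sub>M N)"
    and Q_measurable: "k \<in> I \<Longrightarrow> 0 < t \<Longrightarrow> (\<lambda>(x, y). Q k t x y) \<in> borel_measurable (N \<Otimes>\<^sub>M N)"
    and P_bounded: "0 < a \<Longrightarrow> \<exists>B. \<forall>t\<in>{a..b}. \<forall>x\<in>space N. \<forall>y\<in>space N. \<bar>P t x y\<bar> \<le> B"
    and Q_bounded: "k \<in> I \<Longrightarrow> 0 < a \<Longrightarrow> \<exists>B. \<forall>t\<in>{a..b}. \<forall>x\<in>space N. \<forall>y\<in>space N. norm (Q k t x y) \<le> B"
    and Q_continuous: "k \<in> I \<Longrightarrow> x \<in> space N \<Longrightarrow> y \<in> space N \<Longrightarrow> continuous_on {0<..} (\<lambda>t. Q k t x y)"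
    and P_mass: "0 < t \<Longrightarrow> y \<in> space N \<Longrightarrow> (\<integral>\<^sup>+x. ennreal \<bar>P t x y\<bar> \<partial>N) \<le> 1"
    and Q_mass: "k \<in> I \<Longrightarrow> 0 < t \<Longrightarrow> y \<in> space N \<Longrightarrow>
        (\<integral>\<^sup>+x. ennreal (norm (Q k t x y)) \<partial>N) \<le> ennreal (C / sqrt t)"
    and P_semigroup: "0 < t \<Longrightarrow> 0 < s \<Longrightarrow> x \<in> space N \<Longrightarrow> z \<in> space N \<Longrightarrow>
        (\<integral>y. P t x y * P s y z \<partial>N) = P (t + s) x z"
    and Q_semigroup: "k \<in> I \<Longrightarrow> 0 < t \<Longrightarrow> 0 < s \<Longrightarrow> x \<in> space N \<Longrightarrow> z \<in> space N \<Longrightarrow>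
        (\<integral>y. P t x y *\<^sub>R Q k s y z \<partial>N) = Q k (t + s) x z"
begin

sublocale NN: pair_sigma_finite N N ..
sublocale LN: pair_sigma_finite lborel N ..

section \<open>Bounds and continuity of the Duhamel integrand\<close>

lemma P_bound: assumes "0 < t" obtains B where "0 \<le> B" "\<And>x y. x \<in> space N \<Longrightarrow> y \<in> space N \<Longrightarrow> \<bar>P t x y\<bar> \<le> B"
proof -
  obtain B where "\<forall>x\<in>space N. \<forall>y\<in>space N. \<bar>P t x y\<bar> \<le> B"
    using P_bounded[OF assms, of t] by auto
  then show thesis by (intro that[of "max 0 B"]) (auto simp: le_max_iff_disj)
qed

lemma Q_bound:
  assumes "k \<in> I" "0 < a"
  obtains B where "0 \<le> B" "\<And>t x y. a \<le> t \<Longrightarrow> t \<le> b \<Longrightarrow> x \<in> space N \<Longrightarrow> y \<in> space N \<Longrightarrow> norm (Q k t x y) \<le> B"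
proof -
  obtain B where "\<forall>t\<in>{a..b}. \<forall>x\<in>space N. \<forall>y\<in>space N. norm (Q k t x y) \<le> B"
    using Q_bounded[OF assms, of b] by auto
  then show thesis by (intro that[of "max 0 B"]) (auto simp: le_max_iff_disj)
qed

lemma P_measurable1: "0 < t \<Longrightarrow> x \<in> space N \<Longrightarrow> P t x \<in> borel_measurable N"
  using measurable_compose[OF measurable_Pair1'[of x N N] P_measurable[of t]] by simp

lemma Q_measurable1: "k \<in> I \<Longrightarrow> 0 < t \<Longrightarrow> x \<in> space N \<Longrightarrow> Q k t x \<in> borel_measurable N"
  using measurable_compose[OF measurable_Pair1'[of x N N] Q_measurable[of k t]] by simp

lemma integrable_P_mult:
  fixes h :: "'p \<Rightarrow> 'w::{banach, second_countable_topology}"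
  assumes "0 < t" "x \<in> space N" "integrable N h"
  shows "integrable N (\<lambda>y. P t x y *\<^sub>R h y)"
proof -
  obtain B where B: "0 \<le> B" "\<And>x y. x \<in> space N \<Longrightarrow> y \<in> space N \<Longrightarrow> \<bar>P t x y\<bar> \<le> B" using P_bound assms(1) by blast
  show ?thesis
  proof (rule Bochner_Integration.integrable_bound[where f = "\<lambda>y. B *\<^sub>R h y"])
    show "AE y in N. norm (P t x y *\<^sub>R h y) \<le> norm (B *\<^sub>R h y)"
      using B assms by (intro AE_I2) (auto intro: mult_right_mono)
    show "(\<lambda>y. P t x y *\<^sub>R h y) \<in> borel_measurable N"
      using P_measurable1[OF assms(1,2)] assms(3) by measurable
  qed (use assms in simp)
qed

lemma integrable_Q_inner:
  assumes "k \<in> I" "0 < t" "x \<in> space N" "integrable N h"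
  shows "integrable N (\<lambda>y. Q k t x y \<bullet> h y)"
proof -
  obtain B where B: "0 \<le> B" "\<And>y. y \<in> space N \<Longrightarrow> norm (Q k t x y) \<le> B" using Q_bound[OF assms(1,2), of t] assms(3) by (metis order_refl)
  show ?thesis
  proof (rule Bochner_Integration.integrable_bound[where f = "\<lambda>y. B *\<^sub>R h y"])
    show "AE y in N. norm (Q k t x y \<bullet> h y) \<le> norm (B *\<^sub>R h y)"
    proof (rule AE_I2)
      fix y assume y: "y \<in> space N"
      have "norm (Q k t x y \<bullet> h y) \<le> norm (Q k t x y) * norm (h y)" by (simp add: Cauchy_Schwarz_ineq2)
      also have "\<dots> \<le> B * norm (h y)" using B y by (intro mult_right_mono) auto
      finally show "norm (Q k t x y \<bullet> h y) \<le> norm (B *\<^sub>R h y)" using B by simp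
    qed
    show "(\<lambda>y. Q k t x y \<bullet> h y) \<in> borel_measurable N"
      using Q_measurable1[OF assms(1-3)] assms(4) by measurable
  qed (use assms in simp)
qed

text \<open>As long as \<open>s < t\<close> the kernel has a positive amount of time left, so it is
  bounded and continuous in time; kernel and flux may then both move with \<open>s\<close>.\<close>

lemma flow_continuous:
  assumes G: "\<And>k. k \<in> I \<Longrightarrow> cont_L1 N (\<lambda>s. G s k)" and x: "x \<in> space N"
  shows "continuous_on {0..<t} (flow N Q I G t x)"
  unfolding flow_def
proof (intro continuous_on_sum continuous_on_sequentiallyI)
  fix k u s assume k: "k \<in> I" and u: "\<forall>n. u n \<in> {0..<t}" and s: "s \<in> {0..<t}" and lim: "u \<longlonglongrightarrow> s"
  \<comment> \<open>Half of the remaining time: the times \<open>t - v n\<close> stay in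
    \<open>{a..t}\<close>, where one bound \<open>B\<close> for the kernel holds.\<close>
  define a where "a = (t - s) / 2"
  have a: "0 < a" "s < t - a" using s by (auto simp: a_def field_simps)
  have "\<forall>\<^sub>F n in sequentially. u n < t - a" using order_tendstoD(2)[OF lim a(2)] .
  then obtain n0 where n0: "\<And>n. n \<ge> n0 \<Longrightarrow> u n < t - a" by (auto simp: eventually_sequentially)
  define v where "v n = u (n + n0)" for n
  have v: "v n \<in> {0..<t}" "a \<le> t - v n" "t - v n \<le> t" for n using n0[of "n + n0"] u by (auto simp: v_def less_imp_le)
  have vs: "v \<longlonglongrightarrow> s" unfolding v_def by (rule LIMSEQ_ignore_initial_segment[OF lim])
  obtain B where B: "0 \<le> B" "\<And>t' x y. a \<le> t' \<Longrightarrow> t' \<le> t \<Longrightarrow> x \<in> space N \<Longrightarrow> y \<in> space N \<Longrightarrow> norm (Q k t' x y) \<le> B"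
    using Q_bound[OF k a(1), of t] by blast
  have Gi: "integrable N (G r k)" if "0 \<le> r" for r using G[OF k] that by (auto simp: cont_L1_def)
  have tv: "0 < t - v n" for n using v(1)[of n] by simp
  have ts: "0 < t - s" "a \<le> t - s" "t - s \<le> t" using s by (auto simp: a_def field_simps)
  have i1: "integrable N (\<lambda>y. Q k (t - v n) x y \<bullet> G r k y)" if "0 \<le> r" for n r
    by (rule integrable_Q_inner[OF k tv x Gi[OF that]])
  \<comment> \<open>Here the kernel moves while the flux is frozen at \<open>s\<close>;
    \<open>D\<close> below treats the change of the flux, uniformly in the kernel.\<close>
  have A: "(\<lambda>n. \<integral>y. Q k (t - v n) x y \<bullet> G s k y \<partial>N) \<longlonglongrightarrow> (\<integral>y. Q k (t - s) x y \<bullet> G s k y \<partial>N)"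
  proof (rule integral_dominated_convergence[where w = "\<lambda>y. B * norm (G s k y)"])
    show "(\<lambda>y. Q k (t - s) x y \<bullet> G s k y) \<in> borel_measurable N"
      using integrable_Q_inner[OF k ts(1) x Gi] s by auto
    show "(\<lambda>y. Q k (t - v n) x y \<bullet> G s k y) \<in> borel_measurable N" for n using i1[of s n] s by auto
    show "integrable N (\<lambda>y. B * norm (G s k y))" using Gi[of s] s by auto
    show "AE y in N. (\<lambda>n. Q k (t - v n) x y \<bullet> G s k y) \<longlonglongrightarrow> Q k (t - s) x y \<bullet> G s k y"
    proof (intro AE_I2 tendsto_inner tendsto_const)
      fix y assume y: "y \<in> space N"
      have "(\<lambda>n. t - v n) \<longlonglongrightarrow> t - s" by (intro tendsto_intros vs)
      then show "(\<lambda>n. Q k (t - v n) x y) \<longlonglongrightarrow> Q k (t - s) x y"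
        using Q_continuous[OF k x y, unfolded continuous_on_sequentially, rule_format, of "t - s" "\<lambda>n. t - v n"] tv ts(1)
        unfolding comp_def by auto
    qed
    show "AE y in N. norm (Q k (t - v n) x y \<bullet> G s k y) \<le> B * norm (G s k y)" for n
    proof (rule AE_I2)
      fix y assume y: "y \<in> space N"
      have "norm (Q k (t - v n) x y \<bullet> G s k y) \<le> norm (Q k (t - v n) x y) * norm (G s k y)" by (simp add: Cauchy_Schwarz_ineq2)
      also have "\<dots> \<le> B * norm (G s k y)" using B y x v(2,3) by (intro mult_right_mono) auto
      finally show "norm (Q k (t - v n) x y \<bullet> G s k y) \<le> B * norm (G s k y)" .
    qed
  qed
  have D: "norm ((\<integral>y. Q k (t - v n) x y \<bullet> G (v n) k y \<partial>N) - (\<integral>y. Q k (t - v n) x y \<bullet> G s k y \<partial>N))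
      \<le> B * (\<integral>y. norm (G (v n) k y - G s k y) \<partial>N)" for n
  proof -
    have vn: "0 \<le> v n" and s0: "0 \<le> s" using v(1)[of n] s by auto
    have "(\<integral>y. Q k (t - v n) x y \<bullet> G (v n) k y \<partial>N) - (\<integral>y. Q k (t - v n) x y \<bullet> G s k y \<partial>N)
      = (\<integral>y. Q k (t - v n) x y \<bullet> G (v n) k y - Q k (t - v n) x y \<bullet> G s k y \<partial>N)"
      by (rule Bochner_Integration.integral_diff[symmetric]) (intro i1 vn s0)+
    also have "norm \<dots> \<le> (\<integral>y. B * norm (G (v n) k y - G s k y) \<partial>N)"
    proof (rule order_trans[OF integral_norm_bound], rule integral_mono)
      show "integrable N (\<lambda>y. norm (Q k (t - v n) x y \<bullet> G (v n) k y - Q k (t - v n) x y \<bullet> G s k y))"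
        by (intro integrable_norm Bochner_Integration.integrable_diff i1 vn s0)
      show "integrable N (\<lambda>y. B * norm (G (v n) k y - G s k y))"
        by (intro integrable_mult_right integrable_norm Bochner_Integration.integrable_diff Gi vn s0)
      fix y assume y: "y \<in> space N"
      have "norm (Q k (t - v n) x y \<bullet> G (v n) k y - Q k (t - v n) x y \<bullet> G s k y)
         = norm (Q k (t - v n) x y \<bullet> (G (v n) k y - G s k y))" by (simp add: inner_diff_right)
      also have "\<dots> \<le> norm (Q k (t - v n) x y) * norm (G (v n) k y - G s k y)" by (simp add: Cauchy_Schwarz_ineq2)
      also have "\<dots> \<le> B * norm (G (v n) k y - G s k y)" using B y x v(2,3) by (intro mult_right_mono) auto
      finally show "norm (Q k (t - v n) x y \<bullet> G (v n) k y - Q k (t - v n) x y \<bullet> G s k y) \<le> B * norm (G (v n) k y - G s k y)" .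
    qed
    finally show ?thesis by simp
  qed
  have "(\<lambda>n. \<integral>y. norm (G (v n) k y - G s k y) \<partial>N) \<longlonglongrightarrow> 0"
  proof -
    have "continuous (at s within {0..}) (\<lambda>r. \<integral>y. norm (G r k y - G s k y) \<partial>N)"
      unfolding continuous_within using cont_L1_tendsto[OF G[OF k]] s by simp
    then show ?thesis
      unfolding continuous_within_sequentially using v(1) vs by (auto simp: comp_def)
  qed
  from tendsto_mult_right_zero[OF this, of B]
  have "(\<lambda>n. (\<integral>y. Q k (t - v n) x y \<bullet> G (v n) k y \<partial>N) - (\<integral>y. Q k (t - v n) x y \<bullet> G s k y \<partial>N)) \<longlonglongrightarrow> 0"
    by (rule Lim_null_comparison[rotated]) (intro always_eventually allI D)
  from tendsto_add[OF this A]
  have "(\<lambda>n. \<integral>y. Q k (t - v n) x y \<bullet> G (v n) k y \<partial>N) \<longlonglongrightarrow> (\<integral>y. Q k (t - s) x y \<bullet> G s k y \<partial>N)"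
    by (simp only: diff_add_cancel add_0_left)
  then show "(\<lambda>n. \<integral>y. Q k (t - u n) x y \<bullet> G (u n) k y \<partial>N) \<longlonglongrightarrow> (\<integral>y. Q k (t - s) x y \<bullet> G s k y \<partial>N)"
    unfolding v_def by (rule LIMSEQ_offset)
qed

lemma flow_measurable1:
  assumes G: "\<And>k. k \<in> I \<Longrightarrow> G s k \<in> borel_measurable N" and s: "s < t"
  shows "(\<lambda>x. flow N Q I G t x s) \<in> borel_measurable N"
  unfolding flow_def
proof (intro borel_measurable_sum borel_measurable_lebesgue_integral)
  fix k assume k: "k \<in> I"
  have "0 < t - s" using s by simp
  note [measurable] = Q_measurable[OF k this] G[OF k]
  show "(\<lambda>(x, y). Q k (t - s) x y \<bullet> G s k y) \<in> borel_measurable (N \<Otimes>\<^sub>M N)" by measurable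
qed

lemma flow_measurable:
  assumes G: "\<And>k. k \<in> I \<Longrightarrow> cont_L1 N (\<lambda>s. G s k)"
  shows "(\<lambda>z. indicator {0..<t} (fst z) *\<^sub>R flow N Q I G t (snd z) (fst z)) \<in> borel_measurable (lborel \<Otimes>\<^sub>M N)"
proof (rule caratheodory_measurable)
  show "(\<lambda>x. flow N Q I G t x s) \<in> borel_measurable N" if "s \<in> {0..<t}" for s
    using that by (intro flow_measurable1 borel_measurable_integrable cont_L1_integrable[OF G]) auto
qed (rule flow_continuous[OF G])

text \<open>An inequality of Young type: after Tonelli the mass of \<open>Q\<close> in its first
  argument is at most \<open>C / sqrt (t - s)\<close>, uniformly in the second.\<close>

lemma flow_L1:
  assumes G: "\<And>k. k \<in> I \<Longrightarrow> integrable N (G s k)" and s: "s < t"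
  shows "(\<integral>\<^sup>+x. ennreal \<bar>flow N Q I G t x s\<bar> \<partial>N) \<le> ennreal (C / sqrt (t - s) * (\<Sum>k\<in>I. \<integral>x. norm (G s k x) \<partial>N))"
proof -
  have ts: "0 < t - s" using s by simp
  have "(\<integral>\<^sup>+x. ennreal \<bar>flow N Q I G t x s\<bar> \<partial>N) \<le> (\<integral>\<^sup>+x. (\<Sum>k\<in>I. \<integral>\<^sup>+y. ennreal (norm (Q k (t - s) x y)) * ennreal (norm (G s k y)) \<partial>N) \<partial>N)"
  proof (rule nn_integral_mono)
    fix x assume x: "x \<in> space N"
    have "ennreal \<bar>flow N Q I G t x s\<bar> \<le> (\<Sum>k\<in>I. ennreal \<bar>\<integral>y. Q k (t - s) x y \<bullet> G s k y \<partial>N\<bar>)"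
      unfolding flow_def by (subst sum_ennreal) (auto intro!: ennreal_leI sum_abs)
    also have "\<dots> \<le> (\<Sum>k\<in>I. \<integral>\<^sup>+y. ennreal (norm (Q k (t - s) x y)) * ennreal (norm (G s k y)) \<partial>N)"
    proof (rule sum_mono)
      fix k assume k: "k \<in> I"
      have "ennreal (norm (\<integral>y. Q k (t - s) x y \<bullet> G s k y \<partial>N)) \<le> (\<integral>\<^sup>+y. ennreal (norm (Q k (t - s) x y \<bullet> G s k y)) \<partial>N)"
        by (rule integral_norm_bound_ennreal[OF integrable_Q_inner[OF k ts x G[OF k]]])
      also have "\<dots> \<le> (\<integral>\<^sup>+y. ennreal (norm (Q k (t - s) x y)) * ennreal (norm (G s k y)) \<partial>N)"
        by (rule nn_integral_mono) (simp add: Cauchy_Schwarz_ineq2 flip: ennreal_mult)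
      finally show "ennreal \<bar>\<integral>y. Q k (t - s) x y \<bullet> G s k y \<partial>N\<bar> \<le> \<dots>" by simp
    qed
    finally show "ennreal \<bar>flow N Q I G t x s\<bar> \<le> (\<Sum>k\<in>I. \<integral>\<^sup>+y. ennreal (norm (Q k (t - s) x y)) * ennreal (norm (G s k y)) \<partial>N)" .
  qed
  also have "\<dots> = (\<Sum>k\<in>I. \<integral>\<^sup>+x. \<integral>\<^sup>+y. ennreal (norm (Q k (t - s) x y)) * ennreal (norm (G s k y)) \<partial>N \<partial>N)"
  proof (rule nn_integral_sum)
    fix k assume k: "k \<in> I"
    note [measurable] = Q_measurable[OF k ts] borel_measurable_integrable[OF G[OF k]]
    show "(\<lambda>x. \<integral>\<^sup>+y. ennreal (norm (Q k (t - s) x y)) * ennreal (norm (G s k y)) \<partial>N) \<in> borel_measurable N" by measurable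
  qed
  also have "\<dots> \<le> (\<Sum>k\<in>I. ennreal (C / sqrt (t - s) * (\<integral>x. norm (G s k x) \<partial>N)))"
  proof (rule sum_mono)
    fix k assume k: "k \<in> I"
    note [measurable] = Q_measurable[OF k ts] borel_measurable_integrable[OF G[OF k]]
    have "(\<integral>\<^sup>+x. \<integral>\<^sup>+y. ennreal (norm (Q k (t - s) x y)) * ennreal (norm (G s k y)) \<partial>N \<partial>N)
        = (\<integral>\<^sup>+y. \<integral>\<^sup>+x. ennreal (norm (Q k (t - s) x y)) * ennreal (norm (G s k y)) \<partial>N \<partial>N)"
      by (rule NN.Fubini'[symmetric]) measurable
    also have "\<dots> = (\<integral>\<^sup>+y. (\<integral>\<^sup>+x. ennreal (norm (Q k (t - s) x y)) \<partial>N) * ennreal (norm (G s k y)) \<partial>N)"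
      by (intro nn_integral_cong nn_integral_multc) measurable
    also have "\<dots> \<le> (\<integral>\<^sup>+y. ennreal (C / sqrt (t - s)) * ennreal (norm (G s k y)) \<partial>N)"
      by (intro nn_integral_mono mult_right_mono Q_mass k ts) auto
    also have "\<dots> = ennreal (C / sqrt (t - s)) * (\<integral>\<^sup>+y. ennreal (norm (G s k y)) \<partial>N)"
      by (intro nn_integral_cmult) measurable
    also have "(\<integral>\<^sup>+y. ennreal (norm (G s k y)) \<partial>N) = ennreal (\<integral>y. norm (G s k y) \<partial>N)"
      by (intro nn_integral_eq_integral integrable_norm G k) auto
    also have "ennreal (C / sqrt (t - s)) * \<dots> = ennreal (C / sqrt (t - s) * (\<integral>x. norm (G s k x) \<partial>N))"
      using C_nonneg ts by (intro ennreal_mult[symmetric]) auto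
    finally show "(\<integral>\<^sup>+x. \<integral>\<^sup>+y. ennreal (norm (Q k (t - s) x y)) * ennreal (norm (G s k y)) \<partial>N \<partial>N) \<le> \<dots>" .
  qed
  also have "\<dots> = ennreal (C / sqrt (t - s) * (\<Sum>k\<in>I. \<integral>x. norm (G s k x) \<partial>N))"
    using C_nonneg ts by (subst sum_ennreal) (auto simp: sum_distrib_left)
  finally show ?thesis .
qed

text \<open>The parameter \<open>a\<close> is meant for a flux that vanishes before time
  \<open>a\<close>: the bound then carries \<open>sqrt (t - a)\<close>, so a uniqueness argument can
  be restarted from \<open>a\<close> with the same step length.\<close>

lemma flow_L1_time:
  assumes G: "\<And>k. k \<in> I \<Longrightarrow> cont_L1 N (\<lambda>s. G s k)" and a: "0 \<le> a" "a \<le> t"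
    and m: "\<And>s. s \<in> {0..<t} \<Longrightarrow> (\<Sum>k\<in>I. \<integral>x. norm (G s k x) \<partial>N) \<le> (if s < a then 0 else m)" and m0: "0 \<le> m"
  shows "(\<integral>\<^sup>+x. \<integral>\<^sup>+s. ennreal \<bar>indicator {0..<t} s *\<^sub>R flow N Q I G t x s\<bar> \<partial>lborel \<partial>N) \<le> ennreal (2 * C * m * sqrt (t - a))"
proof -
  note [measurable] = flow_measurable[OF G]
  have [measurable]: "(\<lambda>(s, x). ennreal \<bar>indicator {0..<t} s *\<^sub>R flow N Q I G t x s\<bar>) \<in> borel_measurable (lborel \<Otimes>\<^sub>M N)"
    using flow_measurable[OF G, where t = t] unfolding split_beta' by measurable
  have "(\<integral>\<^sup>+x. \<integral>\<^sup>+s. ennreal \<bar>indicator {0..<t} s *\<^sub>R flow N Q I G t x s\<bar> \<partial>lborel \<partial>N)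
    = (\<integral>\<^sup>+s. \<integral>\<^sup>+x. ennreal \<bar>indicator {0..<t} s *\<^sub>R flow N Q I G t x s\<bar> \<partial>N \<partial>lborel)"
    by (rule LN.Fubini') measurable
  also have "\<dots> \<le> (\<integral>\<^sup>+s. ennreal (indicator {a..<t} s * (C * m / sqrt (t - s))) \<partial>lborel)"
  proof (rule nn_integral_mono)
    fix s :: real
    show "(\<integral>\<^sup>+x. ennreal \<bar>indicator {0..<t} s *\<^sub>R flow N Q I G t x s\<bar> \<partial>N) \<le> ennreal (indicator {a..<t} s * (C * m / sqrt (t - s)))"
    proof (cases "s \<in> {0..<t}")
      case True
      have "(\<integral>\<^sup>+x. ennreal \<bar>indicator {0..<t} s *\<^sub>R flow N Q I G t x s\<bar> \<partial>N) = (\<integral>\<^sup>+x. ennreal \<bar>flow N Q I G t x s\<bar> \<partial>N)"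
        using True by simp
      also have "\<dots> \<le> ennreal (C / sqrt (t - s) * (\<Sum>k\<in>I. \<integral>x. norm (G s k x) \<partial>N))"
        by (rule flow_L1) (use True G in \<open>auto simp: cont_L1_def\<close>)
      also have "\<dots> \<le> ennreal (C / sqrt (t - s) * (if s < a then 0 else m))"
        using m[OF True] True C_nonneg by (intro ennreal_leI mult_left_mono) auto
      also have "\<dots> = ennreal (indicator {a..<t} s * (C * m / sqrt (t - s)))"
        using True by (auto simp: indicator_def)
      finally show ?thesis .
    qed simp
  qed
  also have "\<dots> = ennreal (2 * (C * m) * sqrt (t - a))"
    using a C_nonneg m0 by (intro nn_integral_inverse_sqrt) auto
  finally show ?thesis by (simp add: mult.assoc)
qed

text \<open>Integrability on the product of time and space licenses both uses of Fubini: the time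
  integral exists for almost every \<open>x\<close>, and it may be exchanged with a further
  convolution.\<close>

lemma flow_L1_time_integrable:
  assumes G: "\<And>k. k \<in> I \<Longrightarrow> cont_L1 N (\<lambda>s. G s k)"
  shows "integrable (lborel \<Otimes>\<^sub>M N) (\<lambda>(s, x). indicator {0..<t} s *\<^sub>R flow N Q I G t x s)"
proof (cases "0 \<le> t")
  case True
  have "continuous_on {0..t} (\<lambda>s. \<Sum>k\<in>I. \<integral>x. norm (G s k x) \<partial>N)"
    by (intro continuous_on_sum continuous_on_subset[OF cont_L1_norm_continuous[OF G]]) auto
  then have "bounded ((\<lambda>s. \<Sum>k\<in>I. \<integral>x. norm (G s k x) \<partial>N) ` {0..t})"
    by (intro compact_imp_bounded compact_continuous_image) auto
  then obtain m where m: "\<And>s. s \<in> {0..t} \<Longrightarrow> norm (\<Sum>k\<in>I. \<integral>x. norm (G s k x) \<partial>N) \<le> m"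
    unfolding bounded_iff by (metis imageI)
  have m0: "0 \<le> m" using norm_ge_zero m[of 0] True by (meson order_trans atLeastAtMost_iff order_refl)
  have meas: "(\<lambda>(s, x). indicator {0..<t} s *\<^sub>R flow N Q I G t x s) \<in> borel_measurable (lborel \<Otimes>\<^sub>M N)"
    using flow_measurable[OF G, where t = t] unfolding split_beta' .
  then have meas': "(\<lambda>(s, x). ennreal \<bar>indicator {0..<t} s *\<^sub>R flow N Q I G t x s\<bar>) \<in> borel_measurable (lborel \<Otimes>\<^sub>M N)"
    unfolding split_beta' by measurable
  show ?thesis
  proof (rule integrableI_bounded[OF meas])
    have "(\<integral>\<^sup>+z. ennreal (norm (case z of (s, x) \<Rightarrow> indicator {0..<t} s *\<^sub>R flow N Q I G t x s)) \<partial>(lborel \<Otimes>\<^sub>M N))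
      = (\<integral>\<^sup>+z. (\<lambda>(s, x). ennreal \<bar>indicator {0..<t} s *\<^sub>R flow N Q I G t x s\<bar>) z \<partial>(lborel \<Otimes>\<^sub>M N))"
      by (intro nn_integral_cong) (auto split: prod.splits)
    also have "\<dots> = (\<integral>\<^sup>+x. \<integral>\<^sup>+s. ennreal \<bar>indicator {0..<t} s *\<^sub>R flow N Q I G t x s\<bar> \<partial>lborel \<partial>N)"
      using LN.nn_integral_snd[OF meas'] by simp
    also have "\<dots> \<le> ennreal (2 * C * m * sqrt (t - 0))"
      by (rule flow_L1_time[OF G]) (use True m m0 in \<open>auto intro: order_trans[OF abs_ge_self]\<close>)
    also have "\<dots> < \<infinity>" by simp
    finally show "(\<integral>\<^sup>+z. ennreal (norm (case z of (s, x) \<Rightarrow> indicator {0..<t} s *\<^sub>R flow N Q I G t x s)) \<partial>(lborel \<Otimes>\<^sub>M N)) < \<infinity>" .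
  qed
qed (simp add: indicator_def split_beta')

lemma AE_set_integrable_flow:
  assumes G: "\<And>k. k \<in> I \<Longrightarrow> cont_L1 N (\<lambda>s. G s k)"
  shows "AE x in N. set_integrable lborel {0..<t} (flow N Q I G t x)"
  using LN.AE_integrable_snd[OF flow_L1_time_integrable[OF G]] by (simp add: set_integrable_def)

end

section \<open>From the mild equation to the evolution and back\<close>

context heat_kernels
begin

text \<open>For fixed \<open>x\<close> the kernel \<open>P t x\<close> is bounded, and
  \<open>R\<close> has bounded mass in its first argument, so the integrand is absolutely integrable
  in \<open>(y, z)\<close>. \<open>R\<close> is vector valued to cover \<open>P\<close> itself and
  every \<open>Q k\<close> at once.\<close>

lemma kernel_Fubini:
  fixes R :: "'p \<Rightarrow> 'p \<Rightarrow> 'w::euclidean_space"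
  assumes t: "0 < t" and x: "x \<in> space N"
    and R: "(\<lambda>(y, z). R y z) \<in> borel_measurable (N \<Otimes>\<^sub>M N)"
    and mass: "\<And>z. z \<in> space N \<Longrightarrow> (\<integral>\<^sup>+y. ennreal (norm (R y z)) \<partial>N) \<le> ennreal c"
    and H: "integrable N H"
  shows "(\<integral>y. P t x y * (\<integral>z. R y z \<bullet> H z \<partial>N) \<partial>N) = (\<integral>z. (\<integral>y. P t x y *\<^sub>R R y z \<partial>N) \<bullet> H z \<partial>N)"
proof -
  obtain B where B: "0 \<le> B" "\<And>y. y \<in> space N \<Longrightarrow> \<bar>P t x y\<bar> \<le> B" using P_bound[OF t] x by metis
  note [measurable] = R borel_measurable_integrable[OF H] P_measurable1[OF t x]
  have i: "integrable (N \<Otimes>\<^sub>M N) (\<lambda>(y, z). P t x y * (R y z \<bullet> H z))"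
  proof (rule integrableI_bounded)
    have "(\<integral>\<^sup>+w. ennreal (norm (case w of (y, z) \<Rightarrow> P t x y * (R y z \<bullet> H z))) \<partial>(N \<Otimes>\<^sub>M N))
      = (\<integral>\<^sup>+w. (\<lambda>(y, z). ennreal (norm (P t x y * (R y z \<bullet> H z)))) w \<partial>(N \<Otimes>\<^sub>M N))"
      by (intro nn_integral_cong) (auto split: prod.splits)
    also have "\<dots> = (\<integral>\<^sup>+z. \<integral>\<^sup>+y. ennreal (norm (P t x y * (R y z \<bullet> H z))) \<partial>N \<partial>N)"
      by (subst NN.nn_integral_snd[symmetric]) auto
    also have "\<dots> \<le> (\<integral>\<^sup>+z. \<integral>\<^sup>+y. ennreal (norm (R y z)) * (ennreal B * ennreal (norm (H z))) \<partial>N \<partial>N)"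
    proof (intro nn_integral_mono)
      fix y z assume y: "y \<in> space N"
      have "norm (P t x y * (R y z \<bullet> H z)) \<le> B * (norm (R y z) * norm (H z))"
        unfolding norm_mult using B y by (intro mult_mono) (auto simp: Cauchy_Schwarz_ineq2)
      then have "ennreal (norm (P t x y * (R y z \<bullet> H z))) \<le> ennreal (norm (R y z) * (B * norm (H z)))"
        by (intro ennreal_leI) (simp add: mult.left_commute)
      also have "\<dots> = ennreal (norm (R y z)) * (ennreal B * ennreal (norm (H z)))"
        using B(1) by (simp add: ennreal_mult)
      finally show "ennreal (norm (P t x y * (R y z \<bullet> H z))) \<le> \<dots>" .
    qed
    also have "\<dots> = (\<integral>\<^sup>+z. (\<integral>\<^sup>+y. ennreal (norm (R y z)) \<partial>N) * (ennreal B * ennreal (norm (H z))) \<partial>N)"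
      by (intro nn_integral_cong nn_integral_multc) measurable
    also have "\<dots> \<le> (\<integral>\<^sup>+z. (ennreal c * ennreal B) * ennreal (norm (H z)) \<partial>N)"
      by (rule nn_integral_mono) (use mass in \<open>simp add: mult_right_mono flip: mult.assoc\<close>)
    also have "\<dots> = (ennreal c * ennreal B) * (\<integral>\<^sup>+z. ennreal (norm (H z)) \<partial>N)"
      by (rule nn_integral_cmult) measurable
    also have "\<dots> < \<infinity>"
      using H by (auto simp: integrable_iff_bounded ennreal_mult_less_top)
    finally show "(\<integral>\<^sup>+w. ennreal (norm (case w of (y, z) \<Rightarrow> P t x y * (R y z \<bullet> H z))) \<partial>(N \<Otimes>\<^sub>M N)) < \<infinity>" .
  qed measurable
  have iR: "integrable N (\<lambda>y. P t x y *\<^sub>R R y z)" if z: "z \<in> space N" for z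
  proof (rule integrable_P_mult[OF t x integrableI_bounded])
    show "(\<lambda>y. R y z) \<in> borel_measurable N" using z by measurable
    show "(\<integral>\<^sup>+y. ennreal (norm (R y z)) \<partial>N) < \<infinity>"
      using mass[OF z] by (rule le_less_trans) simp
  qed
  have "(\<integral>y. P t x y * (\<integral>z. R y z \<bullet> H z \<partial>N) \<partial>N) = (\<integral>y. (\<integral>z. P t x y * (R y z \<bullet> H z) \<partial>N) \<partial>N)"
    by simp
  also have "\<dots> = (\<integral>z. (\<integral>y. P t x y * (R y z \<bullet> H z) \<partial>N) \<partial>N)"
    by (rule NN.Fubini_integral[OF i, symmetric])
  also have "\<dots> = (\<integral>z. (\<integral>y. P t x y *\<^sub>R R y z \<partial>N) \<bullet> H z \<partial>N)"
  proof (rule Bochner_Integration.integral_cong[OF refl])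
    fix z assume z: "z \<in> space N"
    show "(\<integral>y. P t x y * (R y z \<bullet> H z) \<partial>N) = (\<integral>y. P t x y *\<^sub>R R y z \<partial>N) \<bullet> H z"
      by (subst integral_inner_left[symmetric]) (auto intro: iR[OF z])
  qed
  finally show ?thesis .
qed

lemma conv_semigroup:
  assumes "0 < t" "0 < s" "x \<in> space N" "integrable N h"
  shows "conv N P t (conv N P s h) x = conv N P (t + s) h x"
proof -
  have "conv N P t (conv N P s h) x = (\<integral>z. (\<integral>y. P t x y *\<^sub>R P s y z \<partial>N) \<bullet> h z \<partial>N)"
    using kernel_Fubini[OF assms(1,3) P_measurable[OF assms(2)], of 1 h] P_mass[OF assms(2)] assms(4)
    by (simp add: conv_def)
  also have "\<dots> = conv N P (t + s) h x"
    unfolding conv_def by (intro Bochner_Integration.integral_cong refl) (simp add: P_semigroup assms)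
  finally show ?thesis .
qed

lemma flow_semigroup:
  assumes "r < s" "s < t" "x \<in> space N" "\<And>k. k \<in> I \<Longrightarrow> integrable N (G r k)"
  shows "conv N P (t - s) (\<lambda>y. flow N Q I G s y r) x = flow N Q I G t x r"
proof -
  have ts: "0 < t - s" "0 < s - r" using assms by auto
  have "conv N P (t - s) (\<lambda>y. flow N Q I G s y r) x
     = (\<integral>y. (\<Sum>k\<in>I. P (t - s) x y * (\<integral>z. Q k (s - r) y z \<bullet> G r k z \<partial>N)) \<partial>N)"
    by (simp add: conv_def flow_def sum_distrib_left)
  also have "\<dots> = (\<Sum>k\<in>I. \<integral>y. P (t - s) x y * (\<integral>z. Q k (s - r) y z \<bullet> G r k z \<partial>N) \<partial>N)"
  proof (rule Bochner_Integration.integral_sum)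
    fix k assume k: "k \<in> I"
    \<comment> \<open>Restricting the index set to \<open>{k}\<close> turns \<open>flow\<close> into
      a single summand, so that \<open>flow_L1\<close> bounds it alone.\<close>
    interpret K: heat_kernels N P Q "{k}" C
      using heat_kernels_axioms k by (auto simp: heat_kernels_def heat_kernels_axioms_def)
    have G: "\<And>k'. k' \<in> {k} \<Longrightarrow> integrable N (G r k')" using assms(4) k by auto
    have "integrable N (\<lambda>y. flow N Q {k} G s y r)"
    proof (rule integrableI_bounded)
      show "(\<lambda>y. flow N Q {k} G s y r) \<in> borel_measurable N"
        using G assms(1) by (intro K.flow_measurable1) auto
      show "(\<integral>\<^sup>+y. ennreal (norm (flow N Q {k} G s y r)) \<partial>N) < \<infinity>"
        using le_less_trans[OF K.flow_L1[of G r s, OF G assms(1)]] by simp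
    qed
    from integrable_P_mult[OF ts(1) assms(3) this]
    show "integrable N (\<lambda>y. P (t - s) x y * (\<integral>z. Q k (s - r) y z \<bullet> G r k z \<partial>N))"
      by (simp add: flow_def)
  qed
  also have "\<dots> = flow N Q I G t x r"
    unfolding flow_def
  proof (rule sum.cong[OF refl])
    fix k assume k: "k \<in> I"
    have "(\<integral>y. P (t - s) x y * (\<integral>z. Q k (s - r) y z \<bullet> G r k z \<partial>N) \<partial>N)
        = (\<integral>z. (\<integral>y. P (t - s) x y *\<^sub>R Q k (s - r) y z \<partial>N) \<bullet> G r k z \<partial>N)"
      by (rule kernel_Fubini[OF ts(1) assms(3) Q_measurable[OF k ts(2)] Q_mass[OF k ts(2)] assms(4)[OF k]])
    also have "\<dots> = (\<integral>z. Q k (t - r) x z \<bullet> G r k z \<partial>N)"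
      by (intro Bochner_Integration.integral_cong refl) (simp add: Q_semigroup[OF k ts assms(3)])
    finally show "(\<integral>y. P (t - s) x y * (\<integral>z. Q k (s - r) y z \<bullet> G r k z \<partial>N) \<partial>N) = (\<integral>z. Q k (t - r) x z \<bullet> G r k z \<partial>N)" .
  qed
  finally show ?thesis .
qed

text \<open>By the semigroup property, convolving for the remaining time \<open>t - s\<close> only
  replaces the target time \<open>s\<close> of the integrand by \<open>t\<close>; the range of
  integration still ends at \<open>s\<close>.\<close>

lemma conv_time_integral:
  assumes G: "\<And>k. k \<in> I \<Longrightarrow> cont_L1 N (\<lambda>s. G s k)" and st: "s < t" and x: "x \<in> space N"
  shows "conv N P (t - s) (\<lambda>y. LINT r:{0..<s}|lborel. flow N Q I G s y r) x
    = (LINT r:{0..<s}|lborel. flow N Q I G t x r)"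
    and "integrable N (\<lambda>y. LINT r:{0..<s}|lborel. flow N Q I G s y r)"
proof -
  have ts: "0 < t - s" using st by simp
  obtain B where B: "0 \<le> B" "\<And>y. y \<in> space N \<Longrightarrow> \<bar>P (t - s) x y\<bar> \<le> B" using P_bound[OF ts] x by metis
  note i = flow_L1_time_integrable[where G = G and t = s, OF G]
  note [measurable] = P_measurable1[OF ts x] borel_measurable_integrable[OF i]
  have i': "integrable (lborel \<Otimes>\<^sub>M N) (\<lambda>(r, y). P (t - s) x y * (indicator {0..<s} r *\<^sub>R flow N Q I G s y r))"
  proof (rule Bochner_Integration.integrable_bound)
    show "integrable (lborel \<Otimes>\<^sub>M N) (\<lambda>w. B *\<^sub>R (case w of (r, y) \<Rightarrow> indicator {0..<s} r *\<^sub>R flow N Q I G s y r))"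
      using i by simp
    have "(\<lambda>w. P (t - s) x (snd w) * (case w of (r, y) \<Rightarrow> indicator {0..<s} r *\<^sub>R flow N Q I G s y r)) \<in> borel_measurable (lborel \<Otimes>\<^sub>M N)"
      by measurable
    then show "(\<lambda>(r, y). P (t - s) x y * (indicator {0..<s} r *\<^sub>R flow N Q I G s y r)) \<in> borel_measurable (lborel \<Otimes>\<^sub>M N)"
      by (simp add: split_beta')
    show "AE w in lborel \<Otimes>\<^sub>M N. norm (case w of (r, y) \<Rightarrow> P (t - s) x y * (indicator {0..<s} r *\<^sub>R flow N Q I G s y r))
      \<le> norm (B *\<^sub>R (case w of (r, y) \<Rightarrow> indicator {0..<s} r *\<^sub>R flow N Q I G s y r))"
      using B by (intro AE_I2) (auto simp: space_pair_measure abs_mult intro!: mult_right_mono)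
  qed
  have "conv N P (t - s) (\<lambda>y. LINT r:{0..<s}|lborel. flow N Q I G s y r) x
      = (\<integral>y. \<integral>r. P (t - s) x y * (indicator {0..<s} r *\<^sub>R flow N Q I G s y r) \<partial>lborel \<partial>N)"
    unfolding conv_def set_lebesgue_integral_def by (simp only: integral_mult_right_zero)
  also have "\<dots> = (\<integral>r. \<integral>y. P (t - s) x y * (indicator {0..<s} r *\<^sub>R flow N Q I G s y r) \<partial>N \<partial>lborel)"
    by (rule LN.Fubini_integral[OF i'])
  also have "\<dots> = (LINT r:{0..<s}|lborel. flow N Q I G t x r)"
    unfolding set_lebesgue_integral_def
  proof (rule Bochner_Integration.integral_cong[OF refl])
    fix r :: real
    show "(\<integral>y. P (t - s) x y * (indicator {0..<s} r *\<^sub>R flow N Q I G s y r) \<partial>N) = indicator {0..<s} r *\<^sub>R flow N Q I G t x r"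
    proof (cases "r \<in> {0..<s}")
      case True
      then show ?thesis
        using flow_semigroup[of r s t x G] st x G by (auto simp: conv_def cont_L1_def)
    qed simp
  qed
  finally show "conv N P (t - s) (\<lambda>y. LINT r:{0..<s}|lborel. flow N Q I G s y r) x
    = (LINT r:{0..<s}|lborel. flow N Q I G t x r)" .
  show "integrable N (\<lambda>y. LINT r:{0..<s}|lborel. flow N Q I G s y r)"
    using LN.integrable_snd[OF i] by (simp add: set_lebesgue_integral_def)
qed

lemma conv_cong_AE:
  assumes "AE y in N. h y = h' y" "0 < t" "x \<in> space N" "integrable N h" "integrable N h'"
  shows "conv N P t h x = conv N P t h' x"
  unfolding conv_def using assms P_measurable1[OF assms(2,3)]
  by (intro integral_cong_AE) (auto intro!: borel_measurable_times)

lemma conv_integrable: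
  assumes "0 < t" "integrable N h"
  shows "integrable N (conv N P t h)"
proof (rule integrableI_bounded)
  note [measurable] = P_measurable[OF assms(1)] borel_measurable_integrable[OF assms(2)]
  show "conv N P t h \<in> borel_measurable N" unfolding conv_def[abs_def] by measurable
  have "(\<integral>\<^sup>+x. ennreal (norm (conv N P t h x)) \<partial>N) \<le> (\<integral>\<^sup>+x. \<integral>\<^sup>+y. ennreal \<bar>P t x y\<bar> * ennreal \<bar>h y\<bar> \<partial>N \<partial>N)"
  proof (rule nn_integral_mono)
    fix x assume x: "x \<in> space N"
    have "ennreal (norm (conv N P t h x)) \<le> (\<integral>\<^sup>+y. ennreal (norm (P t x y * h y)) \<partial>N)"
      unfolding conv_def using integrable_P_mult[OF assms(1) x assms(2)]
      by (intro integral_norm_bound_ennreal) simp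
    then show "ennreal (norm (conv N P t h x)) \<le> (\<integral>\<^sup>+y. ennreal \<bar>P t x y\<bar> * ennreal \<bar>h y\<bar> \<partial>N)"
      by (simp add: abs_mult ennreal_mult)
  qed
  also have "\<dots> = (\<integral>\<^sup>+y. \<integral>\<^sup>+x. ennreal \<bar>P t x y\<bar> * ennreal \<bar>h y\<bar> \<partial>N \<partial>N)"
    by (rule NN.Fubini'[symmetric]) measurable
  also have "\<dots> = (\<integral>\<^sup>+y. (\<integral>\<^sup>+x. ennreal \<bar>P t x y\<bar> \<partial>N) * ennreal \<bar>h y\<bar> \<partial>N)"
    by (intro nn_integral_cong nn_integral_multc) measurable
  also have "\<dots> \<le> (\<integral>\<^sup>+y. 1 * ennreal \<bar>h y\<bar> \<partial>N)"
    by (intro nn_integral_mono mult_right_mono P_mass assms) auto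
  also have "\<dots> < \<infinity>" using assms(2) by (simp add: integrable_iff_bounded)
  finally show "(\<integral>\<^sup>+x. ennreal (norm (conv N P t h x)) \<partial>N) < \<infinity>" .
qed

text \<open>The mild equation at time \<open>s\<close> is propagated to time \<open>t\<close>. It is
  known for almost every point only, but convolution ignores the null set, so the outcome holds at
  every \<open>x\<close>.\<close>

lemma mild_evolution_integral:
  assumes h: "\<And>t. 0 \<le> t \<Longrightarrow> integrable N (h t)"
    and G: "\<And>k. k \<in> I \<Longrightarrow> cont_L1 N (\<lambda>s. G s k)"
    and mild: "\<And>t. 0 < t \<Longrightarrow> AE x in N. duhamel_eq N P Q I h G t x"
    and s: "0 \<le> s" "s < t" and x: "x \<in> space N"
  shows "conv N P (t - s) (h s) x = conv N P t (h 0) x + (LINT r:{0..<s}|lborel. flow N Q I G t x r)"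
\<comment> \<open>The mild equation is available for positive times; at \<open>s = 0\<close> the
  time integral is empty.\<close>
proof (cases "s = 0")
  case False
  then have s0: "0 < s" and ts: "0 < t - s" using s by auto
  have i1: "integrable N (conv N P s (h 0))" by (rule conv_integrable[OF s0 h]) simp
  note i2 = conv_time_integral(2)[where G = G, OF G s(2) x]
  have "conv N P (t - s) (h s) x
      = conv N P (t - s) (\<lambda>y. conv N P s (h 0) y + (LINT r:{0..<s}|lborel. flow N Q I G s y r)) x"
    using mild[OF s0] by (intro conv_cong_AE ts x h s(1) Bochner_Integration.integrable_add i1 i2) (auto simp: duhamel_eq_def)
  also have "\<dots> = conv N P (t - s) (conv N P s (h 0)) x + conv N P (t - s) (\<lambda>y. LINT r:{0..<s}|lborel. flow N Q I G s y r) x"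
    using integrable_P_mult[OF ts x i1] integrable_P_mult[OF ts x i2]
    by (simp add: conv_def[of N P "t - s"] distrib_left)
  also have "\<dots> = conv N P t (h 0) x + (LINT r:{0..<s}|lborel. flow N Q I G t x r)"
    using conv_semigroup[OF ts s0 x h[of 0]] conv_time_integral(1)[where G = G, OF G s(2) x] by simp
  finally show ?thesis .
qed (simp add: set_lebesgue_integral_def)

lemma flow_set_integrable:
  assumes G: "\<And>k. k \<in> I \<Longrightarrow> cont_L1 N (\<lambda>s. G s k)" and "b < t" and x: "x \<in> space N"
  shows "set_integrable lborel {0..b} (flow N Q I G t x)"
  using assms(2) by (intro borel_integrable_atLeastAtMost' continuous_on_subset[OF flow_continuous[where G = G, OF G x]]) auto

lemma flow_integral_eq:
  assumes G: "\<And>k. k \<in> I \<Longrightarrow> cont_L1 N (\<lambda>s. G s k)" and "s < t" and x: "x \<in> space N"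
  shows "(LINT r:{0..<s}|lborel. flow N Q I G t x r) = integral {0..s} (flow N Q I G t x)"
proof -
  have "set_integrable lborel {0..<s} (flow N Q I G t x)"
    by (rule set_integrable_subset[OF flow_set_integrable[where G = G, OF G assms(2) x]]) auto
  then have "(LINT r:{0..<s}|lborel. flow N Q I G t x r) = integral {0..<s} (flow N Q I G t x)"
    by (rule set_borel_integral_eq_integral)
  also have "\<dots> = integral {0..s} (flow N Q I G t x)"
    by (rule integral_subset_negligible) (auto intro: negligible_subset[of "{s}"])
  finally show ?thesis .
qed

lemma flow_integral_tendsto:
  assumes "set_integrable lborel {0..<t} (flow N Q I G t x)" "0 < t"
  shows "((\<lambda>s. LINT r:{0..<s}|lborel. flow N Q I G t x r) \<longlongrightarrow> (LINT r:{0..<t}|lborel. flow N Q I G t x r)) (at_left t)"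
proof (rule tendsto_at_left_sequentially[OF assms(2)])
  fix S assume S: "\<And>n. S n < t" "\<And>n. 0 < S n" "incseq S" "S \<longlonglongrightarrow> t"
  have U: "(\<Union>n. {0..<S n}) = {0..<t}"
  proof safe
    fix r assume r: "r \<in> {0..<t}"
    have "\<forall>\<^sub>F n in sequentially. r < S n" using order_tendstoD(1)[OF S(4)] r by auto
    then obtain n where "r < S n" by (auto simp: eventually_sequentially)
    then show "r \<in> (\<Union>n. {0..<S n})" using r by auto
  next
    fix r n assume "r \<in> {0..<S n}"
    then show "r \<in> {0..<t}" using S(1)[of n] by auto
  qed
  have "(\<lambda>n. LINT r:{0..<S n}|lborel. flow N Q I G t x r) \<longlonglongrightarrow> (LINT r:(\<Union>n. {0..<S n})|lborel. flow N Q I G t x r)"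
  proof (rule set_integral_cont_up)
    show "incseq (\<lambda>n. {0..<S n})" using S(3) by (auto simp: incseq_def intro: less_le_trans)
  qed (use assms(1) U in auto)
  then show "(\<lambda>n. LINT r:{0..<S n}|lborel. flow N Q I G t x r) \<longlonglongrightarrow> (LINT r:{0..<t}|lborel. flow N Q I G t x r)"
    unfolding U .
qed

text \<open>By \<open>mild_evolution_integral\<close> the convolution is an indefinite integral of
  \<open>flow\<close>, which is continuous before \<open>t\<close>; this gives the derivative.
  Letting \<open>s\<close> tend to \<open>t\<close> in the same formula gives the limit, at the
  points where the mild equation holds at time \<open>t\<close>.\<close>

proposition mild_imp_evolution:
  assumes h: "\<And>t. 0 \<le> t \<Longrightarrow> integrable N (h t)"
    and G: "\<And>k. k \<in> I \<Longrightarrow> cont_L1 N (\<lambda>s. G s k)"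
    and mild: "\<And>t. 0 < t \<Longrightarrow> AE x in N. duhamel_eq N P Q I h G t x"
  shows "evolution N P Q I h G"
  unfolding evolution_def
proof (intro conjI allI impI ballI)
  fix t :: real and x s assume t: "0 < t" and x: "x \<in> space N" and s: "s \<in> {0..<t}"
  \<comment> \<open>\<open>flow\<close> is continuous on \<open>{0..<t}\<close>, while the
    fundamental theorem wants a compact interval; \<open>{0..b}\<close> has the same germ at
    \<open>s\<close>.\<close>
  obtain b where b: "s < b" "b < t" using s dense[of s t] by auto
  have eq: "conv N P (t - r) (h r) x = conv N P t (h 0) x + integral {0..r} (flow N Q I G t x)" if "r \<in> {0..<t}" for r
    using mild_evolution_integral[of h G r t x, OF h G mild] flow_integral_eq[of G r t x, OF G] that x by auto
  have "((\<lambda>u. integral {0..u} (flow N Q I G t x)) has_vector_derivative flow N Q I G t x s) (at s within {0..b})"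
    using s b by (intro integral_has_vector_derivative continuous_on_subset[OF flow_continuous[where G = G, OF G x]]) auto
  then have "((\<lambda>u. conv N P t (h 0) x + integral {0..u} (flow N Q I G t x)) has_real_derivative flow N Q I G t x s) (at s within {0..b})"
    by (auto intro!: derivative_eq_intros simp: has_real_derivative_iff_has_vector_derivative)
  moreover have "at s within {0..b} = at s within {0..<t}"
    by (rule at_within_nhd[of s "{..<b}"]) (use s b in auto)
  ultimately have "((\<lambda>u. conv N P t (h 0) x + integral {0..u} (flow N Q I G t x)) has_real_derivative flow N Q I G t x s) (at s within {0..<t})"
    by simp
  then show "((\<lambda>s. conv N P (t - s) (h s) x) has_real_derivative flow N Q I G t x s) (at s within {0..<t})"
    by (rule has_field_derivative_transform_within[where d = 1]) (use s eq in auto)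
next
  fix t :: real assume t: "0 < t"
  show "AE x in N. ((\<lambda>s. conv N P (t - s) (h s) x) \<longlongrightarrow> h t x) (at_left t)"
    using mild[OF t] AE_space
  proof eventually_elim
    case (elim x)
    then have l: "((\<lambda>s. conv N P t (h 0) x + (LINT r:{0..<s}|lborel. flow N Q I G t x r)) \<longlongrightarrow> h t x) (at_left t)"
      using tendsto_add[OF tendsto_const flow_integral_tendsto[OF _ t]] by (auto simp: duhamel_eq_def)
    have "\<forall>\<^sub>F s in at_left t. conv N P t (h 0) x + (LINT r:{0..<s}|lborel. flow N Q I G t x r) = conv N P (t - s) (h s) x"
      using eventually_at_left_real[OF t]
    proof eventually_elim
      case e: (elim s)
      then show ?case using mild_evolution_integral[of h G s t x, OF h G mild] elim by simp
    qed
    from Lim_transform_eventually[OF l this] show ?case .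
  qed
qed

text \<open>The fundamental theorem on \<open>{0..s}\<close> gives Duhamel's formula short of
  \<open>t\<close>. As \<open>s\<close> tends to \<open>t\<close> the time integral converges
  because \<open>flow\<close> is integrable for almost every \<open>x\<close>, and the convolution
  converges to \<open>h t x\<close>.\<close>

proposition evolution_imp_mild:
  assumes G: "\<And>k. k \<in> I \<Longrightarrow> cont_L1 N (\<lambda>s. G s k)"
    and ev: "evolution N P Q I h G" and t: "0 < t"
  shows "AE x in N. duhamel_eq N P Q I h G t x"
proof -
  have "AE x in N. ((\<lambda>s. conv N P (t - s) (h s) x) \<longlongrightarrow> h t x) (at_left t)"
    using ev t by (auto simp: evolution_def)
  moreover have "AE x in N. set_integrable lborel {0..<t} (flow N Q I G t x)"
    by (rule AE_set_integrable_flow) (rule G)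
  ultimately show ?thesis
    using AE_space
  proof eventually_elim
    case (elim x)
    have eq: "conv N P t (h 0) x + (LINT r:{0..<s}|lborel. flow N Q I G t x r) = conv N P (t - s) (h s) x" if s: "s \<in> {0<..<t}" for s
    proof -
      have "(flow N Q I G t x has_integral conv N P (t - s) (h s) x - conv N P (t - 0) (h 0) x) {0..s}"
      proof (rule fundamental_theorem_of_calculus)
        fix r assume r: "r \<in> {0..s}"
        have "((\<lambda>s. conv N P (t - s) (h s) x) has_real_derivative flow N Q I G t x r) (at r within {0..<t})"
          using ev t elim r s by (auto simp: evolution_def)
        then have "((\<lambda>s. conv N P (t - s) (h s) x) has_real_derivative flow N Q I G t x r) (at r within {0..s})"
          by (rule DERIV_subset) (use s in auto)
        then show "((\<lambda>s. conv N P (t - s) (h s) x) has_vector_derivative flow N Q I G t x r) (at r within {0..s})"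
          by (simp add: has_real_derivative_iff_has_vector_derivative)
      qed (use s in auto)
      then have "integral {0..s} (flow N Q I G t x) = conv N P (t - s) (h s) x - conv N P t (h 0) x"
        by (simp add: integral_unique)
      then show ?thesis using flow_integral_eq[of G s t x, OF G] elim s by simp
    qed
    have l: "((\<lambda>s. conv N P t (h 0) x + (LINT r:{0..<s}|lborel. flow N Q I G t x r)) \<longlongrightarrow>
        conv N P t (h 0) x + (LINT r:{0..<t}|lborel. flow N Q I G t x r)) (at_left t)"
      using elim by (intro tendsto_intros flow_integral_tendsto t)
    have "\<forall>\<^sub>F s in at_left t. conv N P t (h 0) x + (LINT r:{0..<s}|lborel. flow N Q I G t x r) = conv N P (t - s) (h s) x"
      using eventually_at_left_real[OF t] by eventually_elim (rule eq)
    from Lim_transform_eventually[OF l this]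
    have "h t x = conv N P t (h 0) x + (LINT r:{0..<t}|lborel. flow N Q I G t x r)"
      using elim by (intro tendsto_unique[OF trivial_limit_at_left_real])
    then show ?case using elim by (simp add: duhamel_eq_def)
  qed
qed

text \<open>The initial terms cancel and the Duhamel integral is linear in the flux, so
  \<open>flow_L1_time\<close> applies to the difference of the fluxes.\<close>

proposition mild_difference_bound:
  assumes G: "\<And>k. k \<in> I \<Longrightarrow> cont_L1 N (\<lambda>s. G s k)" "\<And>k. k \<in> I \<Longrightarrow> cont_L1 N (\<lambda>s. G' s k)"
    and h: "integrable N (h 0)" "integrable N (h' 0)" "AE x in N. h 0 x = h' 0 x"
    and mild: "AE x in N. duhamel_eq N P Q I h G t x" "AE x in N. duhamel_eq N P Q I h' G' t x"
    and a: "0 \<le> a" "a \<le> t" "0 < t"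
    and m: "\<And>s. s \<in> {0..<t} \<Longrightarrow> (\<Sum>k\<in>I. \<integral>x. norm (G s k x - G' s k x) \<partial>N) \<le> (if s < a then 0 else m)" "0 \<le> m"
  shows "(\<integral>\<^sup>+x. ennreal \<bar>h t x - h' t x\<bar> \<partial>N) \<le> ennreal (2 * C * m * sqrt (t - a))"
proof -
  define D where "D s k x = G s k x - G' s k x" for s k x
  have D: "cont_L1 N (\<lambda>s. D s k)" if "k \<in> I" for k
    unfolding D_def by (intro cont_L1_diff G that)
  have fl: "flow N Q I D t x s = flow N Q I G t x s - flow N Q I G' t x s" if "s \<in> {0..<t}" "x \<in> space N" for x s
    unfolding flow_def sum_subtractf[symmetric] D_def inner_diff_right
    using that by (intro sum.cong refl Bochner_Integration.integral_diff integrable_Q_inner cont_L1_integrable[OF G(1)] cont_L1_integrable[OF G(2)]) auto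
  have "AE x in N. set_integrable lborel {0..<t} (flow N Q I D t x)"
    by (rule AE_set_integrable_flow) (rule D)
  with mild have "AE x in N. ennreal \<bar>h t x - h' t x\<bar> \<le> (\<integral>\<^sup>+s. ennreal \<bar>indicator {0..<t} s *\<^sub>R flow N Q I D t x s\<bar> \<partial>lborel)"
    using AE_space
  proof eventually_elim
    case (elim x)
    have "h t x - h' t x = (LINT s:{0..<t}|lborel. flow N Q I G t x s) - (LINT s:{0..<t}|lborel. flow N Q I G' t x s)"
      using elim conv_cong_AE[OF h(3) a(3) _ h(1,2)] by (simp add: duhamel_eq_def)
    also have "\<dots> = (LINT s:{0..<t}|lborel. flow N Q I G t x s - flow N Q I G' t x s)"
      using elim by (intro set_integral_diff(2)[symmetric]) (auto simp: duhamel_eq_def)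
    also have "\<dots> = (LINT s:{0..<t}|lborel. flow N Q I D t x s)"
      using elim fl by (intro set_lebesgue_integral_cong) auto
    finally have "h t x - h' t x = (\<integral>s. indicator {0..<t} s *\<^sub>R flow N Q I D t x s \<partial>lborel)"
      by (simp only: set_lebesgue_integral_def)
    then show ?case
      using elim integral_norm_bound_ennreal[of lborel "\<lambda>s. indicator {0..<t} s *\<^sub>R flow N Q I D t x s"]
      by (simp only: set_integrable_def real_norm_def)
  qed
  then have "(\<integral>\<^sup>+x. ennreal \<bar>h t x - h' t x\<bar> \<partial>N) \<le> (\<integral>\<^sup>+x. \<integral>\<^sup>+s. ennreal \<bar>indicator {0..<t} s *\<^sub>R flow N Q I D t x s\<bar> \<partial>lborel \<partial>N)"
    by (rule nn_integral_mono_AE)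
  also have "\<dots> \<le> ennreal (2 * C * m * sqrt (t - a))"
    using m by (intro flow_L1_time D a) (auto simp: D_def)
  finally show ?thesis .
qed

end

lemma evolution_sum:
  assumes ev: "\<And>a. a \<in> A \<Longrightarrow> evolution N P Q I (h a) (G a)" and A: "finite A" and hk: "heat_kernels N P Q I C"
    and h: "\<And>a t. a \<in> A \<Longrightarrow> 0 \<le> t \<Longrightarrow> integrable N (h a t)"
    and G: "\<And>a t k. a \<in> A \<Longrightarrow> k \<in> I \<Longrightarrow> 0 \<le> t \<Longrightarrow> integrable N (G a t k)"
  shows "evolution N P Q I (\<lambda>t x. \<Sum>a\<in>A. h a t x) (\<lambda>t k x. \<Sum>a\<in>A. G a t k x)"
proof -
  interpret heat_kernels N P Q I C by fact
  have c: "conv N P (t - s) (\<lambda>x. \<Sum>a\<in>A. h a s x) x = (\<Sum>a\<in>A. conv N P (t - s) (h a s) x)"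
    if "0 \<le> s" "s < t" "x \<in> space N" for t s x
    unfolding conv_def sum_distrib_left
    using integrable_P_mult[OF _ that(3) h, of "t - s" _ s] that by (intro Bochner_Integration.integral_sum) auto
  have f: "flow N Q I (\<lambda>t k x. \<Sum>a\<in>A. G a t k x) t x s = (\<Sum>a\<in>A. flow N Q I (G a) t x s)"
    if "0 \<le> s" "s < t" "x \<in> space N" for t s x
  proof -
    have "flow N Q I (\<lambda>t k x. \<Sum>a\<in>A. G a t k x) t x s = (\<Sum>k\<in>I. \<Sum>a\<in>A. \<integral>y. Q k (t - s) x y \<bullet> G a s k y \<partial>N)"
      unfolding flow_def inner_sum_right
      using that by (intro sum.cong refl Bochner_Integration.integral_sum integrable_Q_inner G) auto
    then show ?thesis unfolding flow_def by (subst sum.swap)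
  qed
  show ?thesis
    unfolding evolution_def
  proof (intro conjI allI impI ballI)
    fix t :: real and x s assume t: "0 < t" and x: "x \<in> space N" and s: "s \<in> {0..<t}"
    have "((\<lambda>s. \<Sum>a\<in>A. conv N P (t - s) (h a s) x) has_real_derivative (\<Sum>a\<in>A. flow N Q I (G a) t x s)) (at s within {0..<t})"
      using ev t x s by (intro DERIV_sum) (auto simp: evolution_def)
    then have "((\<lambda>s. \<Sum>a\<in>A. conv N P (t - s) (h a s) x) has_real_derivative flow N Q I (\<lambda>t k x. \<Sum>a\<in>A. G a t k x) t x s) (at s within {0..<t})"
      using f[of s t x] s x by simp
    then show "((\<lambda>s. conv N P (t - s) (\<lambda>x. \<Sum>a\<in>A. h a s x) x) has_real_derivative flow N Q I (\<lambda>t k x. \<Sum>a\<in>A. G a t k x) t x s) (at s within {0..<t})"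
      by (rule has_field_derivative_transform_within[where d = 1]) (use s c x in auto)
  next
    fix t :: real assume t: "0 < t"
    have "AE x in N. \<forall>a\<in>A. ((\<lambda>s. conv N P (t - s) (h a s) x) \<longlongrightarrow> h a t x) (at_left t)"
      using ev t A by (intro AE_finite_allI) (auto simp: evolution_def)
    then show "AE x in N. ((\<lambda>s. conv N P (t - s) (\<lambda>x. \<Sum>a\<in>A. h a s x) x) \<longlongrightarrow> (\<Sum>a\<in>A. h a t x)) (at_left t)"
      using AE_space
    proof eventually_elim
      case (elim x)
      have l: "((\<lambda>s. \<Sum>a\<in>A. conv N P (t - s) (h a s) x) \<longlongrightarrow> (\<Sum>a\<in>A. h a t x)) (at_left t)"
        using elim by (intro tendsto_sum) auto
      have "\<forall>\<^sub>F s in at_left t. (\<Sum>a\<in>A. conv N P (t - s) (h a s) x) = conv N P (t - s) (\<lambda>x. \<Sum>a\<in>A. h a s x) x"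
        using eventually_at_left_real[OF t] by eventually_elim (use c elim in auto)
      from Lim_transform_eventually[OF l this] show ?case .
    qed
  qed
qed

text \<open>The null sets may vary with the time, since an evolution looks at one time slice of the
  solution and of the flux at a time.\<close>

lemma evolution_cong_AE:
  assumes ev: "evolution N P Q I h G" and hk: "heat_kernels N P Q I C"
    and h: "\<And>t. 0 \<le> t \<Longrightarrow> integrable N (h t)" "\<And>t. 0 \<le> t \<Longrightarrow> integrable N (h' t)"
      "\<And>t. 0 \<le> t \<Longrightarrow> AE x in N. h t x = h' t x"
    and G: "\<And>t k. k \<in> I \<Longrightarrow> 0 \<le> t \<Longrightarrow> integrable N (G t k)" "\<And>t k. k \<in> I \<Longrightarrow> 0 \<le> t \<Longrightarrow> integrable N (G' t k)"
      "\<And>t k. k \<in> I \<Longrightarrow> 0 \<le> t \<Longrightarrow> AE x in N. G t k x = G' t k x"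
  shows "evolution N P Q I h' G'"
proof -
  interpret heat_kernels N P Q I C by fact
  have c: "conv N P (t - s) (h s) x = conv N P (t - s) (h' s) x" if "0 \<le> s" "s < t" "x \<in> space N" for t s x
    using that by (intro conv_cong_AE h) auto
  have f: "flow N Q I G t x s = flow N Q I G' t x s" if "0 \<le> s" "s < t" "x \<in> space N" for t s x
    unfolding flow_def
  proof (intro sum.cong refl integral_cong_AE)
    fix k assume k: "k \<in> I"
    show "AE y in N. Q k (t - s) x y \<bullet> G s k y = Q k (t - s) x y \<bullet> G' s k y"
      using G(3)[OF k that(1)] by eventually_elim simp
  qed (use that G integrable_Q_inner in auto)
  show ?thesis
    unfolding evolution_def
  proof (intro conjI allI impI ballI)
    fix t :: real and x s assume t: "0 < t" and x: "x \<in> space N" and s: "s \<in> {0..<t}"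
    have "((\<lambda>s. conv N P (t - s) (h s) x) has_real_derivative flow N Q I G' t x s) (at s within {0..<t})"
      using ev t x s f[of s t x] unfolding evolution_def by (metis atLeastLessThan_iff)
    then show "((\<lambda>s. conv N P (t - s) (h' s) x) has_real_derivative flow N Q I G' t x s) (at s within {0..<t})"
      by (rule has_field_derivative_transform_within[where d = 1]) (use s c x in auto)
  next
    fix t :: real assume t: "0 < t"
    have "AE x in N. ((\<lambda>s. conv N P (t - s) (h s) x) \<longlongrightarrow> h t x) (at_left t)"
      using ev t by (auto simp: evolution_def)
    then show "AE x in N. ((\<lambda>s. conv N P (t - s) (h' s) x) \<longlongrightarrow> h' t x) (at_left t)"
      using AE_space h(3)[OF less_imp_le[OF t]]
    proof eventually_elim
      case (elim x)
      have "\<forall>\<^sub>F s in at_left t. conv N P (t - s) (h s) x = conv N P (t - s) (h' s) x"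
        using eventually_at_left_real[OF t] by eventually_elim (use c elim in auto)
      from Lim_transform_eventually[OF elim(1) this] elim show ?case by simp
    qed
  qed
qed

subsection \<open>The Gauss kernel\<close>

text \<open>Used with counting measure on the lattice, where the integral is an absolutely
  convergent series.\<close>

lemma isCont_integral_dominated:
  fixes f :: "'e::metric_space \<Rightarrow> 'n \<Rightarrow> 'b::{banach, second_countable_topology}"
  assumes cont: "\<And>n. n \<in> space M \<Longrightarrow> isCont (\<lambda>w. f w n) z" and d: "0 < d"
    and meas: "\<And>w. dist w z < d \<Longrightarrow> f w \<in> borel_measurable M"
    and bd: "\<And>w n. dist w z < d \<Longrightarrow> n \<in> space M \<Longrightarrow> norm (f w n) \<le> A n" and A: "integrable M A"
  shows "isCont (\<lambda>w. \<integral>n. f w n \<partial>M) z"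
  unfolding continuous_at_sequentially comp_def
proof (intro allI impI)
  fix u assume u: "u \<longlonglongrightarrow> z"
  then obtain n0 where n0: "\<And>i. i \<ge> n0 \<Longrightarrow> dist (u i) z < d"
    using d by (auto simp: lim_sequentially)
  have u': "(\<lambda>i. u (i + n0)) \<longlonglongrightarrow> z" by (rule LIMSEQ_ignore_initial_segment[OF u])
  have "(\<lambda>i. \<integral>n. f (u (i + n0)) n \<partial>M) \<longlonglongrightarrow> (\<integral>n. f z n \<partial>M)"
  proof (rule integral_dominated_convergence[where w = A])
    show "AE n in M. (\<lambda>i. f (u (i + n0)) n) \<longlonglongrightarrow> f z n"
      using cont u' by (intro AE_I2) (auto simp: continuous_at_sequentially comp_def)
    show "AE n in M. norm (f (u (i + n0)) n) \<le> A n" for i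
      using n0[of "i + n0"] bd by (intro AE_I2) auto
    show "f z \<in> borel_measurable M" using d by (intro meas) auto
    show "f (u (i + n0)) \<in> borel_measurable M" for i using n0[of "i + n0"] by (intro meas) auto
  qed (rule A)
  then show "(\<lambda>i. \<integral>n. f (u i) n \<partial>M) \<longlonglongrightarrow> (\<integral>n. f z n \<partial>M)" by (rule LIMSEQ_offset)
qed

text \<open>This serves twice: for the lattice series of the torus kernel, and for differentiating
  the semigroup identity in its last variable.\<close>

lemma has_derivative_integral_dominated:
  fixes f :: "'e::euclidean_space \<Rightarrow> 'n \<Rightarrow> real" and f' :: "'e \<Rightarrow> 'n \<Rightarrow> 'e"
  assumes der: "\<And>w n. n \<in> space M \<Longrightarrow> ((\<lambda>w. f w n) has_derivative (\<lambda>h. f' w n \<bullet> h)) (at w)"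
    and meas: "f' z \<in> borel_measurable M"
    and int: "\<And>w. integrable M (f w)"
    and bd: "\<And>w n. norm (w - z) \<le> 1 \<Longrightarrow> n \<in> space M \<Longrightarrow> norm (f' w n) \<le> A n" and A: "integrable M A"
  shows "((\<lambda>w. \<integral>n. f w n \<partial>M) has_derivative (\<lambda>h. (\<integral>n. f' z n \<partial>M) \<bullet> h)) (at z)"
  unfolding has_derivative_at
proof
  have if': "integrable M (f' z)"
    by (rule Bochner_Integration.integrable_bound[OF A meas]) (use bd[of z] in \<open>auto intro!: AE_I2 order_trans[OF _ abs_ge_self]\<close>)
  show "bounded_linear ((\<bullet>) (\<integral>n. f' z n \<partial>M))" by (rule bounded_linear_inner_right)
  have lin: "\<bar>f (z + h) n - f z n\<bar> \<le> A n * norm h" if n: "n \<in> space M" and h: "norm h \<le> 1" for n h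
  proof -
    have "norm (f (z + h) n - f z n) \<le> A n * norm (z + h - z)"
    proof (rule differentiable_bound[where S = "cball z 1" and f' = "\<lambda>w h. f' w n \<bullet> h"])
      fix w assume w: "w \<in> cball z 1"
      show "((\<lambda>w. f w n) has_derivative (\<lambda>h. f' w n \<bullet> h)) (at w within cball z 1)"
        by (rule has_derivative_at_withinI[OF der[OF n]])
      have nb: "norm (f' w n) \<le> A n" using w n by (intro bd) (auto simp: dist_norm norm_minus_commute)
      show "onorm (\<lambda>h. f' w n \<bullet> h) \<le> A n"
      proof (rule onorm_bound)
        show "0 \<le> A n" using nb norm_ge_zero order_trans by blast
        fix k show "norm (f' w n \<bullet> k) \<le> A n * norm k"
          using nb by (metis Cauchy_Schwarz_ineq2 mult_right_mono norm_ge_zero order_trans real_norm_def)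
      qed
    qed (use h in \<open>auto simp: dist_norm\<close>)
    then show ?thesis by simp
  qed
  show "(\<lambda>h. norm ((\<integral>n. f (z + h) n \<partial>M) - (\<integral>n. f z n \<partial>M) - (\<integral>n. f' z n \<partial>M) \<bullet> h) / norm h) \<midarrow>0\<rightarrow> 0"
    unfolding tendsto_at_iff_sequentially comp_def
  proof (intro allI impI)
    fix u :: "nat \<Rightarrow> 'e" assume u0: "\<forall>i. u i \<in> UNIV - {0}" and u: "u \<longlonglongrightarrow> 0"
    then obtain n0 where n0: "\<And>i. i \<ge> n0 \<Longrightarrow> norm (u i) < 1"
      using LIMSEQ_D[OF u, of 1] by auto
    define v where "v i = u (i + n0)" for i
    have v: "v i \<noteq> 0" "norm (v i) \<le> 1" for i using u0 n0[of "i + n0"] by (auto simp: v_def less_imp_le)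
    have v0: "v \<longlonglongrightarrow> 0" unfolding v_def by (rule LIMSEQ_ignore_initial_segment[OF u])
    \<comment> \<open>The remainder of the linear approximation, divided by the size of the
      increment. The mean value theorem bounds the difference of \<open>f\<close> by
      \<open>A n\<close>, and the linear part is bounded by \<open>A n\<close> as well; hence the
      majorant \<open>2 * A n\<close>.\<close>
    define r where "r i n = (f (z + v i) n - f z n - f' z n \<bullet> v i) / norm (v i)" for i n
    have ri: "integrable M (r i)" for i
      unfolding r_def using if' int by (intro integrable_divide Bochner_Integration.integrable_diff integrable_inner_left) auto
    have "(\<lambda>i. \<integral>n. r i n \<partial>M) \<longlonglongrightarrow> (\<integral>n. 0 \<partial>M)"
    proof (rule integral_dominated_convergence[where w = "\<lambda>n. 2 * A n"])
      show "AE n in M. (\<lambda>i. r i n) \<longlonglongrightarrow> 0"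
      proof (rule AE_I2)
        fix n assume n: "n \<in> space M"
        have "(\<lambda>h. norm (f (z + h) n - f z n - f' z n \<bullet> h) / norm h) \<midarrow>0\<rightarrow> 0"
          using der[OF n, of z] by (simp add: has_derivative_at)
        then have "(\<lambda>i. norm (f (z + v i) n - f z n - f' z n \<bullet> v i) / norm (v i)) \<longlonglongrightarrow> 0"
          unfolding tendsto_at_iff_sequentially comp_def using v v0 by auto
        then have "(\<lambda>i. norm (r i n)) \<longlonglongrightarrow> 0" by (simp add: r_def)
        then show "(\<lambda>i. r i n) \<longlonglongrightarrow> 0" by (rule tendsto_norm_zero_cancel)
      qed
      show "AE n in M. norm (r i n) \<le> 2 * A n" for i
      proof (rule AE_I2)
        fix n assume n: "n \<in> space M"
        have "\<bar>f' z n \<bullet> v i\<bar> \<le> A n * norm (v i)"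
          using bd[of z n] n by (metis Cauchy_Schwarz_ineq2 mult_right_mono norm_ge_zero order_trans diff_self norm_zero zero_le_one)
        then have "\<bar>f (z + v i) n - f z n - f' z n \<bullet> v i\<bar> \<le> 2 * A n * norm (v i)"
          using lin[OF n v(2), of i] by (simp add: abs_le_iff)
        then show "norm (r i n) \<le> 2 * A n" using v(1)[of i] by (simp add: r_def field_simps)
      qed
      show "r i \<in> borel_measurable M" for i using ri by auto
    qed (use A in auto)
    then have "(\<lambda>i. \<integral>n. r i n \<partial>M) \<longlonglongrightarrow> 0" by simp
    then have "(\<lambda>i. norm (\<integral>n. r i n \<partial>M)) \<longlonglongrightarrow> 0" by (rule tendsto_norm_zero)
    moreover have "(\<integral>n. r i n \<partial>M) = ((\<integral>n. f (z + v i) n \<partial>M) - (\<integral>n. f z n \<partial>M) - (\<integral>n. f' z n \<partial>M) \<bullet> v i) / norm (v i)" for i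
      unfolding r_def using if' int by simp
    ultimately have "(\<lambda>i. norm ((\<integral>n. f (z + v i) n \<partial>M) - (\<integral>n. f z n \<partial>M) - (\<integral>n. f' z n \<partial>M) \<bullet> v i) / norm (v i)) \<longlonglongrightarrow> 0"
      by simp
    then show "(\<lambda>i. norm ((\<integral>n. f (z + u i) n \<partial>M) - (\<integral>n. f z n \<partial>M) - (\<integral>n. f' z n \<partial>M) \<bullet> u i) / norm (u i)) \<longlonglongrightarrow> 0"
      unfolding v_def by (rule LIMSEQ_offset)
  qed
qed

lemma nn_integral_lborel_translate:
  fixes f :: "'e::euclidean_space \<Rightarrow> ennreal"
  assumes [measurable]: "f \<in> borel_measurable borel"
  shows "(\<integral>\<^sup>+x. f (c + x) \<partial>lborel) = (\<integral>\<^sup>+x. f x \<partial>lborel)"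
  by (subst (2) lborel_affine[of 1 c]) (simp_all add: nn_integral_density nn_integral_distr)

lemma gauss_nonneg [simp]: "0 \<le> gauss t z"
  by (simp add: gauss_def)

lemma gauss_uminus [simp]: "gauss t (- z) = gauss t z"
  by (simp add: gauss_def)

lemma borel_measurable_gauss [measurable]: "gauss t \<in> borel_measurable borel"
  unfolding gauss_def[abs_def] by measurable

definition grad_gauss :: "real \<Rightarrow> real^'d \<Rightarrow> real^'d" where
  "grad_gauss t z = - (gauss t z / (2 * t)) *\<^sub>R z"

lemma gauss_has_derivative:
  assumes "0 < t"
  shows "(gauss t has_derivative (\<lambda>h. grad_gauss t z \<bullet> h)) (at z)"
  unfolding gauss_def[abs_def] power2_norm_eq_inner
  by (rule derivative_eq_intros refl | use assms in \<open>force simp: grad_gauss_def gauss_def power2_norm_eq_inner inner_commute field_simps\<close>)+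

lemma gauss_isCont_time: "0 < t \<Longrightarrow> isCont (\<lambda>t. gauss t z) t"
  unfolding gauss_def by (intro continuous_intros) auto

lemma grad_gauss_isCont_time: "0 < t \<Longrightarrow> isCont (\<lambda>t. grad_gauss t z) t"
  unfolding grad_gauss_def gauss_def by (intro continuous_intros) auto

lemma grad_gauss_isCont: "0 < t \<Longrightarrow> isCont (grad_gauss t) z"
  unfolding grad_gauss_def[abs_def] gauss_def by (intro continuous_intros) auto

text \<open>\<open>gauss t\<close> is the product of centred normal densities of variance
  \<open>2 * t\<close> in the coordinates.\<close>

lemma nn_integral_gauss:
  assumes t: "0 < t"
  shows "(\<integral>\<^sup>+z. ennreal (gauss t (z :: real^'d)) \<partial>lborel) = 1"
proof -
  have eq: "gauss t z = (\<Prod>b\<in>Basis. normal_density 0 (sqrt (2 * t)) (z \<bullet> b))" for z :: "real^'d"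
  proof -
    have "(4 * pi * t) powr (- real CARD('d) / 2) = ((4 * pi * t) powr (- (1 / 2))) powr real CARD('d)"
      by (simp add: powr_powr)
    also have "\<dots> = ((4 * pi * t) powr (- (1 / 2))) ^ CARD('d)" using t by (intro powr_realpow) simp
    also have "(4 * pi * t) powr (- (1 / 2)) = 1 / sqrt (4 * pi * t)"
      using t by (simp add: powr_minus_divide powr_half_sqrt)
    finally have c: "(4 * pi * t) powr (- real CARD('d) / 2) = (1 / sqrt (4 * pi * t)) ^ CARD('d)" .
    have "(norm z)\<^sup>2 = (\<Sum>b\<in>Basis. (z \<bullet> b)\<^sup>2)"
      unfolding power2_norm_eq_inner by (subst euclidean_inner) (simp only: power2_eq_square)
    then have "exp (- (norm z)\<^sup>2 / (4 * t)) = exp (\<Sum>b\<in>Basis. - (z \<bullet> b)\<^sup>2 / (4 * t))"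
      by (simp add: sum_negf sum_divide_distrib)
    also have "\<dots> = (\<Prod>b\<in>Basis. exp (- (z \<bullet> b)\<^sup>2 / (4 * t)))" by (simp add: exp_sum)
    finally show ?thesis
      using t unfolding gauss_def c normal_density_def
      by (simp add: prod_dividef power_divide prod.distrib ac_simps)
  qed
  have "(\<integral>\<^sup>+z. ennreal (gauss t (z :: real^'d)) \<partial>lborel)
      = (\<integral>\<^sup>+z. (\<Prod>b\<in>Basis. ennreal (normal_density 0 (sqrt (2 * t)) ((z :: real^'d) \<bullet> b))) \<partial>lborel)"
    by (simp add: eq prod_ennreal)
  also have "\<dots> = (\<Prod>b\<in>(Basis :: (real^'d) set). \<integral>\<^sup>+x. ennreal (normal_density 0 (sqrt (2 * t)) x) \<partial>lborel)"
    by (rule nn_integral_lborel_prod) auto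
  also have "(\<integral>\<^sup>+x. ennreal (normal_density 0 (sqrt (2 * t)) x) \<partial>lborel) = 1"
    using t by (subst nn_integral_eq_integral) auto
  finally show ?thesis by simp
qed

text \<open>The linear factor of the gradient is absorbed by doubling the time: half of the Gaussian
  exponent pays for it. The factor \<open>2 powr (real CARD('d) / 2)\<close> is the ratio of the
  normalising constants at the times \<open>t\<close> and \<open>2 * t\<close>.\<close>

lemma norm_grad_gauss_le:
  fixes z :: "real^'d"
  assumes t: "0 < t"
  shows "norm (grad_gauss t z) \<le> 2 powr (real CARD('d) / 2) / sqrt t * gauss (2 * t) z"
proof -
  define u where "u = norm z / sqrt t"
  have u: "norm z = u * sqrt t" "0 \<le> u" using t by (auto simp: u_def)
  have uu: "(norm z)\<^sup>2 = u\<^sup>2 * t" using t by (simp add: u power_mult_distrib)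
  \<comment> \<open>Divided by 8 this is \<open>u / 2 \<le> 1 + u\<^sup>2 / 8\<close>. The right
    side is at most \<open>exp (u\<^sup>2 / 8)\<close>, which leaves half of the exponent
    \<open>u\<^sup>2 / 4\<close>.\<close>
  have "0 \<le> (u - 2)\<^sup>2 + 4" by simp
  then have "u / 2 \<le> 1 + u\<^sup>2 / 8" by (simp add: power2_eq_square algebra_simps)
  also have "\<dots> \<le> exp (u\<^sup>2 / 8)" by (rule exp_ge_add_one_self)
  finally have "u / 2 * exp (- (u\<^sup>2 / 4)) \<le> exp (u\<^sup>2 / 8) * exp (- (u\<^sup>2 / 4))"
    by (intro mult_right_mono) auto
  also have "\<dots> = exp (- (u\<^sup>2 / 8))" by (simp flip: exp_add)
  finally have *: "u / 2 * exp (- (u\<^sup>2 / 4)) \<le> exp (- (u\<^sup>2 / 8))" .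
  define k where "k = real CARD('d) / 2"
  have c: "(4 * pi * t) powr (- k) = 2 powr k * (4 * pi * (2 * t)) powr (- k)"
  proof -
    have "(4 * pi * (2 * t)) powr (- k) = 2 powr (- k) * (4 * pi * t) powr (- k)"
      using t by (subst powr_mult[symmetric]) (auto simp: mult_ac)
    then show ?thesis by (simp add: powr_minus field_simps)
  qed
  have "norm (grad_gauss t z) = gauss t z / (2 * t) * norm z"
    using t by (simp add: grad_gauss_def)
  also have "\<dots> = (4 * pi * t) powr (- k) / sqrt t * (u / 2 * exp (- (u\<^sup>2 / 4)))"
    using t uu by (simp add: gauss_def k_def u(1) real_div_sqrt field_simps)
  also have "\<dots> \<le> (4 * pi * t) powr (- k) / sqrt t * exp (- (u\<^sup>2 / 8))"
    using * t by (intro mult_left_mono) auto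
  also have "\<dots> = 2 powr k / sqrt t * gauss (2 * t) z"
  proof -
    have e: "- (norm z)\<^sup>2 / (4 * (2 * t)) = - (u\<^sup>2 / 8)" using t uu by simp
    have p: "- real CARD('d) / 2 = - k" by (simp add: k_def)
    show ?thesis unfolding gauss_def c e p by simp
  qed
  finally show ?thesis by (simp add: k_def)
qed

lemma gauss_semigroup:
  fixes x z :: "real^'d"
  assumes t: "0 < t" and s: "0 < s"
  shows "(\<integral>\<^sup>+y. ennreal (gauss t (x - y)) * ennreal (gauss s (y - z)) \<partial>lborel) = ennreal (gauss (t + s) (x - z))"
proof -
  \<comment> \<open>Completing the square in \<open>y\<close>: the product of the two kernels is a
    Gaussian of time \<open>r\<close> centred at \<open>m\<close>, the mean of the end points
    weighted by the two times. It integrates to 1, and the remaining factor is the kernel of time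
    \<open>t + s\<close>.\<close>
  define m where "m = z + (s / (t + s)) *\<^sub>R (x - z)"
  define r where "r = t * s / (t + s)"
  have r: "0 < r" using t s by (simp add: r_def)
  have "gauss t (x - y) * gauss s (y - z) = gauss (t + s) (x - z) * gauss r (- m + y)" for y
  proof -
    have c: "(4 * pi * t) powr k * (4 * pi * s) powr k = (4 * pi * (t + s)) powr k * (4 * pi * r) powr k" for k
    proof -
      have "(4 * pi * t) * (4 * pi * s) = (4 * pi * (t + s)) * (4 * pi * r)"
        using t s by (simp add: r_def field_simps)
      then have "((4 * pi * t) * (4 * pi * s)) powr k = ((4 * pi * (t + s)) * (4 * pi * r)) powr k"
        by (rule arg_cong)
      moreover have "((4 * pi * t) * (4 * pi * s)) powr k = (4 * pi * t) powr k * (4 * pi * s) powr k"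
        by (rule powr_mult)
      moreover have "((4 * pi * (t + s)) * (4 * pi * r)) powr k = (4 * pi * (t + s)) powr k * (4 * pi * r) powr k"
        by (rule powr_mult)
      ultimately show ?thesis by (simp only:)
    qed
    \<comment> \<open>In the increments \<open>a\<close> and \<open>b\<close> the identity for the
      exponents involves only three inner products, so it becomes an identity of rational
      functions.\<close>
    define a b where "a = x - y" and "b = y - z"
    have ab: "x - z = a + b" "- m + y = (1 / (t + s)) *\<^sub>R (t *\<^sub>R b - s *\<^sub>R a)"
    proof -
      show "x - z = a + b" by (simp add: a_def b_def)
      have "(t + s) *\<^sub>R (- m + y) = (t + s) *\<^sub>R b - ((t + s) * (s / (t + s))) *\<^sub>R (a + b)"
        by (simp add: m_def a_def b_def algebra_simps)
      also have "(t + s) * (s / (t + s)) = s" using t s by simp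
      finally have "(t + s) *\<^sub>R (- m + y) = t *\<^sub>R b - s *\<^sub>R a" by (simp add: algebra_simps)
      then have "(1 / (t + s)) *\<^sub>R ((t + s) *\<^sub>R (- m + y)) = (1 / (t + s)) *\<^sub>R (t *\<^sub>R b - s *\<^sub>R a)" by simp
      then show "- m + y = (1 / (t + s)) *\<^sub>R (t *\<^sub>R b - s *\<^sub>R a)" using t s by simp
    qed
    have "(norm (- m + y))\<^sup>2 = (norm (t *\<^sub>R b - s *\<^sub>R a))\<^sup>2 / (t + s)\<^sup>2"
      unfolding ab using t s by (simp add: power_divide)
    then have e1: "(norm (- m + y))\<^sup>2 / (4 * r) = (norm (t *\<^sub>R b - s *\<^sub>R a))\<^sup>2 / (4 * (t * s * (t + s)))"
    proof -
      have "X / u\<^sup>2 / (4 * (t * s / u)) = X / (4 * (t * s * u))" if "0 < u" for X u :: real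
        using t s that by (simp add: field_simps power2_eq_square)
      from this[of "t + s"] show ?thesis
        unfolding \<open>(norm (- m + y))\<^sup>2 = _\<close> r_def using t s by simp
    qed
    have e2: "(norm (t *\<^sub>R b - s *\<^sub>R a))\<^sup>2 = t\<^sup>2 * (b \<bullet> b) - 2 * t * s * (a \<bullet> b) + s\<^sup>2 * (a \<bullet> a)"
      unfolding power2_norm_eq_inner[of "t *\<^sub>R b - s *\<^sub>R a"]
      by (simp add: inner_diff_left inner_diff_right inner_commute[of b a] power2_eq_square algebra_simps)
    have e3: "(norm (x - z))\<^sup>2 = a \<bullet> a + 2 * (a \<bullet> b) + b \<bullet> b"
      unfolding ab by (simp add: power2_norm_eq_inner inner_add_left inner_add_right inner_commute)
    have "(norm a)\<^sup>2 / (4 * t) + (norm b)\<^sup>2 / (4 * s) = (norm (x - z))\<^sup>2 / (4 * (t + s)) + (norm (- m + y))\<^sup>2 / (4 * r)"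
    proof -
      have "A / (4 * t) + B / (4 * s) = (A + 2 * D + B) / (4 * (t + s)) + (t\<^sup>2 * B - 2 * t * s * D + s\<^sup>2 * A) / (4 * (t * s * (t + s)))"
        for A B D :: real
        using t s by (simp add: divide_simps) (simp add: power2_eq_square algebra_simps)
      then show ?thesis unfolding e1 e2 e3 by (simp only: power2_norm_eq_inner)
    qed
    then have "exp (- (norm a)\<^sup>2 / (4 * t)) * exp (- (norm b)\<^sup>2 / (4 * s)) = exp (- (norm (x - z))\<^sup>2 / (4 * (t + s))) * exp (- (norm (- m + y))\<^sup>2 / (4 * r))"
      by (simp flip: exp_add add: algebra_simps)
    with c[of "- real CARD('d) / 2"] show ?thesis
      unfolding gauss_def a_def[symmetric] b_def[symmetric] by (simp add: mult_ac)
  qed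
  then have "(\<integral>\<^sup>+y. ennreal (gauss t (x - y)) * ennreal (gauss s (y - z)) \<partial>lborel)
     = (\<integral>\<^sup>+y. ennreal (gauss (t + s) (x - z)) * ennreal (gauss r (- m + y)) \<partial>lborel)"
    by (simp flip: ennreal_mult)
  also have "\<dots> = ennreal (gauss (t + s) (x - z)) * (\<integral>\<^sup>+y. ennreal (gauss r (- m + y)) \<partial>lborel)"
    by (rule nn_integral_cmult) measurable
  also have "(\<integral>\<^sup>+y. ennreal (gauss r (- m + y)) \<partial>lborel) = 1"
    using nn_integral_lborel_translate[of "\<lambda>y. ennreal (gauss r y)" "- m"] nn_integral_gauss[OF r] by simp
  finally show ?thesis by simp
qed

text \<open>Halving the exponent absorbs a bounded shift, since the square of \<open>norm w\<close>
  is at most twice that of \<open>norm (w + v)\<close> plus twice that of \<open>norm v\<close>.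
  Hence one Gaussian, of time \<open>2 * b\<close>, dominates all times in \<open>{a..b}\<close> and
  all shifts up to \<open>R\<close>.\<close>

lemma gauss_compare:
  assumes a: "0 < a"
  obtains A where "0 \<le> A" "\<And>t w v :: real^'d. a \<le> t \<Longrightarrow> t \<le> b \<Longrightarrow> norm v \<le> R \<Longrightarrow> gauss t (w + v) \<le> A * gauss (2 * b) w"
proof (cases "a \<le> b")
  case True
  define k where "k = real CARD('d) / 2"
  have b: "0 < b" using a True by simp
  \<comment> \<open>The largest normalising factor, that at time \<open>a\<close>, over the factor
    of the dominating Gaussian, times the cost of the shift.\<close>
  define A where "A = (4 * pi * a) powr (- k) / (4 * pi * (2 * b)) powr (- k) * exp (R\<^sup>2 / (4 * b))"
  have "gauss t (w + v) \<le> A * gauss (2 * b) w" if t: "a \<le> t" "t \<le> b" and v: "norm v \<le> R" for t and w v :: "real^'d"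
  proof -
    have t0: "0 < t" using a t by simp
    have p: "(4 * pi * t) powr (- k) \<le> (4 * pi * a) powr (- k)"
      using a t by (intro powr_mono2') (auto simp: k_def)
    have "(norm w)\<^sup>2 \<le> (norm (w + v) + norm v)\<^sup>2"
      by (intro power_mono) (auto, metis add_diff_cancel norm_triangle_ineq4)
    also have "\<dots> \<le> 2 * (norm (w + v))\<^sup>2 + 2 * (norm v)\<^sup>2"
      using sum_squares_bound[of "norm (w + v)" "norm v"] by (simp add: power2_sum)
    also have "\<dots> \<le> 2 * (norm (w + v))\<^sup>2 + 2 * R\<^sup>2" using v by (simp add: power_mono)
    finally have "(norm w)\<^sup>2 / (8 * b) \<le> (2 * (norm (w + v))\<^sup>2 + 2 * R\<^sup>2) / (8 * b)" using b by (intro divide_right_mono) auto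
    moreover have "(norm (w + v))\<^sup>2 / (4 * b) \<le> (norm (w + v))\<^sup>2 / (4 * t)"
      using t0 t by (intro divide_left_mono) auto
    moreover have "(2 * (norm (w + v))\<^sup>2 + 2 * R\<^sup>2) / (8 * b) = (norm (w + v))\<^sup>2 / (4 * b) + R\<^sup>2 / (4 * b)"
      using b by (simp add: field_simps)
    moreover have "(norm w)\<^sup>2 / (8 * b) = (norm w)\<^sup>2 / (4 * (2 * b))" by simp
    ultimately have e: "- (norm (w + v))\<^sup>2 / (4 * t) \<le> R\<^sup>2 / (4 * b) + - (norm w)\<^sup>2 / (4 * (2 * b))"
      by linarith
    have "gauss t (w + v) \<le> (4 * pi * a) powr (- k) * exp (R\<^sup>2 / (4 * b) + - (norm w)\<^sup>2 / (4 * (2 * b)))"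
      unfolding gauss_def using p e by (intro mult_mono) (auto simp: k_def)
    also have "\<dots> = A * gauss (2 * b) w"
      using b unfolding A_def gauss_def k_def exp_add by simp
    finally show ?thesis .
  qed
  moreover have "0 \<le> A" by (simp add: A_def)
  ultimately show thesis using that by blast
qed (use that[of 0] in auto)

subsection \<open>The heat kernel on the torus\<close>

definition lattice_pt :: "int^'d \<Rightarrow> real^'d" where
  "lattice_pt n = (\<chi> i. of_int (n $ i))"

lemma lattice_pt_simps [simp]:
  "lattice_pt 0 = 0" "lattice_pt (m + n) = lattice_pt m + lattice_pt n"
  "lattice_pt (m - n) = lattice_pt m - lattice_pt n" "lattice_pt (- n) = - lattice_pt n"
  by (simp_all add: lattice_pt_def vec_eq_iff)

text \<open>With the trivial lattice for the whole space both domains share one description: the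
  kernel is a sum of Gaussians over \<open>lat \<Omega>\<close>.\<close>

fun lat :: "domain \<Rightarrow> (int^'d) set" where
  "lat Whole_Space = {0}"
| "lat Torus = UNIV"

lemma lat_diff: "m \<in> lat \<Omega> \<Longrightarrow> bij_betw (\<lambda>k. k - m) (lat \<Omega>) (lat \<Omega>)"
  by (cases \<Omega>) (auto simp: bij_betw_def intro: inj_onI surjI[of _ "\<lambda>k. k + m"])

lemma lat_uminus: "bij_betw uminus (lat \<Omega>) (lat \<Omega>)"
  by (cases \<Omega>) (auto simp: bij_betw_def intro: inj_onI surjI[of _ uminus])

definition unit_cube :: "(real^'d) set" where
  "unit_cube = {x. \<forall>i. 0 \<le> x $ i \<and> x $ i < 1}"

lemma unit_cube_borel [measurable]: "unit_cube \<in> sets borel"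
proof -
  have "unit_cube = (\<Inter>i\<in>UNIV. {x. 0 \<le> x $ i} \<inter> {x. x $ i < 1})"
    by (auto simp: unit_cube_def)
  also have "\<dots> \<in> sets borel"
    by (intro sets.finite_INT sets.Int borel_closed borel_open closed_Collect_le open_Collect_less continuous_intros) auto
  finally show ?thesis .
qed

lemma omega_Torus: "omega Torus = restrict_space lborel unit_cube"
  by (simp add: unit_cube_def)

lemma omega_borel [measurable]: "(\<lambda>x. x) \<in> omega \<Omega> \<rightarrow>\<^sub>M borel"
proof (cases \<Omega>)
  case Torus
  then show ?thesis by (simp only: omega_Torus) (rule measurable_restrict_space1, simp)
qed simp

lemma borel_measurable_omega: "f \<in> borel_measurable borel \<Longrightarrow> f \<in> borel_measurable (omega \<Omega>)"
  using measurable_compose[OF omega_borel] by auto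

lemma sigma_finite_omega: "sigma_finite_measure (omega \<Omega>)"
proof (cases \<Omega>)
  case Torus
  have "sigma_finite_measure (lborel :: (real^'a) measure)" ..
  then show ?thesis unfolding Torus omega_Torus
    by (rule sigma_finite_measure_restrict_space) simp
next
  case Whole_Space
  then show ?thesis by (simp add: lborel.sigma_finite_measure_axioms)
qed

text \<open>Unfolding: the translates of the fundamental cube tile the space, so integrating a
  lattice sum over the cube amounts to integrating over the whole space.\<close>

lemma nn_integral_lattice_sum:
  assumes F [measurable]: "F \<in> borel_measurable borel"
  shows "(\<integral>\<^sup>+y. (\<integral>\<^sup>+n. F (y + lattice_pt n) \<partial>count_space (lat \<Omega>)) \<partial>omega \<Omega>) = (\<integral>\<^sup>+y. F y \<partial>lborel)"
proof (cases \<Omega>)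
  case Whole_Space
  then show ?thesis by (simp add: nn_integral_count_space_finite)
next
  case Torus
  have "(\<integral>\<^sup>+y. F y \<partial>lborel) = (\<integral>\<^sup>+y. (\<integral>\<^sup>+n. indicator unit_cube (- lattice_pt n + y) * F y \<partial>count_space UNIV) \<partial>lborel)"
  proof (rule nn_integral_cong)
    fix y :: "real^'a"
    \<comment> \<open>The only lattice translate of the cube that contains \<open>y\<close> sits at
      the integer part of \<open>y\<close>.\<close>
    define n0 where "n0 = (\<chi> i. \<lfloor>y $ i\<rfloor>)"
    have "- lattice_pt n + y \<in> unit_cube \<longleftrightarrow> n = n0" for n :: "int^'a"
    proof
      assume n: "- lattice_pt n + y \<in> unit_cube"
      have "n $ i = \<lfloor>y $ i\<rfloor>" for i
      proof -
        have "0 \<le> (- lattice_pt n + y) $ i \<and> (- lattice_pt n + y) $ i < 1"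
          using n unfolding unit_cube_def by blast
        then have "of_int (n $ i) \<le> y $ i" "y $ i < of_int (n $ i) + 1" by (simp_all add: lattice_pt_def)
        from floor_unique[OF this] show ?thesis by simp
      qed
      then show "n = n0" by (simp add: n0_def vec_eq_iff)
    next
      assume "n = n0"
      moreover have "0 \<le> (- lattice_pt n0 + y) $ i \<and> (- lattice_pt n0 + y) $ i < 1" for i
        by (simp add: lattice_pt_def n0_def) linarith
      ultimately show "- lattice_pt n + y \<in> unit_cube" unfolding unit_cube_def by blast
    qed
    then have "(\<integral>\<^sup>+n. indicator unit_cube (- lattice_pt n + y) * F y \<partial>count_space UNIV) = (\<Sum>n\<in>{n0}. indicator unit_cube (- lattice_pt n + y) * F y)"
      by (intro nn_integral_count_space') auto
    then show "F y = (\<integral>\<^sup>+n. indicator unit_cube (- lattice_pt n + y) * F y \<partial>count_space UNIV)"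
      using \<open>\<And>n. (- lattice_pt n + y \<in> unit_cube) = (n = n0)\<close> by simp
  qed
  also have "\<dots> = (\<integral>\<^sup>+n. (\<integral>\<^sup>+y. indicator unit_cube (- lattice_pt n + y) * F y \<partial>lborel) \<partial>count_space UNIV)"
    by (rule nn_integral_count_space_nn_integral) auto
  also have "\<dots> = (\<integral>\<^sup>+n. (\<integral>\<^sup>+y. indicator unit_cube y * F (lattice_pt n + y) \<partial>lborel) \<partial>count_space UNIV)"
  proof (rule nn_integral_cong)
    fix n :: "int^'a"
    show "(\<integral>\<^sup>+y. indicator unit_cube (- lattice_pt n + y) * F y \<partial>lborel) = (\<integral>\<^sup>+y. indicator unit_cube y * F (lattice_pt n + y) \<partial>lborel)"
      using nn_integral_lborel_translate[of "\<lambda>y. indicator unit_cube (- lattice_pt n + y) * F y" "lattice_pt n"] by simp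
  qed
  also have "\<dots> = (\<integral>\<^sup>+y. (\<integral>\<^sup>+n. indicator unit_cube y * F (lattice_pt n + y) \<partial>count_space UNIV) \<partial>lborel)"
    by (rule nn_integral_count_space_nn_integral[symmetric]) auto
  also have "\<dots> = (\<integral>\<^sup>+y. (\<integral>\<^sup>+n. F (lattice_pt n + y) \<partial>count_space UNIV) * indicator unit_cube y \<partial>lborel)"
    by (intro nn_integral_cong) (auto simp: nn_integral_cmult mult.commute)
  also have "\<dots> = (\<integral>\<^sup>+y. (\<integral>\<^sup>+n. F (y + lattice_pt n) \<partial>count_space (lat \<Omega>)) \<partial>omega \<Omega>)"
    unfolding Torus omega_Torus by (subst nn_integral_restrict_space) (simp_all add: add.commute)
  finally show ?thesis ..
qed

lemma norm_unit_cube: "v \<in> unit_cube \<Longrightarrow> norm (v :: real^'d) \<le> real CARD('d)"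
proof -
  assume v: "v \<in> unit_cube"
  have "norm v \<le> (\<Sum>i\<in>UNIV. \<bar>v $ i\<bar>)" by (rule norm_le_l1_cart)
  also have "\<dots> \<le> (\<Sum>i\<in>(UNIV :: 'd set). 1)"
    using v by (intro sum_mono) (auto simp: unit_cube_def less_imp_le)
  finally show ?thesis by simp
qed

lemma emeasure_unit_cube: "1 \<le> emeasure lborel (unit_cube :: (real^'d) set)"
proof -
  have "emeasure lborel (box 0 (1 :: real^'d)) = ennreal (\<Prod>b\<in>Basis. (1 - 0 :: real^'d) \<bullet> b)"
    by (rule emeasure_lborel_box) (auto simp: Basis_vec_def inner_axis)
  also have "(\<Prod>b\<in>Basis. (1 - 0 :: real^'d) \<bullet> b) = 1"
    by (rule prod.neutral) (auto simp: Basis_vec_def inner_axis)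
  finally have "1 = emeasure lborel (box 0 (1 :: real^'d))" by simp
  also have "\<dots> \<le> emeasure lborel (unit_cube :: (real^'d) set)"
    by (rule emeasure_mono) (auto simp: unit_cube_def mem_box_cart less_imp_le)
  finally show ?thesis .
qed

text \<open>The sum is compared with an integral: the cube has measure at least 1, so the sum may be
  averaged over shifts in it; each shift costs the factor of \<open>gauss_compare\<close>, and
  unfolding leaves the total mass of one Gaussian.\<close>

lemma gauss_lattice_bound:
  assumes a: "0 < a"
  obtains A where "0 \<le> A" "\<And>t z :: real^'d. a \<le> t \<Longrightarrow> t \<le> b \<Longrightarrow>
    (\<integral>\<^sup>+n. ennreal (gauss t (z + lattice_pt n)) \<partial>count_space UNIV) \<le> ennreal A"
proof -
  obtain A where A: "0 \<le> A" "\<And>t w v :: real^'d. a \<le> t \<Longrightarrow> t \<le> b \<Longrightarrow> norm v \<le> real CARD('d) \<Longrightarrow> gauss t (w + v) \<le> A * gauss (2 * b) w"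
    using gauss_compare[OF a] by metis
  have "(\<integral>\<^sup>+n. ennreal (gauss t (z + lattice_pt n)) \<partial>count_space UNIV) \<le> ennreal A" if t: "a \<le> t" "t \<le> b" for t and z :: "real^'d"
  proof -
    let ?S = "\<integral>\<^sup>+n. ennreal (gauss t (z + lattice_pt n)) \<partial>count_space UNIV"
    have "?S = ?S * 1" by simp
    also have "\<dots> \<le> ?S * emeasure lborel (unit_cube :: (real^'d) set)" by (intro mult_left_mono emeasure_unit_cube) simp
    also have "\<dots> = (\<integral>\<^sup>+v. ?S \<partial>(omega Torus :: (real^'d) measure))"
      unfolding omega_Torus by (simp add: emeasure_restrict_space space_restrict_space)
    also have "\<dots> \<le> (\<integral>\<^sup>+v. (\<integral>\<^sup>+n. (\<lambda>u. ennreal (A * gauss (2 * b) (z + u))) (v + lattice_pt n) \<partial>count_space (lat Torus)) \<partial>omega Torus)"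
    proof (rule nn_integral_mono)
      fix v :: "real^'d" assume "v \<in> space (omega Torus)"
      then have "v \<in> unit_cube" unfolding omega_Torus by (simp add: space_restrict_space)
      then have v: "norm (- v) \<le> real CARD('d)" by (simp add: norm_unit_cube)
      show "?S \<le> (\<integral>\<^sup>+n. ennreal (A * gauss (2 * b) (z + (v + lattice_pt n))) \<partial>count_space (lat Torus))"
        unfolding lat.simps using A(2)[OF t v, of "z + (v + lattice_pt _)"]
        by (intro nn_integral_mono ennreal_leI) (simp add: add_ac)
    qed
    also have "\<dots> = (\<integral>\<^sup>+u. ennreal (A * gauss (2 * b) (z + u)) \<partial>lborel)"
      by (rule nn_integral_lattice_sum) measurable
    also have "\<dots> = ennreal A * (\<integral>\<^sup>+u. ennreal (gauss (2 * b) (z + u)) \<partial>lborel)"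
      using A(1) by (simp add: ennreal_mult nn_integral_cmult)
    also have "(\<integral>\<^sup>+u. ennreal (gauss (2 * b) (z + u)) \<partial>lborel) = 1"
      using nn_integral_lborel_translate[of "\<lambda>y. ennreal (gauss (2 * b) y)" z] nn_integral_gauss[of "2 * b"] a t by simp
    finally show ?thesis by simp
  qed
  then show thesis using that A(1) by blast
qed

lemma gauss_lat_bound:
  assumes a: "0 < a"
  obtains A where "0 \<le> A" "\<And>t z :: real^'d. a \<le> t \<Longrightarrow> t \<le> b \<Longrightarrow>
    (\<integral>\<^sup>+n. ennreal (gauss t (z + lattice_pt n)) \<partial>count_space (lat \<Omega>)) \<le> ennreal A"
proof -
  obtain A where A: "0 \<le> A" "\<And>t z :: real^'d. a \<le> t \<Longrightarrow> t \<le> b \<Longrightarrow>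
    (\<integral>\<^sup>+n. ennreal (gauss t (z + lattice_pt n)) \<partial>count_space UNIV) \<le> ennreal A"
    using gauss_lattice_bound[OF a] by metis
  have le: "(\<integral>\<^sup>+n. ennreal (gauss t (z + lattice_pt n)) \<partial>count_space (lat \<Omega>))
    \<le> (\<integral>\<^sup>+n. ennreal (gauss t (z + lattice_pt n)) \<partial>count_space UNIV)" for t and z :: "real^'d"
    by (subst nn_integral_count_space_indicator) (auto intro!: nn_integral_mono simp: indicator_def)
  show thesis by (rule that[OF A(1)]) (rule order_trans[OF le A(2)])
qed

lemma integrable_gauss_lat:
  assumes "0 < t"
  shows "integrable (count_space (lat \<Omega>)) (\<lambda>n. gauss t (z + lattice_pt n))"
proof -
  obtain A where "(\<integral>\<^sup>+n. ennreal (gauss t (z + lattice_pt n)) \<partial>count_space (lat \<Omega>)) \<le> ennreal A"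
    using gauss_lat_bound[OF assms, of t] by (metis order_refl)
  then have "(\<integral>\<^sup>+n. ennreal (gauss t (z + lattice_pt n)) \<partial>count_space (lat \<Omega>)) < \<infinity>"
    by (rule le_less_trans) simp
  then show ?thesis by (intro integrableI_bounded) auto
qed

text \<open>The kernel of the torus is an unordered sum. Absolute summability turns it into an
  integral for counting measure, so that the convergence theorems apply to both domains.\<close>

lemma heat_eq_integral:
  assumes "0 < t"
  shows "heat \<Omega> t z = (\<integral>n. gauss t (z + lattice_pt n) \<partial>count_space (lat \<Omega>))"
proof (cases \<Omega>)
  case Whole_Space
  then show ?thesis by (simp add: lebesgue_integral_count_space_finite)
next
  case Torus
  have "Infinite_Set_Sum.abs_summable_on (\<lambda>n. gauss t (z + lattice_pt n)) UNIV"
    using integrable_gauss_lat[OF assms, of Torus z] by (simp add: Infinite_Set_Sum.abs_summable_on_def)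
  from infsetsum_infsum[OF this]
  show ?thesis by (simp add: Torus infsetsum_def lattice_pt_def)
qed

lemma ennreal_heat:
  assumes "0 < t"
  shows "ennreal (heat \<Omega> t z) = (\<integral>\<^sup>+n. ennreal (gauss t (z + lattice_pt n)) \<partial>count_space (lat \<Omega>))"
  unfolding heat_eq_integral[OF assms]
  by (rule nn_integral_eq_integral[symmetric]) (auto intro: integrable_gauss_lat assms)

lemma heat_nonneg: "0 < t \<Longrightarrow> 0 \<le> heat \<Omega> t z"
  by (simp add: heat_eq_integral)

lemma heat_uminus: "0 < t \<Longrightarrow> heat \<Omega> t (- z) = heat \<Omega> t z"
proof -
  assume t: "0 < t"
  have "ennreal (heat \<Omega> t (- z)) = (\<integral>\<^sup>+n. (\<lambda>n. ennreal (gauss t (- z - lattice_pt n))) (- n) \<partial>count_space (lat \<Omega>))"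
    unfolding ennreal_heat[OF t] by simp
  also have "\<dots> = (\<integral>\<^sup>+n. ennreal (gauss t (- z - lattice_pt n)) \<partial>count_space (lat \<Omega>))"
    by (rule nn_integral_bij_count_space[OF lat_uminus])
  also have "\<dots> = ennreal (heat \<Omega> t z)"
    unfolding ennreal_heat[OF t] using gauss_uminus[of t "z + lattice_pt _"] by simp
  finally show ?thesis using t by (simp add: heat_nonneg)
qed

definition grad_heat :: "domain \<Rightarrow> real \<Rightarrow> real^'d \<Rightarrow> real^'d" where
  "grad_heat \<Omega> t z = (\<integral>n. grad_gauss t (z + lattice_pt n) \<partial>count_space (lat \<Omega>))"

text \<open>One summable majorant for kernels and gradients, locally uniform in time and space. The
  gradient is dominated by the kernel at time \<open>2 * t\<close>, so its share runs through the
  times \<open>{2 * a..2 * b}\<close> and ends with a Gaussian of time \<open>4 * b\<close>.\<close>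

lemma gauss_lat_majorant:
  fixes z :: "real^'d"
  assumes a: "0 < a" "a \<le> b"
  obtains A where "integrable (count_space (lat \<Omega>)) A"
    "\<And>t w n. a \<le> t \<Longrightarrow> t \<le> b \<Longrightarrow> norm (w - z) \<le> 1 \<Longrightarrow> gauss t (w + lattice_pt n) \<le> A n"
    "\<And>t w n. a \<le> t \<Longrightarrow> t \<le> b \<Longrightarrow> norm (w - z) \<le> 1 \<Longrightarrow> norm (grad_gauss t (w + lattice_pt n)) \<le> A n"
proof -
  obtain A1 where A1: "0 \<le> A1" "\<And>t w v :: real^'d. a \<le> t \<Longrightarrow> t \<le> b \<Longrightarrow> norm v \<le> 1 \<Longrightarrow> gauss t (w + v) \<le> A1 * gauss (2 * b) w"
    using gauss_compare[OF a(1)] by metis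
  obtain A2 where A2: "0 \<le> A2" "\<And>t w v :: real^'d. 2 * a \<le> t \<Longrightarrow> t \<le> 2 * b \<Longrightarrow> norm v \<le> 1 \<Longrightarrow> gauss t (w + v) \<le> A2 * gauss (2 * (2 * b)) w"
    using gauss_compare[of "2 * a" "2 * b" 1] a by auto
  define c where "c = 2 powr (real CARD('d) / 2) / sqrt a"
  define A where "A n = A1 * gauss (2 * b) (z + lattice_pt n) + c * (A2 * gauss (2 * (2 * b)) (z + lattice_pt n))" for n
  have c: "0 \<le> c" using a by (simp add: c_def)
  show thesis
  proof (rule that[of A])
    show "integrable (count_space (lat \<Omega>)) A"
      unfolding A_def using a
      by (intro Bochner_Integration.integrable_add integrable_mult_right integrable_gauss_lat) auto
    fix t w n assume t: "a \<le> t" "t \<le> b" and w: "norm (w - z) \<le> 1"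
    have eq: "w + lattice_pt n = z + lattice_pt n + (w - z)" by simp
    have n1: "gauss t (w + lattice_pt n) \<le> A1 * gauss (2 * b) (z + lattice_pt n)"
      unfolding eq by (rule A1(2)[OF t w])
    have n2: "gauss (2 * t) (w + lattice_pt n) \<le> A2 * gauss (2 * (2 * b)) (z + lattice_pt n)"
      unfolding eq by (rule A2(2)) (use t w in auto)
    show "gauss t (w + lattice_pt n) \<le> A n"
      unfolding A_def using n1 c A2(1) by (intro order_trans[OF n1]) auto
    have "norm (grad_gauss t (w + lattice_pt n)) \<le> 2 powr (real CARD('d) / 2) / sqrt t * gauss (2 * t) (w + lattice_pt n)"
      using a t by (intro norm_grad_gauss_le) auto
    also have "\<dots> \<le> c * (A2 * gauss (2 * (2 * b)) (z + lattice_pt n))"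
      using a t n2 unfolding c_def by (intro mult_mono divide_left_mono) auto
    also have "\<dots> \<le> A n" using A1(1) by (simp add: A_def)
    finally show "norm (grad_gauss t (w + lattice_pt n)) \<le> A n" .
  qed
qed

lemma has_derivative_shift:
  assumes "(f has_derivative f') (at (z + c))"
  shows "((\<lambda>w. f (w + c)) has_derivative f') (at z)"
proof -
  have "((\<lambda>w. w + c) has_derivative (\<lambda>h. h)) (at z)" by (auto intro!: derivative_eq_intros)
  from has_derivative_compose[OF this, of f f'] assms show ?thesis by simp
qed

lemma heat_has_derivative:
  assumes t: "0 < t"
  shows "(heat \<Omega> t has_derivative (\<lambda>h. grad_heat \<Omega> t z \<bullet> h)) (at z)"
proof -
  obtain A where A: "integrable (count_space (lat \<Omega>)) A"
    "\<And>w n. norm (w - z) \<le> 1 \<Longrightarrow> norm (grad_gauss t (w + lattice_pt n)) \<le> A n"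
    using gauss_lat_majorant[OF t order_refl, of \<Omega> z] by (metis order_refl)
  have der: "((\<lambda>w. \<integral>n. gauss t (w + lattice_pt n) \<partial>count_space (lat \<Omega>)) has_derivative (\<lambda>h. (\<integral>n. grad_gauss t (z + lattice_pt n) \<partial>count_space (lat \<Omega>)) \<bullet> h)) (at z)"
    by (rule has_derivative_integral_dominated[where A = A])
      (auto intro!: has_derivative_shift gauss_has_derivative integrable_gauss_lat t A)
  have eq: "heat \<Omega> t = (\<lambda>w. \<integral>n. gauss t (w + lattice_pt n) \<partial>count_space (lat \<Omega>))"
    using heat_eq_integral[OF t] by auto
  show ?thesis unfolding eq grad_heat_def by (rule der)
qed

lemma heat_isCont_time:
  assumes t: "0 < t"
  shows "isCont (\<lambda>t. heat \<Omega> t z) t" "isCont (\<lambda>t. grad_heat \<Omega> t z) t"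
proof -
  have pos: "0 < t / 2" "t / 2 \<le> 2 * t" using t by auto
  obtain A where A0: "integrable (count_space (lat \<Omega>)) A"
    "\<And>s w n. t / 2 \<le> s \<Longrightarrow> s \<le> 2 * t \<Longrightarrow> norm (w - z) \<le> 1 \<Longrightarrow> gauss s (w + lattice_pt n) \<le> A n"
    "\<And>s w n. t / 2 \<le> s \<Longrightarrow> s \<le> 2 * t \<Longrightarrow> norm (w - z) \<le> 1 \<Longrightarrow> norm (grad_gauss s (w + lattice_pt n)) \<le> A n"
    using gauss_lat_majorant[OF pos, of \<Omega> z] by blast
  have A: "gauss s (z + lattice_pt n) \<le> A n" "norm (grad_gauss s (z + lattice_pt n)) \<le> A n"
    if "t / 2 \<le> s" "s \<le> 2 * t" for s n
    using A0(2,3)[OF that, of z] by simp_all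
  have d: "t / 2 \<le> s" "s \<le> 2 * t" if "dist s t < t / 2" for s
    using that t unfolding dist_real_def by linarith+
  have "isCont (\<lambda>t. \<integral>n. gauss t (z + lattice_pt n) \<partial>count_space (lat \<Omega>)) t"
    by (rule isCont_integral_dominated[where d = "t / 2" and A = A]) (use t d A A0(1) in \<open>simp_all add: gauss_isCont_time\<close>)
  moreover have ev: "\<forall>\<^sub>F s in nhds t. heat \<Omega> s z = (\<integral>n. gauss s (z + lattice_pt n) \<partial>count_space (lat \<Omega>))"
    using eventually_nhds_in_open[of "{0<..}" t] t by (auto elim!: eventually_mono simp: heat_eq_integral)
  ultimately show "isCont (\<lambda>t. heat \<Omega> t z) t" using isCont_cong[OF ev] by simp
  show "isCont (\<lambda>t. grad_heat \<Omega> t z) t" unfolding grad_heat_def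
    by (rule isCont_integral_dominated[where d = "t / 2" and A = A]) (use t d A A0(1) in \<open>simp_all add: grad_gauss_isCont_time\<close>)
qed

lemma grad_heat_isCont:
  assumes t: "0 < t"
  shows "isCont (grad_heat \<Omega> t) z"
proof -
  obtain A where A: "integrable (count_space (lat \<Omega>)) A"
    "\<And>w n. norm (w - z) \<le> 1 \<Longrightarrow> norm (grad_gauss t (w + lattice_pt n)) \<le> A n"
    using gauss_lat_majorant[OF t order_refl, of \<Omega> z] by (metis order_refl)
  have "isCont (\<lambda>w. \<integral>n. grad_gauss t (w + lattice_pt n) \<partial>count_space (lat \<Omega>)) z"
  proof (rule isCont_integral_dominated[where d = 1 and A = A])
    fix n show "isCont (\<lambda>w. grad_gauss t (w + lattice_pt n)) z"
      by (rule isCont_o2[where g = "grad_gauss t"]) (auto intro: grad_gauss_isCont t)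
  qed (use A in \<open>auto simp: dist_norm\<close>)
  then show ?thesis by (simp add: grad_heat_def[abs_def])
qed

lemma borel_measurable_heat: "0 < t \<Longrightarrow> heat \<Omega> t \<in> borel_measurable borel"
  by (rule borel_measurable_continuous_onI)
    (meson heat_has_derivative has_derivative_continuous continuous_at_imp_continuous_on)

lemma borel_measurable_grad_heat: "0 < t \<Longrightarrow> grad_heat \<Omega> t \<in> borel_measurable borel"
  by (rule borel_measurable_continuous_onI)
    (meson grad_heat_isCont continuous_at_imp_continuous_on)

lemma norm_grad_heat_le:
  fixes z :: "real^'d"
  assumes t: "0 < t"
  shows "norm (grad_heat \<Omega> t z) \<le> 2 powr (real CARD('d) / 2) / sqrt t * heat \<Omega> (2 * t) z"
proof -
  let ?c = "2 powr (real CARD('d) / 2) / sqrt t"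
  have i: "integrable (count_space (lat \<Omega>)) (\<lambda>n. ?c * gauss (2 * t) (z + lattice_pt n))"
    using t by (intro integrable_mult_right integrable_gauss_lat) auto
  have "norm (grad_heat \<Omega> t z) \<le> (\<integral>n. norm (grad_gauss t (z + lattice_pt n)) \<partial>count_space (lat \<Omega>))"
    unfolding grad_heat_def by (rule integral_norm_bound)
  also have "\<dots> \<le> (\<integral>n. ?c * gauss (2 * t) (z + lattice_pt n) \<partial>count_space (lat \<Omega>))"
  proof (rule integral_mono)
    show "integrable (count_space (lat \<Omega>)) (\<lambda>n. norm (grad_gauss t (z + lattice_pt n)))"
      by (rule Bochner_Integration.integrable_bound[OF i]) (simp, rule AE_I2,
          simp only: real_norm_def abs_norm_cancel, rule order_trans[OF norm_grad_gauss_le[OF t] abs_ge_self])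
  qed (use norm_grad_gauss_le[OF t] i in auto)
  also have "\<dots> = ?c * heat \<Omega> (2 * t) z" using t by (simp add: heat_eq_integral)
  finally show ?thesis .
qed

lemma heat_bounded:
  assumes a: "0 < a"
  obtains B where "0 \<le> B" "\<And>t z :: real^'d. a \<le> t \<Longrightarrow> t \<le> b \<Longrightarrow> heat \<Omega> t z \<le> B"
proof -
  obtain A where A: "0 \<le> A" "\<And>t z :: real^'d. a \<le> t \<Longrightarrow> t \<le> b \<Longrightarrow>
    (\<integral>\<^sup>+n. ennreal (gauss t (z + lattice_pt n)) \<partial>count_space (lat \<Omega>)) \<le> ennreal A"
    using gauss_lat_bound[OF a] by metis
  have "heat \<Omega> t z \<le> A" if "a \<le> t" "t \<le> b" for t and z :: "real^'d"
  proof -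
    have "ennreal (heat \<Omega> t z) \<le> ennreal A"
      using A(2)[OF that, of z] ennreal_heat[of t \<Omega> z] a that by (simp only:)
    then show ?thesis using A(1) by (simp only: ennreal_le_iff)
  qed
  then show thesis using that A(1) by blast
qed

lemma grad_heat_bounded:
  assumes a: "0 < a"
  obtains B where "0 \<le> B" "\<And>t z :: real^'d. a \<le> t \<Longrightarrow> t \<le> b \<Longrightarrow> norm (grad_heat \<Omega> t z) \<le> B"
proof -
  obtain B where B: "0 \<le> B" "\<And>t z :: real^'d. 2 * a \<le> t \<Longrightarrow> t \<le> 2 * b \<Longrightarrow> heat \<Omega> t z \<le> B"
    using heat_bounded[of "2 * a" "2 * b" \<Omega>] a by auto
  have "norm (grad_heat \<Omega> t z) \<le> 2 powr (real CARD('d) / 2) / sqrt a * B" if t: "a \<le> t" "t \<le> b" for t and z :: "real^'d"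
  proof -
    have "norm (grad_heat \<Omega> t z) \<le> 2 powr (real CARD('d) / 2) / sqrt t * heat \<Omega> (2 * t) z"
      using a t by (intro norm_grad_heat_le) auto
    also have "\<dots> \<le> 2 powr (real CARD('d) / 2) / sqrt a * B"
      using a t B by (intro mult_mono divide_left_mono heat_nonneg) auto
    finally show ?thesis .
  qed
  moreover have "0 \<le> 2 powr (real CARD('d) / 2) / sqrt a * B" using a B by simp
  ultimately show thesis using that by blast
qed

lemma heat_mass:
  assumes t: "0 < t"
  shows "(\<integral>\<^sup>+x. ennreal (heat \<Omega> t (x - y)) \<partial>omega \<Omega>) = 1"
proof -
  have "(\<integral>\<^sup>+x. ennreal (heat \<Omega> t (x - y)) \<partial>omega \<Omega>)
      = (\<integral>\<^sup>+x. (\<integral>\<^sup>+n. (\<lambda>w. ennreal (gauss t (- y + w))) (x + lattice_pt n) \<partial>count_space (lat \<Omega>)) \<partial>omega \<Omega>)"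
    unfolding ennreal_heat[OF t] by (simp add: algebra_simps)
  also have "\<dots> = (\<integral>\<^sup>+w. ennreal (gauss t (- y + w)) \<partial>lborel)"
    by (rule nn_integral_lattice_sum) measurable
  also have "\<dots> = 1"
    using nn_integral_lborel_translate[of "\<lambda>w. ennreal (gauss t w)" "- y"] nn_integral_gauss[OF t] by simp
  finally show ?thesis .
qed

text \<open>Only the second kernel is unfolded. The first is periodic, so lattice sum and cube
  combine to an integral over the whole space, where the Gauss semigroup applies to each remaining
  lattice term.\<close>

lemma nn_integral_heat_semigroup:
  assumes t: "0 < t" and s: "0 < s"
  shows "(\<integral>\<^sup>+y. ennreal (heat \<Omega> t (x - y) * heat \<Omega> s (y - z)) \<partial>omega \<Omega>) = ennreal (heat \<Omega> (t + s) (x - z))"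
proof -
  note [measurable] = borel_measurable_heat[OF t] borel_measurable_heat[OF s]
  define F where "F w = ennreal (heat \<Omega> t (x - w)) * ennreal (gauss s (w - z))" for w
  have F_meas: "F \<in> borel_measurable borel" unfolding F_def by measurable
  have per: "ennreal (heat \<Omega> t (w - lattice_pt m)) = ennreal (heat \<Omega> t w)" if "m \<in> lat \<Omega>" for w m
    using nn_integral_bij_count_space[OF lat_diff[OF that], of "\<lambda>n. ennreal (gauss t (w + lattice_pt n))"]
    unfolding ennreal_heat[OF t] by (simp add: algebra_simps)
  have "(\<integral>\<^sup>+y. ennreal (heat \<Omega> t (x - y) * heat \<Omega> s (y - z)) \<partial>omega \<Omega>)
    = (\<integral>\<^sup>+y. (\<integral>\<^sup>+m. F (y + lattice_pt m) \<partial>count_space (lat \<Omega>)) \<partial>omega \<Omega>)"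
  proof (rule nn_integral_cong)
    fix y
    have "ennreal (heat \<Omega> t (x - y) * heat \<Omega> s (y - z)) = ennreal (heat \<Omega> t (x - y)) * ennreal (heat \<Omega> s (y - z))"
      using t s by (simp add: ennreal_mult heat_nonneg)
    also have "\<dots> = (\<integral>\<^sup>+m. ennreal (heat \<Omega> t (x - y)) * ennreal (gauss s (y - z + lattice_pt m)) \<partial>count_space (lat \<Omega>))"
      unfolding ennreal_heat[OF s] by (rule nn_integral_cmult[symmetric]) simp
    also have "\<dots> = (\<integral>\<^sup>+m. F (y + lattice_pt m) \<partial>count_space (lat \<Omega>))"
    proof (rule nn_integral_cong)
      fix m :: "int^'a" assume "m \<in> space (count_space (lat \<Omega>))"
      then have m: "m \<in> lat \<Omega>" by simp
      show "ennreal (heat \<Omega> t (x - y)) * ennreal (gauss s (y - z + lattice_pt m)) = F (y + lattice_pt m)"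
        using per[OF m, of "x - y"] by (simp add: F_def algebra_simps)
    qed
    finally show "ennreal (heat \<Omega> t (x - y) * heat \<Omega> s (y - z)) = (\<integral>\<^sup>+m. F (y + lattice_pt m) \<partial>count_space (lat \<Omega>))" .
  qed
  also have "\<dots> = (\<integral>\<^sup>+w. F w \<partial>lborel)"
    by (rule nn_integral_lattice_sum[OF F_meas])
  also have "\<dots> = (\<integral>\<^sup>+w. (\<integral>\<^sup>+k. ennreal (gauss t (x + lattice_pt k - w)) * ennreal (gauss s (w - z)) \<partial>count_space (lat \<Omega>)) \<partial>lborel)"
    unfolding F_def ennreal_heat[OF t] by (intro nn_integral_cong, subst nn_integral_multc) (simp_all add: diff_add_eq)
  also have "\<dots> = (\<integral>\<^sup>+k. (\<integral>\<^sup>+w. ennreal (gauss t (x + lattice_pt k - w)) * ennreal (gauss s (w - z)) \<partial>lborel) \<partial>count_space (lat \<Omega>))"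
    by (rule nn_integral_count_space_nn_integral) auto
  also have "\<dots> = (\<integral>\<^sup>+k. ennreal (gauss (t + s) (x - z + lattice_pt k)) \<partial>count_space (lat \<Omega>))"
    unfolding gauss_semigroup[OF t s] by (simp add: algebra_simps)
  finally show ?thesis using t s by (simp add: ennreal_heat)
qed

lemma heat_semigroup:
  assumes t: "0 < t" and s: "0 < s"
  shows "integrable (omega \<Omega>) (\<lambda>y. heat \<Omega> t (x - y) * heat \<Omega> s (y - z))"
    and "(\<integral>y. heat \<Omega> t (x - y) * heat \<Omega> s (y - z) \<partial>omega \<Omega>) = heat \<Omega> (t + s) (x - z)"
proof -
  note [measurable] = borel_measurable_heat[OF t] borel_measurable_heat[OF s]
  have m: "(\<lambda>y. heat \<Omega> t (x - y) * heat \<Omega> s (y - z)) \<in> borel_measurable (omega \<Omega>)"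
    by (rule borel_measurable_omega) measurable
  have n: "0 \<le> heat \<Omega> t (x - y) * heat \<Omega> s (y - z)" for y using t s by (simp add: heat_nonneg)
  show "integrable (omega \<Omega>) (\<lambda>y. heat \<Omega> t (x - y) * heat \<Omega> s (y - z))"
    using nn_integral_heat_semigroup[OF t s, of \<Omega> x z] n by (intro integrableI_bounded m) simp
  show "(\<integral>y. heat \<Omega> t (x - y) * heat \<Omega> s (y - z) \<partial>omega \<Omega>) = heat \<Omega> (t + s) (x - z)"
    using nn_integral_heat_semigroup[OF t s, of \<Omega> x z] t s n
    by (subst integral_eq_nn_integral[OF m]) (auto simp: heat_nonneg)
qed

text \<open>Differentiate \<open>heat_semigroup\<close> in \<open>z\<close> under the integral. Both
  sides acquire the same sign, since \<open>z\<close> enters with a minus.\<close>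

lemma grad_heat_semigroup:
  fixes x z :: "real^'d"
  assumes t: "0 < t" and s: "0 < s"
  shows "(\<integral>y. heat \<Omega> t (x - y) *\<^sub>R grad_heat \<Omega> s (y - z) \<partial>omega \<Omega>) = grad_heat \<Omega> (t + s) (x - z)"
proof -
  note [measurable] = borel_measurable_heat[OF t] borel_measurable_grad_heat[OF s]
  obtain B where B: "0 \<le> B" "\<And>z :: real^'d. norm (grad_heat \<Omega> s z) \<le> B"
    using grad_heat_bounded[OF s, of s \<Omega>] by (metis order_refl)
  have i: "integrable (omega \<Omega>) (\<lambda>y. heat \<Omega> t (x - y))"
  proof (rule integrableI_bounded)
    have "heat \<Omega> t (x - y) = heat \<Omega> t (y - x)" for y using heat_uminus[OF t, of \<Omega> "x - y"] by simp
    then show "(\<integral>\<^sup>+y. ennreal (norm (heat \<Omega> t (x - y))) \<partial>omega \<Omega>) < \<infinity>"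
      using heat_mass[OF t, of \<Omega> x] t by (simp add: heat_nonneg)
  qed (rule borel_measurable_omega, measurable)
  have "((\<lambda>w. \<integral>y. heat \<Omega> t (x - y) * heat \<Omega> s (y - w) \<partial>omega \<Omega>) has_derivative
     (\<lambda>h. (\<integral>y. - (heat \<Omega> t (x - y) *\<^sub>R grad_heat \<Omega> s (y - z)) \<partial>omega \<Omega>) \<bullet> h)) (at z)"
  proof (rule has_derivative_integral_dominated[where A = "\<lambda>y. heat \<Omega> t (x - y) * B"])
    fix w y :: "real^'d"
    have "((\<lambda>w. y - w) has_derivative (\<lambda>h. - h)) (at w)" by (auto intro!: derivative_eq_intros)
    from has_derivative_compose[OF this heat_has_derivative[OF s, of \<Omega> "y - w"]]
    have "((\<lambda>w. heat \<Omega> s (y - w)) has_derivative (\<lambda>h. grad_heat \<Omega> s (y - w) \<bullet> - h)) (at w)" .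
    from has_derivative_mult_right[OF this, of "heat \<Omega> t (x - y)"]
    show "((\<lambda>w. heat \<Omega> t (x - y) * heat \<Omega> s (y - w)) has_derivative (\<lambda>h. - (heat \<Omega> t (x - y) *\<^sub>R grad_heat \<Omega> s (y - w)) \<bullet> h)) (at w)"
      by simp
  next
    show "(\<lambda>y. - (heat \<Omega> t (x - y) *\<^sub>R grad_heat \<Omega> s (y - z))) \<in> borel_measurable (omega \<Omega>)"
      by (rule borel_measurable_omega) measurable
  next
    fix w y :: "real^'d"
    show "norm (- (heat \<Omega> t (x - y) *\<^sub>R grad_heat \<Omega> s (y - w))) \<le> heat \<Omega> t (x - y) * B"
      using B(2) heat_nonneg[OF t, of \<Omega> "x - y"] by (simp add: abs_of_nonneg mult_left_mono)
  qed (use heat_semigroup[OF t s] i in auto)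
  moreover have "((\<lambda>w. heat \<Omega> (t + s) (x - w)) has_derivative (\<lambda>h. grad_heat \<Omega> (t + s) (x - z) \<bullet> - h)) (at z)"
  proof -
    have "((\<lambda>w. x - w) has_derivative (\<lambda>h. - h)) (at z)" by (auto intro!: derivative_eq_intros)
    from has_derivative_compose[OF this heat_has_derivative[of "t + s" \<Omega> "x - z"]] show ?thesis using t s by simp
  qed
  ultimately have "(\<lambda>h. (\<integral>y. - (heat \<Omega> t (x - y) *\<^sub>R grad_heat \<Omega> s (y - z)) \<partial>omega \<Omega>) \<bullet> h) = (\<lambda>h. grad_heat \<Omega> (t + s) (x - z) \<bullet> - h)"
    unfolding heat_semigroup(2)[OF t s] by (rule has_derivative_unique)
  then have "(\<integral>y. heat \<Omega> t (x - y) *\<^sub>R grad_heat \<Omega> s (y - z) \<partial>omega \<Omega>) \<bullet> h = grad_heat \<Omega> (t + s) (x - z) \<bullet> h" for h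
    by (simp add: fun_eq_iff)
  then show ?thesis using vector_eq_rdot by blast
qed

subsection \<open>Heat kernels on products\<close>

abbreviation Om :: "domain \<Rightarrow> nat set \<Rightarrow> (nat \<Rightarrow> real^'d) measure" where
  "Om \<Omega> I \<equiv> \<Pi>\<^sub>M k\<in>I. omega \<Omega>"

lemma product_sigma_finite_omega: "product_sigma_finite (\<lambda>_ :: nat. omega \<Omega>)"
  by (simp add: product_sigma_finite_def sigma_finite_omega)

lemma sigma_finite_Om: "finite I \<Longrightarrow> sigma_finite_measure (Om \<Omega> I)"
  by (rule product_sigma_finite.sigma_finite[OF product_sigma_finite_omega])

definition hk :: "domain \<Rightarrow> nat set \<Rightarrow> real \<Rightarrow> (nat \<Rightarrow> real^'d) \<Rightarrow> (nat \<Rightarrow> real^'d) \<Rightarrow> real" where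
  "hk \<Omega> I t x y = (\<Prod>k\<in>I. heat \<Omega> t (x k - y k))"

text \<open>The gradient of \<open>hk\<close> with respect to the variable
  \<open>x k\<close>.\<close>

definition ghk :: "domain \<Rightarrow> nat set \<Rightarrow> nat \<Rightarrow> real \<Rightarrow> (nat \<Rightarrow> real^'d) \<Rightarrow> (nat \<Rightarrow> real^'d) \<Rightarrow> real^'d" where
  "ghk \<Omega> I k t x y = (\<Prod>l\<in>I - {k}. heat \<Omega> t (x l - y l)) *\<^sub>R grad_heat \<Omega> t (x k - y k)"

lemma Om_diff_measurable:
  assumes "k \<in> I" and [measurable]: "f \<in> borel_measurable borel"
  shows "(\<lambda>z. f (fst z k - snd z k)) \<in> borel_measurable (Om \<Omega> I \<Otimes>\<^sub>M Om \<Omega> I)"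
proof -
  have c: "(\<lambda>x. x k) \<in> Om \<Omega> I \<rightarrow>\<^sub>M borel"
    using measurable_compose[OF measurable_component_singleton[OF assms(1), of "\<lambda>_. omega \<Omega>"] omega_borel] by simp
  have [measurable]: "(\<lambda>z. fst z k) \<in> Om \<Omega> I \<Otimes>\<^sub>M Om \<Omega> I \<rightarrow>\<^sub>M borel" "(\<lambda>z. snd z k) \<in> Om \<Omega> I \<Otimes>\<^sub>M Om \<Omega> I \<rightarrow>\<^sub>M borel"
    using measurable_compose[OF measurable_fst c] measurable_compose[OF measurable_snd c] by auto
  show ?thesis by measurable
qed

lemma ghk_inner:
  assumes "finite I" "k \<in> I"
  shows "ghk \<Omega> I k t x y \<bullet> b = (\<Prod>l\<in>I. if l = k then grad_heat \<Omega> t (x l - y l) \<bullet> b else heat \<Omega> t (x l - y l))"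
  using assms by (simp add: ghk_def prod.remove[of I k])

lemma norm_ghk:
  assumes "finite I" "k \<in> I" "0 < t"
  shows "norm (ghk \<Omega> I k t x y) = (\<Prod>l\<in>I. if l = k then norm (grad_heat \<Omega> t (x l - y l)) else heat \<Omega> t (x l - y l))"
  using assms by (simp add: ghk_def prod.remove[of I k] abs_of_nonneg[OF prod_nonneg] heat_nonneg mult.commute)

lemma integrable_heat: "0 < t \<Longrightarrow> integrable (omega \<Omega>) (\<lambda>x. heat \<Omega> t (x - y))"
proof (rule integrableI_bounded)
  assume t: "0 < t"
  note [measurable] = borel_measurable_heat[OF t]
  show "(\<lambda>x. heat \<Omega> t (x - y)) \<in> borel_measurable (omega \<Omega>)" by (rule borel_measurable_omega) measurable
  show "(\<integral>\<^sup>+x. ennreal (norm (heat \<Omega> t (x - y))) \<partial>omega \<Omega>) < \<infinity>"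
    using heat_mass[OF t, of \<Omega> y] t by (simp add: heat_nonneg)
qed

lemma nn_integral_grad_heat:
  fixes y :: "real^'d"
  assumes t: "0 < t"
  shows "(\<integral>\<^sup>+x. ennreal (norm (grad_heat \<Omega> t (x - y))) \<partial>omega \<Omega>) \<le> ennreal (2 powr (real CARD('d) / 2) / sqrt t)"
    (is "?L \<le> ennreal ?c")
proof -
  have t2: "0 < 2 * t" using t by simp
  note [measurable] = borel_measurable_heat[OF t2]
  have [measurable]: "(\<lambda>x. heat \<Omega> (2 * t) (x - y)) \<in> borel_measurable (omega \<Omega>)" by (rule borel_measurable_omega) measurable
  have "?L \<le> (\<integral>\<^sup>+x. ennreal ?c * ennreal (heat \<Omega> (2 * t) (x - y)) \<partial>omega \<Omega>)"
  proof (rule nn_integral_mono)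
    fix x :: "real^'d"
    have "ennreal (norm (grad_heat \<Omega> t (x - y))) \<le> ennreal (?c * heat \<Omega> (2 * t) (x - y))"
      by (rule ennreal_leI[OF norm_grad_heat_le[OF t]])
    also have "\<dots> = ennreal ?c * ennreal (heat \<Omega> (2 * t) (x - y))"
      using t by (intro ennreal_mult') simp
    finally show "ennreal (norm (grad_heat \<Omega> t (x - y))) \<le> \<dots>" .
  qed
  also have "\<dots> = ennreal ?c * 1"
    by (subst nn_integral_cmult) (simp_all add: heat_mass[OF t2])
  finally show ?thesis by simp
qed

text \<open>Every clause factorises over the particles, at most one factor being a gradient. The
  other factors have mass 1, so the constant is that of a single particle, whatever the size of
  \<open>I\<close>.\<close>

lemma heat_kernels_Om:
  assumes I: "finite I"
  shows "heat_kernels (Om \<Omega> I :: (nat \<Rightarrow> real^'d) measure) (hk \<Omega> I) (ghk \<Omega> I) I (2 powr (real CARD('d) / 2))"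
proof -
  interpret product_sigma_finite "\<lambda>_ :: nat. omega \<Omega> :: (real^'d) measure" by (rule product_sigma_finite_omega)
  interpret sigma_finite_measure "Om \<Omega> I :: (nat \<Rightarrow> real^'d) measure" by (rule sigma_finite_Om[OF I])
  let ?N = "Om \<Omega> I :: (nat \<Rightarrow> real^'d) measure"
  show ?thesis
  proof
    show "finite I" by fact
    show "0 \<le> 2 powr (real CARD('d) / 2)" by simp
  next
    fix t :: real assume t: "0 < t"
    show "(\<lambda>(x, y). hk \<Omega> I t x y) \<in> borel_measurable (?N \<Otimes>\<^sub>M ?N)"
      unfolding hk_def split_beta' by (intro borel_measurable_prod Om_diff_measurable borel_measurable_heat t)
    fix k assume k: "k \<in> I"
    show "(\<lambda>(x, y). ghk \<Omega> I k t x y) \<in> borel_measurable (?N \<Otimes>\<^sub>M ?N)"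
      unfolding ghk_def split_beta'
      by (intro borel_measurable_scaleR borel_measurable_prod Om_diff_measurable borel_measurable_heat borel_measurable_grad_heat t k) auto
  next
    fix a b :: real assume a: "0 < a"
    obtain B where B: "0 \<le> B" "\<And>t z :: real^'d. a \<le> t \<Longrightarrow> t \<le> b \<Longrightarrow> heat \<Omega> t z \<le> B" using heat_bounded[OF a] by metis
    obtain B' where B': "0 \<le> B'" "\<And>t z :: real^'d. a \<le> t \<Longrightarrow> t \<le> b \<Longrightarrow> norm (grad_heat \<Omega> t z) \<le> B'" using grad_heat_bounded[OF a] by metis
    have pr: "\<bar>\<Prod>l\<in>J. heat \<Omega> t (x l - y l)\<bar> \<le> B ^ card J" if "t \<in> {a..b}" for J t and x y :: "nat \<Rightarrow> real^'d"
    proof -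
      have "\<bar>\<Prod>l\<in>J. heat \<Omega> t (x l - y l)\<bar> = (\<Prod>l\<in>J. heat \<Omega> t (x l - y l))"
        using a that by (intro abs_of_nonneg prod_nonneg) (auto intro: heat_nonneg)
      also have "\<dots> \<le> (\<Prod>l\<in>J. B)"
        using a that B by (intro prod_mono) (auto intro: heat_nonneg)
      finally show ?thesis by simp
    qed
    show "\<exists>B. \<forall>t\<in>{a..b}. \<forall>x\<in>space ?N. \<forall>y\<in>space ?N. \<bar>hk \<Omega> I t x y\<bar> \<le> B"
      unfolding hk_def by (intro exI[of _ "B ^ card I"] ballI pr)
    show "\<exists>B. \<forall>t\<in>{a..b}. \<forall>x\<in>space ?N. \<forall>y\<in>space ?N. norm (ghk \<Omega> I k t x y) \<le> B" for k
      unfolding ghk_def norm_scaleR using pr B'(2) B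
      by (intro exI[of _ "B ^ card (I - {k}) * B'"] ballI mult_mono) auto
  next
    fix k and x y :: "nat \<Rightarrow> real^'d" assume "k \<in> I"
    show "continuous_on {0<..} (\<lambda>t. ghk \<Omega> I k t x y)"
      unfolding ghk_def
      by (intro continuous_on_scaleR continuous_on_prod continuous_at_imp_continuous_on ballI heat_isCont_time) auto
  next
    fix t :: real and y :: "nat \<Rightarrow> real^'d" assume t: "0 < t"
    note [measurable] = borel_measurable_heat[OF t] borel_measurable_grad_heat[OF t]
    have [measurable]: "(\<lambda>u. heat \<Omega> t (u - v)) \<in> borel_measurable (omega \<Omega>)"
      "(\<lambda>u. grad_heat \<Omega> t (u - v)) \<in> borel_measurable (omega \<Omega>)" for v :: "real^'d"
      by (rule borel_measurable_omega, measurable)+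
    have "(\<integral>\<^sup>+x. ennreal \<bar>hk \<Omega> I t x y\<bar> \<partial>Om \<Omega> I) = (\<integral>\<^sup>+x. (\<Prod>k\<in>I. ennreal (heat \<Omega> t (x k - y k))) \<partial>Om \<Omega> I)"
      unfolding hk_def using t by (intro nn_integral_cong) (simp add: prod_ennreal heat_nonneg abs_of_nonneg prod_nonneg)
    also have "\<dots> = (\<Prod>k\<in>I. \<integral>\<^sup>+u. ennreal (heat \<Omega> t (u - y k)) \<partial>omega \<Omega>)"
      by (rule product_nn_integral_prod[OF I]) measurable
    also have "\<dots> = 1" by (simp add: heat_mass[OF t])
    finally show "(\<integral>\<^sup>+x. ennreal \<bar>hk \<Omega> I t x y\<bar> \<partial>Om \<Omega> I) \<le> 1" by simp
    fix k assume k: "k \<in> I"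
    define f where "f l u = ennreal (if l = k then norm (grad_heat \<Omega> t (u - y l)) else heat \<Omega> t (u - y l))" for l u
    have "(\<integral>\<^sup>+x. ennreal (norm (ghk \<Omega> I k t x y)) \<partial>Om \<Omega> I) = (\<integral>\<^sup>+x. (\<Prod>l\<in>I. f l (x l)) \<partial>Om \<Omega> I)"
      unfolding norm_ghk[OF I k t] f_def using t by (intro nn_integral_cong) (subst prod_ennreal, auto simp: heat_nonneg)
    also have "\<dots> = (\<Prod>l\<in>I. \<integral>\<^sup>+u. f l u \<partial>omega \<Omega>)"
    proof (rule product_nn_integral_prod[OF I])
      show "f l \<in> borel_measurable (omega \<Omega>)" for l unfolding f_def by (cases "l = k") simp_all
    qed
    also have "\<dots> = (\<integral>\<^sup>+u. f k u \<partial>omega \<Omega>) * (\<Prod>l\<in>I - {k}. \<integral>\<^sup>+u. f l u \<partial>omega \<Omega>)"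
      by (rule prod.remove[OF I k])
    also have "(\<Prod>l\<in>I - {k}. \<integral>\<^sup>+u. f l u \<partial>omega \<Omega>) = 1"
      by (rule prod.neutral) (auto simp: f_def heat_mass[OF t])
    also have "(\<integral>\<^sup>+u. f k u \<partial>omega \<Omega>) * 1 \<le> ennreal (2 powr (real CARD('d) / 2) / sqrt t)"
      using nn_integral_grad_heat[OF t, where \<Omega> = \<Omega> and y = "y k"] by (simp add: f_def)
    finally show "(\<integral>\<^sup>+x. ennreal (norm (ghk \<Omega> I k t x y)) \<partial>Om \<Omega> I) \<le> ennreal (2 powr (real CARD('d) / 2) / sqrt t)" .
  next
    fix t s :: real and x z :: "nat \<Rightarrow> real^'d" assume t: "0 < t" and s: "0 < s"
    show "(\<integral>y. hk \<Omega> I t x y * hk \<Omega> I s y z \<partial>Om \<Omega> I) = hk \<Omega> I (t + s) x z"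
      unfolding hk_def prod.distrib[symmetric]
      by (subst product_integral_prod[OF I]) (simp_all add: heat_semigroup[OF t s])
    fix k assume k: "k \<in> I"
    obtain B where B: "0 \<le> B" "\<And>w :: real^'d. norm (grad_heat \<Omega> s w) \<le> B"
      using grad_heat_bounded[OF s, of s] by (metis order_refl)
    note [measurable] = borel_measurable_heat[OF t] borel_measurable_grad_heat[OF s] borel_measurable_heat[OF s]
    have ih: "integrable (omega \<Omega>) (\<lambda>u. heat \<Omega> t (v - u))" for v :: "real^'d"
      using integrable_heat[OF t, of \<Omega> v] heat_uminus[OF t, of \<Omega> "v - _"] by simp
    have ig: "integrable (omega \<Omega>) (\<lambda>u. heat \<Omega> t (v - u) *\<^sub>R grad_heat \<Omega> s (u - w))" for v w :: "real^'d"
    proof (rule Bochner_Integration.integrable_bound)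
      show "integrable (omega \<Omega>) (\<lambda>u. B *\<^sub>R heat \<Omega> t (v - u))" using ih by simp
      show "(\<lambda>u. heat \<Omega> t (v - u) *\<^sub>R grad_heat \<Omega> s (u - w)) \<in> borel_measurable (omega \<Omega>)"
        by (rule borel_measurable_omega) measurable
      show "AE u in omega \<Omega>. norm (heat \<Omega> t (v - u) *\<^sub>R grad_heat \<Omega> s (u - w)) \<le> norm (B *\<^sub>R heat \<Omega> t (v - u))"
        using B heat_nonneg[OF t, of \<Omega> "v - _"] by (intro AE_I2) (simp add: abs_of_nonneg mult_left_mono mult.commute[of B])
    qed
    \<comment> \<open>Pairing with a fixed vector \<open>b\<close> turns the integrand into a
      product of scalar functions of single particles, whose integral is the product of the
      integrals.\<close>
    define F where "F b l u = (if l = k then (heat \<Omega> t (x l - u) *\<^sub>R grad_heat \<Omega> s (u - z l)) \<bullet> b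
        else heat \<Omega> t (x l - u) * heat \<Omega> s (u - z l))" for b l u
    have iF: "integrable (omega \<Omega>) (F b l)" for b l
      unfolding F_def using ig heat_semigroup(1)[OF t s] by (cases "l = k") (auto simp del: inner_scaleR_left)
    have FP: "(hk \<Omega> I t x y *\<^sub>R ghk \<Omega> I k s y z) \<bullet> b = (\<Prod>l\<in>I. F b l (y l))" for y b
      unfolding inner_scaleR_left ghk_inner[OF I k] hk_def prod.distrib[symmetric]
      by (intro prod.cong) (auto simp: F_def)
    have iP: "integrable (Om \<Omega> I) (\<lambda>y. (hk \<Omega> I t x y *\<^sub>R ghk \<Omega> I k s y z) \<bullet> b)" for b
      unfolding FP by (rule product_integrable_prod[OF I iF])
    have "integrable (Om \<Omega> I) (\<lambda>y. \<Sum>b\<in>Basis. ((hk \<Omega> I t x y *\<^sub>R ghk \<Omega> I k s y z) \<bullet> b) *\<^sub>R b)"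
      by (intro Bochner_Integration.integrable_sum integrable_scaleR_left iP)
    then have iV: "integrable (Om \<Omega> I) (\<lambda>y. hk \<Omega> I t x y *\<^sub>R ghk \<Omega> I k s y z)"
      by (simp only: euclidean_representation)
    show "(\<integral>y. hk \<Omega> I t x y *\<^sub>R ghk \<Omega> I k s y z \<partial>Om \<Omega> I) = ghk \<Omega> I k (t + s) x z"
    proof (rule euclidean_eqI)
      fix b :: "real^'d"
      have "(\<integral>y. hk \<Omega> I t x y *\<^sub>R ghk \<Omega> I k s y z \<partial>Om \<Omega> I) \<bullet> b = (\<integral>y. (\<Prod>l\<in>I. F b l (y l)) \<partial>Om \<Omega> I)"
        by (subst integral_inner_left[symmetric]) (simp_all only: FP iV simp_thms)
      also have "\<dots> = (\<Prod>l\<in>I. \<integral>u. F b l u \<partial>omega \<Omega>)" by (rule product_integral_prod[OF I iF])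
      also have "\<dots> = ghk \<Omega> I k (t + s) x z \<bullet> b"
        unfolding ghk_inner[OF I k]
      proof (rule prod.cong[OF refl])
        fix l
        have "(\<integral>u. (heat \<Omega> t (x l - u) *\<^sub>R grad_heat \<Omega> s (u - z l)) \<bullet> b \<partial>omega \<Omega>) = grad_heat \<Omega> (t + s) (x l - z l) \<bullet> b"
          by (subst integral_inner_left) (simp_all only: ig grad_heat_semigroup[OF t s] simp_thms)
        then show "(\<integral>u. F b l u \<partial>omega \<Omega>) = (if l = k then grad_heat \<Omega> (t + s) (x l - z l) \<bullet> b else heat \<Omega> (t + s) (x l - z l))"
          unfolding F_def by (cases "l = k") (simp_all add: heat_semigroup(2)[OF t s] del: inner_scaleR_left)
      qed
      finally show "(\<integral>y. hk \<Omega> I t x y *\<^sub>R ghk \<Omega> I k s y z \<partial>Om \<Omega> I) \<bullet> b = ghk \<Omega> I k (t + s) x z \<bullet> b" .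
    qed
  qed
qed

section \<open>The mild equation and tensor products over finite label sets\<close>

lemma gradient_cmult_heat:
  assumes t: "0 < t"
  shows "gradient (\<lambda>v. c * heat \<Omega> t v) z = c *\<^sub>R grad_heat \<Omega> t z"
  using frechet_derivative_at[OF has_derivative_mult_right[OF heat_has_derivative[OF t, of \<Omega> z], of c], symmetric]
  by (simp add: gradient_def vec_eq_iff inner_axis)

lemma grad_heat_pow_eq:
  assumes t: "0 < t" and k: "k \<in> {1..j}"
  shows "grad_heat_pow \<Omega> j t k (\<lambda>l. x l - y l) = ghk \<Omega> {1..j} k t x y"
proof -
  have "heat_pow \<Omega> j t ((\<lambda>l. x l - y l)(k := v)) = (\<Prod>l\<in>{1..j} - {k}. heat \<Omega> t (x l - y l)) * heat \<Omega> t v" for v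
    unfolding heat_pow_def using k by (subst prod.remove[of _ k]) auto
  then show ?thesis
    by (simp add: grad_heat_pow_def gradient_cmult_heat[OF t] ghk_def)
qed

text \<open>For \<open>s < t\<close> the gradient defined through a derivative coincides with
  \<open>ghk\<close>, and the time integral runs over such \<open>s\<close> only.\<close>

lemma mild_solution_iff:
  "mild_solution \<Omega> j h G \<longleftrightarrow>
     (\<forall>t\<ge>0. integrable (Om \<Omega> {1..j}) (h t)) \<and>
     (\<forall>t\<ge>0. \<forall>k\<in>{1..j}. integrable (Om \<Omega> {1..j}) (G t k)) \<and>
     (\<forall>t>0. AE x in Om \<Omega> {1..j}. duhamel_eq (Om \<Omega> {1..j}) (hk \<Omega> {1..j}) (ghk \<Omega> {1..j}) {1..j} h G t x)"
proof -
  have d: "duhamel \<Omega> j G t x s = flow (Om \<Omega> {1..j}) (ghk \<Omega> {1..j}) {1..j} G t x s" if "s \<in> {0..<t}" for t x s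
    unfolding duhamel_def flow_def omega_pow_def using that
    by (intro sum.cong refl Bochner_Integration.integral_cong) (simp add: grad_heat_pow_eq)
  have 1: "set_integrable lborel {0..<t} (duhamel \<Omega> j G t x) = set_integrable lborel {0..<t} (flow (Om \<Omega> {1..j}) (ghk \<Omega> {1..j}) {1..j} G t x)" for t x
    by (rule set_integrable_cong) (auto simp: d)
  have 2: "(LINT s:{0..<t}|lborel. duhamel \<Omega> j G t x s) = (LINT s:{0..<t}|lborel. flow (Om \<Omega> {1..j}) (ghk \<Omega> {1..j}) {1..j} G t x s)" for t x
    by (rule set_lebesgue_integral_cong) (auto simp: d)
  show ?thesis
    unfolding mild_solution_def duhamel_eq_def 1 2 conv_def hk_def heat_pow_def omega_pow_def ..
qed

lemma C0_L1_iff: "C0_L1 \<Omega> j h \<longleftrightarrow> cont_L1 (Om \<Omega> {1..j}) h"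
  by (simp add: C0_L1_def cont_L1_def omega_pow_def)

lemma restrict_merge_space:
  assumes "x \<in> space (Om \<Omega> I)" "y \<in> space (Om \<Omega> J)" "I \<inter> J = {}"
  shows "restrict (merge I J (x, y)) I = x" "restrict (merge I J (x, y)) J = y"
  using assms by (auto simp: space_PiM PiE_def extensional_restrict)

text \<open>The second factor may be vector valued, so that products of a density with a flux are
  covered.\<close>

lemma tensor:
  fixes a :: "(nat \<Rightarrow> real^'d) \<Rightarrow> real" and b :: "(nat \<Rightarrow> real^'d) \<Rightarrow> 'b::{banach, second_countable_topology}"
  assumes fin: "finite I" "finite J" and IJ: "I \<inter> J = {}"
    and a: "integrable (Om \<Omega> I) a" and b: "integrable (Om \<Omega> J) b"
  shows "integrable (Om \<Omega> (I \<union> J)) (\<lambda>x. a (restrict x I) *\<^sub>R b (restrict x J))"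
    and "(\<integral>x. a (restrict x I) *\<^sub>R b (restrict x J) \<partial>Om \<Omega> (I \<union> J)) = (\<integral>x. a x \<partial>Om \<Omega> I) *\<^sub>R (\<integral>x. b x \<partial>Om \<Omega> J)"
proof -
  interpret product_sigma_finite "\<lambda>_ :: nat. omega \<Omega> :: (real^'d) measure" by (rule product_sigma_finite_omega)
  interpret I: sigma_finite_measure "Om \<Omega> I :: (nat \<Rightarrow> real^'d) measure" by (rule sigma_finite_Om[OF fin(1)])
  interpret J: sigma_finite_measure "Om \<Omega> J :: (nat \<Rightarrow> real^'d) measure" by (rule sigma_finite_Om[OF fin(2)])
  interpret P: pair_sigma_finite "Om \<Omega> I :: (nat \<Rightarrow> real^'d) measure" "Om \<Omega> J :: (nat \<Rightarrow> real^'d) measure" ..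
  let ?f = "\<lambda>x. a (restrict x I) *\<^sub>R b (restrict x J)"
  have [measurable]: "a \<in> borel_measurable (Om \<Omega> I)" "b \<in> borel_measurable (Om \<Omega> J)" using a b by auto
  have [measurable]: "(\<lambda>x. restrict x I) \<in> Om \<Omega> (I \<union> J) \<rightarrow>\<^sub>M Om \<Omega> I" "(\<lambda>x. restrict x J) \<in> Om \<Omega> (I \<union> J) \<rightarrow>\<^sub>M Om \<Omega> J"
    by (rule measurable_restrict_subset; auto)+
  have fm: "?f \<in> borel_measurable (Om \<Omega> (I \<union> J))" by measurable
  have i: "integrable (Om \<Omega> I \<Otimes>\<^sub>M Om \<Omega> J) (\<lambda>(x, y). a x *\<^sub>R b y)"
  proof (rule P.Fubini_integrable)
    show "integrable (Om \<Omega> I) (\<lambda>x. \<integral>y. norm (case (x, y) of (x, y) \<Rightarrow> a x *\<^sub>R b y) \<partial>Om \<Omega> J)" using a b by simp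
    show "AE x in Om \<Omega> I. integrable (Om \<Omega> J) (\<lambda>y. case (x, y) of (x, y) \<Rightarrow> a x *\<^sub>R b y)" using b by simp
  qed measurable
  have eq: "?f (merge I J z) = (case z of (x, y) \<Rightarrow> a x *\<^sub>R b y)" if zin: "z \<in> space (Om \<Omega> I \<Otimes>\<^sub>M Om \<Omega> J)" for z
  proof -
    obtain x y where z: "z = (x, y)" "x \<in> space (Om \<Omega> I)" "y \<in> space (Om \<Omega> J)"
      using zin by (auto simp: space_pair_measure)
    show ?thesis using restrict_merge_space[OF z(2,3) IJ] by (simp add: z(1))
  qed
  have i': "integrable (Om \<Omega> I \<Otimes>\<^sub>M Om \<Omega> J) (\<lambda>z. ?f (merge I J z))"
    by (rule Bochner_Integration.integrable_cong[THEN iffD2, OF refl eq i])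
  show "integrable (Om \<Omega> (I \<union> J)) ?f"
    by (subst distr_merge[OF IJ fin, symmetric]) (subst integrable_distr_eq[OF measurable_merge fm], rule i')
  have "(\<integral>x. ?f x \<partial>Om \<Omega> (I \<union> J)) = (\<integral>z. ?f (merge I J z) \<partial>(Om \<Omega> I \<Otimes>\<^sub>M Om \<Omega> J))"
    by (subst distr_merge[OF IJ fin, symmetric]) (rule integral_distr[OF measurable_merge fm])
  also have "\<dots> = (\<integral>z. (case z of (x, y) \<Rightarrow> a x *\<^sub>R b y) \<partial>(Om \<Omega> I \<Otimes>\<^sub>M Om \<Omega> J))"
    by (rule Bochner_Integration.integral_cong[OF refl eq])
  also have "\<dots> = (\<integral>x. \<integral>y. a x *\<^sub>R b y \<partial>Om \<Omega> J \<partial>Om \<Omega> I)"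
    using P.integral_fst'[OF i] by simp
  finally show "(\<integral>x. ?f x \<partial>Om \<Omega> (I \<union> J)) = (\<integral>x. a x \<partial>Om \<Omega> I) *\<^sub>R (\<integral>x. b x \<partial>Om \<Omega> J)"
    using a by simp
qed

lemma AE_Om_restrict:
  fixes \<phi> :: "(nat \<Rightarrow> real^'d) \<Rightarrow> bool"
  assumes K: "finite K" and J: "J \<subseteq> K" and ae: "AE x in Om \<Omega> J. \<phi> x"
  shows "AE x in Om \<Omega> K. \<phi> (restrict x J)"
proof -
  interpret product_sigma_finite "\<lambda>_ :: nat. omega \<Omega> :: (real^'d) measure" by (rule product_sigma_finite_omega)
  let ?L = "Om \<Omega> (K - J) :: (nat \<Rightarrow> real^'d) measure"
  obtain E where E: "{x\<in>space (Om \<Omega> J). \<not> \<phi> x} \<subseteq> E" "emeasure (Om \<Omega> J) E = 0" "E \<in> sets (Om \<Omega> J)"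
    using ae by (rule AE_E)
  have KJ: "J \<union> (K - J) = K" and fin: "finite J" "finite (K - J)" using J K finite_subset by auto
  have r: "(\<lambda>x. restrict x J) \<in> Om \<Omega> K \<rightarrow>\<^sub>M Om \<Omega> J" by (rule measurable_restrict_subset[OF J])
  define E' where "E' = (\<lambda>x. restrict x J) -` E \<inter> space (Om \<Omega> K)"
  have E': "E' \<in> sets (Om \<Omega> K)" unfolding E'_def by (rule measurable_sets[OF r E(3)])
  note [measurable] = E(3)
  have "emeasure (Om \<Omega> K) E' = (\<integral>\<^sup>+x. indicator E' x \<partial>Om \<Omega> K)" using E' by simp
  also have "\<dots> = (\<integral>\<^sup>+x. indicator E' x \<partial>Om \<Omega> (J \<union> (K - J)))" by (simp only: KJ)
  also have "\<dots> = (\<integral>\<^sup>+x. (\<integral>\<^sup>+y. indicator E' (merge J (K - J) (x, y)) \<partial>?L) \<partial>Om \<Omega> J)"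
    by (rule product_nn_integral_fold) (use fin E' KJ in auto)
  also have "\<dots> \<le> (\<integral>\<^sup>+x. (\<integral>\<^sup>+y. indicator E x \<partial>?L) \<partial>Om \<Omega> J)"
  proof (intro nn_integral_mono)
    fix x y :: "nat \<Rightarrow> real^'d" assume "x \<in> space (Om \<Omega> J)" "y \<in> space (?L)"
    then show "indicator E' (merge J (K - J) (x, y)) \<le> (indicator E x :: ennreal)"
      using restrict_merge_space(1)[where x = x and y = y and \<Omega> = \<Omega> and I = J and J = "K - J"] by (auto simp: E'_def indicator_def)
  qed
  \<comment> \<open>The omitted coordinates may carry infinite mass; the product with the measure of
    a null set is 0 nevertheless.\<close>
  also have "\<dots> = (\<integral>\<^sup>+x. emeasure (?L) (space (?L)) * indicator E x \<partial>Om \<Omega> J)"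
    by (simp add: mult.commute)
  also have "\<dots> = 0" using E(2,3) by (simp add: nn_integral_cmult)
  finally have "E' \<in> null_sets (Om \<Omega> K)" using E' by auto
  then show ?thesis
  proof (rule AE_I')
    show "{x \<in> space (Om \<Omega> K). \<not> \<phi> (restrict x J)} \<subseteq> E'"
      using E(1) measurable_space[OF r] by (auto simp: E'_def)
  qed
qed

text \<open>One factor is changed at a time, and by \<open>tensor\<close> the integral of each of
  the two increments factorises.\<close>

lemma cont_L1_tensor:
  fixes b :: "real \<Rightarrow> (nat \<Rightarrow> real^'d) \<Rightarrow> 'b::{banach, second_countable_topology}"
  assumes fin: "finite I" "finite J" and IJ: "I \<inter> J = {}"
    and a: "cont_L1 (Om \<Omega> I) a" and b: "cont_L1 (Om \<Omega> J) b"
  shows "cont_L1 (Om \<Omega> (I \<union> J)) (\<lambda>t x. a t (restrict x I) *\<^sub>R b t (restrict x J))"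
  unfolding cont_L1_def
proof (intro conjI allI impI)
  fix t :: real assume t: "0 \<le> t"
  note T = tensor[OF fin IJ]
  note ai = cont_L1_integrable[OF a] and bi = cont_L1_integrable[OF b]
  show "integrable (Om \<Omega> (I \<union> J)) (\<lambda>x. a t (restrict x I) *\<^sub>R b t (restrict x J))"
    by (rule T(1)[OF ai[OF t] bi[OF t]])
  define e where "e s = (\<integral>x. \<bar>a s x - a t x\<bar> \<partial>Om \<Omega> I) * (\<integral>x. norm (b s x) \<partial>Om \<Omega> J)
     + (\<integral>x. \<bar>a t x\<bar> \<partial>Om \<Omega> I) * (\<integral>x. norm (b s x - b t x) \<partial>Om \<Omega> J)" for s
  have "(e \<longlongrightarrow> 0 * (\<integral>x. norm (b t x) \<partial>Om \<Omega> J) + (\<integral>x. \<bar>a t x\<bar> \<partial>Om \<Omega> I) * 0) (at t within {0..})"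
    unfolding e_def using cont_L1_norm_continuous[OF b] t cont_L1_tendsto[OF a t] cont_L1_tendsto[OF b t]
    by (intro tendsto_intros) (auto simp: continuous_on_def)
  then have e0: "(e \<longlongrightarrow> 0) (at t within {0..})" by simp
  show "((\<lambda>s. \<integral>x. norm (a s (restrict x I) *\<^sub>R b s (restrict x J) - a t (restrict x I) *\<^sub>R b t (restrict x J)) \<partial>Om \<Omega> (I \<union> J)) \<longlongrightarrow> 0) (at t within {0..})"
  proof (rule tendsto_zero_atLeast_comparison[OF _ _ e0])
    fix s :: real assume s: "0 \<le> s"
    have i1: "integrable (Om \<Omega> I) (\<lambda>x. \<bar>a s x - a t x\<bar>)" "integrable (Om \<Omega> J) (\<lambda>x. norm (b s x))"
      "integrable (Om \<Omega> I) (\<lambda>x. \<bar>a t x\<bar>)" "integrable (Om \<Omega> J) (\<lambda>x. norm (b s x - b t x))"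
      by (intro integrable_abs integrable_norm Bochner_Integration.integrable_diff ai bi s t)+
    let ?u = "\<lambda>x. \<bar>a s (restrict x I) - a t (restrict x I)\<bar> *\<^sub>R norm (b s (restrict x J)) + \<bar>a t (restrict x I)\<bar> *\<^sub>R norm (b s (restrict x J) - b t (restrict x J))"
    have "(\<integral>x. norm (a s (restrict x I) *\<^sub>R b s (restrict x J) - a t (restrict x I) *\<^sub>R b t (restrict x J)) \<partial>Om \<Omega> (I \<union> J)) \<le> (\<integral>x. ?u x \<partial>Om \<Omega> (I \<union> J))"
    proof (rule integral_mono)
      show "integrable (Om \<Omega> (I \<union> J)) (\<lambda>x. norm (a s (restrict x I) *\<^sub>R b s (restrict x J) - a t (restrict x I) *\<^sub>R b t (restrict x J)))"
        by (intro integrable_norm Bochner_Integration.integrable_diff T(1) ai bi s t)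
      show "integrable (Om \<Omega> (I \<union> J)) ?u"
        by (intro Bochner_Integration.integrable_add T(1)[OF i1(1,2)] T(1)[OF i1(3,4)])
      fix x
      have "norm (p *\<^sub>R v - q *\<^sub>R w) \<le> \<bar>p - q\<bar> *\<^sub>R norm v + \<bar>q\<bar> *\<^sub>R norm (v - w)" for p q and v w :: 'b
      proof -
        have "p *\<^sub>R v - q *\<^sub>R w = (p - q) *\<^sub>R v + q *\<^sub>R (v - w)" by (simp add: algebra_simps)
        also have "norm \<dots> \<le> norm ((p - q) *\<^sub>R v) + norm (q *\<^sub>R (v - w))" by (rule norm_triangle_ineq)
        finally show ?thesis by simp
      qed
      then show "norm (a s (restrict x I) *\<^sub>R b s (restrict x J) - a t (restrict x I) *\<^sub>R b t (restrict x J)) \<le> ?u x" .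
    qed
    also have "\<dots> = e s"
      unfolding e_def
      by (subst Bochner_Integration.integral_add[OF T(1)[OF i1(1,2)] T(1)[OF i1(3,4)]])
        (simp only: T(2)[OF i1(1,2)] T(2)[OF i1(3,4)], simp only: real_scaleR_def)
    finally show "(\<integral>x. norm (a s (restrict x I) *\<^sub>R b s (restrict x J) - a t (restrict x I) *\<^sub>R b t (restrict x J)) \<partial>Om \<Omega> (I \<union> J)) \<le> e s" .
  qed (rule Bochner_Integration.integral_nonneg, rule norm_ge_zero)
qed

subsection \<open>Tensor products of evolutions\<close>

lemma hk_union:
  assumes "finite I" "finite J" "I \<inter> J = {}"
  shows "hk \<Omega> (I \<union> J) t x y = hk \<Omega> I t (restrict x I) (restrict y I) * hk \<Omega> J t (restrict x J) (restrict y J)"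
  using assms by (simp add: hk_def prod.union_disjoint)

lemma ghk_union:
  assumes "finite I" "finite J" "I \<inter> J = {}" "k \<in> I"
  shows "ghk \<Omega> (I \<union> J) k t x y = hk \<Omega> J t (restrict x J) (restrict y J) *\<^sub>R ghk \<Omega> I k t (restrict x I) (restrict y I)"
proof -
  have "I \<union> J - {k} = (I - {k}) \<union> J" using assms by auto
  moreover have "(\<Prod>l\<in>(I - {k}) \<union> J. heat \<Omega> t (x l - y l)) = (\<Prod>l\<in>I - {k}. heat \<Omega> t (x l - y l)) * (\<Prod>l\<in>J. heat \<Omega> t (x l - y l))"
    using assms by (intro prod.union_disjoint) auto
  ultimately show ?thesis using assms(4) by (simp add: ghk_def hk_def mult.commute)
qed

abbreviation (input) "evol \<Omega> I \<equiv> evolution (Om \<Omega> I) (hk \<Omega> I) (ghk \<Omega> I) I"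

text \<open>Leibniz' rule for fluxes: the factor that carries the particle \<open>k\<close>
  contributes its flux, the other one its density.\<close>

abbreviation (input) "tensor_flux I J h1 G1 h2 G2 \<equiv> (\<lambda>t k x. if k \<in> I then h2 t (restrict x J) *\<^sub>R G1 t k (restrict x I) else h1 t (restrict x I) *\<^sub>R G2 t k (restrict x J))"

text \<open>For \<open>s < t\<close> the convolution of the product factorises at every point, so
  the product rule needed is that for real functions; the null sets of the two limits are lifted to
  cylinders.\<close>

lemma evolution_tensor:
  fixes h1 h2 :: "real \<Rightarrow> (nat \<Rightarrow> real^'d) \<Rightarrow> real" and G1 G2 :: "real \<Rightarrow> nat \<Rightarrow> (nat \<Rightarrow> real^'d) \<Rightarrow> real^'d"
  assumes fin: "finite I" "finite J" and IJ: "I \<inter> J = {}"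
    and ev: "evol \<Omega> I h1 G1" "evol \<Omega> J h2 G2"
    and h: "\<And>t. 0 \<le> t \<Longrightarrow> integrable (Om \<Omega> I) (h1 t)" "\<And>t. 0 \<le> t \<Longrightarrow> integrable (Om \<Omega> J) (h2 t)"
    and G: "\<And>t k. 0 \<le> t \<Longrightarrow> k \<in> I \<Longrightarrow> integrable (Om \<Omega> I) (G1 t k)" "\<And>t k. 0 \<le> t \<Longrightarrow> k \<in> J \<Longrightarrow> integrable (Om \<Omega> J) (G2 t k)"
  shows "evol \<Omega> (I \<union> J) (\<lambda>t x. h1 t (restrict x I) * h2 t (restrict x J)) (tensor_flux I J h1 G1 h2 G2)"
proof -
  interpret I: heat_kernels "Om \<Omega> I :: (nat \<Rightarrow> real^'d) measure" "hk \<Omega> I" "ghk \<Omega> I" I "2 powr (real CARD('d) / 2)" by (rule heat_kernels_Om[OF fin(1)])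
  interpret J: heat_kernels "Om \<Omega> J :: (nat \<Rightarrow> real^'d) measure" "hk \<Omega> J" "ghk \<Omega> J" J "2 powr (real CARD('d) / 2)" by (rule heat_kernels_Om[OF fin(2)])
  let ?h = "\<lambda>t x. h1 t (restrict x I) * h2 t (restrict x J)"
  let ?G = "tensor_flux I J h1 G1 h2 G2"
  have rI: "restrict x I \<in> space (Om \<Omega> I)" and rJ: "restrict x J \<in> space (Om \<Omega> J)" if "x \<in> space (Om \<Omega> (I \<union> J))" for x :: "nat \<Rightarrow> real^'d"
    using that by (auto simp: space_PiM PiE_def)
  let ?cI = "\<lambda>t s x. conv (Om \<Omega> I) (hk \<Omega> I) (t - s) (h1 s) (restrict x I)"
  let ?cJ = "\<lambda>t s x. conv (Om \<Omega> J) (hk \<Omega> J) (t - s) (h2 s) (restrict x J)"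
  let ?fI = "\<lambda>t s x. flow (Om \<Omega> I) (ghk \<Omega> I) I G1 t (restrict x I) s"
  let ?fJ = "\<lambda>t s x. flow (Om \<Omega> J) (ghk \<Omega> J) J G2 t (restrict x J) s"
  have c: "conv (Om \<Omega> (I \<union> J)) (hk \<Omega> (I \<union> J)) (t - s) (?h s) x = ?cI t s x * ?cJ t s x"
    if s: "0 \<le> s" "s < t" and x: "x \<in> space (Om \<Omega> (I \<union> J))" for t s x
  proof -
    have ts: "0 < t - s" using s by simp
    have i1: "integrable (Om \<Omega> I) (\<lambda>y. hk \<Omega> I (t - s) (restrict x I) y * h1 s y)"
      using I.integrable_P_mult[OF ts rI[OF x] h(1)[OF s(1)]] by simp
    have i2: "integrable (Om \<Omega> J) (\<lambda>y. hk \<Omega> J (t - s) (restrict x J) y * h2 s y)"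
      using J.integrable_P_mult[OF ts rJ[OF x] h(2)[OF s(1)]] by simp
    show ?thesis
      using tensor(2)[OF fin IJ i1 i2] unfolding conv_def hk_union[OF fin IJ] by (simp add: ac_simps)
  qed
  have f: "flow (Om \<Omega> (I \<union> J)) (ghk \<Omega> (I \<union> J)) (I \<union> J) ?G t x s = ?fI t s x * ?cJ t s x + ?cI t s x * ?fJ t s x"
    if s: "0 \<le> s" "s < t" and x: "x \<in> space (Om \<Omega> (I \<union> J))" for t s x
  proof -
    have ts: "0 < t - s" using s by simp
    have i1: "integrable (Om \<Omega> I) (\<lambda>y. hk \<Omega> I (t - s) (restrict x I) y * h1 s y)"
      using I.integrable_P_mult[OF ts rI[OF x] h(1)[OF s(1)]] by simp
    have i2: "integrable (Om \<Omega> J) (\<lambda>y. hk \<Omega> J (t - s) (restrict x J) y * h2 s y)"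
      using J.integrable_P_mult[OF ts rJ[OF x] h(2)[OF s(1)]] by simp
    have k1: "(\<integral>y. ghk \<Omega> (I \<union> J) k (t - s) x y \<bullet> ?G s k y \<partial>Om \<Omega> (I \<union> J)) = (\<integral>y. ghk \<Omega> I k (t - s) (restrict x I) y \<bullet> G1 s k y \<partial>Om \<Omega> I) * ?cJ t s x" if k: "k \<in> I" for k
      using tensor(2)[OF fin IJ I.integrable_Q_inner[OF k ts rI[OF x] G(1)[OF s(1) k]] i2] k
      unfolding conv_def ghk_union[OF fin IJ k] by (simp add: ac_simps)
    have k2: "(\<integral>y. ghk \<Omega> (I \<union> J) k (t - s) x y \<bullet> ?G s k y \<partial>Om \<Omega> (I \<union> J)) = ?cI t s x * (\<integral>y. ghk \<Omega> J k (t - s) (restrict x J) y \<bullet> G2 s k y \<partial>Om \<Omega> J)" if k: "k \<in> J" for k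
    proof -
      have "k \<notin> I" using k IJ by auto
      have e: "ghk \<Omega> (I \<union> J) k (t - s) x y = hk \<Omega> I (t - s) (restrict x I) (restrict y I) *\<^sub>R ghk \<Omega> J k (t - s) (restrict x J) (restrict y J)" for y
        using ghk_union[OF fin(2,1) _ k, of \<Omega> "t - s" x y] IJ by (simp add: Un_commute Int_commute)
      show ?thesis
        using tensor(2)[OF fin IJ i1 J.integrable_Q_inner[OF k ts rJ[OF x] G(2)[OF s(1) k]]] \<open>k \<notin> I\<close>
        unfolding conv_def e by (simp add: ac_simps)
    qed
    show ?thesis
      unfolding flow_def sum.union_disjoint[OF fin IJ] sum_distrib_right sum_distrib_left
      by (intro arg_cong2[where f = "(+)"] sum.cong refl k1 k2)
  qed
  show ?thesis
    unfolding evolution_def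
  proof (intro conjI allI impI ballI)
    fix t :: real and x :: "nat \<Rightarrow> real^'d" and s assume t: "0 < t" and x: "x \<in> space (Om \<Omega> (I \<union> J))" and s: "s \<in> {0..<t}"
    have "((\<lambda>s. ?cI t s x) has_real_derivative ?fI t s x) (at s within {0..<t})" "((\<lambda>s. ?cJ t s x) has_real_derivative ?fJ t s x) (at s within {0..<t})"
      using ev t rI[OF x] rJ[OF x] s by (auto simp: evolution_def)
    from DERIV_mult[OF this]
    have "((\<lambda>s. ?cI t s x * ?cJ t s x) has_real_derivative flow (Om \<Omega> (I \<union> J)) (ghk \<Omega> (I \<union> J)) (I \<union> J) ?G t x s) (at s within {0..<t})"
      using f[of s t x] s x by (simp add: ac_simps)
    then show "((\<lambda>s. conv (Om \<Omega> (I \<union> J)) (hk \<Omega> (I \<union> J)) (t - s) (?h s) x) has_real_derivative flow (Om \<Omega> (I \<union> J)) (ghk \<Omega> (I \<union> J)) (I \<union> J) ?G t x s) (at s within {0..<t})"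
      by (rule has_field_derivative_transform_within[where d = 1]) (use s c x in auto)
  next
    fix t :: real assume t: "0 < t"
    have "AE x in Om \<Omega> I. ((\<lambda>s. conv (Om \<Omega> I) (hk \<Omega> I) (t - s) (h1 s) x) \<longlongrightarrow> h1 t x) (at_left t)"
      "AE x in Om \<Omega> J. ((\<lambda>s. conv (Om \<Omega> J) (hk \<Omega> J) (t - s) (h2 s) x) \<longlongrightarrow> h2 t x) (at_left t)"
      using ev t by (auto simp: evolution_def)
    then have "AE x in Om \<Omega> (I \<union> J). ((\<lambda>s. ?cI t s x) \<longlongrightarrow> h1 t (restrict x I)) (at_left t)"
      "AE x in Om \<Omega> (I \<union> J). ((\<lambda>s. ?cJ t s x) \<longlongrightarrow> h2 t (restrict x J)) (at_left t)"
      using fin by (auto intro: AE_Om_restrict)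
    then show "AE x in Om \<Omega> (I \<union> J). ((\<lambda>s. conv (Om \<Omega> (I \<union> J)) (hk \<Omega> (I \<union> J)) (t - s) (?h s) x) \<longlongrightarrow> ?h t x) (at_left t)"
      using AE_space
    proof eventually_elim
      case (elim x)
      have "\<forall>\<^sub>F s in at_left t. ?cI t s x * ?cJ t s x = conv (Om \<Omega> (I \<union> J)) (hk \<Omega> (I \<union> J)) (t - s) (?h s) x"
        using eventually_at_left_real[OF t] by eventually_elim (use c elim in auto)
      from Lim_transform_eventually[OF tendsto_mult[OF elim(1,2)] this] show ?case .
    qed
  qed
qed

section \<open>Relabelling of particles\<close>

abbreviation (input) reindex :: "nat set \<Rightarrow> (nat \<Rightarrow> nat) \<Rightarrow> (nat \<Rightarrow> 'a) \<Rightarrow> nat \<Rightarrow> 'a" where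
  "reindex I e x \<equiv> (\<lambda>n\<in>I. x (e n))"

lemma measurable_reindex:
  "e ` I \<subseteq> J \<Longrightarrow> reindex I e \<in> Om \<Omega> J \<rightarrow>\<^sub>M Om \<Omega> I"
  by (intro measurable_restrict measurable_component_singleton) auto

lemma distr_reindex:
  assumes I: "finite I" and e: "bij_betw e I J"
  shows "distr (Om \<Omega> J) (Om \<Omega> I) (reindex I e) = Om \<Omega> I"
proof (rule product_sigma_finite.PiM_eqI[OF product_sigma_finite_omega I])
  interpret product_sigma_finite "\<lambda>_ :: nat. omega \<Omega> :: (real^'a) measure" by (rule product_sigma_finite_omega)
  have J: "finite J" and im: "e ` I = J" and inj: "inj_on e I" using e I by (auto simp: bij_betw_def)
  show "sets (distr (Om \<Omega> J) (Om \<Omega> I) (reindex I e)) = sets (Om \<Omega> I :: (nat \<Rightarrow> real^'a) measure)" by simp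
  fix A :: "nat \<Rightarrow> (real^'a) set" assume A: "\<And>i. i \<in> I \<Longrightarrow> A i \<in> sets (omega \<Omega>)"
  have m: "reindex I e \<in> Om \<Omega> J \<rightarrow>\<^sub>M (Om \<Omega> I :: (nat \<Rightarrow> real^'a) measure)" by (rule measurable_reindex) (simp add: im)
  have "(reindex I e) -` (Pi\<^sub>E I A) \<inter> space (Om \<Omega> J) = Pi\<^sub>E J (A \<circ> inv_into I e)"
  proof (rule set_eqI)
    fix x :: "nat \<Rightarrow> real^'a"
    have "x \<in> (reindex I e) -` (Pi\<^sub>E I A) \<inter> space (Om \<Omega> J) \<longleftrightarrow> (\<forall>n\<in>I. x (e n) \<in> A n) \<and> x \<in> extensional J \<and> (\<forall>k\<in>J. x k \<in> space (omega \<Omega>))"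
      by (auto simp: space_PiM PiE_def Pi_iff)
    also have "\<dots> \<longleftrightarrow> (\<forall>k\<in>J. x k \<in> A (inv_into I e k)) \<and> x \<in> extensional J"
    proof -
      have "(\<forall>n\<in>I. x (e n) \<in> A n) \<longleftrightarrow> (\<forall>k\<in>J. x k \<in> A (inv_into I e k))"
        unfolding im[symmetric] using inj by (simp add: ball_simps)
      moreover have "A (inv_into I e k) \<subseteq> space (omega \<Omega>)" if "k \<in> J" for k
        using A[THEN sets.sets_into_space] inv_into_into[of k e I] that im by auto
      ultimately show ?thesis by blast
    qed
    finally show "x \<in> (reindex I e) -` (Pi\<^sub>E I A) \<inter> space (Om \<Omega> J) \<longleftrightarrow> x \<in> Pi\<^sub>E J (A \<circ> inv_into I e)"
      by (auto simp: PiE_def Pi_iff)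
  qed
  then have "emeasure (distr (Om \<Omega> J) (Om \<Omega> I) (reindex I e)) (Pi\<^sub>E I A) = emeasure (Om \<Omega> J) (Pi\<^sub>E J (A \<circ> inv_into I e))"
    using A I by (subst emeasure_distr[OF m]) (auto intro!: sets_PiM_I_finite)
  also have "\<dots> = (\<Prod>k\<in>J. emeasure (omega \<Omega>) ((A \<circ> inv_into I e) k))"
    using A inv_into_into[of _ e I] im by (intro emeasure_PiM[OF J]) auto
  also have "\<dots> = (\<Prod>n\<in>I. emeasure (omega \<Omega>) (A n))"
    by (subst prod.reindex_bij_betw[OF e, symmetric]) (use inj in auto)
  finally show "emeasure (distr (Om \<Omega> J) (Om \<Omega> I) (reindex I e)) (Pi\<^sub>E I A) = (\<Prod>n\<in>I. emeasure (omega \<Omega>) (A n))" .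
qed

lemma integrable_reindex:
  fixes f :: "(nat \<Rightarrow> real^'d) \<Rightarrow> 'b::{banach, second_countable_topology}"
  assumes I: "finite I" and e: "bij_betw e I J" and f: "integrable (Om \<Omega> I) f"
  shows "integrable (Om \<Omega> J) (\<lambda>x. f (reindex I e x))"
    and "(\<integral>x. f (reindex I e x) \<partial>Om \<Omega> J) = (\<integral>x. f x \<partial>Om \<Omega> I)"
proof -
  have m: "reindex I e \<in> Om \<Omega> J \<rightarrow>\<^sub>M (Om \<Omega> I :: (nat \<Rightarrow> real^'d) measure)"
    using e by (intro measurable_reindex) (auto simp: bij_betw_def)
  show "integrable (Om \<Omega> J) (\<lambda>x. f (reindex I e x))"
    using integrable_distr[OF m, of f] f by (simp only: distr_reindex[OF I e])
  show "(\<integral>x. f (reindex I e x) \<partial>Om \<Omega> J) = (\<integral>x. f x \<partial>Om \<Omega> I)"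
    using integral_distr[OF m, of f] borel_measurable_integrable[OF f] by (simp only: distr_reindex[OF I e])
qed

lemma AE_reindex:
  fixes \<phi> :: "(nat \<Rightarrow> real^'d) \<Rightarrow> bool"
  assumes I: "finite I" and e: "bij_betw e I J" and ae: "AE x in Om \<Omega> I. \<phi> x"
  shows "AE x in Om \<Omega> J. \<phi> (reindex I e x)"
proof -
  have m: "reindex I e \<in> Om \<Omega> J \<rightarrow>\<^sub>M (Om \<Omega> I :: (nat \<Rightarrow> real^'d) measure)"
    using e by (intro measurable_reindex) (auto simp: bij_betw_def)
  show ?thesis by (rule AE_distrD[OF m]) (simp only: distr_reindex[OF I e] ae)
qed

lemma cont_L1_reindex:
  fixes h :: "real \<Rightarrow> (nat \<Rightarrow> real^'d) \<Rightarrow> 'b::{banach, second_countable_topology}"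
  assumes I: "finite I" and e: "bij_betw e I J" and h: "cont_L1 (Om \<Omega> I) h"
  shows "cont_L1 (Om \<Omega> J) (\<lambda>t x. h t (reindex I e x))"
proof (rule cont_L1_compare[OF h, where B = 1])
  note i = cont_L1_integrable[OF h]
  show "integrable (Om \<Omega> J) (\<lambda>x. h t (reindex I e x))" if "0 \<le> t" for t
    by (rule integrable_reindex(1)[OF I e i[OF that]])
  fix s t :: real assume st: "0 \<le> s" "0 \<le> t"
  have "integrable (Om \<Omega> I) (\<lambda>x. norm (h s x - h t x))"
    by (intro integrable_norm Bochner_Integration.integrable_diff i st)
  from integrable_reindex(2)[OF I e this]
  show "(\<integral>x. norm (h s (reindex I e x) - h t (reindex I e x)) \<partial>Om \<Omega> J) \<le> 1 * (\<integral>x. norm (h s x - h t x) \<partial>Om \<Omega> I)" by simp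
qed

text \<open>The hierarchy speaks of \<open>{1..j}\<close>, whereas the blocks of a partition carry
  arbitrary labels; a bijection of labels transports the equation from one to the other.\<close>

lemma evolution_reindex:
  fixes h :: "real \<Rightarrow> (nat \<Rightarrow> real^'d) \<Rightarrow> real" and G :: "real \<Rightarrow> nat \<Rightarrow> (nat \<Rightarrow> real^'d) \<Rightarrow> real^'d"
  assumes I: "finite I" and e: "bij_betw e I J" and ev: "evol \<Omega> I h G"
    and h: "\<And>t. 0 \<le> t \<Longrightarrow> integrable (Om \<Omega> I) (h t)"
    and G: "\<And>t k. 0 \<le> t \<Longrightarrow> k \<in> I \<Longrightarrow> integrable (Om \<Omega> I) (G t k)"
  shows "evol \<Omega> J (\<lambda>t x. h t (reindex I e x)) (\<lambda>t k x. G t (inv_into I e k) (reindex I e x))"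
proof -
  interpret I: heat_kernels "Om \<Omega> I :: (nat \<Rightarrow> real^'d) measure" "hk \<Omega> I" "ghk \<Omega> I" I "2 powr (real CARD('d) / 2)" by (rule heat_kernels_Om[OF I])
  have J: "finite J" and im: "e ` I = J" and inj: "inj_on e I" using e I by (auto simp: bij_betw_def)
  have sp: "reindex I e x \<in> space (Om \<Omega> I)" if "x \<in> space (Om \<Omega> J)" for x :: "nat \<Rightarrow> real^'d"
    using that im by (auto simp: space_PiM PiE_def)
  have hk: "hk \<Omega> J t x y = hk \<Omega> I t (reindex I e x) (reindex I e y)" for t and x y :: "nat \<Rightarrow> real^'d"
    unfolding hk_def by (subst prod.reindex_bij_betw[OF e, symmetric]) auto
  have ghk: "ghk \<Omega> J (e k) t x y = ghk \<Omega> I k t (reindex I e x) (reindex I e y)" if k: "k \<in> I" for k t and x y :: "nat \<Rightarrow> real^'d"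
  proof -
    have b: "bij_betw e (I - {k}) (J - {e k})"
      using e k by (auto simp: bij_betw_def inj_on_def)
    have "(\<Prod>l\<in>J - {e k}. heat \<Omega> t (x l - y l)) = (\<Prod>l\<in>I - {k}. heat \<Omega> t (reindex I e x l - reindex I e y l))"
      by (subst prod.reindex_bij_betw[OF b, symmetric]) (auto intro: prod.cong)
    then show ?thesis using k by (simp add: ghk_def)
  qed
  have c: "conv (Om \<Omega> J) (hk \<Omega> J) (t - s) (\<lambda>x. h s (reindex I e x)) x = conv (Om \<Omega> I) (hk \<Omega> I) (t - s) (h s) (reindex I e x)"
    if s: "0 \<le> s" "s < t" and x: "x \<in> space (Om \<Omega> J)" for t s x
  proof -
    have ts: "0 < t - s" using s by simp
    have "integrable (Om \<Omega> I) (\<lambda>y. hk \<Omega> I (t - s) (reindex I e x) y * h s y)"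
      using I.integrable_P_mult[OF ts sp[OF x] h[OF s(1)]] by simp
    from integrable_reindex(2)[OF I e this] show ?thesis unfolding conv_def hk .
  qed
  have f: "flow (Om \<Omega> J) (ghk \<Omega> J) J (\<lambda>t k x. G t (inv_into I e k) (reindex I e x)) t x s = flow (Om \<Omega> I) (ghk \<Omega> I) I G t (reindex I e x) s"
    if s: "0 \<le> s" "s < t" and x: "x \<in> space (Om \<Omega> J)" for t s x
  proof -
    have ts: "0 < t - s" using s by simp
    show ?thesis unfolding flow_def
    proof (subst sum.reindex_bij_betw[OF e, symmetric], rule sum.cong[OF refl])
      fix k assume k: "k \<in> I"
      from integrable_reindex(2)[OF I e I.integrable_Q_inner[OF k ts sp[OF x] G[OF s(1) k]]]
      show "(\<integral>y. ghk \<Omega> J (e k) (t - s) x y \<bullet> G s (inv_into I e (e k)) (reindex I e y) \<partial>Om \<Omega> J)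
        = (\<integral>y. ghk \<Omega> I k (t - s) (reindex I e x) y \<bullet> G s k y \<partial>Om \<Omega> I)"
        unfolding ghk[OF k] inv_into_f_f[OF inj k] .
    qed
  qed
  show ?thesis
    unfolding evolution_def
  proof (intro conjI allI impI ballI)
    fix t :: real and x :: "nat \<Rightarrow> real^'d" and s assume t: "0 < t" and x: "x \<in> space (Om \<Omega> J)" and s: "s \<in> {0..<t}"
    have "((\<lambda>s. conv (Om \<Omega> I) (hk \<Omega> I) (t - s) (h s) (reindex I e x)) has_real_derivative flow (Om \<Omega> I) (ghk \<Omega> I) I G t (reindex I e x) s) (at s within {0..<t})"
      using ev t sp[OF x] s unfolding evolution_def by blast
    then have "((\<lambda>s. conv (Om \<Omega> I) (hk \<Omega> I) (t - s) (h s) (reindex I e x)) has_real_derivative flow (Om \<Omega> J) (ghk \<Omega> J) J (\<lambda>t k x. G t (inv_into I e k) (reindex I e x)) t x s) (at s within {0..<t})"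
      using f[of s t x] s x by simp
    then show "((\<lambda>s. conv (Om \<Omega> J) (hk \<Omega> J) (t - s) (\<lambda>x. h s (reindex I e x)) x) has_real_derivative flow (Om \<Omega> J) (ghk \<Omega> J) J (\<lambda>t k x. G t (inv_into I e k) (reindex I e x)) t x s) (at s within {0..<t})"
      by (rule has_field_derivative_transform_within[where d = 1]) (use s c x in auto)
  next
    fix t :: real assume t: "0 < t"
    have "AE x in Om \<Omega> I. ((\<lambda>s. conv (Om \<Omega> I) (hk \<Omega> I) (t - s) (h s) x) \<longlongrightarrow> h t x) (at_left t)"
      using ev t by (auto simp: evolution_def)
    from AE_reindex[OF I e this] AE_space
    show "AE x in Om \<Omega> J. ((\<lambda>s. conv (Om \<Omega> J) (hk \<Omega> J) (t - s) (\<lambda>x. h s (reindex I e x)) x) \<longlongrightarrow> h t (reindex I e x)) (at_left t)"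
    proof eventually_elim
      case (elim x)
      have "\<forall>\<^sub>F s in at_left t. conv (Om \<Omega> I) (hk \<Omega> I) (t - s) (h s) (reindex I e x) = conv (Om \<Omega> J) (hk \<Omega> J) (t - s) (\<lambda>x. h s (reindex I e x)) x"
        using eventually_at_left_real[OF t] by eventually_elim (use c elim in auto)
      from Lim_transform_eventually[OF elim(1) this] show ?case .
    qed
  qed
qed

text \<open>Over the empty label set the space is a point and the kernel the empty product. This is
  the base of the induction over label sets.\<close>

lemma evolution_empty: "evol \<Omega> {} (\<lambda>t x. c) G"
  by (simp add: evolution_def flow_def conv_def hk_def PiM_empty lebesgue_integral_count_space_finite)

subsection \<open>Partition sums\<close>

definition partsum :: "('b set \<Rightarrow> 'a::comm_semiring_1) \<Rightarrow> 'b set \<Rightarrow> 'a" where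
  "partsum \<gamma> I = (\<Sum>\<pi>\<in>{\<pi>. partition_on I \<pi>}. \<Prod>P\<in>\<pi>. \<gamma> P)"

lemma partsum_empty [simp]: "partsum \<gamma> {} = 1"
  by (simp add: partsum_def partition_on_empty)

lemma partsum_cong:
  assumes "\<And>P. P \<subseteq> I \<Longrightarrow> P \<noteq> {} \<Longrightarrow> \<gamma> P = \<gamma>' P"
  shows "partsum \<gamma> I = partsum \<gamma>' I"
  unfolding partsum_def by (intro sum.cong prod.cong refl assms) (auto simp: partition_on_def)

text \<open>A partition is given by the block containing \<open>k\<close> and a partition of the
  remaining labels. This recursion drives the later inductions over label sets.\<close>

lemma partsum_insert:
  assumes J: "finite J" and k: "k \<notin> J"
  shows "partsum \<gamma> (insert k J) = (\<Sum>U\<in>Pow J. \<gamma> (insert k U) * partsum \<gamma> (J - U))"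
proof -
  define S where "S = Sigma (Pow J) (\<lambda>U. {\<pi>. partition_on (J - U) \<pi>})"
  define blk where "blk \<pi> = (THE P. P \<in> \<pi> \<and> k \<in> P)" for \<pi>
  have blk: "blk \<pi> = P" if "partition_on I \<pi>" "P \<in> \<pi>" "k \<in> P" for \<pi> P I
    unfolding blk_def using that by (intro the_equality) (auto simp: partition_on_def disjoint_def)
  have ex: "blk \<pi> \<in> \<pi>" "k \<in> blk \<pi>" if p: "partition_on (insert k J) \<pi>" for \<pi>
  proof -
    obtain P where "P \<in> \<pi>" "k \<in> P" using p by (auto simp: partition_on_def)
    with blk[OF p] show "blk \<pi> \<in> \<pi>" "k \<in> blk \<pi>" by auto
  qed
  have ins: "partition_on (insert k J) (insert (insert k U) \<pi>)" "insert k U \<notin> \<pi>" if "U \<subseteq> J" "partition_on (J - U) \<pi>" for U \<pi>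
  proof -
    have u: "\<Union>\<pi> = J - U" using that by (auto simp: partition_on_def)
    have d: "disjnt (insert k U) (\<Union>\<pi>)" unfolding u using k by (auto simp: disjnt_def)
    have e: "insert k J - insert k U = J - U" using k by auto
    show "partition_on (insert k J) (insert (insert k U) \<pi>)"
      using that unfolding partition_on_insert[OF d] e by auto
    show "insert k U \<notin> \<pi>" using u k by auto
  qed
  have "(\<Sum>U\<in>Pow J. \<gamma> (insert k U) * partsum \<gamma> (J - U)) = (\<Sum>U\<in>Pow J. \<Sum>\<pi>\<in>{\<pi>. partition_on (J - U) \<pi>}. \<gamma> (insert k U) * (\<Prod>P\<in>\<pi>. \<gamma> P))"
    by (simp add: partsum_def sum_distrib_left)
  also have "\<dots> = (\<Sum>(U, \<pi>)\<in>S. \<gamma> (insert k U) * (\<Prod>P\<in>\<pi>. \<gamma> P))"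
    unfolding S_def using J by (intro sum.Sigma) (auto intro: finitely_many_partition_on)
  also have "\<dots> = (\<Sum>\<pi>\<in>{\<pi>. partition_on (insert k J) \<pi>}. \<Prod>P\<in>\<pi>. \<gamma> P)"
  proof (rule sum.reindex_bij_witness[where i = "\<lambda>\<pi>. (blk \<pi> - {k}, \<pi> - {blk \<pi>})" and j = "\<lambda>(U, \<pi>). insert (insert k U) \<pi>"])
    fix a assume a: "a \<in> S"
    then obtain U \<pi> where a': "a = (U, \<pi>)" "U \<subseteq> J" "partition_on (J - U) \<pi>" by (auto simp: S_def)
    have b: "blk (insert (insert k U) \<pi>) = insert k U" by (rule blk[OF ins(1)[OF a'(2,3)]]) auto
    show "(blk (case a of (U, \<pi>) \<Rightarrow> insert (insert k U) \<pi>) - {k}, (case a of (U, \<pi>) \<Rightarrow> insert (insert k U) \<pi>) - {blk (case a of (U, \<pi>) \<Rightarrow> insert (insert k U) \<pi>)}) = a"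
      using a' b ins(2)[OF a'(2,3)] k by auto
    show "(case a of (U, \<pi>) \<Rightarrow> insert (insert k U) \<pi>) \<in> {\<pi>. partition_on (insert k J) \<pi>}"
      using ins(1)[OF a'(2,3)] by (simp add: a')
    have "finite \<pi>" using a'(3) J finite_elements[of "J - U" \<pi>] by auto
    then show "(\<Prod>P\<in>(case a of (U, \<pi>) \<Rightarrow> insert (insert k U) \<pi>). \<gamma> P) = (case a of (U, \<pi>) \<Rightarrow> \<gamma> (insert k U) * (\<Prod>P\<in>\<pi>. \<gamma> P))"
      using ins(2)[OF a'(2,3)] by (simp add: a')
  next
    fix \<pi> assume "\<pi> \<in> {\<pi>. partition_on (insert k J) \<pi>}"
    then have p: "partition_on (insert k J) \<pi>" by simp
    note e = ex[OF p]
    have i: "insert k (blk \<pi> - {k}) = blk \<pi>" using e by auto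
    show "(case (blk \<pi> - {k}, \<pi> - {blk \<pi>}) of (U, \<pi>) \<Rightarrow> insert (insert k U) \<pi>) = \<pi>"
      using e i by auto
    have sub: "blk \<pi> \<subseteq> insert k J" using p e by (auto simp: partition_on_def)
    have "J - (blk \<pi> - {k}) = insert k J - blk \<pi>" using k e by auto
    moreover have "partition_on (insert k J - blk \<pi>) (\<pi> - {blk \<pi>})"
    proof -
      have d: "disjnt (blk \<pi>) (\<Union>(\<pi> - {blk \<pi>}))"
        using p e unfolding partition_on_def disjoint_def disjnt_def by blast
      have "insert (blk \<pi>) (\<pi> - {blk \<pi>}) = \<pi>" using e by auto
      then show ?thesis using partition_on_insert[OF d, of "insert k J"] p by auto
    qed
    ultimately show "(blk \<pi> - {k}, \<pi> - {blk \<pi>}) \<in> S" using sub by (auto simp: S_def)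
  qed
  finally show ?thesis by (simp add: partsum_def)
qed

text \<open>A set with a distinguished subset is the same as two disjoint sets, chosen one after the
  other.\<close>

lemma sum_Pow_Pow:
  assumes J: "finite J"
  shows "(\<Sum>U\<in>Pow J. \<Sum>W\<in>Pow U. F W (U - W)) = (\<Sum>W\<in>Pow J. \<Sum>V\<in>Pow (J - W). F W V)"
proof -
  have "(\<Sum>U\<in>Pow J. \<Sum>W\<in>Pow U. F W (U - W)) = (\<Sum>(U, W)\<in>Sigma (Pow J) Pow. F W (U - W))"
    using J by (intro sum.Sigma) (auto intro: finite_subset)
  also have "\<dots> = (\<Sum>(W, V)\<in>Sigma (Pow J) (\<lambda>W. Pow (J - W)). F W V)"
    by (rule sum.reindex_bij_witness[where i = "\<lambda>(W, V). (W \<union> V, W)" and j = "\<lambda>(U, W). (W, U - W)"]) auto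
  also have "\<dots> = (\<Sum>W\<in>Pow J. \<Sum>V\<in>Pow (J - W). F W V)"
    using J by (intro sum.Sigma[symmetric]) auto
  finally show ?thesis .
qed

lemma sum_Pow_insert:
  assumes J: "finite J" and l: "l \<notin> J"
  shows "(\<Sum>U\<in>Pow (insert l J). F U) = (\<Sum>U\<in>Pow J. F U) + (\<Sum>U\<in>Pow J. F (insert l U))"
proof -
  have "inj_on (insert l) (Pow J)" using l by (auto simp: inj_on_def)
  then show ?thesis
    unfolding Pow_insert using J l by (subst sum.union_disjoint) (auto simp: sum.reindex)
qed

text \<open>Double counting: \<open>card V\<close> is the number of \<open>k\<close> in
  \<open>V\<close>, and for fixed \<open>k\<close> the sum over the sets containing \<open>k\<close>
  is the expansion of \<open>partsum \<gamma> J\<close> by the block of \<open>k\<close>. This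
  removes the weights of the hierarchy.\<close>

lemma partsum_weighted:
  assumes J: "finite J"
  shows "(\<Sum>V\<in>Pow J. of_nat (card V) * (\<gamma> V * partsum \<gamma> (J - V))) = of_nat (card J) * partsum \<gamma> J"
proof -
  have "(\<Sum>V\<in>Pow J. of_nat (card V) * (\<gamma> V * partsum \<gamma> (J - V))) = (\<Sum>V\<in>Pow J. \<Sum>k\<in>J. if k \<in> V then \<gamma> V * partsum \<gamma> (J - V) else 0)"
  proof (rule sum.cong[OF refl])
    fix V assume V: "V \<in> Pow J"
    have "(\<Sum>k\<in>J. if k \<in> V then \<gamma> V * partsum \<gamma> (J - V) else 0) = (\<Sum>k\<in>J \<inter> V. \<gamma> V * partsum \<gamma> (J - V))"
      by (rule sum.inter_restrict[symmetric, OF J])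
    also have "J \<inter> V = V" using V by auto
    finally show "of_nat (card V) * (\<gamma> V * partsum \<gamma> (J - V)) = (\<Sum>k\<in>J. if k \<in> V then \<gamma> V * partsum \<gamma> (J - V) else 0)" by simp
  qed
  also have "\<dots> = (\<Sum>k\<in>J. \<Sum>V\<in>Pow J. if k \<in> V then \<gamma> V * partsum \<gamma> (J - V) else 0)" by (rule sum.swap)
  also have "\<dots> = (\<Sum>k\<in>J. partsum \<gamma> J)"
  proof (rule sum.cong[OF refl])
    fix k assume k: "k \<in> J"
    define L where "L = J - {k}"
    have L: "finite L" "k \<notin> L" "J = insert k L" using J k by (auto simp: L_def)
    have "(\<Sum>V\<in>Pow J. if k \<in> V then \<gamma> V * partsum \<gamma> (J - V) else 0) = (\<Sum>V\<in>Pow L. 0) + (\<Sum>V\<in>Pow L. \<gamma> (insert k V) * partsum \<gamma> (L - V))"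
      unfolding L(3) sum_Pow_insert[OF L(1,2)] using L(2) by (intro arg_cong2[where f = "(+)"] sum.cong refl) auto
    then show "(\<Sum>V\<in>Pow J. if k \<in> V then \<gamma> V * partsum \<gamma> (J - V) else 0) = partsum \<gamma> J"
      unfolding L(3) partsum_insert[OF L(1,2)] by simp
  qed
  finally show ?thesis by simp
qed

text \<open>The generating function of what is integrated against \<open>K (x k)\<close> in the
  equation for the block \<open>P\<close>. The quadratic sum does not restrict the orders of its two
  factors, so it comprises the two terms of the linearised operator.\<close>

definition H_density :: "(nat set \<Rightarrow> 'a::comm_ring_1) \<Rightarrow> 'a \<Rightarrow> nat set \<Rightarrow> nat \<Rightarrow> 'a" where
  "H_density \<gamma> X P k =
     - \<gamma> (P \<union> {star}) - (\<Sum>W\<in>Pow (P - {k}). \<gamma> (W \<union> {k}) * \<gamma> (P \<union> {star} - W - {k}))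
     + X * (of_nat (card P) * \<gamma> (P \<union> {star})
        + (\<Sum>W\<in>Pow (P - {k}). of_int (int (card P) - 1 - int (card W)) * (\<gamma> (W \<union> {k, star}) * \<gamma> (P - {k} - W)))
        + of_nat (card P) * (\<Sum>W\<in>Pow (P - {k}). \<gamma> (W \<union> {k}) * \<gamma> (P \<union> {star} - W - {k}))
        + (\<Sum>W\<in>Pow (P - {k}). \<Sum>R\<in>Pow (P - {k} - W). of_int (int (card P) - 1 - int (card W) - int (card R)) *
             (\<gamma> (W \<union> {k}) * \<gamma> (R \<union> {star}) * \<gamma> (P - R - W - {k}))))"

text \<open>The terms without an integral, for one fixed partner \<open>l\<close>: either
  \<open>l\<close> shares the block of \<open>k\<close>, or it lies in the other of two
  blocks.\<close>

definition S_density :: "(nat set \<Rightarrow> 'a::comm_ring_1) \<Rightarrow> 'a \<Rightarrow> nat set \<Rightarrow> nat \<Rightarrow> nat \<Rightarrow> 'a" where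
  "S_density \<gamma> X P k l =
     - X * (\<gamma> P + (if l = k then 0 else \<Sum>W\<in>Pow (P - {k, l}). \<gamma> (W \<union> {k}) * \<gamma> (P - {k} - W)))"

text \<open>With \<open>k\<close> removed from the label set, the integer weights become
  cardinalities of complements, and no subtraction remains in the coefficients.\<close>

lemma H_density_insert:
  assumes U: "finite U" "k \<notin> U" "star \<notin> U" "k \<noteq> star"
  shows "H_density \<gamma> X (insert k U) k =
     - \<gamma> (insert k (insert star U)) - (\<Sum>W\<in>Pow U. \<gamma> (insert k W) * \<gamma> (insert star (U - W)))
     + X * (of_nat (1 + card U) * \<gamma> (insert k (insert star U))
        + (\<Sum>W\<in>Pow U. of_nat (card (U - W)) * (\<gamma> (insert k (insert star W)) * \<gamma> (U - W)))
        + of_nat (1 + card U) * (\<Sum>W\<in>Pow U. \<gamma> (insert k W) * \<gamma> (insert star (U - W)))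
        + (\<Sum>W\<in>Pow U. \<Sum>R\<in>Pow (U - W). of_nat (card (U - W - R)) *
             (\<gamma> (insert k W) * \<gamma> (insert star R) * \<gamma> (U - W - R))))"
proof -
  have e: "insert k U \<union> {star} = insert k (insert star U)" "insert k U - {k} = U" "card (insert k U) = 1 + card U"
    using U by auto
  have w: "W \<union> {k} = insert k W" "insert k (insert star U) - W - {k} = insert star (U - W)" "W \<union> {k, star} = insert k (insert star W)"
    "of_int (int (1 + card U) - 1 - int (card W)) = (of_nat (card (U - W)) :: 'a)" if "W \<in> Pow U" for W
  proof -
    have fin: "finite W" using that U finite_subset by auto
    then have "card (U - W) = card U - card W" "card W \<le> card U" using that U by (auto intro: card_Diff_subset card_mono)
    then show "of_int (int (1 + card U) - 1 - int (card W)) = (of_nat (card (U - W)) :: 'a)" by (simp add: of_nat_diff)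
  qed (use that U in auto)
  have r: "insert k U - R - W - {k} = U - W - R" "R \<union> {star} = insert star R"
    "of_int (int (1 + card U) - 1 - int (card W) - int (card R)) = (of_nat (card (U - W - R)) :: 'a)" if "W \<in> Pow U" "R \<in> Pow (U - W)" for W R
  proof -
    have fin: "finite W" "finite R" using that U by (auto intro: finite_subset)
    then have "card (U - W) = card U - card W" "card W \<le> card U" "card (U - W - R) = card (U - W) - card R" "card R \<le> card (U - W)"
      using that U by (auto intro: card_Diff_subset card_mono)
    then show "of_int (int (1 + card U) - 1 - int (card W) - int (card R)) = (of_nat (card (U - W - R)) :: 'a)" by (simp add: of_nat_diff)
  qed (use that U in auto)
  show ?thesis
    unfolding H_density_def e
    by (intro arg_cong2[where f = "(+)"] arg_cong2[where f = "(-)"] arg_cong2[where f = "(*)"] sum.cong refl)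
      (simp_all only: w r)
qed

text \<open>In a partition of \<open>insert star (insert k J)\<close> the labels \<open>k\<close>
  and \<open>star\<close> share a block or they do not; \<open>T1\<close> and \<open>T2\<close>
  collect these cases. In the factor of \<open>X\<close> the weights together count each label of
  \<open>insert k J\<close> once, whence the common coefficient.\<close>

lemma partsum_H_density:
  assumes J: "finite J" "k \<notin> J" "star \<notin> J" "k \<noteq> star"
  shows "(\<Sum>U\<in>Pow J. H_density \<gamma> X (insert k U) k * partsum \<gamma> (J - U))
    = - (1 - of_nat (card (insert k J)) * X) * partsum \<gamma> (insert star (insert k J))"
proof -
  let ?f = "partsum \<gamma>"
  define T1 where "T1 = (\<Sum>U\<in>Pow J. \<gamma> (insert k (insert star U)) * ?f (J - U))"
  define T2 where "T2 = (\<Sum>W\<in>Pow J. \<Sum>V\<in>Pow (J - W). \<gamma> (insert k W) * \<gamma> (insert star V) * ?f (J - W - V))"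
  have JUW: "J - U = J - W - (U - W)" if "W \<in> Pow U" "U \<in> Pow J" for U W using that by auto
  have fin: "finite (J - W)" for W using J by auto
  have a1: "(\<Sum>U\<in>Pow J. (\<Sum>W\<in>Pow U. \<gamma> (insert k W) * \<gamma> (insert star (U - W))) * ?f (J - U)) = T2"
  proof -
    have "(\<Sum>U\<in>Pow J. (\<Sum>W\<in>Pow U. \<gamma> (insert k W) * \<gamma> (insert star (U - W))) * ?f (J - U)) = (\<Sum>U\<in>Pow J. \<Sum>W\<in>Pow U. \<gamma> (insert k W) * \<gamma> (insert star (U - W)) * ?f (J - W - (U - W)))"
      unfolding sum_distrib_right by (intro sum.cong refl) (simp only: JUW)
    also have "\<dots> = T2" unfolding T2_def by (rule sum_Pow_Pow[OF J(1), of "\<lambda>W V. \<gamma> (insert k W) * \<gamma> (insert star V) * ?f (J - W - V)"])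
    finally show ?thesis .
  qed
  have main: "?f (insert star (insert k J)) = T1 + T2"
  proof -
    have i: "insert star (insert k J) = insert k (insert star J)" by auto
    have "?f (insert star (insert k J)) = (\<Sum>U\<in>Pow (insert star J). \<gamma> (insert k U) * ?f (insert star J - U))"
      unfolding i using J by (intro partsum_insert) auto
    also have "\<dots> = (\<Sum>U\<in>Pow J. \<gamma> (insert k U) * ?f (insert star J - U)) + (\<Sum>U\<in>Pow J. \<gamma> (insert k (insert star U)) * ?f (insert star J - insert star U))"
      by (rule sum_Pow_insert[OF J(1,3)])
    also have "(\<Sum>U\<in>Pow J. \<gamma> (insert k (insert star U)) * ?f (insert star J - insert star U)) = T1"
      unfolding T1_def
    proof (intro sum.cong refl)
      fix U assume "U \<in> Pow J"
      then have "insert star J - insert star U = J - U" using J by auto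
      then show "\<gamma> (insert k (insert star U)) * ?f (insert star J - insert star U) = \<gamma> (insert k (insert star U)) * ?f (J - U)" by simp
    qed
    also have "(\<Sum>U\<in>Pow J. \<gamma> (insert k U) * ?f (insert star J - U)) = T2"
      unfolding T2_def
    proof (rule sum.cong[OF refl])
      fix U assume U: "U \<in> Pow J"
      then have e: "insert star J - U = insert star (J - U)" using J by auto
      show "\<gamma> (insert k U) * ?f (insert star J - U) = (\<Sum>V\<in>Pow (J - U). \<gamma> (insert k U) * \<gamma> (insert star V) * ?f (J - U - V))"
        unfolding e using J by (subst partsum_insert) (auto simp: sum_distrib_left mult.assoc)
    qed
    finally show ?thesis by (simp add: add.commute)
  qed
  \<comment> \<open>The factor \<open>\<gamma> (U - W)\<close> is a block without \<open>k\<close>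
    and \<open>star\<close>, weighted by its size, so \<open>partsum_weighted\<close> merges it with
    \<open>partsum \<gamma> (J - U)\<close>.\<close>
  have a2: "(\<Sum>U\<in>Pow J. (\<Sum>W\<in>Pow U. of_nat (card (U - W)) * (\<gamma> (insert k (insert star W)) * \<gamma> (U - W))) * ?f (J - U))
      = (\<Sum>W\<in>Pow J. of_nat (card (J - W)) * (\<gamma> (insert k (insert star W)) * ?f (J - W)))"
  proof -
    have "(\<Sum>U\<in>Pow J. (\<Sum>W\<in>Pow U. of_nat (card (U - W)) * (\<gamma> (insert k (insert star W)) * \<gamma> (U - W))) * ?f (J - U))
        = (\<Sum>U\<in>Pow J. \<Sum>W\<in>Pow U. \<gamma> (insert k (insert star W)) * (of_nat (card (U - W)) * (\<gamma> (U - W) * ?f (J - W - (U - W)))))"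
      unfolding sum_distrib_right by (intro sum.cong refl) (simp only: JUW ac_simps)
    also have "\<dots> = (\<Sum>W\<in>Pow J. \<Sum>V\<in>Pow (J - W). \<gamma> (insert k (insert star W)) * (of_nat (card V) * (\<gamma> V * ?f (J - W - V))))"
      by (rule sum_Pow_Pow[OF J(1), of "\<lambda>W V. \<gamma> (insert k (insert star W)) * (of_nat (card V) * (\<gamma> V * ?f (J - W - V)))"])
    also have "\<dots> = (\<Sum>W\<in>Pow J. \<gamma> (insert k (insert star W)) * (of_nat (card (J - W)) * ?f (J - W)))"
      by (simp only: sum_distrib_left[symmetric] partsum_weighted[OF fin])
    finally show ?thesis by (simp only: ac_simps)
  qed
  have a3: "(\<Sum>U\<in>Pow J. of_nat (1 + card U) * (\<Sum>W\<in>Pow U. \<gamma> (insert k W) * \<gamma> (insert star (U - W))) * ?f (J - U))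
     = (\<Sum>W\<in>Pow J. \<Sum>V\<in>Pow (J - W). of_nat (1 + card W + card V) * (\<gamma> (insert k W) * \<gamma> (insert star V) * ?f (J - W - V)))"
  proof -
    have cU: "card U = card W + card (U - W)" if "W \<in> Pow U" "U \<in> Pow J" for U W
      using that J(1) card_Un_disjoint[of W "U - W"] finite_subset[of U J] finite_subset[of W U] by (auto simp: Un_absorb1)
    have "(\<Sum>U\<in>Pow J. of_nat (1 + card U) * (\<Sum>W\<in>Pow U. \<gamma> (insert k W) * \<gamma> (insert star (U - W))) * ?f (J - U))
       = (\<Sum>U\<in>Pow J. \<Sum>W\<in>Pow U. of_nat (1 + card W + card (U - W)) * (\<gamma> (insert k W) * \<gamma> (insert star (U - W)) * ?f (J - W - (U - W))))"
      unfolding sum_distrib_right sum_distrib_left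
    proof (intro sum.cong refl)
      fix U W assume h: "U \<in> Pow J" "W \<in> Pow U"
      have c: "1 + card U = 1 + card W + card (U - W)" using cU[OF h(2,1)] by simp
      show "of_nat (1 + card U) * (\<gamma> (insert k W) * \<gamma> (insert star (U - W))) * ?f (J - U)
        = of_nat (1 + card W + card (U - W)) * (\<gamma> (insert k W) * \<gamma> (insert star (U - W)) * ?f (J - W - (U - W)))"
        unfolding c JUW[OF h(2,1)] by (simp only: mult.assoc)
    qed
    also have "\<dots> = (\<Sum>W\<in>Pow J. \<Sum>V\<in>Pow (J - W). of_nat (1 + card W + card V) * (\<gamma> (insert k W) * \<gamma> (insert star V) * ?f (J - W - V)))"
      by (rule sum_Pow_Pow[OF J(1), of "\<lambda>W V. of_nat (1 + card W + card V) * (\<gamma> (insert k W) * \<gamma> (insert star V) * ?f (J - W - V))"])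
    finally show ?thesis .
  qed
  have a4: "(\<Sum>U\<in>Pow J. (\<Sum>W\<in>Pow U. \<Sum>R\<in>Pow (U - W). of_nat (card (U - W - R)) * (\<gamma> (insert k W) * \<gamma> (insert star R) * \<gamma> (U - W - R))) * ?f (J - U))
     = (\<Sum>W\<in>Pow J. \<Sum>V\<in>Pow (J - W). of_nat (card (J - W - V)) * (\<gamma> (insert k W) * \<gamma> (insert star V) * ?f (J - W - V)))"
  proof -
    \<comment> \<open>Written as a function of \<open>W\<close> and \<open>T = U - W\<close>, so
      that \<open>sum_Pow_Pow\<close> applies first to \<open>W\<close> inside \<open>U\<close> and
      then to \<open>R\<close> inside \<open>T\<close>.\<close>
    define Fn where "Fn W T = (\<Sum>R\<in>Pow T. \<gamma> (insert k W) * \<gamma> (insert star R) * (of_nat (card (T - R)) * (\<gamma> (T - R) * ?f (J - W - R - (T - R)))))" for W T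
    have "(\<Sum>U\<in>Pow J. (\<Sum>W\<in>Pow U. \<Sum>R\<in>Pow (U - W). of_nat (card (U - W - R)) * (\<gamma> (insert k W) * \<gamma> (insert star R) * \<gamma> (U - W - R))) * ?f (J - U))
        = (\<Sum>U\<in>Pow J. \<Sum>W\<in>Pow U. Fn W (U - W))"
      unfolding sum_distrib_right Fn_def
    proof (intro sum.cong refl)
      fix U W R assume h: "U \<in> Pow J" "W \<in> Pow U" "R \<in> Pow (U - W)"
      have c: "J - U = J - W - R - (U - W - R)" using h by auto
      show "of_nat (card (U - W - R)) * (\<gamma> (insert k W) * \<gamma> (insert star R) * \<gamma> (U - W - R)) * ?f (J - U)
        = \<gamma> (insert k W) * \<gamma> (insert star R) * (of_nat (card (U - W - R)) * (\<gamma> (U - W - R) * ?f (J - W - R - (U - W - R))))"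
        unfolding c by (simp only: ac_simps)
    qed
    also have "\<dots> = (\<Sum>W\<in>Pow J. \<Sum>T\<in>Pow (J - W). Fn W T)" by (rule sum_Pow_Pow[OF J(1)])
    also have "\<dots> = (\<Sum>W\<in>Pow J. \<Sum>R\<in>Pow (J - W). \<Sum>V\<in>Pow (J - W - R). \<gamma> (insert k W) * \<gamma> (insert star R) * (of_nat (card V) * (\<gamma> V * ?f (J - W - R - V))))"
      unfolding Fn_def
      by (intro sum.cong refl sum_Pow_Pow[OF fin, of "\<lambda>R V. \<gamma> (insert k W) * \<gamma> (insert star R) * (of_nat (card V) * (\<gamma> V * ?f (J - W - R - V)))" for W])
    also have "\<dots> = (\<Sum>W\<in>Pow J. \<Sum>R\<in>Pow (J - W). \<gamma> (insert k W) * \<gamma> (insert star R) * (of_nat (card (J - W - R)) * ?f (J - W - R)))"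
      using J by (intro sum.cong refl) (simp only: sum_distrib_left[symmetric] partsum_weighted finite_Diff)
    finally show ?thesis by (simp only: ac_simps)
  qed
  define n where "n = (of_nat (card (insert k J)) :: 'a)"
  \<comment> \<open>Apart from \<open>star\<close>, the block of \<open>k\<close> has
    \<open>1 + card U\<close> labels, and \<open>card (J - U)\<close> labels lie outside; together
    these are all particles. In \<open>n2\<close> the same count is made with \<open>k\<close> and
    \<open>star\<close> in different blocks.\<close>
  have n1: "(\<Sum>U\<in>Pow J. of_nat (1 + card U) * \<gamma> (insert k (insert star U)) * ?f (J - U))
     + (\<Sum>W\<in>Pow J. of_nat (card (J - W)) * (\<gamma> (insert k (insert star W)) * ?f (J - W))) = n * T1"
    unfolding T1_def sum_distrib_left sum.distrib[symmetric]
  proof (rule sum.cong[OF refl])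
    fix U assume "U \<in> Pow J"
    then have "card (insert k J) = (1 + card U) + card (J - U)"
      using J card_mono[of J U] by (simp add: card_Diff_subset finite_subset)
    then have "n = of_nat (1 + card U) + of_nat (card (J - U))" unfolding n_def by (simp only: of_nat_add)
    then show "of_nat (1 + card U) * \<gamma> (insert k (insert star U)) * ?f (J - U) + of_nat (card (J - U)) * (\<gamma> (insert k (insert star U)) * ?f (J - U)) = n * (\<gamma> (insert k (insert star U)) * ?f (J - U))"
      by (simp only: mult.assoc distrib_right)
  qed
  have n2: "(\<Sum>W\<in>Pow J. \<Sum>V\<in>Pow (J - W). of_nat (1 + card W + card V) * (\<gamma> (insert k W) * \<gamma> (insert star V) * ?f (J - W - V)))
     + (\<Sum>W\<in>Pow J. \<Sum>V\<in>Pow (J - W). of_nat (card (J - W - V)) * (\<gamma> (insert k W) * \<gamma> (insert star V) * ?f (J - W - V))) = n * T2"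
    unfolding T2_def sum_distrib_left sum.distrib[symmetric]
  proof (intro sum.cong refl)
    fix W V assume h: "W \<in> Pow J" "V \<in> Pow (J - W)"
    then have "card (J - W) = card J - card W" "card W \<le> card J" "card (J - W - V) = card (J - W) - card V" "card V \<le> card (J - W)"
      using J by (auto intro!: card_Diff_subset card_mono intro: finite_subset)
    then have "card (insert k J) = (1 + card W + card V) + card (J - W - V)" using J by simp
    then have "n = of_nat (1 + card W + card V) + of_nat (card (J - W - V))" unfolding n_def by (simp only: of_nat_add)
    then show "of_nat (1 + card W + card V) * (\<gamma> (insert k W) * \<gamma> (insert star V) * ?f (J - W - V)) + of_nat (card (J - W - V)) * (\<gamma> (insert k W) * \<gamma> (insert star V) * ?f (J - W - V))
       = n * (\<gamma> (insert k W) * \<gamma> (insert star V) * ?f (J - W - V))"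
      by (simp only: distrib_right)
  qed
  have Hi: "H_density \<gamma> X (insert k U) k = - \<gamma> (insert k (insert star U)) - (\<Sum>W\<in>Pow U. \<gamma> (insert k W) * \<gamma> (insert star (U - W)))
     + X * (of_nat (1 + card U) * \<gamma> (insert k (insert star U))
        + (\<Sum>W\<in>Pow U. of_nat (card (U - W)) * (\<gamma> (insert k (insert star W)) * \<gamma> (U - W)))
        + of_nat (1 + card U) * (\<Sum>W\<in>Pow U. \<gamma> (insert k W) * \<gamma> (insert star (U - W)))
        + (\<Sum>W\<in>Pow U. \<Sum>R\<in>Pow (U - W). of_nat (card (U - W - R)) *
             (\<gamma> (insert k W) * \<gamma> (insert star R) * \<gamma> (U - W - R))))" if "U \<in> Pow J" for U
    using that J by (intro H_density_insert) (auto intro: finite_subset)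
  define a where "a U = \<gamma> (insert k (insert star U)) * ?f (J - U)" for U
  define b where "b U = (\<Sum>W\<in>Pow U. \<gamma> (insert k W) * \<gamma> (insert star (U - W))) * ?f (J - U)" for U
  define c1 where "c1 U = of_nat (1 + card U) * \<gamma> (insert k (insert star U)) * ?f (J - U)" for U
  define c2 where "c2 U = (\<Sum>W\<in>Pow U. of_nat (card (U - W)) * (\<gamma> (insert k (insert star W)) * \<gamma> (U - W))) * ?f (J - U)" for U
  define c3 where "c3 U = of_nat (1 + card U) * (\<Sum>W\<in>Pow U. \<gamma> (insert k W) * \<gamma> (insert star (U - W))) * ?f (J - U)" for U
  define c4 where "c4 U = (\<Sum>W\<in>Pow U. \<Sum>R\<in>Pow (U - W). of_nat (card (U - W - R)) * (\<gamma> (insert k W) * \<gamma> (insert star R) * \<gamma> (U - W - R))) * ?f (J - U)" for U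
  have "H_density \<gamma> X (insert k U) k * ?f (J - U) = - a U - b U + X * (c1 U + c2 U + c3 U + c4 U)" if "U \<in> Pow J" for U
    unfolding Hi[OF that] a_def b_def c1_def c2_def c3_def c4_def
    by (simp only: left_diff_distrib distrib_right mult_minus_left mult.assoc)
  then have "(\<Sum>U\<in>Pow J. H_density \<gamma> X (insert k U) k * ?f (J - U)) = (\<Sum>U\<in>Pow J. - a U - b U + X * (c1 U + c2 U + c3 U + c4 U))"
    by (intro sum.cong refl)
  also have "\<dots> = - sum a (Pow J) - sum b (Pow J) + X * (sum c1 (Pow J) + sum c2 (Pow J) + sum c3 (Pow J) + sum c4 (Pow J))"
    by (simp only: sum.distrib sum_subtractf sum_negf sum_distrib_left[symmetric])
  also have "sum a (Pow J) = T1" unfolding a_def[abs_def] T1_def ..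
  also have "sum b (Pow J) = T2" unfolding b_def[abs_def] a1 ..
  also have "sum c1 (Pow J) + sum c2 (Pow J) + sum c3 (Pow J) + sum c4 (Pow J) = n * T1 + n * T2"
    using n1 n2 a2 a3 a4 unfolding c1_def[abs_def] c2_def[abs_def] c3_def[abs_def] c4_def[abs_def] by (simp only: add.assoc)
  also have "- T1 - T2 + X * (n * T1 + n * T2) = - (1 - n * X) * (T1 + T2)" by (simp add: algebra_simps)
  finally show ?thesis unfolding main n_def .
qed

lemma partsum_S_density_same:
  assumes J: "finite J" "k \<notin> J"
  shows "(\<Sum>U\<in>Pow J. S_density \<gamma> X (insert k U) k k * partsum \<gamma> (J - U)) = - X * partsum \<gamma> (insert k J)"
  by (simp add: S_density_def partsum_insert[OF J] sum_distrib_left mult.assoc sum_negf)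

text \<open>The sum runs over the sets that contain both labels. The first part of
  \<open>S_density\<close> accounts for the partitions in which \<open>k\<close> and
  \<open>l\<close> share a block; the second splits the set into two blocks and accounts for those
  that separate them.\<close>

lemma partsum_S_density_other:
  assumes L: "finite L" "k \<notin> L" "l \<notin> L" "k \<noteq> l"
  shows "(\<Sum>U\<in>Pow L. S_density \<gamma> X (insert k (insert l U)) k l * partsum \<gamma> (L - U)) = - X * partsum \<gamma> (insert k (insert l L))"
proof -
  let ?f = "partsum \<gamma>"
  have fin: "finite (L - W)" for W using L by auto
  have "?f (insert k (insert l L)) = (\<Sum>U\<in>Pow (insert l L). \<gamma> (insert k U) * ?f (insert l L - U))"
    using L by (intro partsum_insert) auto
  also have "\<dots> = (\<Sum>U\<in>Pow L. \<gamma> (insert k U) * ?f (insert l L - U)) + (\<Sum>U\<in>Pow L. \<gamma> (insert k (insert l U)) * ?f (insert l L - insert l U))"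
    by (rule sum_Pow_insert[OF L(1,3)])
  also have "(\<Sum>U\<in>Pow L. \<gamma> (insert k (insert l U)) * ?f (insert l L - insert l U)) = (\<Sum>U\<in>Pow L. \<gamma> (insert k (insert l U)) * ?f (L - U))"
  proof (intro sum.cong refl)
    fix U assume "U \<in> Pow L"
    then have "insert l L - insert l U = L - U" using L by auto
    then show "\<gamma> (insert k (insert l U)) * ?f (insert l L - insert l U) = \<gamma> (insert k (insert l U)) * ?f (L - U)" by simp
  qed
  also have "(\<Sum>U\<in>Pow L. \<gamma> (insert k U) * ?f (insert l L - U)) = (\<Sum>W\<in>Pow L. \<Sum>V\<in>Pow (L - W). \<gamma> (insert k W) * \<gamma> (insert l V) * ?f (L - W - V))"
  proof (rule sum.cong[OF refl])
    fix U assume U: "U \<in> Pow L"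
    then have e: "insert l L - U = insert l (L - U)" using L by auto
    show "\<gamma> (insert k U) * ?f (insert l L - U) = (\<Sum>V\<in>Pow (L - U). \<gamma> (insert k U) * \<gamma> (insert l V) * ?f (L - U - V))"
      unfolding e using L by (subst partsum_insert) (auto simp: sum_distrib_left mult.assoc)
  qed
  also have "\<dots> = (\<Sum>U\<in>Pow L. \<Sum>W\<in>Pow U. \<gamma> (insert k W) * \<gamma> (insert l (U - W)) * ?f (L - W - (U - W)))"
    by (rule sum_Pow_Pow[OF L(1), of "\<lambda>W V. \<gamma> (insert k W) * \<gamma> (insert l V) * ?f (L - W - V)", symmetric])
  finally have main: "?f (insert k (insert l L)) = \<dots> + (\<Sum>U\<in>Pow L. \<gamma> (insert k (insert l U)) * ?f (L - U))" .
  have "S_density \<gamma> X (insert k (insert l U)) k l * ?f (L - U)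
     = - X * ((\<Sum>W\<in>Pow U. \<gamma> (insert k W) * \<gamma> (insert l (U - W)) * ?f (L - W - (U - W))) + \<gamma> (insert k (insert l U)) * ?f (L - U))" if U: "U \<in> Pow L" for U
  proof -
    have e: "insert k (insert l U) - {k, l} = U" using U L by auto
    have "(\<Sum>W\<in>Pow U. \<gamma> (W \<union> {k}) * \<gamma> (insert k (insert l U) - {k} - W)) * ?f (L - U) = (\<Sum>W\<in>Pow U. \<gamma> (insert k W) * \<gamma> (insert l (U - W)) * ?f (L - W - (U - W)))"
      unfolding sum_distrib_right
    proof (intro sum.cong refl)
      fix W assume W: "W \<in> Pow U"
      have "insert k (insert l U) - {k} - W = insert l (U - W)" "L - U = L - W - (U - W)" "W \<union> {k} = insert k W" using U L W by auto
      then show "\<gamma> (W \<union> {k}) * \<gamma> (insert k (insert l U) - {k} - W) * ?f (L - U) = \<gamma> (insert k W) * \<gamma> (insert l (U - W)) * ?f (L - W - (U - W))" by (simp only:)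
    qed
    then show ?thesis using L(4) unfolding S_density_def e by (simp add: algebra_simps)
  qed
  then have "(\<Sum>U\<in>Pow L. S_density \<gamma> X (insert k (insert l U)) k l * ?f (L - U)) = - X * ?f (insert k (insert l L))"
    unfolding main by (simp only: sum_distrib_left[symmetric] sum.distrib cong: sum.cong)
  then show ?thesis .
qed

text \<open>This links \<open>f_family\<close> to power series: the multi-indices with sum
  \<open>i\<close> are the ways to collect the exponent \<open>i\<close> from the factors.\<close>

lemma fps_nth_prod_Abs:
  fixes h :: "'b \<Rightarrow> nat \<Rightarrow> 'a::comm_semiring_1"
  assumes "finite \<pi>"
  shows "fps_nth (\<Prod>P\<in>\<pi>. Abs_fps (h P)) i = (\<Sum>a\<in>{a \<in> \<pi> \<rightarrow>\<^sub>E UNIV. (\<Sum>P\<in>\<pi>. a P) = i}. \<Prod>P\<in>\<pi>. h P (a P))"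
  using assms
proof (induction \<pi> arbitrary: i rule: finite_induct)
  case empty
  have "{a \<in> {} \<rightarrow>\<^sub>E (UNIV :: nat set). (\<Sum>P\<in>({} :: 'b set). a P) = i} = (if i = 0 then {\<lambda>_. undefined} else {})"
    by auto
  then show ?case by simp
next
  case (insert p \<pi>)
  let ?A = "\<lambda>\<pi> i. {a \<in> \<pi> \<rightarrow>\<^sub>E (UNIV :: nat set). (\<Sum>P\<in>\<pi>. a P) = i}"
  have finA: "finite (?A \<pi> i)" for i
  proof (rule finite_subset)
    show "?A \<pi> i \<subseteq> \<pi> \<rightarrow>\<^sub>E {..i}"
      using insert(1) by (auto simp: PiE_def Pi_iff intro: member_le_sum)
  qed (use insert(1) in \<open>auto intro: finite_PiE\<close>)
  have "fps_nth (\<Prod>P\<in>insert p \<pi>. Abs_fps (h P)) i = (\<Sum>m\<in>{0..i}. h p m * (\<Sum>a\<in>?A \<pi> (i - m). \<Prod>P\<in>\<pi>. h P (a P)))"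
    using insert by (simp add: fps_mult_nth)
  also have "\<dots> = (\<Sum>(m, a)\<in>Sigma {0..i} (\<lambda>m. ?A \<pi> (i - m)). h p m * (\<Prod>P\<in>\<pi>. h P (a P)))"
    unfolding sum_distrib_left by (intro sum.Sigma) (auto simp: finA)
  also have "\<dots> = (\<Sum>a\<in>?A (insert p \<pi>) i. \<Prod>P\<in>insert p \<pi>. h P (a P))"
  proof (rule sum.reindex_bij_witness[where i = "\<lambda>a. (a p, restrict a \<pi>)" and j = "\<lambda>(m, a). a(p := m)"])
    fix z assume "z \<in> Sigma {0..i} (\<lambda>m. ?A \<pi> (i - m))"
    then obtain m a where z: "z = (m, a)" "m \<le> i" "a \<in> \<pi> \<rightarrow>\<^sub>E UNIV" "(\<Sum>P\<in>\<pi>. a P) = i - m" by auto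
    have s: "(\<Sum>P\<in>\<pi>. (a(p := m)) P) = (\<Sum>P\<in>\<pi>. a P)" using insert(2) by (intro sum.cong) auto
    have q: "(\<Prod>P\<in>\<pi>. h P ((a(p := m)) P)) = (\<Prod>P\<in>\<pi>. h P (a P))" using insert(2) by (intro prod.cong) auto
    show "(\<lambda>a. (a p, restrict a \<pi>)) (case z of (m, a) \<Rightarrow> a(p := m)) = z"
      using z insert(2) by (auto simp: fun_eq_iff PiE_def extensional_def)
    show "(case z of (m, a) \<Rightarrow> a(p := m)) \<in> ?A (insert p \<pi>) i"
      using z s insert(1,2) by (auto simp: PiE_def extensional_def)
    show "(\<Prod>P\<in>insert p \<pi>. h P ((case z of (m, a) \<Rightarrow> a(p := m)) P)) = (case z of (m, a) \<Rightarrow> h p m * (\<Prod>P\<in>\<pi>. h P (a P)))"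
      using z q insert(1,2) by simp
  next
    fix a assume a: "a \<in> ?A (insert p \<pi>) i"
    then have s: "a p + (\<Sum>P\<in>\<pi>. a P) = i" using insert(1,2) by simp
    show "(case (a p, restrict a \<pi>) of (m, a) \<Rightarrow> a(p := m)) = a"
      using a by (auto simp: fun_eq_iff PiE_def extensional_def)
    show "(a p, restrict a \<pi>) \<in> Sigma {0..i} (\<lambda>m. ?A \<pi> (i - m))" using s by auto
  qed
  finally show ?case .
qed

subsection \<open>Bounded interactions\<close>

lemma distr_Om_insert:
  assumes I: "finite I" "i \<notin> I"
  shows "distr (Om \<Omega> I \<Otimes>\<^sub>M omega \<Omega>) (Om \<Omega> (insert i I)) (\<lambda>(x, y). x(i := y)) = (Om \<Omega> (insert i I) :: (nat \<Rightarrow> real^'d) measure)"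
proof -
  interpret product_sigma_finite "\<lambda>_ :: nat. omega \<Omega> :: (real^'d) measure" by (rule product_sigma_finite_omega)
  interpret O: sigma_finite_measure "omega \<Omega> :: (real^'d) measure" by (rule sigma_finite_omega)
  let ?T = "\<lambda>(x, y). x(i := y) :: nat \<Rightarrow> real^'d"
  have T: "?T \<in> Om \<Omega> I \<Otimes>\<^sub>M omega \<Omega> \<rightarrow>\<^sub>M Om \<Omega> (insert i I)" by (rule measurable_add_dim)
  show ?thesis
  proof (rule measure_eqI)
    fix A assume "A \<in> sets (distr (Om \<Omega> I \<Otimes>\<^sub>M omega \<Omega>) (Om \<Omega> (insert i I)) ?T)"
    then have A: "A \<in> sets (Om \<Omega> (insert i I))" by simp
    have m: "(\<lambda>z. indicator A (?T z)) \<in> borel_measurable (Om \<Omega> I \<Otimes>\<^sub>M omega \<Omega>)"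
      using T A by measurable
    have "emeasure (distr (Om \<Omega> I \<Otimes>\<^sub>M omega \<Omega>) (Om \<Omega> (insert i I)) ?T) A = (\<integral>\<^sup>+z. indicator A z \<partial>distr (Om \<Omega> I \<Otimes>\<^sub>M omega \<Omega>) (Om \<Omega> (insert i I)) ?T)"
      using A by simp
    also have "\<dots> = (\<integral>\<^sup>+z. indicator A (?T z) \<partial>(Om \<Omega> I \<Otimes>\<^sub>M omega \<Omega>))"
      using A by (intro nn_integral_distr[OF T]) simp
    also have "\<dots> = (\<integral>\<^sup>+x. \<integral>\<^sup>+y. indicator A (?T (x, y)) \<partial>omega \<Omega> \<partial>Om \<Omega> I)"
      using sigma_finite_measure.nn_integral_fst[OF sigma_finite_omega m] by simp
    also have "\<dots> = (\<integral>\<^sup>+z. indicator A z \<partial>Om \<Omega> (insert i I))"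
      using product_nn_integral_insert[OF I, of "indicator A"] A by simp
    finally show "emeasure (distr (Om \<Omega> I \<Otimes>\<^sub>M omega \<Omega>) (Om \<Omega> (insert i I)) ?T) A = emeasure (Om \<Omega> (insert i I)) A" using A by simp
  qed simp
qed

lemma AE_Om_insert:
  fixes \<phi> :: "(nat \<Rightarrow> real^'d) \<Rightarrow> bool"
  assumes I: "finite I" "i \<notin> I" and ae: "AE z in Om \<Omega> (insert i I). \<phi> z"
  shows "AE x in Om \<Omega> I. AE y in omega \<Omega>. \<phi> (x(i := y))"
proof -
  interpret A: sigma_finite_measure "Om \<Omega> I :: (nat \<Rightarrow> real^'d) measure" by (rule sigma_finite_Om[OF I(1)])
  interpret O: sigma_finite_measure "omega \<Omega> :: (real^'d) measure" by (rule sigma_finite_omega)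
  interpret P: pair_sigma_finite "Om \<Omega> I :: (nat \<Rightarrow> real^'d) measure" "omega \<Omega> :: (real^'d) measure" ..
  have T: "(\<lambda>(x, y). x(i := y)) \<in> Om \<Omega> I \<Otimes>\<^sub>M omega \<Omega> \<rightarrow>\<^sub>M (Om \<Omega> (insert i I) :: (nat \<Rightarrow> real^'d) measure)"
    by (rule measurable_add_dim)
  have "AE z in Om \<Omega> I \<Otimes>\<^sub>M omega \<Omega>. \<phi> ((\<lambda>(x, y). x(i := y)) z)"
    by (rule AE_distrD[OF T]) (simp only: distr_Om_insert[OF I] ae)
  from P.AE_pair[OF this] show ?thesis by simp
qed

lemma integrable_Om_insert:
  fixes V :: "(nat \<Rightarrow> real^'d) \<Rightarrow> 'b::{banach, second_countable_topology}"
  assumes I: "finite I" "i \<notin> I" and V: "integrable (Om \<Omega> (insert i I)) V"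
  shows "AE x in Om \<Omega> I. integrable (omega \<Omega>) (\<lambda>y. V (x(i := y)))"
    and "integrable (Om \<Omega> I) (\<lambda>x. \<integral>y. V (x(i := y)) \<partial>omega \<Omega>)"
    and "(\<integral>x. (\<integral>y. V (x(i := y)) \<partial>omega \<Omega>) \<partial>Om \<Omega> I) = (\<integral>z. V z \<partial>Om \<Omega> (insert i I))"
proof -
  interpret A: sigma_finite_measure "Om \<Omega> I :: (nat \<Rightarrow> real^'d) measure" by (rule sigma_finite_Om[OF I(1)])
  interpret O: sigma_finite_measure "omega \<Omega> :: (real^'d) measure" by (rule sigma_finite_omega)
  interpret P: pair_sigma_finite "Om \<Omega> I :: (nat \<Rightarrow> real^'d) measure" "omega \<Omega> :: (real^'d) measure" ..
  interpret product_sigma_finite "\<lambda>_ :: nat. omega \<Omega> :: (real^'d) measure" by (rule product_sigma_finite_omega)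
  have T: "(\<lambda>(x, y). x(i := y)) \<in> Om \<Omega> I \<Otimes>\<^sub>M omega \<Omega> \<rightarrow>\<^sub>M (Om \<Omega> (insert i I) :: (nat \<Rightarrow> real^'d) measure)"
    by (rule measurable_add_dim)
  have "integrable (Om \<Omega> I \<Otimes>\<^sub>M omega \<Omega>) (\<lambda>z. V ((\<lambda>(x, y). x(i := y)) z))"
    by (rule integrable_distr[OF T]) (simp only: distr_Om_insert[OF I] V)
  then have i: "integrable (Om \<Omega> I \<Otimes>\<^sub>M omega \<Omega>) (\<lambda>(x, y). V (x(i := y)))" by (simp add: split_beta')
  show "AE x in Om \<Omega> I. integrable (omega \<Omega>) (\<lambda>y. V (x(i := y)))" using P.AE_integrable_fst'[OF i] by simp
  show "integrable (Om \<Omega> I) (\<lambda>x. \<integral>y. V (x(i := y)) \<partial>omega \<Omega>)" using P.integrable_fst'[OF i] by simp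
  show "(\<integral>x. (\<integral>y. V (x(i := y)) \<partial>omega \<Omega>) \<partial>Om \<Omega> I) = (\<integral>z. V z \<partial>Om \<Omega> (insert i I))"
    by (rule product_integral_insert[OF I V, symmetric])
qed

definition H_integrable :: "domain \<Rightarrow> (real^'d \<Rightarrow> real^'d \<Rightarrow> real^'d) \<Rightarrow> nat \<Rightarrow> ((nat \<Rightarrow> real^'d) \<Rightarrow> real) \<Rightarrow> (nat \<Rightarrow> real^'d) \<Rightarrow> bool" where
  "H_integrable \<Omega> K k F x \<longleftrightarrow> integrable (omega \<Omega>) (\<lambda>y. F (x(star := y)) *\<^sub>R K (x k) y)"

text \<open>The diagonal is a null set of the product measure, so an almost everywhere bound there
  says nothing about \<open>K x x\<close>. The bound on the diagonal is a separate clause, used for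
  the terms with \<open>k = l\<close>.\<close>

locale bounded_interaction =
  fixes \<Omega> :: domain and K :: "real^'d \<Rightarrow> real^'d \<Rightarrow> real^'d" and B :: real
  assumes K_measurable: "(\<lambda>(x, y). K x y) \<in> borel_measurable (omega \<Omega> \<Otimes>\<^sub>M omega \<Omega>)"
    and K_bound: "AE z in omega \<Omega> \<Otimes>\<^sub>M omega \<Omega>. norm (K (fst z) (snd z)) \<le> B"
    and K_diag_bound: "AE x in omega \<Omega>. norm (K x x) \<le> B"
    and B_nonneg: "0 \<le> B"
begin

lemma K_Om_measurable:
  assumes "k \<in> I" "l \<in> I"
  shows "(\<lambda>z. K (z k) (z l)) \<in> borel_measurable (Om \<Omega> I)"
proof -
  have "(\<lambda>z. (z k, z l)) \<in> Om \<Omega> I \<rightarrow>\<^sub>M omega \<Omega> \<Otimes>\<^sub>M omega \<Omega>"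
    using assms by (intro measurable_Pair measurable_component_singleton)
  from measurable_compose[OF this K_measurable] show ?thesis by simp
qed

text \<open>For distinct labels the exceptional set of pairs is pulled back to two coordinates; for
  equal labels it is the diagonal bound that is lifted.\<close>

lemma K_Om_bound:
  assumes I: "finite I" and k: "k \<in> I" "l \<in> I"
  shows "AE z in Om \<Omega> I. norm (K (z k) (z l)) \<le> B"
proof (cases "k = l")
  case True
  have "AE z in Om \<Omega> {k}. norm (K (z k) (z k)) \<le> B"
  proof -
    have m: "(\<lambda>z. z k) \<in> Om \<Omega> {k} \<rightarrow>\<^sub>M (omega \<Omega> :: (real^'d) measure)" by (rule measurable_component_singleton) simp
    show ?thesis
      by (rule AE_distrD[OF m]) (simp only: product_sigma_finite.distr_singleton[OF product_sigma_finite_omega] K_diag_bound)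
  qed
  from AE_Om_restrict[OF I _ this] k True show ?thesis by simp
next
  case False
  define E where "E = {z \<in> space (omega \<Omega> \<Otimes>\<^sub>M omega \<Omega>). B < norm (K (fst z) (snd z))}"
  have [measurable]: "(\<lambda>z. K (fst z) (snd z)) \<in> borel_measurable (omega \<Omega> \<Otimes>\<^sub>M omega \<Omega>)"
    using K_measurable by (simp add: split_beta')
  have E: "E \<in> sets (omega \<Omega> \<Otimes>\<^sub>M omega \<Omega>)" unfolding E_def by measurable
  have "emeasure (omega \<Omega> \<Otimes>\<^sub>M omega \<Omega>) E = 0"
    using K_bound AE_iff_measurable[OF E, of "\<lambda>z. norm (K (fst z) (snd z)) \<le> B"] by (auto simp: E_def not_le)
  then have z: "(\<integral>\<^sup>+z. indicator E z \<partial>(omega \<Omega> \<Otimes>\<^sub>M omega \<Omega>)) = 0" using E by simp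
  have mc: "case_prod (\<lambda>x y. indicator E (x, y) :: ennreal) \<in> borel_measurable (omega \<Omega> \<Otimes>\<^sub>M omega \<Omega>)" using E by simp
  have "(\<integral>\<^sup>+\<sigma>. indicator E (\<sigma> k, \<sigma> l) \<partial>Om \<Omega> {k, l}) = 0"
    using product_sigma_finite.product_nn_integral_pair[OF product_sigma_finite_omega mc False] z by simp
  moreover have "(\<lambda>\<sigma>. indicator E (\<sigma> k, \<sigma> l) :: ennreal) \<in> borel_measurable (Om \<Omega> {k, l})"
  proof -
    have "(\<lambda>z. (z k, z l)) \<in> Om \<Omega> {k, l} \<rightarrow>\<^sub>M omega \<Omega> \<Otimes>\<^sub>M omega \<Omega>"
      by (intro measurable_Pair measurable_component_singleton) auto
    from measurable_compose[OF this mc] show ?thesis by simp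
  qed
  ultimately have "AE \<sigma> in Om \<Omega> {k, l}. (indicator E (\<sigma> k, \<sigma> l) :: ennreal) = 0"
    by (subst (asm) nn_integral_0_iff_AE) auto
  then have "AE \<sigma> in Om \<Omega> {k, l}. norm (K (\<sigma> k) (\<sigma> l)) \<le> B"
    using AE_space
  proof eventually_elim
    case (elim \<sigma>)
    then have "(\<sigma> k, \<sigma> l) \<in> space (omega \<Omega> \<Otimes>\<^sub>M omega \<Omega>)" by (auto simp: space_PiM space_pair_measure)
    then show ?case using elim(1) by (auto simp: E_def indicator_def split: if_splits)
  qed
  from AE_Om_restrict[OF I _ this] k show ?thesis by simp
qed

lemma integrable_mult_K:
  assumes I: "finite I" "k \<in> I" and F: "integrable (Om \<Omega> (insert n I)) F"
  shows "integrable (Om \<Omega> (insert n I)) (\<lambda>z. F z *\<^sub>R K (z k) (z n))"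
    and "(\<integral>z. norm (F z *\<^sub>R K (z k) (z n)) \<partial>Om \<Omega> (insert n I)) \<le> B * (\<integral>z. norm (F z) \<partial>Om \<Omega> (insert n I))"
proof -
  have m: "(\<lambda>z. K (z k) (z n)) \<in> borel_measurable (Om \<Omega> (insert n I))" using I by (intro K_Om_measurable) auto
  have b: "AE z in Om \<Omega> (insert n I). norm (K (z k) (z n)) \<le> B" using I by (intro K_Om_bound) auto
  have b': "AE z in Om \<Omega> (insert n I). norm (F z *\<^sub>R K (z k) (z n)) \<le> B * norm (F z)"
    using b by eventually_elim (simp add: mult.commute[of B] mult_left_mono)
  show i: "integrable (Om \<Omega> (insert n I)) (\<lambda>z. F z *\<^sub>R K (z k) (z n))"
  proof (rule Bochner_Integration.integrable_bound)
    show "integrable (Om \<Omega> (insert n I)) (\<lambda>z. B * norm (F z))" using F by simp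
    show "(\<lambda>z. F z *\<^sub>R K (z k) (z n)) \<in> borel_measurable (Om \<Omega> (insert n I))" using F m by auto
    show "AE z in Om \<Omega> (insert n I). norm (F z *\<^sub>R K (z k) (z n)) \<le> norm (B * norm (F z))"
      using b' by eventually_elim (erule order_trans, simp)
  qed
  have "(\<integral>z. norm (F z *\<^sub>R K (z k) (z n)) \<partial>Om \<Omega> (insert n I)) \<le> (\<integral>z. B * norm (F z) \<partial>Om \<Omega> (insert n I))"
    by (rule integral_mono_AE[OF integrable_norm[OF i] integrable_mult_right[OF integrable_norm[OF F]] b'])
  then show "(\<integral>z. norm (F z *\<^sub>R K (z k) (z n)) \<partial>Om \<Omega> (insert n I)) \<le> B * (\<integral>z. norm (F z) \<partial>Om \<Omega> (insert n I))" by simp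
qed

context
  fixes I :: "nat set" and k :: nat
  assumes I: "finite I" "star \<notin> I" and k: "k \<in> I"
begin

lemma k_ne_star: "k \<noteq> star"
  using I(2) k by metis

lemma H_flux_eq: "H_flux \<Omega> K k F x = (\<integral>y. (\<lambda>z. F z *\<^sub>R K (z k) (z star)) (x(star := y)) \<partial>omega \<Omega>)"
  using k_ne_star by (simp add: H_flux_def)

text \<open>\<open>H_integrable\<close> is recorded along with the bounds because the integral of a
  non-integrable function is 0 by convention, and linearity in the density would fail at such
  points.\<close>

lemma H_flux_L1:
  assumes F: "integrable (Om \<Omega> (insert star I)) F"
  shows "AE x in Om \<Omega> I. H_integrable \<Omega> K k F x"
    and "integrable (Om \<Omega> I) (H_flux \<Omega> K k F)"
    and "(\<integral>x. norm (H_flux \<Omega> K k F x) \<partial>Om \<Omega> I) \<le> B * (\<integral>z. norm (F z) \<partial>Om \<Omega> (insert star I))"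
proof -
  let ?V = "\<lambda>z. F z *\<^sub>R K (z k) (z star)"
  note V = integrable_mult_K[OF I(1) k F]
  note ks = k_ne_star
  show "AE x in Om \<Omega> I. H_integrable \<Omega> K k F x"
    using integrable_Om_insert(1)[OF I V(1)] ks by (simp add: H_integrable_def)
  show i: "integrable (Om \<Omega> I) (H_flux \<Omega> K k F)"
    using integrable_Om_insert(2)[OF I V(1)] unfolding H_flux_eq[abs_def] .
  have nV: "integrable (Om \<Omega> (insert star I)) (\<lambda>z. norm (?V z))" by (rule integrable_norm[OF V(1)])
  have "(\<integral>x. norm (H_flux \<Omega> K k F x) \<partial>Om \<Omega> I) \<le> (\<integral>x. (\<integral>y. (\<lambda>z. norm (?V z)) (x(star := y)) \<partial>omega \<Omega>) \<partial>Om \<Omega> I)"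
  proof (rule integral_mono)
    show "integrable (Om \<Omega> I) (\<lambda>x. norm (H_flux \<Omega> K k F x))" using i by simp
    show "integrable (Om \<Omega> I) (\<lambda>x. \<integral>y. (\<lambda>z. norm (?V z)) (x(star := y)) \<partial>omega \<Omega>)" by (rule integrable_Om_insert(2)[OF I nV])
    show "norm (H_flux \<Omega> K k F x) \<le> (\<integral>y. (\<lambda>z. norm (?V z)) (x(star := y)) \<partial>omega \<Omega>)" for x
      unfolding H_flux_eq by (rule integral_norm_bound)
  qed
  also have "\<dots> = (\<integral>z. norm (?V z) \<partial>Om \<Omega> (insert star I))" by (rule integrable_Om_insert(3)[OF I nV])
  also note V(2)
  finally show "(\<integral>x. norm (H_flux \<Omega> K k F x) \<partial>Om \<Omega> I) \<le> B * (\<integral>z. norm (F z) \<partial>Om \<Omega> (insert star I))" .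
qed

lemma H_flux_diff_L1:
  assumes F: "integrable (Om \<Omega> (insert star I)) F" and F': "integrable (Om \<Omega> (insert star I)) F'"
  shows "(\<integral>x. norm (H_flux \<Omega> K k F x - H_flux \<Omega> K k F' x) \<partial>Om \<Omega> I) \<le> B * (\<integral>z. norm (F z - F' z) \<partial>Om \<Omega> (insert star I))"
proof -
  have D: "integrable (Om \<Omega> (insert star I)) (\<lambda>z. F z - F' z)" by (rule Bochner_Integration.integrable_diff[OF F F'])
  have "(\<integral>x. norm (H_flux \<Omega> K k F x - H_flux \<Omega> K k F' x) \<partial>Om \<Omega> I) = (\<integral>x. norm (H_flux \<Omega> K k (\<lambda>z. F z - F' z) x) \<partial>Om \<Omega> I)"
  proof (rule integral_cong_AE)
    note m = H_flux_L1(2)[THEN borel_measurable_integrable]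
    show "(\<lambda>x. norm (H_flux \<Omega> K k F x - H_flux \<Omega> K k F' x)) \<in> borel_measurable (Om \<Omega> I)"
      using m[OF F] m[OF F'] by measurable
    show "(\<lambda>x. norm (H_flux \<Omega> K k (\<lambda>z. F z - F' z) x)) \<in> borel_measurable (Om \<Omega> I)"
      using m[OF D] by measurable
    show "AE x in Om \<Omega> I. norm (H_flux \<Omega> K k F x - H_flux \<Omega> K k F' x) = norm (H_flux \<Omega> K k (\<lambda>z. F z - F' z) x)"
      using H_flux_L1(1)[OF F] H_flux_L1(1)[OF F']
      by eventually_elim (simp add: H_flux_def H_integrable_def scaleR_diff_left)
  qed
  also note H_flux_L1(3)[OF D]
  finally show ?thesis .
qed

lemma cont_L1_H_flux:
  assumes F: "cont_L1 (Om \<Omega> (insert star I)) F"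
  shows "cont_L1 (Om \<Omega> I) (\<lambda>t. H_flux \<Omega> K k (F t))"
  by (rule cont_L1_compare[OF F, where B = B]) (intro H_flux_L1(2) H_flux_diff_L1 cont_L1_integrable[OF F]; assumption)+

lemma H_flux_cong_AE:
  assumes F: "integrable (Om \<Omega> (insert star I)) F" and F': "integrable (Om \<Omega> (insert star I)) F'"
    and ae: "AE z in Om \<Omega> (insert star I). F z = F' z"
  shows "AE x in Om \<Omega> I. H_flux \<Omega> K k F x = H_flux \<Omega> K k F' x"
  using AE_Om_insert[OF I ae] H_flux_L1(1)[OF F] H_flux_L1(1)[OF F']
proof eventually_elim
  case (elim x)
  show ?case unfolding H_flux_def
  proof (rule integral_cong_AE)
    show "AE y in omega \<Omega>. F (x(star := y)) *\<^sub>R K (x k) y = F' (x(star := y)) *\<^sub>R K (x k) y"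
      using elim(1) by eventually_elim simp
  qed (use elim in \<open>auto simp: H_integrable_def\<close>)
qed

end

lemma cont_L1_S_flux:
  assumes I: "finite I" "k \<in> I" "l \<in> I" and F: "cont_L1 (Om \<Omega> I) F"
  shows "cont_L1 (Om \<Omega> I) (\<lambda>t x. F t x *\<^sub>R K (x k) (x l))"
proof (rule cont_L1_bounded_image[OF F _ K_Om_bound[OF I]])
  show "(\<lambda>x. F t x *\<^sub>R K (x k) (x l)) \<in> borel_measurable (Om \<Omega> I)" if "0 \<le> t" for t
    using cont_L1_integrable[OF F that] K_Om_measurable[OF I(2,3)] by auto
qed

end

text \<open>Both essential suprema are below their finite sum, which serves as the common
  bound.\<close>

lemma Linf_delta_bounded_interaction:
  assumes "Linf_delta \<Omega> K"
  shows "\<exists>B. bounded_interaction \<Omega> K B"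
proof -
  define b where "b = Linf_delta_norm \<Omega> K"
  have b: "b < \<infinity>" and m: "(\<lambda>(x, y). K x y) \<in> borel_measurable (omega \<Omega> \<Otimes>\<^sub>M omega \<Omega>)"
    using assms by (auto simp: Linf_delta_def b_def)
  have le: "norm v \<le> enn2real b" if "ennreal (norm v) \<le> b" for v :: "real^'a"
    using that b by (metis enn2real_ennreal enn2real_mono infinity_ennreal_def norm_ge_zero)
  show ?thesis
  proof (intro exI[of _ "enn2real b"] bounded_interaction.intro m)
    have "AE z in omega \<Omega> \<Otimes>\<^sub>M omega \<Omega>. (\<lambda>(x, y). ennreal (norm (K x y))) z \<le> esssup (omega \<Omega> \<Otimes>\<^sub>M omega \<Omega>) (\<lambda>(x, y). ennreal (norm (K x y)))"
      by (rule esssup_AE)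
    then show "AE z in omega \<Omega> \<Otimes>\<^sub>M omega \<Omega>. norm (K (fst z) (snd z)) \<le> enn2real b"
    proof eventually_elim
      case (elim z)
      have "esssup (omega \<Omega> \<Otimes>\<^sub>M omega \<Omega>) (\<lambda>(x, y). ennreal (norm (K x y))) \<le> b"
        unfolding b_def Linf_delta_norm_def by (rule add_increasing2[OF zero_le order_refl])
      from order_trans[OF elim this] show ?case by (intro le) (simp add: split_beta')
    qed
    have "AE x in omega \<Omega>. ennreal (norm (K x x)) \<le> esssup (omega \<Omega>) (\<lambda>x. ennreal (norm (K x x)))"
      by (rule esssup_AE)
    then show "AE x in omega \<Omega>. norm (K x x) \<le> enn2real b"
    proof eventually_elim
      case (elim x)
      have "esssup (omega \<Omega>) (\<lambda>x. ennreal (norm (K x x))) \<le> b"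
        unfolding b_def Linf_delta_norm_def by (rule add_increasing[OF zero_le order_refl])
      from order_trans[OF elim this] show ?case by (rule le)
    qed
  qed simp
qed

subsection \<open>The hierarchy as a power series identity\<close>

definition enum :: "nat set \<Rightarrow> nat \<Rightarrow> nat" where
  "enum P n = sorted_list_of_set P ! (n - 1)"

lemma bij_enum:
  assumes "finite P"
  shows "bij_betw (enum P) {1..card P} P"
proof -
  have "bij_betw (\<lambda>n. sorted_list_of_set P ! n) {..<card P} P"
    using assms by (intro bij_betw_nth) auto
  moreover have "bij_betw (\<lambda>n. n - 1) {1..card P} {..<card P}"
    by (rule bij_betwI[where g = Suc]) auto
  ultimately have "bij_betw ((\<lambda>n. sorted_list_of_set P ! n) \<circ> (\<lambda>n. n - 1)) {1..card P} P"
    by (rule bij_betw_trans[rotated])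
  then show ?thesis by (simp add: enum_def[abs_def] comp_def)
qed

lemma block_eq: "P \<noteq> {} \<Longrightarrow> block g i P t x = g i (card P) t (reindex {1..card P} (enum P) x)"
  by (simp add: block_def enum_def)

lemma block_cong:
  assumes "finite P" "\<And>p. p \<in> P \<Longrightarrow> x p = y p"
  shows "block g i P t x = block g i P t y"
proof (cases "P = {}")
  case False
  have "reindex {1..card P} (enum P) x = reindex {1..card P} (enum P) y"
    using bij_betwE[OF bij_enum[OF assms(1)]] assms(2) by (intro restrict_ext) auto
  then show ?thesis by (simp only: block_eq[OF False])
qed (simp add: block_def)

lemma block_restrict: "finite P \<Longrightarrow> P \<subseteq> J \<Longrightarrow> block g i P t (restrict x J) = block g i P t x"
  by (rule block_cong) auto

lemma enum_image:
  assumes P: "finite P" and e: "strict_mono_on P e" and n: "n \<in> {1..card P}"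
  shows "enum (e ` P) n = e (enum P n)"
proof -
  have inj: "inj_on e P" by (rule strict_mono_on_imp_inj_on[OF e])
  have "sorted_list_of_set (e ` P) = map e (sorted_list_of_set P)"
  proof (rule sorted_list_of_set_unique[OF finite_imageI[OF P], THEN iffD1], intro conjI)
    show "sorted_wrt (<) (map e (sorted_list_of_set P))"
      unfolding sorted_wrt_map
      by (rule sorted_wrt_mono_rel[OF _ strict_sorted_list_of_set])
        (use P e in \<open>auto simp: strict_mono_on_def\<close>)
  qed (use P inj in \<open>auto simp: card_image\<close>)
  moreover have "n - 1 < length (sorted_list_of_set P)" using n P by auto
  ultimately show ?thesis by (simp add: enum_def)
qed

text \<open>Labels enter a block in increasing order, so a strictly increasing relabelling is
  respected at every point and not merely almost everywhere.\<close>

lemma block_image: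
  assumes P: "finite P" and e: "strict_mono_on P e"
  shows "block g i (e ` P) t z = block g i P t (\<lambda>n. z (e n))"
proof (cases "P = {}")
  case False
  have "card (e ` P) = card P" by (rule card_image[OF strict_mono_on_imp_inj_on[OF e]])
  moreover have "reindex {1..card P} (enum (e ` P)) z = reindex {1..card P} (enum P) (\<lambda>n. z (e n))"
    by (intro restrict_ext) (simp add: enum_image[OF P e])
  ultimately show ?thesis using False by (simp add: block_eq)
qed (simp add: block_def)

lemma sum_Pow_image: "inj_on e U \<Longrightarrow> (\<Sum>W\<in>Pow (e ` U). F W) = (\<Sum>W\<in>Pow U. F (e ` W))"
  by (simp add: image_Pow_surj[OF refl, symmetric] sum.reindex inj_on_image_Pow)

text \<open>An injective relabelling that fixes \<open>star\<close> preserves cardinalities and set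
  differences. This lets the equation on \<open>{1..j}\<close> be read as an equation for an
  arbitrary block.\<close>

lemma H_density_image:
  assumes P: "finite P" "k \<in> P" "star \<notin> P" and inj: "inj_on e (insert star P)" and e0: "e star = star"
  shows "H_density \<gamma> X (e ` P) (e k) = H_density (\<lambda>Q. \<gamma> (e ` Q)) X P k"
proof -
  define U where "U = P - {k}"
  have k0: "k \<noteq> star" using P(2,3) by metis
  have U: "P = insert k U" "k \<notin> U" "finite U" "star \<notin> U" "k \<noteq> star" using P k0 by (auto simp: U_def)
  have iU: "inj_on e U" by (rule inj_on_subset[OF inj]) (auto simp: U(1))
  have U': "e k \<notin> e ` U" "star \<notin> e ` U" "e k \<noteq> star"
    using inj U e0 unfolding inj_on_def by (metis imageE insertI1 insertI2)+
  have d: "e ` (A - W) = e ` A - e ` W" if "W \<subseteq> A" "A \<subseteq> U" for A W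
    by (rule inj_on_image_set_diff[OF iU]) (use that in auto)
  have c: "card (e ` W) = card W" if "W \<subseteq> U" for W by (rule card_image[OF inj_on_subset[OF iU that]])
  have i: "inj_on e W" if "W \<subseteq> U" for W by (rule inj_on_subset[OF iU that])
  have 1: "(\<Sum>W\<in>Pow (e ` U). \<gamma> (insert (e k) W) * \<gamma> (insert star (e ` U - W))) = (\<Sum>W\<in>Pow U. \<gamma> (e ` insert k W) * \<gamma> (e ` insert star (U - W)))"
    unfolding sum_Pow_image[OF iU] by (intro sum.cong refl) (simp add: d e0)
  have 2: "(\<Sum>W\<in>Pow (e ` U). of_nat (card (e ` U - W)) * (\<gamma> (insert (e k) (insert star W)) * \<gamma> (e ` U - W)))
     = (\<Sum>W\<in>Pow U. of_nat (card (U - W)) * (\<gamma> (e ` insert k (insert star W)) * \<gamma> (e ` (U - W))))"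
    unfolding sum_Pow_image[OF iU] by (intro sum.cong refl) (simp add: d e0 c flip: d)
  have 3: "(\<Sum>W\<in>Pow (e ` U). \<Sum>R\<in>Pow (e ` U - W). of_nat (card (e ` U - W - R)) * (\<gamma> (insert (e k) W) * \<gamma> (insert star R) * \<gamma> (e ` U - W - R)))
     = (\<Sum>W\<in>Pow U. \<Sum>R\<in>Pow (U - W). of_nat (card (U - W - R)) * (\<gamma> (e ` insert k W) * \<gamma> (e ` insert star R) * \<gamma> (e ` (U - W - R))))"
    unfolding sum_Pow_image[OF iU]
  proof (rule sum.cong[OF refl])
    fix W assume W: "W \<in> Pow U"
    have dW: "e ` U - e ` W = e ` (U - W)" using d[of W U] W by auto
    have iW: "inj_on e (U - W)" by (rule i) auto
    show "(\<Sum>R\<in>Pow (e ` U - e ` W). of_nat (card (e ` U - e ` W - R)) * (\<gamma> (insert (e k) (e ` W)) * \<gamma> (insert star R) * \<gamma> (e ` U - e ` W - R)))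
      = (\<Sum>R\<in>Pow (U - W). of_nat (card (U - W - R)) * (\<gamma> (e ` insert k W) * \<gamma> (e ` insert star R) * \<gamma> (e ` (U - W - R))))"
      unfolding dW sum_Pow_image[OF iW]
    proof (intro sum.cong refl)
      fix R assume R: "R \<in> Pow (U - W)"
      have dR: "e ` (U - W) - e ` R = e ` (U - W - R)" using d[of R "U - W"] R by auto
      have cR: "card (e ` (U - W - R)) = card (U - W - R)" by (rule c) auto
      show "of_nat (card (e ` (U - W) - e ` R)) * (\<gamma> (insert (e k) (e ` W)) * \<gamma> (insert star (e ` R)) * \<gamma> (e ` (U - W) - e ` R))
        = of_nat (card (U - W - R)) * (\<gamma> (e ` insert k W) * \<gamma> (e ` insert star R) * \<gamma> (e ` (U - W - R)))"
        unfolding dR cR by (simp add: e0)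
    qed
  qed
  have 4: "insert (e k) (insert star (e ` U)) = e ` insert k (insert star U)" by (simp add: e0)
  have fU: "finite (e ` U)" using U(3) by simp
  have cU: "card (e ` U) = card U" by (rule c) simp
  show ?thesis
    unfolding U(1) image_insert H_density_insert[OF fU U'] H_density_insert[OF U(3,2,4,5)]
    unfolding 1 2 3 4 cU image_insert ..
qed

lemma S_density_image:
  assumes P: "k \<in> P" "l \<in> P" and inj: "inj_on e P"
  shows "S_density \<gamma> X (e ` P) (e k) (e l) = S_density (\<lambda>Q. \<gamma> (e ` Q)) X P k l"
proof -
  have d: "e ` P - {e k, e l} = e ` (P - {k, l})"
    using P inj by (subst inj_on_image_set_diff[OF inj]) auto
  have i: "inj_on e (P - {k, l})" by (rule inj_on_subset[OF inj]) auto
  have kl: "e l = e k \<longleftrightarrow> l = k" using inj P by (auto simp: inj_on_def)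
  have "(\<Sum>W\<in>Pow (e ` P - {e k, e l}). \<gamma> (W \<union> {e k}) * \<gamma> (e ` P - {e k} - W)) = (\<Sum>W\<in>Pow (P - {k, l}). \<gamma> (e ` (W \<union> {k})) * \<gamma> (e ` (P - {k} - W)))"
    unfolding d sum_Pow_image[OF i]
  proof (intro sum.cong refl)
    fix W assume W: "W \<in> Pow (P - {k, l})"
    have "e ` (P - {k} - W) = e ` P - {e k} - e ` W"
    proof -
      have "e ` (P - ({k} \<union> W)) = e ` P - e ` ({k} \<union> W)"
        by (rule inj_on_image_set_diff[OF inj]) (use P W in auto)
      then show ?thesis by (auto simp: set_diff_eq)
    qed
    then show "\<gamma> (e ` W \<union> {e k}) * \<gamma> (e ` P - {e k} - e ` W) = \<gamma> (e ` (W \<union> {k})) * \<gamma> (e ` (P - {k} - W))" by (simp add: image_Un)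
  qed
  then show ?thesis unfolding S_density_def kl by simp
qed

text \<open>The power series are formed at each point \<open>z\<close> separately, before the
  integral over the variable \<open>star\<close> is taken.\<close>

definition hdens :: "(nat \<Rightarrow> nat set \<Rightarrow> 'z \<Rightarrow> real) \<Rightarrow> nat \<Rightarrow> nat set \<Rightarrow> nat \<Rightarrow> 'z \<Rightarrow> real" where
  "hdens \<gamma> i P k z = fps_nth (H_density (\<lambda>Q. Abs_fps (\<lambda>m. \<gamma> m Q z)) fps_X P k) i"

definition sdens :: "(nat \<Rightarrow> nat set \<Rightarrow> 'z \<Rightarrow> real) \<Rightarrow> nat \<Rightarrow> nat set \<Rightarrow> nat \<Rightarrow> nat \<Rightarrow> 'z \<Rightarrow> real" where
  "sdens \<gamma> i P k l z = fps_nth (S_density (\<lambda>Q. Abs_fps (\<lambda>m. \<gamma> m Q z)) fps_X P k l) i"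

lemma hdens_0:
  "hdens \<gamma> 0 P k z = - \<gamma> 0 (P \<union> {star}) z - (\<Sum>W\<in>Pow (P - {k}). \<gamma> 0 (W \<union> {k}) z * \<gamma> 0 (P \<union> {star} - W - {k}) z)"
  by (simp add: hdens_def H_density_def fps_sum_nth fps_mult_nth)

lemma fps_nth_of_nat_mult: "fps_nth (of_nat c * f) n = of_nat c * fps_nth f n" for f :: "real fps"
  by (simp only: fps_of_nat[symmetric] fps_mult_left_const_nth)

lemma fps_nth_of_int_mult: "fps_nth (of_int c * f) n = of_int c * fps_nth f n" for f :: "real fps"
  by (simp only: fps_of_int[symmetric] fps_mult_left_const_nth)

lemma fps_nth_Suc_X_mult: "fps_nth (fps_X * f) (Suc n) = fps_nth f n" for f :: "real fps"
  by simp

lemma hdens_Suc: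
  "hdens \<gamma> (Suc i) P k z =
     - \<gamma> (Suc i) (P \<union> {star}) z
     - (\<Sum>W\<in>Pow (P - {k}). \<Sum>m\<in>{0..Suc i}. \<gamma> m (W \<union> {k}) z * \<gamma> (Suc i - m) (P \<union> {star} - W - {k}) z)
     + (real (card P) * \<gamma> i (P \<union> {star}) z
        + (\<Sum>W\<in>Pow (P - {k}). (real (card P) - 1 - real (card W)) * (\<Sum>m\<in>{0..i}. \<gamma> m (W \<union> {k, star}) z * \<gamma> (i - m) (P - {k} - W) z))
        + real (card P) * (\<Sum>W\<in>Pow (P - {k}). \<Sum>m\<in>{0..i}. \<gamma> m (W \<union> {k}) z * \<gamma> (i - m) (P \<union> {star} - W - {k}) z)
        + (\<Sum>W\<in>Pow (P - {k}). \<Sum>R\<in>Pow (P - {k} - W). (real (card P) - 1 - real (card W) - real (card R)) *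
             (\<Sum>m\<in>{0..i}. \<Sum>n\<in>{0..i - m}. \<gamma> m (W \<union> {k}) z * \<gamma> n (R \<union> {star}) z * \<gamma> (i - m - n) (P - R - W - {k}) z)))"
proof -
  have c: "real_of_int (int a - 1 - int b) = real a - 1 - real b" "real_of_int (int a - 1 - int b - int c) = real a - 1 - real b - real c" for a b c
    by simp_all
  show ?thesis
    unfolding hdens_def H_density_def fps_add_nth fps_sub_nth fps_neg_nth fps_nth_Suc_X_mult fps_sum_nth
      fps_nth_of_nat_mult fps_nth_of_int_mult c
    unfolding mult.assoc fps_mult_nth fps_nth_Abs_fps sum_distrib_left ..
qed

lemma sdens_0: "sdens \<gamma> 0 P k l z = 0"
  by (simp add: sdens_def S_density_def)

lemma sdens_Suc:
  "sdens \<gamma> (Suc i) P k l z = - (\<gamma> i P z + (if l = k then 0 else \<Sum>W\<in>Pow (P - {k, l}). \<Sum>m\<in>{0..i}. \<gamma> m (W \<union> {k}) z * \<gamma> (i - m) (P - {k} - W) z))"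
proof -
  have "fps_nth (- fps_X * f) (Suc i) = - fps_nth f i" for f :: "real fps" by simp
  then show ?thesis
    unfolding sdens_def S_density_def by (simp add: fps_sum_nth fps_mult_nth[of "Abs_fps _"])
qed

text \<open>Integrability and the value of the flux are carried together, so that linearity can be
  followed through a long sum without a separate integrability argument for each partial
  sum.\<close>

definition H_value :: "domain \<Rightarrow> (real^'d \<Rightarrow> real^'d \<Rightarrow> real^'d) \<Rightarrow> nat \<Rightarrow> (nat \<Rightarrow> real^'d) \<Rightarrow> ((nat \<Rightarrow> real^'d) \<Rightarrow> real) \<Rightarrow> real^'d \<Rightarrow> bool" where
  "H_value \<Omega> K k x F v \<longleftrightarrow> has_bochner_integral (omega \<Omega>) (\<lambda>y. F (x(star := y)) *\<^sub>R K (x k) y) v"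

lemma H_value_base: "H_integrable \<Omega> K k F x \<Longrightarrow> H_value \<Omega> K k x F (H_flux \<Omega> K k F x)"
  by (simp add: H_value_def H_integrable_def H_flux_def has_bochner_integral_integrable)

lemma H_value_iff: "H_value \<Omega> K k x F v \<longleftrightarrow> H_integrable \<Omega> K k F x \<and> H_flux \<Omega> K k F x = v"
  by (auto simp: H_value_def H_integrable_def H_flux_def has_bochner_integral_iff)

lemma H_value_add: "H_value \<Omega> K k x F v \<Longrightarrow> H_value \<Omega> K k x G w \<Longrightarrow> H_value \<Omega> K k x (\<lambda>z. F z + G z) (v + w)"
  unfolding H_value_def scaleR_add_left by (rule has_bochner_integral_add)

lemma H_value_diff: "H_value \<Omega> K k x F v \<Longrightarrow> H_value \<Omega> K k x G w \<Longrightarrow> H_value \<Omega> K k x (\<lambda>z. F z - G z) (v - w)"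
  unfolding H_value_def scaleR_diff_left by (rule has_bochner_integral_diff)

lemma H_value_minus: "H_value \<Omega> K k x F v \<Longrightarrow> H_value \<Omega> K k x (\<lambda>z. - F z) (- v)"
  unfolding H_value_def scaleR_minus_left by (rule has_bochner_integral_minus)

lemma H_value_cmult: "H_value \<Omega> K k x F v \<Longrightarrow> H_value \<Omega> K k x (\<lambda>z. c * F z) (c *\<^sub>R v)"
  unfolding H_value_def scaleR_scaleR[symmetric] by (rule has_bochner_integral_scaleR_right) simp

lemma H_value_sum: "(\<And>a. a \<in> A \<Longrightarrow> H_value \<Omega> K k x (F a) (v a)) \<Longrightarrow> H_value \<Omega> K k x (\<lambda>z. \<Sum>a\<in>A. F a z) (\<Sum>a\<in>A. v a)"
  unfolding H_value_def scaleR_sum_left by (rule has_bochner_integral_sum)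

lemma H_flux_eq_0:
  assumes "AE y in omega \<Omega>. F (x(star := y)) = 0" shows "H_flux \<Omega> K k F x = 0"
  unfolding H_flux_def by (rule integral_eq_zero_AE) (use assms in eventually_elim, simp)

text \<open>The clauses of \<open>regular_point\<close> hold for almost every \<open>x\<close>; they make the flux linear in the density.\<close>

definition regular_point where
  "regular_point \<Omega> K \<gamma> P k x \<longleftrightarrow>
    (\<forall>m. H_integrable \<Omega> K k (\<gamma> m (insert star P)) x) \<and>
    (\<forall>m n Q R. Q \<union> R = insert star P \<longrightarrow> Q \<inter> R = {} \<longrightarrow> H_integrable \<Omega> K k (\<lambda>z. \<gamma> m Q z * \<gamma> n R z) x) \<and>
    (\<forall>m n l Q R S. Q \<union> R \<union> S = insert star P \<longrightarrow> Q \<inter> R = {} \<longrightarrow> (Q \<union> R) \<inter> S = {} \<longrightarrow> H_integrable \<Omega> K k (\<lambda>z. \<gamma> m Q z * \<gamma> n R z * \<gamma> l S z) x) \<and>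
    (\<forall>Q\<subseteq>insert star P. 2 \<le> card Q \<longrightarrow> (AE y in omega \<Omega>. \<gamma> 0 Q (x(star := y)) = 0))"

text \<open>The two sides differ in the range of \<open>m\<close>: the density has
  \<open>{0..i}\<close>, the hierarchy has \<open>{1..i - 1}\<close> and the two linearised terms.
  Blocks of order 0 with at least two labels vanish, so \<open>m = 0\<close> leaves only
  \<open>W = {}\<close> and \<open>m = i\<close> only the second block \<open>{star}\<close>; these
  are precisely the linearised terms.\<close>

lemma hierarchy_flux_density:
  assumes reg: "regular_point \<Omega> K \<gamma> {1..j} k x" and k: "k \<in> {1..j}"
  shows "hierarchy_flux \<Omega> K \<gamma> i j k x
    = H_flux \<Omega> K k (hdens \<gamma> i {1..j} k) x + (\<Sum>l\<in>{1..j}. sdens \<gamma> i {1..j} k l x *\<^sub>R K (x k) (x l))"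
proof -
  let ?P = "{1..j}" and ?J = "{1..j} - {k}"
  let ?H = "\<lambda>F. H_flux \<Omega> K k F x"
  have un: "?P \<union> {star} = insert star ?P" by auto
  have b1: "H_value \<Omega> K k x (\<gamma> m (?P \<union> {star})) (?H (\<gamma> m (?P \<union> {star})))" for m
    using reg unfolding un by (intro H_value_base) (auto simp: regular_point_def)
  have b2: "H_value \<Omega> K k x (\<lambda>z. \<gamma> m Q z * \<gamma> n R z) (?H (\<lambda>z. \<gamma> m Q z * \<gamma> n R z))" if "Q \<union> R = insert star ?P" "Q \<inter> R = {}" for m n Q R
    using reg that by (intro H_value_base) (auto simp: regular_point_def)
  have b3: "H_value \<Omega> K k x (\<lambda>z. \<gamma> m Q z * \<gamma> n R z * \<gamma> l S z) (?H (\<lambda>z. \<gamma> m Q z * \<gamma> n R z * \<gamma> l S z))"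
    if "Q \<union> R \<union> S = insert star ?P" "Q \<inter> R = {}" "(Q \<union> R) \<inter> S = {}" for m n l Q R S
    using reg that by (intro H_value_base) (auto simp: regular_point_def)
  have k0: "k \<noteq> star" using k by auto
  have p2: "H_value \<Omega> K k x (\<lambda>z. \<gamma> m (W \<union> {k}) z * \<gamma> n (?P \<union> {star} - W - {k}) z) (?H (\<lambda>z. \<gamma> m (W \<union> {k}) z * \<gamma> n (?P \<union> {star} - W - {k}) z))" if "W \<in> Pow ?J" for W m n
    by (rule b2) (use that k in auto)
  have p3: "H_value \<Omega> K k x (\<lambda>z. \<gamma> m (W \<union> {k, star}) z * \<gamma> n (?P - {k} - W) z) (?H (\<lambda>z. \<gamma> m (W \<union> {k, star}) z * \<gamma> n (?P - {k} - W) z))" if "W \<in> Pow ?J" for W m n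
    by (rule b2) (use that k in auto)
  have p4: "H_value \<Omega> K k x (\<lambda>z. \<gamma> m (W \<union> {k}) z * \<gamma> n (R \<union> {star}) z * \<gamma> l (?P - R - W - {k}) z) (?H (\<lambda>z. \<gamma> m (W \<union> {k}) z * \<gamma> n (R \<union> {star}) z * \<gamma> l (?P - R - W - {k}) z))"
    if "W \<in> Pow ?J" "R \<in> Pow (?J - W)" for W R m n l
    by (rule b3) (use that k in auto)
  show ?thesis
  proof (cases i)
    case 0
    have "H_value \<Omega> K k x (hdens \<gamma> 0 ?P k) (- ?H (\<gamma> 0 (?P \<union> {star})) - (\<Sum>W\<in>Pow ?J. ?H (\<lambda>z. \<gamma> 0 (W \<union> {k}) z * \<gamma> 0 (?P \<union> {star} - W - {k}) z)))"
      unfolding hdens_0[abs_def] by (intro H_value_diff H_value_minus H_value_sum b1 p2)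
    then show ?thesis by (simp add: 0 H_value_iff sdens_0)
  next
    case (Suc i')
    let ?h = "\<lambda>W m. ?H (\<lambda>z. \<gamma> m (W \<union> {k}) z * \<gamma> (Suc i' - m) (?P \<union> {star} - W - {k}) z)"
    have V: "H_value \<Omega> K k x (hdens \<gamma> (Suc i') ?P k) (- ?H (\<gamma> (Suc i') (?P \<union> {star})) - (\<Sum>W\<in>Pow ?J. \<Sum>m\<in>{0..Suc i'}. ?h W m)
       + (real (card ?P) *\<^sub>R ?H (\<gamma> i' (?P \<union> {star}))
        + (\<Sum>W\<in>Pow ?J. (real (card ?P) - 1 - real (card W)) *\<^sub>R (\<Sum>m\<in>{0..i'}. ?H (\<lambda>z. \<gamma> m (W \<union> {k, star}) z * \<gamma> (i' - m) (?P - {k} - W) z)))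
        + real (card ?P) *\<^sub>R (\<Sum>W\<in>Pow ?J. \<Sum>m\<in>{0..i'}. ?H (\<lambda>z. \<gamma> m (W \<union> {k}) z * \<gamma> (i' - m) (?P \<union> {star} - W - {k}) z))
        + (\<Sum>W\<in>Pow ?J. \<Sum>R\<in>Pow (?J - W). (real (card ?P) - 1 - real (card W) - real (card R)) *\<^sub>R
             (\<Sum>m\<in>{0..i'}. \<Sum>n\<in>{0..i' - m}. ?H (\<lambda>z. \<gamma> m (W \<union> {k}) z * \<gamma> n (R \<union> {star}) z * \<gamma> (i' - m - n) (?P - R - W - {k}) z)))))"
      unfolding hdens_Suc[abs_def] by (intro H_value_add H_value_diff H_value_minus H_value_sum H_value_cmult b1 p2 p3 p4)
    have z0: "?h W 0 = 0" if W: "W \<in> Pow ?J" "W \<noteq> {}" for W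
    proof (rule H_flux_eq_0)
      have fW: "finite W" using W finite_subset[of W ?J] by auto
      have "card (W \<union> {k}) = card W + 1" using W fW by (subst card_Un_disjoint) auto
      moreover have "card W \<noteq> 0" using W fW by simp
      ultimately have "2 \<le> card (W \<union> {k})" by simp
      moreover have "W \<union> {k} \<subseteq> insert star ?P" using W k by auto
      ultimately have "AE y in omega \<Omega>. \<gamma> 0 (W \<union> {k}) (x(star := y)) = 0" using reg unfolding regular_point_def by blast
      then show "AE y in omega \<Omega>. \<gamma> 0 (W \<union> {k}) (x(star := y)) * \<gamma> (Suc i' - 0) (?P \<union> {star} - W - {k}) (x(star := y)) = 0"
        by eventually_elim simp
    qed
    have z1: "?h W (Suc i') = 0" if W: "W \<in> Pow ?J" "W \<noteq> ?J" for W
    proof (rule H_flux_eq_0)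
      \<comment> \<open>A label left out of \<open>W\<close> joins \<open>star\<close> in the second
        block, which has order 0 and then at least two labels.\<close>
      obtain l where l: "l \<in> ?J" "l \<notin> W" using W by blast
      have s: "{star, l} \<subseteq> ?P \<union> {star} - W - {k}" using l W k0 by auto
      have "card {star, l} \<le> card (?P \<union> {star} - W - {k})" by (rule card_mono[OF _ s]) auto
      moreover have "card {star, l} = 2" using l by auto
      ultimately have "2 \<le> card (?P \<union> {star} - W - {k})" by simp
      moreover have "?P \<union> {star} - W - {k} \<subseteq> insert star ?P" by auto
      ultimately have "AE y in omega \<Omega>. \<gamma> 0 (?P \<union> {star} - W - {k}) (x(star := y)) = 0" using reg unfolding regular_point_def by blast
      then show "AE y in omega \<Omega>. \<gamma> (Suc i') (W \<union> {k}) (x(star := y)) * \<gamma> (Suc i' - Suc i') (?P \<union> {star} - W - {k}) (x(star := y)) = 0"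
        by eventually_elim simp
    qed
    have split: "(\<Sum>m\<in>{0..Suc i'}. ?h W m) = ?h W 0 + ?h W (Suc i') + (\<Sum>m\<in>{1..i'}. ?h W m)" for W
    proof -
      have "{0..Suc i'} = insert 0 (insert (Suc i') {1..i'})" by auto
      then show ?thesis by (simp add: add.assoc)
    qed
    have "(\<Sum>W\<in>Pow ?J. ?h W 0) = (\<Sum>W\<in>{{}}. ?h W 0)"
      by (rule sum.mono_neutral_right) (use z0 in auto)
    moreover have "(\<Sum>W\<in>Pow ?J. ?h W (Suc i')) = (\<Sum>W\<in>{?J}. ?h W (Suc i'))"
      by (rule sum.mono_neutral_right) (use z1 in auto)
    ultimately have s2: "(\<Sum>W\<in>Pow ?J. \<Sum>m\<in>{0..Suc i'}. ?h W m) = ?h {} 0 + ?h ?J (Suc i') + (\<Sum>W\<in>Pow ?J. \<Sum>m\<in>{1..i'}. ?h W m)"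
      unfolding split sum.distrib by simp
    have sets: "{} \<union> {k} = {k}" "?P \<union> {star} - {} - {k} = ?P \<union> {star} - {k}" "?J \<union> {k} = ?P" "?P \<union> {star} - ?J - {k} = {star}"
      using k k0 by auto
    have e1: "?h {} 0 = ?H (\<lambda>z. \<gamma> 0 {k} z * \<gamma> (Suc i') (?P \<union> {star} - {k}) z)"
      unfolding sets by simp
    have e2: "?h ?J (Suc i') = ?H (\<lambda>z. \<gamma> (Suc i') ?P z * \<gamma> 0 {star} z)"
      unfolding sets by simp
    have S: "(\<Sum>l\<in>?P. sdens \<gamma> (Suc i') ?P k l x *\<^sub>R K (x k) (x l)) =
        - (\<Sum>l\<in>?P. S_flux K k l (\<gamma> i' ?P) x) - (\<Sum>l\<in>?J. \<Sum>W\<in>Pow (?P - {k, l}). \<Sum>m\<in>{0..i'}. S_flux K k l (\<lambda>z. \<gamma> m (W \<union> {k}) z * \<gamma> (i' - m) (?P - {k} - W) z) x)"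
    proof -
      let ?s = "\<lambda>l. \<Sum>W\<in>Pow (?P - {k, l}). \<Sum>m\<in>{0..i'}. \<gamma> m (W \<union> {k}) x * \<gamma> (i' - m) (?P - {k} - W) x"
      have "(\<Sum>l\<in>?P. sdens \<gamma> (Suc i') ?P k l x *\<^sub>R K (x k) (x l)) = (\<Sum>l\<in>?P. - S_flux K k l (\<gamma> i' ?P) x - (if l = k then 0 else ?s l *\<^sub>R K (x k) (x l)))"
        by (intro sum.cong refl) (simp add: sdens_Suc S_flux_def scaleR_add_left scaleR_diff_left)
      also have "\<dots> = - (\<Sum>l\<in>?P. S_flux K k l (\<gamma> i' ?P) x) - (\<Sum>l\<in>?P. if l = k then 0 else ?s l *\<^sub>R K (x k) (x l))"
        by (simp add: sum_subtractf sum_negf)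
      also have "(\<Sum>l\<in>?P. if l = k then 0 else ?s l *\<^sub>R K (x k) (x l)) = (\<Sum>l\<in>?J. if l = k then 0 else ?s l *\<^sub>R K (x k) (x l))"
        by (rule sum.mono_neutral_right) auto
      also have "\<dots> = (\<Sum>l\<in>?J. \<Sum>W\<in>Pow (?P - {k, l}). \<Sum>m\<in>{0..i'}. S_flux K k l (\<lambda>z. \<gamma> m (W \<union> {k}) z * \<gamma> (i' - m) (?P - {k} - W) z) x)"
        by (intro sum.cong refl) (simp add: S_flux_def scaleR_sum_left)
      finally show ?thesis .
    qed
    have c: "real (card ?P) = real j" by simp
    have i1: "Suc i' - 1 = i'" by simp
    show ?thesis
      using V unfolding Suc H_value_iff S s2 e1 e2 c hierarchy_flux.simps Let_def i1 by (simp add: algebra_simps)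
  qed
qed

lemma H_density_cong:
  assumes k: "k \<in> P" and eq: "\<And>Q. Q \<subseteq> insert star P \<Longrightarrow> \<gamma> Q = \<gamma>' Q"
  shows "H_density \<gamma> X P k = H_density \<gamma>' X P k"
proof -
  have s: "P \<union> {star} \<subseteq> insert star P" "\<And>W. P \<union> {star} - W - {k} \<subseteq> insert star P" "\<And>W. P - {k} - W \<subseteq> insert star P" "\<And>R W. P - R - W - {k} \<subseteq> insert star P"
    "\<And>W. W \<in> Pow (P - {k}) \<Longrightarrow> W \<union> {k} \<subseteq> insert star P" "\<And>W. W \<in> Pow (P - {k}) \<Longrightarrow> W \<union> {k, star} \<subseteq> insert star P"
    "\<And>R W. R \<in> Pow (P - {k} - W) \<Longrightarrow> R \<union> {star} \<subseteq> insert star P"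
    using k by auto
  show ?thesis
    unfolding H_density_def
    by (intro arg_cong2[where f = "(+)"] arg_cong2[where f = "(-)"] arg_cong2[where f = "(*)"] arg_cong[where f = uminus] sum.cong refl eq s; assumption)
qed

lemma S_density_cong:
  assumes k: "k \<in> P" and eq: "\<And>Q. Q \<subseteq> P \<Longrightarrow> \<gamma> Q = \<gamma>' Q"
  shows "S_density \<gamma> X P k l = S_density \<gamma>' X P k l"
proof -
  have "(\<Sum>W\<in>Pow (P - {k, l}). \<gamma> (W \<union> {k}) * \<gamma> (P - {k} - W)) = (\<Sum>W\<in>Pow (P - {k, l}). \<gamma>' (W \<union> {k}) * \<gamma>' (P - {k} - W))"
    by (intro sum.cong refl arg_cong2[where f = "(*)"] eq) (use k in auto)
  then show ?thesis by (simp add: S_density_def eq)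
qed

context heat_kernels
begin

lemma flow_cong_AE:
  assumes G: "\<And>k. k \<in> I \<Longrightarrow> integrable N (G s k)" "\<And>k. k \<in> I \<Longrightarrow> integrable N (G' s k)"
      "\<And>k. k \<in> I \<Longrightarrow> AE x in N. G s k x = G' s k x"
    and s: "s < t" and x: "x \<in> space N"
  shows "flow N Q I G t x s = flow N Q I G' t x s"
  unfolding flow_def
proof (intro sum.cong refl integral_cong_AE)
  fix k assume k: "k \<in> I"
  have ts: "0 < t - s" using s by simp
  show "AE y in N. Q k (t - s) x y \<bullet> G s k y = Q k (t - s) x y \<bullet> G' s k y"
    using G(3)[OF k] by eventually_elim simp
  show "(\<lambda>y. Q k (t - s) x y \<bullet> G s k y) \<in> borel_measurable N" "(\<lambda>y. Q k (t - s) x y \<bullet> G' s k y) \<in> borel_measurable N"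
    by (rule borel_measurable_integrable, rule integrable_Q_inner[OF k ts x], rule G[OF k])+
qed

lemma duhamel_eq_cong_AE:
  assumes G: "\<And>k s. k \<in> I \<Longrightarrow> 0 \<le> s \<Longrightarrow> integrable N (G s k)" "\<And>k s. k \<in> I \<Longrightarrow> 0 \<le> s \<Longrightarrow> integrable N (G' s k)"
      "\<And>k s. k \<in> I \<Longrightarrow> 0 \<le> s \<Longrightarrow> AE x in N. G s k x = G' s k x"
    and x: "x \<in> space N" and d: "duhamel_eq N P Q I h G t x"
  shows "duhamel_eq N P Q I h G' t x"
proof -
  have f: "flow N Q I G t x s = flow N Q I G' t x s" if "s \<in> {0..<t}" for s
    using that x by (intro flow_cong_AE G) auto
  have "set_integrable lborel {0..<t} (flow N Q I G t x) = set_integrable lborel {0..<t} (flow N Q I G' t x)"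
    by (rule set_integrable_cong) (auto simp: f)
  moreover have "(LINT s:{0..<t}|lborel. flow N Q I G t x s) = (LINT s:{0..<t}|lborel. flow N Q I G' t x s)"
    by (rule set_lebesgue_integral_cong) (auto simp: f)
  ultimately show ?thesis using d by (simp add: duhamel_eq_def)
qed

end

lemma cont_L1_cmult: "cont_L1 N h \<Longrightarrow> cont_L1 N (\<lambda>t x. (c :: real) * h t x)"
  using cont_L1_scaleR[of N h c] by simp

section \<open>Each block solves an equation over its own labels\<close>

locale hierarchy = bounded_interaction \<Omega> K B for \<Omega> and K :: "real^'d \<Rightarrow> real^'d \<Rightarrow> real^'d" and B +
  fixes f :: "real^'d \<Rightarrow> real" and g :: "nat \<Rightarrow> nat \<Rightarrow> real \<Rightarrow> (nat \<Rightarrow> real^'d) \<Rightarrow> real"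
  assumes family: "hierarchy_family \<Omega> K f g"
begin

abbreviation blk :: "real \<Rightarrow> nat \<Rightarrow> nat set \<Rightarrow> (nat \<Rightarrow> real^'d) \<Rightarrow> real" where
  "blk t \<equiv> (\<lambda>m P. block g m P t)"

lemma g_cont: "1 \<le> j \<Longrightarrow> cont_L1 (Om \<Omega> {1..j}) (g i j)"
  using family by (auto simp: hierarchy_family_def C0_L1_iff)

lemma g_exchangeable: "1 \<le> j \<Longrightarrow> 0 \<le> t \<Longrightarrow> \<sigma> permutes {1..j} \<Longrightarrow> AE x in Om \<Omega> {1..j}. g i j t (x \<circ> \<sigma>) = g i j t x"
  using family unfolding hierarchy_family_def exchangeable_def omega_pow_def by blast

lemma g_zero: "1 \<le> j \<Longrightarrow> i + 1 < j \<Longrightarrow> 0 \<le> t \<Longrightarrow> AE x in Om \<Omega> {1..j}. g i j t x = 0"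
  using family unfolding hierarchy_family_def omega_pow_def by blast

lemma g_initial: "1 \<le> j \<Longrightarrow> AE x in Om \<Omega> {1..j}. g i j 0 x = (if i = 0 \<and> j = 1 then f (x 1) else 0)"
  using family unfolding hierarchy_family_def omega_pow_def by blast

lemma g_mild: "1 \<le> j \<Longrightarrow> mild_solution \<Omega> j (g i j) (\<lambda>t. hierarchy_flux \<Omega> K (blk t) i j)"
  using family by (auto simp: hierarchy_family_def)

lemma card_pos: "finite P \<Longrightarrow> P \<noteq> {} \<Longrightarrow> 1 \<le> card P"
  by (simp add: Suc_le_eq card_gt_0_iff)

lemma cont_L1_block:
  assumes P: "finite P" shows "cont_L1 (Om \<Omega> P) (\<lambda>t. block g m P t)"
proof (cases "P = {}")
  case True
  then show ?thesis by (simp add: block_def[abs_def])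
next
  case False
  have eq: "(\<lambda>t. block g m P t) = (\<lambda>t x. g m (card P) t (reindex {1..card P} (enum P) x))"
    by (intro ext block_eq False)
  show ?thesis unfolding eq
    by (rule cont_L1_reindex[OF finite_atLeastAtMost bij_enum[OF P] g_cont[OF card_pos[OF P False]]])
qed

lemma block_AE:
  assumes P: "finite P" "P \<noteq> {}" and ae: "AE y in Om \<Omega> {1..card P}. \<phi> y (g m (card P) t y)"
  shows "AE x in Om \<Omega> P. \<phi> (reindex {1..card P} (enum P) x) (block g m P t x)"
  using AE_reindex[OF finite_atLeastAtMost bij_enum[OF P(1)] ae] by (simp add: block_eq[OF P(2)])

lemma block_zero:
  assumes P: "finite P" "m + 1 < card P" and t: "0 \<le> t"
  shows "AE x in Om \<Omega> P. block g m P t x = 0"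
proof -
  have ne: "P \<noteq> {}" using P by auto
  show ?thesis
    using block_AE[OF P(1) ne, of "\<lambda>_ v. v = 0" m t] g_zero[OF card_pos[OF P(1) ne] P(2) t] by simp
qed

lemma cont_L1_block2:
  assumes D: "finite D" "Q \<union> R = D" "Q \<inter> R = {}"
  shows "cont_L1 (Om \<Omega> D) (\<lambda>t z. block g m Q t z * block g n R t z)"
proof -
  have fin: "finite Q" "finite R" using D by auto
  show ?thesis
    using cont_L1_tensor[OF fin D(3) cont_L1_block[OF fin(1), of m] cont_L1_block[OF fin(2), of n]] fin
    by (simp add: block_restrict D(2))
qed

lemma cont_L1_block3:
  assumes D: "finite D" "Q \<union> R \<union> S = D" "Q \<inter> R = {}" "(Q \<union> R) \<inter> S = {}"
  shows "cont_L1 (Om \<Omega> D) (\<lambda>t z. block g m Q t z * block g n R t z * block g l S t z)"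
proof -
  have fin: "finite (Q \<union> R)" "finite S" "finite Q" "finite R" using D by auto
  show ?thesis
    using cont_L1_tensor[OF fin(1,2) D(4) cont_L1_block2[OF fin(1) refl D(3)] cont_L1_block[OF fin(2), of l]] fin
    by (simp add: block_restrict D(2))
qed

lemma cont_L1_hdens:
  assumes P: "finite P" "star \<notin> P" "k \<in> P"
  shows "cont_L1 (Om \<Omega> (insert star P)) (\<lambda>t z. hdens (blk t) i P k z)"
proof -
  have fD: "finite (insert star P)" using P by simp
  have k0: "k \<noteq> star" using P by metis
  have p1: "cont_L1 (Om \<Omega> (insert star P)) (\<lambda>t z. block g m (P \<union> {star}) t z)" for m
    using cont_L1_block[OF fD] by simp
  have p2: "cont_L1 (Om \<Omega> (insert star P)) (\<lambda>t z. block g m (W \<union> {k}) t z * block g n (P \<union> {star} - W - {k}) t z)" if "W \<in> Pow (P - {k})" for W m n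
    by (rule cont_L1_block2[OF fD]) (use that P in auto)
  have p3: "cont_L1 (Om \<Omega> (insert star P)) (\<lambda>t z. block g m (W \<union> {k, star}) t z * block g n (P - {k} - W) t z)" if "W \<in> Pow (P - {k})" for W m n
    by (rule cont_L1_block2[OF fD]) (use that P in auto)
  have p4: "cont_L1 (Om \<Omega> (insert star P)) (\<lambda>t z. block g m (W \<union> {k}) t z * block g n (R \<union> {star}) t z * block g l (P - R - W - {k}) t z)"
    if "W \<in> Pow (P - {k})" "R \<in> Pow (P - {k} - W)" for W R m n l
    by (rule cont_L1_block3[OF fD]) (use that P k0 in auto)
  show ?thesis
  proof (cases i)
    case 0
    show ?thesis unfolding 0 hdens_0 by (intro cont_L1_diff cont_L1_minus cont_L1_sum p1 p2)
  next
    case (Suc i')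
    show ?thesis unfolding Suc hdens_Suc
      by (intro cont_L1_add cont_L1_diff cont_L1_minus cont_L1_sum cont_L1_cmult p1 p2 p3 p4)
  qed
qed

lemma cont_L1_sdens:
  assumes P: "finite P" "k \<in> P" "l \<in> P"
  shows "cont_L1 (Om \<Omega> P) (\<lambda>t z. sdens (blk t) i P k l z)"
proof (cases i)
  case 0
  then show ?thesis by (simp add: sdens_0)
next
  case (Suc i')
  have p2: "cont_L1 (Om \<Omega> P) (\<lambda>t z. block g m (W \<union> {k}) t z * block g n (P - {k} - W) t z)" if "W \<in> Pow (P - {k, l})" for W m n
    by (rule cont_L1_block2[OF P(1)]) (use that P in auto)
  show ?thesis
  proof (cases "l = k")
    case True
    show ?thesis unfolding Suc sdens_Suc if_P[OF True] by (intro cont_L1_minus cont_L1_add cont_L1_block P cont_L1_zero)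
  next
    case False
    show ?thesis unfolding Suc sdens_Suc if_not_P[OF False] by (intro cont_L1_minus cont_L1_add cont_L1_sum cont_L1_block P p2)
  qed
qed

text \<open>The flux of a block over an arbitrary label set \<open>P\<close>. For
  \<open>P = {1..j}\<close> it agrees with \<open>hierarchy_flux\<close> almost everywhere at each
  time, and its form makes continuity in \<open>L1\<close> immediate.\<close>

definition Phi :: "nat \<Rightarrow> nat set \<Rightarrow> real \<Rightarrow> nat \<Rightarrow> (nat \<Rightarrow> real^'d) \<Rightarrow> real^'d" where
  "Phi i P t k x = H_flux \<Omega> K k (hdens (blk t) i P k) x + (\<Sum>l\<in>P. sdens (blk t) i P k l x *\<^sub>R K (x k) (x l))"

lemma cont_L1_Phi:
  assumes P: "finite P" "star \<notin> P" "k \<in> P"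
  shows "cont_L1 (Om \<Omega> P) (\<lambda>t. Phi i P t k)"
  unfolding Phi_def[abs_def]
  by (intro cont_L1_add cont_L1_sum cont_L1_H_flux cont_L1_S_flux cont_L1_hdens cont_L1_sdens P)

text \<open>Countably many orders and finitely many choices of label sets occur, so the exceptional
  null sets may be united.\<close>

lemma AE_regular_point:
  assumes P: "finite P" "star \<notin> P" "k \<in> P" and t: "0 \<le> t"
  shows "AE x in Om \<Omega> P. regular_point \<Omega> K (blk t) P k x"
proof -
  let ?D = "insert star P"
  have fD: "finite ?D" using P by simp
  have 1: "AE x in Om \<Omega> P. \<forall>m. H_integrable \<Omega> K k (block g m ?D t) x"
    unfolding AE_all_countable by (intro allI H_flux_L1(1)[OF P] cont_L1_integrable[OF cont_L1_block[OF fD] t])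
  let ?S2 = "{(Q, R). Q \<union> R = ?D \<and> Q \<inter> R = {}}"
  have "?S2 \<subseteq> Pow ?D \<times> Pow ?D" by auto
  then have f2: "finite ?S2" by (rule finite_subset) (use fD in simp)
  have 2: "AE x in Om \<Omega> P. \<forall>p\<in>?S2. \<forall>m n. H_integrable \<Omega> K k (\<lambda>z. block g m (fst p) t z * block g n (snd p) t z) x"
  proof (intro AE_finite_allI[OF f2])
    fix p assume "p \<in> ?S2"
    then have p: "fst p \<union> snd p = ?D" "fst p \<inter> snd p = {}" by (simp_all add: case_prod_unfold)
    show "AE x in Om \<Omega> P. \<forall>m n. H_integrable \<Omega> K k (\<lambda>z. block g m (fst p) t z * block g n (snd p) t z) x"
      unfolding AE_all_countable by (intro allI H_flux_L1(1)[OF P] cont_L1_integrable[OF cont_L1_block2[OF fD p] t])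
  qed
  let ?S3 = "{(Q, R, S). Q \<union> R \<union> S = ?D \<and> Q \<inter> R = {} \<and> (Q \<union> R) \<inter> S = {}}"
  have "?S3 \<subseteq> Pow ?D \<times> Pow ?D \<times> Pow ?D" by auto
  then have f3: "finite ?S3" by (rule finite_subset) (use fD in simp)
  have 3: "AE x in Om \<Omega> P. \<forall>p\<in>?S3. \<forall>m n l. H_integrable \<Omega> K k (\<lambda>z. block g m (fst p) t z * block g n (fst (snd p)) t z * block g l (snd (snd p)) t z) x"
  proof (intro AE_finite_allI[OF f3])
    fix p assume "p \<in> ?S3"
    then have p: "fst p \<union> fst (snd p) \<union> snd (snd p) = ?D" "fst p \<inter> fst (snd p) = {}" "(fst p \<union> fst (snd p)) \<inter> snd (snd p) = {}" by (simp_all add: case_prod_unfold)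
    show "AE x in Om \<Omega> P. \<forall>m n l. H_integrable \<Omega> K k (\<lambda>z. block g m (fst p) t z * block g n (fst (snd p)) t z * block g l (snd (snd p)) t z) x"
      unfolding AE_all_countable by (intro allI H_flux_L1(1)[OF P] cont_L1_integrable[OF cont_L1_block3[OF fD p] t])
  qed
  have f4: "finite {Q. Q \<subseteq> ?D \<and> 2 \<le> card Q}" using fD by simp
  have 4: "AE x in Om \<Omega> P. \<forall>Q\<in>{Q. Q \<subseteq> ?D \<and> 2 \<le> card Q}. AE y in omega \<Omega>. block g 0 Q t (x(star := y)) = 0"
  proof (intro AE_finite_allI[OF f4] AE_Om_insert[OF P(1,2)])
    fix Q assume Q: "Q \<in> {Q. Q \<subseteq> ?D \<and> 2 \<le> card Q}"
    then have fQ: "finite Q" using fD by (auto intro: finite_subset)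
    have "AE z in Om \<Omega> Q. block g 0 Q t z = 0" using Q by (intro block_zero fQ t) auto
    from AE_Om_restrict[OF fD _ this] Q
    show "AE z in Om \<Omega> ?D. block g 0 Q t z = 0" by (simp add: block_restrict[OF fQ order_refl])
  qed
  show ?thesis
    using 1 2 3 4
  proof eventually_elim
    case (elim x)
    show ?case unfolding regular_point_def
    proof (intro conjI allI impI)
      fix m n Q R assume "Q \<union> R = ?D" "Q \<inter> R = {}"
      then have "(Q, R) \<in> ?S2" by simp
      from elim(2)[rule_format, OF this] show "H_integrable \<Omega> K k (\<lambda>z. block g m Q t z * block g n R t z) x" by simp
    next
      fix m n l Q R S assume "Q \<union> R \<union> S = ?D" "Q \<inter> R = {}" "(Q \<union> R) \<inter> S = {}"
      then have "(Q, R, S) \<in> ?S3" by simp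
      from elim(3)[rule_format, OF this] show "H_integrable \<Omega> K k (\<lambda>z. block g m Q t z * block g n R t z * block g l S t z) x" by simp
    qed (use elim(1,4) in blast)+
  qed
qed

text \<open>The given flux is known to be integrable at each time; replacing it by
  \<open>Phi\<close>, to which it is equal almost everywhere, supplies the continuity that
  \<open>mild_imp_evolution\<close> asks for.\<close>

lemma evol_g:
  assumes j: "1 \<le> j"
  shows "evol \<Omega> {1..j} (g i j) (Phi i {1..j})"
proof -
  interpret H: heat_kernels "Om \<Omega> {1..j} :: (nat \<Rightarrow> real^'d) measure" "hk \<Omega> {1..j}" "ghk \<Omega> {1..j}" "{1..j}" "2 powr (real CARD('d) / 2)"
    by (rule heat_kernels_Om) simp
  note m = g_mild[OF j, unfolded mild_solution_iff]
  have P: "finite {1..j}" "star \<notin> {1..j}" by auto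
  show ?thesis
  proof (rule H.mild_imp_evolution)
    show "integrable (Om \<Omega> {1..j}) (g i j t)" if "0 \<le> t" for t using m that by blast
    show cP: "cont_L1 (Om \<Omega> {1..j}) (\<lambda>s. Phi i {1..j} s k)" if "k \<in> {1..j}" for k by (rule cont_L1_Phi[OF P that])
    fix t :: real assume t: "0 < t"
    have "AE x in Om \<Omega> {1..j}. duhamel_eq (Om \<Omega> {1..j}) (hk \<Omega> {1..j}) (ghk \<Omega> {1..j}) {1..j} (g i j) (\<lambda>t. hierarchy_flux \<Omega> K (blk t) i j) t x"
      using m t by blast
    then show "AE x in Om \<Omega> {1..j}. duhamel_eq (Om \<Omega> {1..j}) (hk \<Omega> {1..j}) (ghk \<Omega> {1..j}) {1..j} (g i j) (Phi i {1..j}) t x"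
      using AE_space
    proof eventually_elim
      case (elim x)
      show ?case
      proof (rule H.duhamel_eq_cong_AE[OF _ _ _ elim(2,1)])
        fix k s assume k: "k \<in> {1..j}" and s: "0 \<le> (s :: real)"
        show "integrable (Om \<Omega> {1..j}) (hierarchy_flux \<Omega> K (blk s) i j k)" using m k s by blast
        show "integrable (Om \<Omega> {1..j}) (Phi i {1..j} s k)" by (rule cont_L1_integrable[OF cP[OF k] s])
        show "AE x in Om \<Omega> {1..j}. hierarchy_flux \<Omega> K (blk s) i j k x = Phi i {1..j} s k x"
          using AE_regular_point[OF P k s] by eventually_elim (simp only: hierarchy_flux_density[OF _ k] Phi_def)
      qed
    qed
  qed
qed

lemma Phi_enum:
  assumes P: "finite P" "star \<notin> P" and k: "k \<in> {1..card P}"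
  shows "Phi i P t (enum P k) x = Phi i {1..card P} t k (reindex {1..card P} (enum P) x)"
proof -
  let ?I = "{1..card P}" and ?x = "reindex {1..card P} (enum P) x"
  \<comment> \<open>The enumeration of \<open>P\<close>, extended so as to fix \<open>star\<close>.
    It stays strictly increasing because \<open>star\<close> is the label 0 and lies below all
    others, so \<open>block_image\<close> also covers the blocks that contain
    \<open>star\<close>.\<close>
  define e where "e n = (if n = star then star else enum P n)" for n
  have bij: "bij_betw (enum P) ?I P" by (rule bij_enum[OF P(1)])
  have mono: "strict_mono_on (insert star ?I) e"
  proof (rule strict_mono_onI)
    fix a b assume ab: "a \<in> insert star ?I" "b \<in> insert star ?I" "a < b"
    have b: "b \<in> ?I" using ab by auto
    show "e a < e b"
    proof (cases "a = star")
      case True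
      have "enum P b \<in> P" using bij b by (auto dest: bij_betwE)
      then have "enum P b \<noteq> star" using P(2) by metis
      then show ?thesis using True b by (simp add: e_def)
    next
      case False
      have "sorted_wrt (<) (sorted_list_of_set P)" by (rule strict_sorted_list_of_set)
      moreover have "a - 1 < b - 1" "b - 1 < length (sorted_list_of_set P)" using False ab P by auto
      ultimately have "sorted_list_of_set P ! (a - 1) < sorted_list_of_set P ! (b - 1)" by (simp add: sorted_wrt_iff_nth_less)
      then show ?thesis using False b by (simp add: e_def enum_def)
    qed
  qed
  have mono': "strict_mono_on Q e" if Q: "Q \<subseteq> insert star ?I" for Q
    using mono Q unfolding strict_mono_on_def by blast
  have inj: "inj_on e (insert star ?I)" by (rule strict_mono_on_imp_inj_on[OF mono])
  have eI: "e n = enum P n" if "n \<in> ?I" for n using that by (simp add: e_def)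
  have im: "e ` ?I = P" using bij eI by (auto simp: bij_betw_def image_def)
  have e0: "e star = star" by (simp add: e_def)
  have bl: "block g m (e ` Q) t z = block g m Q t w" if "Q \<subseteq> insert star ?I" "\<And>n. n \<in> insert star ?I \<Longrightarrow> z (e n) = w n" for m Q z w
  proof -
    have fQ: "finite Q" using that(1) finite_subset by auto
    have "block g m (e ` Q) t z = block g m Q t (\<lambda>n. z (e n))"
      by (rule block_image[OF fQ mono'[OF that(1)]])
    also have "\<dots> = block g m Q t w" by (rule block_cong[OF fQ]) (use that in auto)
    finally show ?thesis .
  qed
  have I: "finite ?I" "k \<in> ?I" "star \<notin> ?I" using k by auto
  have ek: "enum P k = e k" using eI[OF k] by simp
  have h: "hdens (blk t) i P (e k) (x(star := y)) = hdens (blk t) i ?I k (?x(star := y))" for y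
  proof -
    have ze: "(x(star := y)) (e n) = (?x(star := y)) n" if n: "n \<in> insert star ?I" for n
    proof (cases "n = star")
      case False
      then have "n \<in> ?I" using n by blast
      then have "e n \<in> P" using im by blast
      then have "e n \<noteq> star" using P(2) by metis
      then show ?thesis using False \<open>n \<in> ?I\<close> eI[OF \<open>n \<in> ?I\<close>] by simp
    qed (simp add: e0)
    have "H_density (\<lambda>Q. Abs_fps (\<lambda>m. block g m (e ` Q) t (x(star := y)))) fps_X ?I k
        = H_density (\<lambda>Q. Abs_fps (\<lambda>m. block g m Q t (?x(star := y)))) fps_X ?I k"
    proof (rule H_density_cong[OF I(2)])
      fix Q assume "Q \<subseteq> insert star ?I"
      then have "block g m (e ` Q) t (x(star := y)) = block g m Q t (?x(star := y))" for m
        using ze by (rule bl)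
      then show "Abs_fps (\<lambda>m. block g m (e ` Q) t (x(star := y))) = Abs_fps (\<lambda>m. block g m Q t (?x(star := y)))"
        by (simp only:)
    qed
    then show ?thesis
      unfolding hdens_def H_density_image[OF I inj e0, unfolded im] by simp
  qed
  have s: "sdens (blk t) i P (e k) (e l) x = sdens (blk t) i ?I k l ?x" if l: "l \<in> ?I" for l
  proof -
    have inj': "inj_on e ?I" by (rule inj_on_subset[OF inj]) auto
    have "S_density (\<lambda>Q. Abs_fps (\<lambda>m. block g m (e ` Q) t x)) fps_X ?I k l = S_density (\<lambda>Q. Abs_fps (\<lambda>m. block g m Q t ?x)) fps_X ?I k l"
    proof (rule S_density_cong[OF I(2)])
      fix Q assume Q: "Q \<subseteq> ?I"
      have fQ: "finite Q" using Q finite_subset by auto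
      have "block g m (e ` Q) t x = block g m Q t ?x" for m
      proof -
        have "block g m (e ` Q) t x = block g m Q t (\<lambda>n. x (e n))"
          by (rule block_image[OF fQ mono']) (use Q in blast)
        also have "\<dots> = block g m Q t ?x" by (rule block_cong[OF fQ]) (use Q eI in auto)
        finally show ?thesis .
      qed
      then show "Abs_fps (\<lambda>m. block g m (e ` Q) t x) = Abs_fps (\<lambda>m. block g m Q t ?x)" by simp
    qed
    then show ?thesis
      unfolding sdens_def S_density_image[OF I(2) l inj', unfolded im] by simp
  qed
  have "e k \<in> P" using im k by blast
  then have k0: "e k \<noteq> star" "k \<noteq> star" using P(2) k by (metis, auto)
  have xk: "x (e k) = ?x k" using k eI by simp
  have "H_flux \<Omega> K (e k) (hdens (blk t) i P (e k)) x = H_flux \<Omega> K k (hdens (blk t) i ?I k) ?x"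
    unfolding H_flux_def h xk ..
  moreover have "(\<Sum>l\<in>P. sdens (blk t) i P (e k) l x *\<^sub>R K (x (e k)) (x l)) = (\<Sum>l\<in>?I. sdens (blk t) i ?I k l ?x *\<^sub>R K (?x k) (?x l))"
  proof -
    have b: "bij_betw e ?I P" using im inj_on_subset[OF inj, of ?I] by (auto simp: bij_betw_def)
    show ?thesis
    proof (subst sum.reindex_bij_betw[OF b, symmetric], rule sum.cong[OF refl])
      fix l assume l: "l \<in> ?I"
      have xl: "x (e l) = ?x l" using l eI[OF l] by simp
      show "sdens (blk t) i P (e k) (e l) x *\<^sub>R K (x (e k)) (x (e l)) = sdens (blk t) i ?I k l ?x *\<^sub>R K (?x k) (?x l)"
        by (simp only: s[OF l] xk xl)
    qed
  qed
  ultimately show ?thesis unfolding ek Phi_def by simp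
qed

lemma evol_block:
  assumes P: "finite P" "star \<notin> P" "P \<noteq> {}"
  shows "evol \<Omega> P (\<lambda>t. block g i P t) (Phi i P)"
proof -
  let ?I = "{1..card P}"
  have c: "1 \<le> card P" by (rule card_pos[OF P(1,3)])
  have I: "finite ?I" "star \<notin> ?I" by auto
  have bij: "bij_betw (enum P) ?I P" by (rule bij_enum[OF P(1)])
  have ev: "evol \<Omega> P (\<lambda>t x. g i (card P) t (reindex ?I (enum P) x)) (\<lambda>t k x. Phi i ?I t (inv_into ?I (enum P) k) (reindex ?I (enum P) x))"
    by (rule evolution_reindex[OF I(1) bij evol_g[OF c] cont_L1_integrable[OF g_cont[OF c]] cont_L1_integrable[OF cont_L1_Phi[OF I]]])
  have eqF: "Phi i ?I t (inv_into ?I (enum P) k) (reindex ?I (enum P) x) = Phi i P t k x" if k: "k \<in> P" for t k x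
  proof -
    have "k \<in> enum P ` ?I" using bij k unfolding bij_betw_def by blast
    then have "inv_into ?I (enum P) k \<in> ?I" "enum P (inv_into ?I (enum P) k) = k"
      by (rule inv_into_into, rule f_inv_into_f)
    then show ?thesis using Phi_enum[OF P(1,2), of "inv_into ?I (enum P) k" i t x] by simp
  qed
  have eqh: "(\<lambda>x. g i (card P) t (reindex ?I (enum P) x)) = block g i P t" for t by (rule ext) (rule block_eq[OF P(3), symmetric])
  show ?thesis
  proof (rule evolution_cong_AE[OF ev heat_kernels_Om[OF P(1)]])
    fix t :: real assume t: "0 \<le> t"
    show "integrable (Om \<Omega> P) (\<lambda>x. g i (card P) t (reindex ?I (enum P) x))" "integrable (Om \<Omega> P) (block g i P t)"
      unfolding eqh by (rule cont_L1_integrable[OF cont_L1_block[OF P(1)] t])+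
    show "AE x in Om \<Omega> P. g i (card P) t (reindex ?I (enum P) x) = block g i P t x" by (simp add: block_eq[OF P(3)])
    fix k assume k: "k \<in> P"
    show "integrable (Om \<Omega> P) (\<lambda>x. Phi i ?I t (inv_into ?I (enum P) k) (reindex ?I (enum P) x))" "integrable (Om \<Omega> P) (Phi i P t k)"
      unfolding eqF[OF k] by (rule cont_L1_integrable[OF cont_L1_Phi[OF P(1,2) k] t])+
    show "AE x in Om \<Omega> P. Phi i ?I t (inv_into ?I (enum P) k) (reindex ?I (enum P) x) = Phi i P t k x"
      by (rule AE_I2) (rule eqF[OF k])
  qed
qed

end

subsection \<open>The equation for the partition sums\<close>

lemma evolution_flux_cong:
  assumes "evolution N P Q I h G" "\<And>t k x. k \<in> I \<Longrightarrow> G t k x = G' t k x"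
  shows "evolution N P Q I h G'"
proof -
  have "flow N Q I G = flow N Q I G'"
    unfolding flow_def[abs_def] using assms(2) by (intro ext sum.cong refl) simp
  then show ?thesis using assms(1) by (simp add: evolution_def)
qed

lemma cont_L1_tensor_local:
  fixes b :: "real \<Rightarrow> (nat \<Rightarrow> real^'d) \<Rightarrow> 'b::{banach, second_countable_topology}"
  assumes D: "finite D" "Q \<union> R = D" "Q \<inter> R = {}"
    and a: "cont_L1 (Om \<Omega> Q) a" and b: "cont_L1 (Om \<Omega> R) b"
    and loc: "\<And>t x. a t (restrict x Q) = a t x" "\<And>t x. b t (restrict x R) = b t x"
  shows "cont_L1 (Om \<Omega> D) (\<lambda>t x. a t x *\<^sub>R b t x)"
proof -
  have fin: "finite Q" "finite R" using D by auto
  show ?thesis using cont_L1_tensor[OF fin D(3) a b] by (simp add: loc D(2))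
qed

lemma cont_L1_Om_empty: "cont_L1 (Om \<Omega> {}) (\<lambda>t x. c)"
  by (simp add: cont_L1_def PiM_empty integrable_count_space)

section \<open>Partition sums as evolutions\<close>

context hierarchy
begin

text \<open>The function \<open>f\<close> of order \<open>i\<close> over an arbitrary finite label
  set, which may contain \<open>star\<close>.\<close>

definition pf :: "nat set \<Rightarrow> nat \<Rightarrow> real \<Rightarrow> (nat \<Rightarrow> real^'d) \<Rightarrow> real" where
  "pf I i t x = fps_nth (partsum (\<lambda>Q. Abs_fps (\<lambda>m. block g m Q t x)) I) i"

lemma pf_empty: "pf {} i t x = (if i = 0 then 1 else 0)"
  by (simp add: pf_def)

lemma pf_insert:
  assumes "finite J" "k \<notin> J"
  shows "pf (insert k J) i t x = (\<Sum>U\<in>Pow J. \<Sum>a\<in>{0..i}. block g a (insert k U) t x * pf (J - U) (i - a) t x)"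
  unfolding pf_def partsum_insert[OF assms] fps_sum_nth fps_mult_nth fps_nth_Abs_fps ..

lemma pf_cong:
  assumes "finite I" "\<And>p. p \<in> I \<Longrightarrow> x p = y p"
  shows "pf I i t x = pf I i t y"
proof -
  have "block g m Q t x = block g m Q t y" if "Q \<subseteq> I" for m Q
    by (rule block_cong) (use that assms finite_subset in auto)
  then have "partsum (\<lambda>Q. Abs_fps (\<lambda>m. block g m Q t x)) I = partsum (\<lambda>Q. Abs_fps (\<lambda>m. block g m Q t y)) I"
    by (intro partsum_cong) simp
  then show ?thesis by (simp add: pf_def)
qed

lemma pf_restrict: "finite I \<Longrightarrow> I \<subseteq> J \<Longrightarrow> pf I i t (restrict x J) = pf I i t x"
  by (rule pf_cong) auto

lemma hdens_cong:
  assumes "finite P" "k \<in> P" "\<And>p. p \<in> insert star P \<Longrightarrow> x p = y p"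
  shows "hdens (blk t) i P k x = hdens (blk t) i P k y"
proof -
  have "block g m Q t x = block g m Q t y" if "Q \<subseteq> insert star P" for m Q
    by (rule block_cong) (use that assms finite_subset[OF that] in auto)
  then show ?thesis unfolding hdens_def by (subst H_density_cong[OF assms(2), where \<gamma>' = "\<lambda>Q. Abs_fps (\<lambda>m. block g m Q t y)"]) simp_all
qed

lemma sdens_cong:
  assumes "finite P" "k \<in> P" "\<And>p. p \<in> P \<Longrightarrow> x p = y p"
  shows "sdens (blk t) i P k l x = sdens (blk t) i P k l y"
proof -
  have "block g m Q t x = block g m Q t y" if "Q \<subseteq> P" for m Q
    by (rule block_cong) (use that assms finite_subset[OF that] in auto)
  then show ?thesis unfolding sdens_def by (subst S_density_cong[OF assms(2), where \<gamma>' = "\<lambda>Q. Abs_fps (\<lambda>m. block g m Q t y)"]) simp_all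
qed

lemma Phi_cong:
  assumes P: "finite P" "k \<in> P" and eq: "\<And>p. p \<in> P \<Longrightarrow> x p = y p"
  shows "Phi i P t k x = Phi i P t k y"
proof -
  have "hdens (blk t) i P k (x(star := v)) = hdens (blk t) i P k (y(star := v))" for v
    by (rule hdens_cong[OF P]) (use eq in auto)
  moreover have "sdens (blk t) i P k l x = sdens (blk t) i P k l y" for l
    by (rule sdens_cong[OF P eq])
  moreover have "(\<Sum>l\<in>P. sdens (blk t) i P k l y *\<^sub>R K (y k) (x l)) = (\<Sum>l\<in>P. sdens (blk t) i P k l y *\<^sub>R K (y k) (y l))"
    by (intro sum.cong refl) (simp add: eq)
  ultimately show ?thesis using eq[OF P(2)] by (simp add: Phi_def H_flux_def)
qed

lemma Phi_restrict: "finite P \<Longrightarrow> k \<in> P \<Longrightarrow> P \<subseteq> J \<Longrightarrow> Phi i P t k (restrict x J) = Phi i P t k x"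
  by (rule Phi_cong) auto

lemma cont_L1_pf:
  assumes "finite I" shows "cont_L1 (Om \<Omega> I) (pf I i)"
  using assms
proof (induction I arbitrary: i rule: finite_psubset_induct)
  case (psubset I)
  show ?case
  proof (cases "I = {}")
    case True
    have eq: "pf {} i = (\<lambda>t x. if i = 0 then 1 else 0)" by (intro ext) (rule pf_empty)
    show ?thesis unfolding True eq by (rule cont_L1_Om_empty)
  next
    case False
    then obtain k where k: "k \<in> I" by auto
    define J where "J = I - {k}"
    have J: "I = insert k J" "k \<notin> J" "finite J" using k psubset(1) by (auto simp: J_def)
    have eq: "pf I i = (\<lambda>t x. \<Sum>U\<in>Pow J. \<Sum>a\<in>{0..i}. block g a (insert k U) t x *\<^sub>R pf (J - U) (i - a) t x)"
      unfolding J(1) by (intro ext) (simp add: pf_insert[OF J(3,2)])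
    show ?thesis unfolding eq
    proof (intro cont_L1_sum cont_L1_tensor_local[of I "insert k U" "J - U" for U])
      fix U a assume U: "U \<in> Pow J"
      have fU: "finite U" using U J(3) finite_subset by auto
      show "insert k U \<union> (J - U) = I" "insert k U \<inter> (J - U) = {}" using U J by auto
      show "cont_L1 (Om \<Omega> (insert k U)) (block g a (insert k U))" by (rule cont_L1_block) (use fU in simp)
      show "cont_L1 (Om \<Omega> (J - U)) (pf (J - U) (i - a))" by (rule psubset(2)) (use J in auto)
      show "block g a (insert k U) t (restrict x (insert k U)) = block g a (insert k U) t x" for t x
        by (rule block_restrict) (use fU in auto)
      show "pf (J - U) (i - a) t (restrict x (J - U)) = pf (J - U) (i - a) t x" for t x
        by (rule pf_restrict) (use J in auto)
    qed (rule psubset(1))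
  qed
qed

text \<open>The flux of \<open>pf I i\<close> for the particle \<open>k\<close>: in every partition,
  the block containing \<open>k\<close> is replaced by its flux.\<close>

definition Fl :: "nat \<Rightarrow> nat set \<Rightarrow> real \<Rightarrow> nat \<Rightarrow> (nat \<Rightarrow> real^'d) \<Rightarrow> real^'d" where
  "Fl i I t k x = (\<Sum>U\<in>Pow (I - {k}). \<Sum>a\<in>{0..i}. pf (I - {k} - U) (i - a) t x *\<^sub>R Phi a (insert k U) t k x)"

text \<open>Each component of the flux is itself a partition sum, for the family in which the blocks
  containing \<open>k\<close> are replaced by their fluxes. Passing to a component keeps the
  coefficients in a commutative ring, and a partition sum can be expanded at any label.\<close>

lemma Fl_component:
  assumes I: "finite I" "k \<in> I"
  shows "Fl i I t k x \<bullet> b = fps_nth (partsum (\<lambda>Q. Abs_fps (\<lambda>m. if k \<in> Q then Phi m Q t k x \<bullet> b else block g m Q t x)) I) i"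
proof -
  define J where "J = I - {k}"
  have J: "I = insert k J" "k \<notin> J" "finite J" using I by (auto simp: J_def)
  let ?\<gamma> = "\<lambda>Q. Abs_fps (\<lambda>m. if k \<in> Q then Phi m Q t k x \<bullet> b else block g m Q t x)"
  have p: "partsum ?\<gamma> (J - U) = partsum (\<lambda>Q. Abs_fps (\<lambda>m. block g m Q t x)) (J - U)" for U
  proof (rule partsum_cong)
    fix Q assume "Q \<subseteq> J - U"
    then have "k \<notin> Q" using J by auto
    then show "?\<gamma> Q = Abs_fps (\<lambda>m. block g m Q t x)" by simp
  qed
  have "fps_nth (partsum ?\<gamma> I) i = (\<Sum>U\<in>Pow J. \<Sum>a\<in>{0..i}. (Phi a (insert k U) t k x \<bullet> b) * pf (J - U) (i - a) t x)"
    unfolding J(1) partsum_insert[OF J(3,2)] p by (simp add: fps_sum_nth fps_mult_nth pf_def)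
  also have "\<dots> = Fl i I t k x \<bullet> b"
    unfolding Fl_def J_def[symmetric] by (simp add: inner_sum_left mult.commute)
  finally show ?thesis ..
qed

text \<open>The expansion at \<open>k0\<close> instead of \<open>k\<close> has the shape of a tensor
  product flux, according to whether \<open>k\<close> lies in the block split off or in the
  rest.\<close>

lemma Fl_insert:
  assumes J: "finite J" "k0 \<notin> J" and k: "k \<in> insert k0 J"
  shows "Fl i (insert k0 J) t k x = (\<Sum>U\<in>Pow J. \<Sum>a\<in>{0..i}.
     if k \<in> insert k0 U then pf (J - U) (i - a) t x *\<^sub>R Phi a (insert k0 U) t k x
     else block g a (insert k0 U) t x *\<^sub>R Fl (i - a) (J - U) t k x)"
proof (rule euclidean_eqI)
  fix b :: "real^'d"
  let ?\<gamma> = "\<lambda>Q. Abs_fps (\<lambda>m. if k \<in> Q then Phi m Q t k x \<bullet> b else block g m Q t x)"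
  have "Fl i (insert k0 J) t k x \<bullet> b = fps_nth (partsum ?\<gamma> (insert k0 J)) i"
    using J k by (intro Fl_component) auto
  also have "\<dots> = (\<Sum>U\<in>Pow J. \<Sum>a\<in>{0..i}. fps_nth (?\<gamma> (insert k0 U)) a * fps_nth (partsum ?\<gamma> (J - U)) (i - a))"
    unfolding partsum_insert[OF J] fps_sum_nth fps_mult_nth ..
  also have "\<dots> = (\<Sum>U\<in>Pow J. \<Sum>a\<in>{0..i}.
     if k \<in> insert k0 U then pf (J - U) (i - a) t x * (Phi a (insert k0 U) t k x \<bullet> b)
     else block g a (insert k0 U) t x * (Fl (i - a) (J - U) t k x \<bullet> b))"
  proof (intro sum.cong refl)
    fix U a assume U: "U \<in> Pow J"
    show "fps_nth (?\<gamma> (insert k0 U)) a * fps_nth (partsum ?\<gamma> (J - U)) (i - a) =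
      (if k \<in> insert k0 U then pf (J - U) (i - a) t x * (Phi a (insert k0 U) t k x \<bullet> b)
       else block g a (insert k0 U) t x * (Fl (i - a) (J - U) t k x \<bullet> b))"
    proof (cases "k \<in> insert k0 U")
      case True
      have "partsum ?\<gamma> (J - U) = partsum (\<lambda>Q. Abs_fps (\<lambda>m. block g m Q t x)) (J - U)"
      proof (rule partsum_cong)
        fix Q assume "Q \<subseteq> J - U"
        then have "k \<notin> Q" using True J by auto
        then show "?\<gamma> Q = Abs_fps (\<lambda>m. block g m Q t x)" by simp
      qed
      then show ?thesis using True by (simp add: pf_def mult.commute)
    next
      case False
      then have "k \<in> J - U" using k by auto
      then show ?thesis using False Fl_component[of "J - U" k "i - a" t x b] J(1) by simp
    qed
  qed
  also have "\<dots> = (\<Sum>U\<in>Pow J. \<Sum>a\<in>{0..i}.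
     if k \<in> insert k0 U then pf (J - U) (i - a) t x *\<^sub>R Phi a (insert k0 U) t k x
     else block g a (insert k0 U) t x *\<^sub>R Fl (i - a) (J - U) t k x) \<bullet> b"
    unfolding inner_sum_left by (intro sum.cong refl) simp
  finally show "Fl i (insert k0 J) t k x \<bullet> b = \<dots>" .
qed

lemma Fl_restrict: "finite I \<Longrightarrow> k \<in> I \<Longrightarrow> Fl i I t k (restrict x I) = Fl i I t k x"
  unfolding Fl_def
  by (intro sum.cong refl arg_cong2[where f = "(*\<^sub>R)"] pf_restrict Phi_restrict) (auto intro: finite_subset)

lemma cont_L1_Fl:
  assumes I: "finite I" "star \<notin> I" "k \<in> I"
  shows "cont_L1 (Om \<Omega> I) (\<lambda>t. Fl i I t k)"
proof -
  have k0: "k \<noteq> star" using I by metis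
  show ?thesis unfolding Fl_def[abs_def]
  proof (intro cont_L1_sum cont_L1_tensor_local[of I "I - {k} - U" "insert k U" for U])
    fix U a assume U: "U \<in> Pow (I - {k})"
    have fU: "finite (insert k U)" using U I(1) finite_subset[of U I] by auto
    show "I - {k} - U \<union> insert k U = I" "(I - {k} - U) \<inter> insert k U = {}" using U I by auto
    show "cont_L1 (Om \<Omega> (I - {k} - U)) (pf (I - {k} - U) (i - a))" by (rule cont_L1_pf) (use I in simp)
    show "cont_L1 (Om \<Omega> (insert k U)) (\<lambda>t. Phi a (insert k U) t k)" by (rule cont_L1_Phi[OF fU]) (use U I k0 in auto)
    show "pf (I - {k} - U) (i - a) t (restrict x (I - {k} - U)) = pf (I - {k} - U) (i - a) t x" for t x
      by (rule pf_restrict) (use I in auto)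
    show "Phi a (insert k U) t k (restrict x (insert k U)) = Phi a (insert k U) t k x" for t x
      by (rule Phi_restrict[OF fU]) auto
  qed (rule I(1))
qed

text \<open>Splitting off the block of a fixed label \<open>k0\<close> writes \<open>pf I i\<close>
  as a sum of tensor products of a block with a smaller partition sum. The label \<open>k0\<close>
  has to be the same for all components \<open>k\<close> of the flux, which is what
  \<open>Fl_insert\<close> provides.\<close>

lemma evol_pf:
  assumes "finite I" "star \<notin> I"
  shows "evol \<Omega> I (pf I i) (Fl i I)"
  using assms
proof (induction I arbitrary: i rule: finite_psubset_induct)
  case (psubset I)
  show ?case
  proof (cases "I = {}")
    case True
    have eq: "pf {} i = (\<lambda>t x. if i = 0 then 1 else 0)" by (intro ext) (rule pf_empty)
    show ?thesis unfolding True eq by (rule evolution_empty)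
  next
    case False
    then obtain k0 where k0: "k0 \<in> I" by auto
    define J where "J = I - {k0}"
    have J: "I = insert k0 J" "k0 \<notin> J" "finite J" "star \<notin> J" using k0 psubset by (auto simp: J_def)
    define h where "h p t x = block g (snd p) (insert k0 (fst p)) t x * pf (J - fst p) (i - snd p) t x" for p t x
    define G where "G p t k x = (if k \<in> insert k0 (fst p) then pf (J - fst p) (i - snd p) t x *\<^sub>R Phi (snd p) (insert k0 (fst p)) t k x
       else block g (snd p) (insert k0 (fst p)) t x *\<^sub>R Fl (i - snd p) (J - fst p) t k x)" for p t k x
    let ?A = "Pow J \<times> {0..i}"
    have fA: "finite ?A" using J by simp
    have set: "finite (insert k0 U)" "finite (J - U)" "insert k0 U \<union> (J - U) = I" "(J - U) \<union> insert k0 U = I" "insert k0 U \<inter> (J - U) = {}" "(J - U) \<inter> insert k0 U = {}"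
        "star \<notin> insert k0 U" "star \<notin> J - U" "insert k0 U \<noteq> {}" "J - U \<subset> I" if "U \<subseteq> J" for U
      using that J psubset(3) finite_subset[of U J] by auto
    have ev: "evol \<Omega> I (h p) (G p)" and hi: "\<And>t. 0 \<le> t \<Longrightarrow> integrable (Om \<Omega> I) (h p t)"
      and Gi: "\<And>t k. k \<in> I \<Longrightarrow> 0 \<le> t \<Longrightarrow> integrable (Om \<Omega> I) (G p t k)" if p: "p \<in> ?A" for p
    proof -
      obtain U a where pU: "p = (U, a)" "U \<subseteq> J" using p by auto
      note s = set[OF pU(2)]
      have br: "block g a (insert k0 U) t (restrict x (insert k0 U)) = block g a (insert k0 U) t x" for t x
        by (rule block_restrict[OF s(1) order_refl])
      have pr: "pf (J - U) (i - a) t (restrict x (J - U)) = pf (J - U) (i - a) t x" for t x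
        by (rule pf_restrict[OF s(2) order_refl])
      have e: "evol \<Omega> (insert k0 U \<union> (J - U)) (\<lambda>t x. block g a (insert k0 U) t (restrict x (insert k0 U)) * pf (J - U) (i - a) t (restrict x (J - U)))
          (tensor_flux (insert k0 U) (J - U) (\<lambda>t. block g a (insert k0 U) t) (Phi a (insert k0 U)) (pf (J - U) (i - a)) (Fl (i - a) (J - U)))"
      proof (rule evolution_tensor[OF s(1,2,5) evol_block[OF s(1,7,9)] psubset(2)[OF s(10,8)]])
        fix t :: real and k assume t: "0 \<le> t"
        show "integrable (Om \<Omega> (insert k0 U)) (block g a (insert k0 U) t)" by (rule cont_L1_integrable[OF cont_L1_block[OF s(1)] t])
        show "integrable (Om \<Omega> (J - U)) (pf (J - U) (i - a) t)" by (rule cont_L1_integrable[OF cont_L1_pf[OF s(2)] t])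
        show "integrable (Om \<Omega> (insert k0 U)) (Phi a (insert k0 U) t k)" if "k \<in> insert k0 U" by (rule cont_L1_integrable[OF cont_L1_Phi[OF s(1,7) that] t])
        show "integrable (Om \<Omega> (J - U)) (Fl (i - a) (J - U) t k)" if "k \<in> J - U" by (rule cont_L1_integrable[OF cont_L1_Fl[OF s(2,8) that] t])
      qed
      have hp: "h p = (\<lambda>t x. block g a (insert k0 U) t x * pf (J - U) (i - a) t x)" by (intro ext) (simp add: h_def pU)
      show "evol \<Omega> I (h p) (G p)"
        unfolding hp
      proof (rule evolution_flux_cong[OF e[unfolded br pr s(3)]])
        fix t k x assume k: "k \<in> I"
        show "(if k \<in> insert k0 U then pf (J - U) (i - a) t x *\<^sub>R Phi a (insert k0 U) t k (restrict x (insert k0 U)) else block g a (insert k0 U) t x *\<^sub>R Fl (i - a) (J - U) t k (restrict x (J - U))) = G p t k x"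
          unfolding G_def pU fst_conv snd_conv
          using k s(3) Phi_restrict[OF s(1) _ order_refl] Fl_restrict[OF s(2)] by (intro if_cong) auto
      qed
      show "integrable (Om \<Omega> I) (h p t)" if t: "0 \<le> t" for t
      proof -
        have "cont_L1 (Om \<Omega> I) (\<lambda>t x. block g a (insert k0 U) t x *\<^sub>R pf (J - U) (i - a) t x)"
        proof (rule cont_L1_tensor_local[OF psubset(1) s(3,5)])
          show "cont_L1 (Om \<Omega> (insert k0 U)) (block g a (insert k0 U))" by (rule cont_L1_block[OF s(1)])
          show "cont_L1 (Om \<Omega> (J - U)) (pf (J - U) (i - a))" by (rule cont_L1_pf[OF s(2)])
        qed (rule br pr)+
        from cont_L1_integrable[OF this t] show ?thesis by (simp add: hp)
      qed
      show "integrable (Om \<Omega> I) (G p t k)" if k: "k \<in> I" and t: "0 \<le> t" for t k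
      proof (cases "k \<in> insert k0 U")
        case True
        have "cont_L1 (Om \<Omega> I) (\<lambda>t x. pf (J - U) (i - a) t x *\<^sub>R Phi a (insert k0 U) t k x)"
        proof (rule cont_L1_tensor_local[OF psubset(1) s(4,6)])
          show "cont_L1 (Om \<Omega> (J - U)) (pf (J - U) (i - a))" by (rule cont_L1_pf[OF s(2)])
          show "cont_L1 (Om \<Omega> (insert k0 U)) (\<lambda>t. Phi a (insert k0 U) t k)" by (rule cont_L1_Phi[OF s(1,7) True])
          show "Phi a (insert k0 U) t k (restrict x (insert k0 U)) = Phi a (insert k0 U) t k x" for t x by (rule Phi_restrict[OF s(1) True order_refl])
        qed (rule pr)
        from cont_L1_integrable[OF this t] True show ?thesis by (simp add: G_def[abs_def] pU)
      next
        case False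
        then have kU: "k \<in> J - U" using k s(3) by auto
        have "cont_L1 (Om \<Omega> I) (\<lambda>t x. block g a (insert k0 U) t x *\<^sub>R Fl (i - a) (J - U) t k x)"
        proof (rule cont_L1_tensor_local[OF psubset(1) s(3,5)])
          show "cont_L1 (Om \<Omega> (insert k0 U)) (block g a (insert k0 U))" by (rule cont_L1_block[OF s(1)])
          show "cont_L1 (Om \<Omega> (J - U)) (\<lambda>t. Fl (i - a) (J - U) t k)" by (rule cont_L1_Fl[OF s(2,8) kU])
          show "Fl (i - a) (J - U) t k (restrict x (J - U)) = Fl (i - a) (J - U) t k x" for t x by (rule Fl_restrict[OF s(2) kU])
        qed (rule br)
        from cont_L1_integrable[OF this t] False show ?thesis by (simp add: G_def[abs_def] pU)
      qed
    qed
    have S: "evol \<Omega> I (\<lambda>t x. \<Sum>p\<in>?A. h p t x) (\<lambda>t k x. \<Sum>p\<in>?A. G p t k x)"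
      by (rule evolution_sum[OF ev fA heat_kernels_Om[OF psubset(1)] hi Gi])
    have eqh: "(\<lambda>t x. \<Sum>p\<in>?A. h p t x) = pf I i"
      unfolding J(1) by (intro ext) (simp add: pf_insert[OF J(3,2)] h_def sum.cartesian_product split_beta')
    show ?thesis
    proof (rule evolution_flux_cong[OF S[unfolded eqh]])
      fix t k x assume "k \<in> I"
      then show "(\<Sum>p\<in>?A. G p t k x) = Fl i I t k x"
        unfolding J(1) by (subst Fl_insert[OF J(3,2)]) (simp_all only: G_def sum.cartesian_product split_beta')
    qed
  qed
qed

text \<open>The partition sum of the densities is evaluated under the integral over the variable
  \<open>star\<close>: \<open>partsum_H_density\<close> holds at each value of that variable, and
  the factors from the other blocks are constant in it.\<close>

lemma Fl_eq:
  assumes I: "finite I" "star \<notin> I" "k \<in> I" and t: "0 \<le> t"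
  shows "AE x in Om \<Omega> I. Fl i I t k x =
    - H_flux \<Omega> K k (pf (insert star I) i t) x
    + (if i = 0 then 0 else real (card I) *\<^sub>R H_flux \<Omega> K k (pf (insert star I) (i - 1) t) x
         - (\<Sum>l\<in>I. pf I (i - 1) t x *\<^sub>R K (x k) (x l)))"
proof -
  define J where "J = I - {k}"
  have k0: "k \<noteq> star" using I by metis
  have J: "I = insert k J" "k \<notin> J" "finite J" "star \<notin> J" using I by (auto simp: J_def)
  have fD: "finite (insert star I)" using I by simp
  have fU: "finite (insert k U)" "insert k U \<subseteq> I" "star \<notin> insert k U" if "U \<in> Pow J" for U
    using that J k0 finite_subset[of U J] by auto
  have fP: "finite (Pow J)" using J by simp
  have A1: "AE x in Om \<Omega> I. \<forall>U\<in>Pow J. \<forall>a. H_integrable \<Omega> K k (hdens (blk t) a (insert k U) k) x"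
  proof (rule AE_finite_allI[OF fP], unfold AE_all_countable, rule allI)
    fix U a assume U: "U \<in> Pow J"
    note fU = fU[OF U]
    have "AE x in Om \<Omega> (insert k U). H_integrable \<Omega> K k (hdens (blk t) a (insert k U) k) x"
      by (rule H_flux_L1(1)[OF fU(1,3) insertI1 cont_L1_integrable[OF cont_L1_hdens[OF fU(1,3) insertI1] t]])
    from AE_Om_restrict[OF I(1) fU(2) this]
    show "AE x in Om \<Omega> I. H_integrable \<Omega> K k (hdens (blk t) a (insert k U) k) x"
    proof eventually_elim
      case (elim x)
      have "hdens (blk t) a (insert k U) k ((restrict x (insert k U))(star := y)) = hdens (blk t) a (insert k U) k (x(star := y))" for y
        by (rule hdens_cong[OF fU(1) insertI1]) auto
      then show ?case using elim by (simp add: H_integrable_def)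
    qed
  qed
  have A2: "AE x in Om \<Omega> I. \<forall>i. H_integrable \<Omega> K k (pf (insert star I) i t) x"
    unfolding AE_all_countable by (intro allI H_flux_L1(1)[OF I] cont_L1_integrable[OF cont_L1_pf[OF fD] t])
  show ?thesis
    using A1 A2
  proof eventually_elim
    case (elim x)
    let ?H = "\<lambda>F. H_flux \<Omega> K k F x"
    let ?\<gamma> = "\<lambda>z Q. Abs_fps (\<lambda>m. block g m Q t z)"
    have X: "fps_nth (fps_X * (p :: real fps)) i = (if i = 0 then 0 else fps_nth p (i - 1))" for p by simp
    have dens: "(\<Sum>U\<in>Pow J. \<Sum>a\<in>{0..i}. pf (J - U) (i - a) t x * hdens (blk t) a (insert k U) k (x(star := y)))
      = - pf (insert star I) i t (x(star := y)) + (if i = 0 then 0 else real (card I)) * pf (insert star I) (i - 1) t (x(star := y))" for y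
    proof -
      let ?z = "x(star := y)"
      \<comment> \<open>\<open>star\<close> is not in \<open>J - U\<close>, so the insertion of
        \<open>y\<close> does not change the factors that stood outside the integral.\<close>
      have "pf (J - U) a t x = pf (J - U) a t ?z" for U a by (rule pf_cong) (use J in auto)
      then have "(\<Sum>U\<in>Pow J. \<Sum>a\<in>{0..i}. pf (J - U) (i - a) t x * hdens (blk t) a (insert k U) k ?z)
        = (\<Sum>U\<in>Pow J. \<Sum>a\<in>{0..i}. hdens (blk t) a (insert k U) k ?z * pf (J - U) (i - a) t ?z)"
        by (simp add: mult.commute)
      also have "\<dots> = fps_nth (\<Sum>U\<in>Pow J. H_density (?\<gamma> ?z) fps_X (insert k U) k * partsum (?\<gamma> ?z) (J - U)) i"
        by (simp add: fps_sum_nth fps_mult_nth hdens_def pf_def)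
      also have "\<dots> = fps_nth (- partsum (?\<gamma> ?z) (insert star I) + fps_X * (of_nat (card I) * partsum (?\<gamma> ?z) (insert star I))) i"
        unfolding partsum_H_density[OF J(3,2,4) k0] J(1)[symmetric] by (simp add: algebra_simps)
      also have "\<dots> = - pf (insert star I) i t ?z + (if i = 0 then 0 else real (card I)) * pf (insert star I) (i - 1) t ?z"
        unfolding fps_add_nth X fps_nth_of_nat_mult by (simp add: pf_def)
      finally show ?thesis .
    qed
    have v1: "H_value \<Omega> K k x (\<lambda>z. \<Sum>U\<in>Pow J. \<Sum>a\<in>{0..i}. pf (J - U) (i - a) t x * hdens (blk t) a (insert k U) k z)
        (\<Sum>U\<in>Pow J. \<Sum>a\<in>{0..i}. pf (J - U) (i - a) t x *\<^sub>R ?H (hdens (blk t) a (insert k U) k))"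
      using elim(1) by (intro H_value_sum H_value_cmult H_value_base) auto
    have v2: "H_value \<Omega> K k x (\<lambda>z. - pf (insert star I) i t z + (if i = 0 then 0 else real (card I)) * pf (insert star I) (i - 1) t z)
        (- ?H (pf (insert star I) i t) + (if i = 0 then 0 else real (card I)) *\<^sub>R ?H (pf (insert star I) (i - 1) t))"
      using elim(2) by (intro H_value_add H_value_minus H_value_cmult H_value_base) auto
    have Hp: "(\<Sum>U\<in>Pow J. \<Sum>a\<in>{0..i}. pf (J - U) (i - a) t x *\<^sub>R ?H (hdens (blk t) a (insert k U) k))
       = - ?H (pf (insert star I) i t) + (if i = 0 then 0 else real (card I)) *\<^sub>R ?H (pf (insert star I) (i - 1) t)"
    proof -
      have "?H (\<lambda>z. \<Sum>U\<in>Pow J. \<Sum>a\<in>{0..i}. pf (J - U) (i - a) t x * hdens (blk t) a (insert k U) k z)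
        = ?H (\<lambda>z. - pf (insert star I) i t z + (if i = 0 then 0 else real (card I)) * pf (insert star I) (i - 1) t z)"
        unfolding H_flux_def dens ..
      then show ?thesis using v1 v2 unfolding H_value_iff by simp
    qed
    have Sp: "(\<Sum>U\<in>Pow J. \<Sum>a\<in>{0..i}. if l \<in> insert k U then pf (J - U) (i - a) t x * sdens (blk t) a (insert k U) k l x else 0)
       = (if i = 0 then 0 else - pf I (i - 1) t x)" if l: "l \<in> I" for l
    proof -
      have "(\<Sum>U\<in>Pow J. \<Sum>a\<in>{0..i}. if l \<in> insert k U then pf (J - U) (i - a) t x * sdens (blk t) a (insert k U) k l x else 0)
        = (\<Sum>U\<in>Pow J. if l \<in> insert k U then fps_nth (S_density (?\<gamma> x) fps_X (insert k U) k l * partsum (?\<gamma> x) (J - U)) i else 0)"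
      proof (rule sum.cong[OF refl])
        fix U
        have "fps_nth (S_density (?\<gamma> x) fps_X (insert k U) k l * partsum (?\<gamma> x) (J - U)) i = (\<Sum>a\<in>{0..i}. pf (J - U) (i - a) t x * sdens (blk t) a (insert k U) k l x)"
          unfolding fps_mult_nth sdens_def pf_def by (intro sum.cong refl mult.commute)
        then show "(\<Sum>a\<in>{0..i}. if l \<in> insert k U then pf (J - U) (i - a) t x * sdens (blk t) a (insert k U) k l x else 0)
          = (if l \<in> insert k U then fps_nth (S_density (?\<gamma> x) fps_X (insert k U) k l * partsum (?\<gamma> x) (J - U)) i else 0)" by simp
      qed
      also have "\<dots> = fps_nth (- fps_X * partsum (?\<gamma> x) I) i"
      proof (cases "l = k")
        case True
        then have "(\<Sum>U\<in>Pow J. if l \<in> insert k U then fps_nth (S_density (?\<gamma> x) fps_X (insert k U) k l * partsum (?\<gamma> x) (J - U)) i else 0)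
          = fps_nth (\<Sum>U\<in>Pow J. S_density (?\<gamma> x) fps_X (insert k U) k k * partsum (?\<gamma> x) (J - U)) i"
          by (simp add: fps_sum_nth)
        then show ?thesis unfolding partsum_S_density_same[OF J(3,2)] J(1)[symmetric] .
      next
        case False
        \<comment> \<open>Only sets \<open>U\<close> that contain \<open>l\<close> contribute;
          removing \<open>l\<close> from them gives the form of
          \<open>partsum_S_density_other\<close>.\<close>
        define L where "L = J - {l}"
        have L: "J = insert l L" "l \<notin> L" "finite L" "k \<notin> L" using False l J by (auto simp: L_def)
        have "(\<Sum>U\<in>Pow J. if l \<in> insert k U then fps_nth (S_density (?\<gamma> x) fps_X (insert k U) k l * partsum (?\<gamma> x) (J - U)) i else 0)
          = (\<Sum>U\<in>Pow L. 0) + (\<Sum>U\<in>Pow L. fps_nth (S_density (?\<gamma> x) fps_X (insert k (insert l U)) k l * partsum (?\<gamma> x) (L - U)) i)"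
          unfolding L(1) sum_Pow_insert[OF L(3,2)]
        proof (intro arg_cong2[where f = "(+)"] sum.cong refl)
          fix U assume U: "U \<in> Pow L"
          show "(if l \<in> insert k U then fps_nth (S_density (?\<gamma> x) fps_X (insert k U) k l * partsum (?\<gamma> x) (insert l L - U)) i else 0) = 0"
            using U L(2) False by auto
          have "insert l L - insert l U = L - U" using U L(2) by auto
          then show "(if l \<in> insert k (insert l U) then fps_nth (S_density (?\<gamma> x) fps_X (insert k (insert l U)) k l * partsum (?\<gamma> x) (insert l L - insert l U)) i else 0)
            = fps_nth (S_density (?\<gamma> x) fps_X (insert k (insert l U)) k l * partsum (?\<gamma> x) (L - U)) i" by simp
        qed
        also have "\<dots> = fps_nth (\<Sum>U\<in>Pow L. S_density (?\<gamma> x) fps_X (insert k (insert l U)) k l * partsum (?\<gamma> x) (L - U)) i"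
          by (simp add: fps_sum_nth)
        also have "\<dots> = fps_nth (- fps_X * partsum (?\<gamma> x) I) i"
          using partsum_S_density_other[OF L(3,4,2), of "?\<gamma> x" fps_X] False unfolding J(1) L(1) by simp
        finally show ?thesis .
      qed
      also have "\<dots> = (if i = 0 then 0 else - pf I (i - 1) t x)" by (simp add: pf_def)
      finally show ?thesis .
    qed
    have S: "(\<Sum>U\<in>Pow J. \<Sum>a\<in>{0..i}. pf (J - U) (i - a) t x *\<^sub>R (\<Sum>l\<in>insert k U. sdens (blk t) a (insert k U) k l x *\<^sub>R K (x k) (x l)))
       = (\<Sum>l\<in>I. (if i = 0 then 0 else - pf I (i - 1) t x) *\<^sub>R K (x k) (x l))"
    proof -
      let ?c = "\<lambda>U a l. if l \<in> insert k U then pf (J - U) (i - a) t x * sdens (blk t) a (insert k U) k l x else 0"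
      have "(\<Sum>U\<in>Pow J. \<Sum>a\<in>{0..i}. pf (J - U) (i - a) t x *\<^sub>R (\<Sum>l\<in>insert k U. sdens (blk t) a (insert k U) k l x *\<^sub>R K (x k) (x l)))
        = (\<Sum>U\<in>Pow J. \<Sum>a\<in>{0..i}. \<Sum>l\<in>I. ?c U a l *\<^sub>R K (x k) (x l))"
      proof (intro sum.cong refl)
        fix U a assume U: "U \<in> Pow J"
        have "(\<Sum>l\<in>I. ?c U a l *\<^sub>R K (x k) (x l)) = (\<Sum>l\<in>insert k U. ?c U a l *\<^sub>R K (x k) (x l))"
          by (rule sum.mono_neutral_right[OF I(1) fU(2)[OF U]]) auto
        then show "pf (J - U) (i - a) t x *\<^sub>R (\<Sum>l\<in>insert k U. sdens (blk t) a (insert k U) k l x *\<^sub>R K (x k) (x l)) = (\<Sum>l\<in>I. ?c U a l *\<^sub>R K (x k) (x l))"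
          by (simp add: scaleR_sum_right)
      qed
      also have "\<dots> = (\<Sum>U\<in>Pow J. \<Sum>l\<in>I. \<Sum>a\<in>{0..i}. ?c U a l *\<^sub>R K (x k) (x l))"
        by (rule sum.cong[OF refl], rule sum.swap)
      also have "\<dots> = (\<Sum>l\<in>I. \<Sum>U\<in>Pow J. \<Sum>a\<in>{0..i}. ?c U a l *\<^sub>R K (x k) (x l))"
        by (rule sum.swap)
      also have "\<dots> = (\<Sum>l\<in>I. (if i = 0 then 0 else - pf I (i - 1) t x) *\<^sub>R K (x k) (x l))"
        by (rule sum.cong[OF refl]) (simp only: scaleR_sum_left[symmetric] Sp)
      finally show ?thesis .
    qed
    have "Fl i I t k x = (\<Sum>U\<in>Pow J. \<Sum>a\<in>{0..i}. pf (J - U) (i - a) t x *\<^sub>R ?H (hdens (blk t) a (insert k U) k))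
      + (\<Sum>U\<in>Pow J. \<Sum>a\<in>{0..i}. pf (J - U) (i - a) t x *\<^sub>R (\<Sum>l\<in>insert k U. sdens (blk t) a (insert k U) k l x *\<^sub>R K (x k) (x l)))"
      unfolding Fl_def J_def[symmetric] Phi_def scaleR_add_right sum.distrib ..
    then show ?case unfolding Hp S by (simp add: sum_negf)
  qed
qed

end

text \<open>Every partition other than the one into singletons has a block with at least two
  elements, hence a vanishing factor.\<close>

lemma partsum_singletons:
  assumes "finite I" "\<And>P. P \<subseteq> I \<Longrightarrow> 2 \<le> card P \<Longrightarrow> \<gamma> P = 0"
  shows "partsum \<gamma> I = (\<Prod>k\<in>I. \<gamma> {k})"
  using assms
proof (induction I rule: finite_induct)
  case (insert k J)
  have z: "\<gamma> (insert k U) * partsum \<gamma> (J - U) = 0" if U: "U \<in> Pow J" "U \<noteq> {}" for U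
  proof -
    have fU: "finite U" using U insert(1) finite_subset by auto
    have "2 \<le> card (insert k U)" using U insert(2) fU by (subst card_insert_disjoint) (auto simp: Suc_le_eq card_gt_0_iff)
    moreover have "insert k U \<subseteq> insert k J" using U by auto
    ultimately have "\<gamma> (insert k U) = 0" by (intro insert.prems)
    then show ?thesis by simp
  qed
  have "partsum \<gamma> (insert k J) = (\<Sum>U\<in>Pow J. \<gamma> (insert k U) * partsum \<gamma> (J - U))"
    by (rule partsum_insert[OF insert(1,2)])
  also have "\<dots> = (\<Sum>U\<in>{{}}. \<gamma> (insert k U) * partsum \<gamma> (J - U))"
    by (rule sum.mono_neutral_right) (use insert(1) z in auto)
  also have "\<dots> = (\<Prod>k\<in>insert k J. \<gamma> {k})"
    using insert.IH insert.prems insert(1,2) by (simp add: subset_insertI2)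
  finally show ?case .
qed simp

lemma fps_nth_partsum_0: "fps_nth (partsum \<gamma> I) 0 = partsum (\<lambda>Q. fps_nth (\<gamma> Q) 0) I"
proof -
  have "fps_nth (prod \<gamma> \<pi>) 0 = (\<Prod>P\<in>\<pi>. fps_nth (\<gamma> P) 0)" for \<pi>
    by (induction \<pi> rule: infinite_finite_induct) auto
  then show ?thesis by (simp add: partsum_def fps_sum_nth)
qed

section \<open>Exchangeability, the equation for \<open>f\<close>, and initial data\<close>

context hierarchy
begin

lemma f_family_eq: "f_family g i j t x = pf {1..j} i t x"
proof -
  have "fps_nth (\<Prod>P\<in>\<pi>. Abs_fps (\<lambda>m. block g m P t x)) i = (\<Sum>a\<in>{a \<in> \<pi> \<rightarrow>\<^sub>E UNIV. (\<Sum>P\<in>\<pi>. a P) = i}. \<Prod>P\<in>\<pi>. block g (a P) P t x)"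
    if "partition_on {1..j} \<pi>" for \<pi>
    by (rule fps_nth_prod_Abs) (rule finite_elements[OF _ that], simp)
  then show ?thesis by (simp add: f_family_def pf_def partsum_def fps_sum_nth)
qed

text \<open>Two enumerations of the same set differ by a permutation of \<open>{1..card P}\<close>,
  to which exchangeability applies.\<close>

lemma block_permuted:
  assumes P: "finite P" "P \<noteq> {}" and e: "bij_betw e {1..card P} P" and t: "0 \<le> t"
  shows "AE u in Om \<Omega> P. g m (card P) t (reindex {1..card P} e u) = block g m P t u"
proof -
  let ?I = "{1..card P}"
  have b: "bij_betw (enum P) ?I P" by (rule bij_enum[OF P(1)])
  define \<sigma> where "\<sigma> i = (if i \<in> ?I then inv_into ?I (enum P) (e i) else i)" for i
  have "bij_betw (inv_into ?I (enum P) \<circ> e) ?I ?I" by (rule bij_betw_trans[OF e bij_betw_inv_into[OF b]])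
  then have "bij_betw \<sigma> ?I ?I" by (rule bij_betw_cong[THEN iffD1, rotated]) (simp add: \<sigma>_def)
  then have perm: "\<sigma> permutes ?I" by (rule bij_imp_permutes) (auto simp: \<sigma>_def)
  have eq: "reindex ?I (enum P) u \<circ> \<sigma> = reindex ?I e u" for u :: "nat \<Rightarrow> real^'d"
  proof (rule ext)
    fix i
    show "(reindex ?I (enum P) u \<circ> \<sigma>) i = reindex ?I e u i"
    proof (cases "i \<in> ?I")
      case True
      have "e i \<in> enum P ` ?I" using b bij_betwE[OF e] True unfolding bij_betw_def by blast
      then have "enum P (\<sigma> i) = e i" using True by (simp add: \<sigma>_def f_inv_into_f del: atLeastAtMost_iff)
      moreover have "\<sigma> i \<in> ?I" using permutes_in_image[OF perm] True by blast
      ultimately show ?thesis using True by simp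
    next
      case False
      then have "\<sigma> i = i" by (simp only: \<sigma>_def if_False)
      then show ?thesis using False by (simp only: comp_apply restrict_apply if_False)
    qed
  qed
  have "AE y in Om \<Omega> ?I. g m (card P) t (y \<circ> \<sigma>) = g m (card P) t y"
    by (rule g_exchangeable[OF card_pos[OF P] t perm])
  from AE_reindex[OF finite_atLeastAtMost b this]
  show ?thesis unfolding eq by (simp add: block_eq[OF P(2)])
qed

text \<open>The theorem integrates out the variable \<open>j + 1\<close>, the hierarchy the variable
  \<open>star\<close>. The former label comes last in the order and the latter first, so the
  arguments of a block get permuted. This is where exchangeability enters, and why the identity
  holds only almost everywhere.\<close>

lemma block_relabel:
  assumes W: "finite W" "star \<notin> W" "n \<notin> W" and t: "0 \<le> t"
  shows "AE z in Om \<Omega> (insert star W). block g m (insert n W) t (z(n := z star)) = block g m (insert star W) t z"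
proof -
  define \<kappa> where "\<kappa> p = (if p = n then star else p)" for p
  have c: "card (insert n W) = card (insert star W)" using W by simp
  have k: "bij_betw \<kappa> (insert n W) (insert star W)"
  proof -
    have "0 < p" if "p \<in> W" for p using W(2) that by (metis gr0I)
    then show ?thesis using W(3) by (auto simp: \<kappa>_def bij_betw_def inj_on_def image_def)
  qed
  have b: "bij_betw (\<kappa> \<circ> enum (insert n W)) {1..card (insert star W)} (insert star W)"
    using bij_betw_trans[OF bij_enum k] W c by simp
  have z: "(z(n := z star)) p = z (\<kappa> p)" for p and z :: "nat \<Rightarrow> real^'d" by (simp add: \<kappa>_def)
  have "block g m (insert n W) t (z(n := z star)) = g m (card (insert star W)) t (reindex {1..card (insert star W)} (\<kappa> \<circ> enum (insert n W)) z)" for z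
    unfolding block_eq[OF insert_not_empty] c z comp_def ..
  then show ?thesis using block_permuted[OF _ insert_not_empty b t, of m] W by simp
qed

lemma pf_relabel:
  assumes I: "finite I" "star \<notin> I" "n \<notin> I" and t: "0 \<le> t"
  shows "AE z in Om \<Omega> (insert star I). pf (insert n I) i t (z(n := z star)) = pf (insert star I) i t z"
proof -
  have fD: "finite (insert star I)" and fP: "finite (Pow I)" using I by auto
  have "AE z in Om \<Omega> (insert star I). \<forall>W\<in>Pow I. \<forall>m. block g m (insert n W) t (z(n := z star)) = block g m (insert star W) t z"
  proof (rule AE_finite_allI[OF fP], unfold AE_all_countable, rule allI)
    fix W m assume W: "W \<in> Pow I"
    have fW: "finite W" "star \<notin> W" "n \<notin> W" using W I finite_subset by auto
    from AE_Om_restrict[OF fD _ block_relabel[OF fW t, of m]] W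
    have "AE z in Om \<Omega> (insert star I). block g m (insert n W) t ((restrict z (insert star W))(n := restrict z (insert star W) star)) = block g m (insert star W) t (restrict z (insert star W))"
      by auto
    then show "AE z in Om \<Omega> (insert star I). block g m (insert n W) t (z(n := z star)) = block g m (insert star W) t z"
    proof eventually_elim
      case (elim z)
      have "block g m (insert n W) t ((restrict z (insert star W))(n := restrict z (insert star W) star)) = block g m (insert n W) t (z(n := z star))"
        by (rule block_cong) (use fW in auto)
      moreover have "block g m (insert star W) t (restrict z (insert star W)) = block g m (insert star W) t z"
        by (rule block_restrict) (use fW in auto)
      ultimately show ?case using elim by simp
    qed
  qed
  then show ?thesis
  proof eventually_elim
    case (elim z)
    have p: "pf (I - U) a t (z(n := z star)) = pf (I - U) a t z" for U a
      by (rule pf_cong) (use I in auto)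
    show ?case
      unfolding pf_insert[OF I(1,3)] pf_insert[OF I(1,2)] p
      by (intro sum.cong refl) (simp add: elim)
  qed
qed

lemma H_flux_relabel:
  assumes I: "finite I" "star \<notin> I" "n \<notin> I" "k \<in> I" and t: "0 \<le> t"
  shows "AE x in Om \<Omega> I. H_flux \<Omega> K k (pf (insert star I) i t) x = (\<integral>y. pf (insert n I) i t (x(n := y)) *\<^sub>R K (x k) y \<partial>omega \<Omega>)"
    and "integrable (Om \<Omega> I) (\<lambda>x. \<integral>y. pf (insert n I) i t (x(n := y)) *\<^sub>R K (x k) y \<partial>omega \<Omega>)"
proof -
  have kn: "k \<noteq> n" using I by metis
  have p: "integrable (Om \<Omega> (insert m I)) (pf (insert m I) i t)" for m
    by (rule cont_L1_integrable[OF cont_L1_pf t]) (use I in simp)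
  note V = integrable_mult_K(1)[OF I(1,4) p[of n]]
  show "integrable (Om \<Omega> I) (\<lambda>x. \<integral>y. pf (insert n I) i t (x(n := y)) *\<^sub>R K (x k) y \<partial>omega \<Omega>)"
    using integrable_Om_insert(2)[OF I(1,3) V] kn by simp
  have A1: "AE x in Om \<Omega> I. integrable (omega \<Omega>) (\<lambda>y. pf (insert n I) i t (x(n := y)) *\<^sub>R K (x k) y)"
    using integrable_Om_insert(1)[OF I(1,3) V] kn by simp
  show "AE x in Om \<Omega> I. H_flux \<Omega> K k (pf (insert star I) i t) x = (\<integral>y. pf (insert n I) i t (x(n := y)) *\<^sub>R K (x k) y \<partial>omega \<Omega>)"
    using A1 H_flux_L1(1)[OF I(1,2,4) p] AE_Om_insert[OF I(1,2) pf_relabel[OF I(1-3) t, of i]]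
  proof eventually_elim
    case (elim x)
    have e: "pf (insert n I) i t ((x(star := y))(n := (x(star := y)) star)) = pf (insert n I) i t (x(n := y))" for y
      by (rule pf_cong) (use I in auto)
    show ?case unfolding H_flux_def
    proof (rule integral_cong_AE)
      show "AE y in omega \<Omega>. pf (insert star I) i t (x(star := y)) *\<^sub>R K (x k) y = pf (insert n I) i t (x(n := y)) *\<^sub>R K (x k) y"
        using elim(3) unfolding e by eventually_elim simp
    qed (use elim in \<open>auto simp: H_integrable_def\<close>)
  qed
qed

theorem f_family_mild:
  assumes j: "1 \<le> j"
  shows "mild_solution \<Omega> j (f_family g i j)
        (\<lambda>t k x.
           - (\<integral>y. f_family g i (j + 1) t (x(j + 1 := y)) *\<^sub>R K (x k) y \<partial>omega \<Omega>)
           - (\<Sum>l\<in>{1..j}. f_pred g i j t x *\<^sub>R K (x k) (x l))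
           + real j *\<^sub>R (\<integral>y. f_pred g i (j + 1) t (x(j + 1 := y)) *\<^sub>R K (x k) y \<partial>omega \<Omega>))"
proof -
  let ?I = "{1..j}" and ?n = "j + 1"
  have I: "finite ?I" "star \<notin> ?I" "?n \<notin> ?I" by auto
  have In: "{1..?n} = insert ?n ?I" by auto
  interpret H: heat_kernels "Om \<Omega> ?I :: (nat \<Rightarrow> real^'d) measure" "hk \<Omega> ?I" "ghk \<Omega> ?I" "?I" "2 powr (real CARD('d) / 2)"
    by (rule heat_kernels_Om) simp
  let ?E = "\<lambda>i t k x. \<integral>y. pf (insert ?n ?I) i t (x(?n := y)) *\<^sub>R K (x k) y \<partial>omega \<Omega>"
  define T where "T t k x = - ?E i t k x + (if i = 0 then 0 else real j *\<^sub>R ?E (i - 1) t k x - (\<Sum>l\<in>?I. pf ?I (i - 1) t x *\<^sub>R K (x k) (x l)))" for t k x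
  have T: "(\<lambda>t k x.
           - (\<integral>y. f_family g i (j + 1) t (x(j + 1 := y)) *\<^sub>R K (x k) y \<partial>omega \<Omega>)
           - (\<Sum>l\<in>{1..j}. f_pred g i j t x *\<^sub>R K (x k) (x l))
           + real j *\<^sub>R (\<integral>y. f_pred g i (j + 1) t (x(j + 1 := y)) *\<^sub>R K (x k) y \<partial>omega \<Omega>)) = T"
    unfolding T_def f_pred_def f_family_eq In by (intro ext) (cases "i = 0"; simp add: algebra_simps)
  have iT: "integrable (Om \<Omega> ?I) (T t k)" if k: "k \<in> ?I" and t: "0 \<le> t" for t k
  proof -
    have S: "integrable (Om \<Omega> ?I) (\<lambda>x. pf ?I (i - 1) t x *\<^sub>R K (x k) (x l))" if "l \<in> ?I" for l
      by (rule cont_L1_integrable[OF cont_L1_S_flux[OF I(1) k that cont_L1_pf[OF I(1)]] t])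
    note E = H_flux_relabel(2)[OF I k t]
    show ?thesis
    proof (cases "i = 0")
      case True
      have "T t k = (\<lambda>x. - ?E i t k x)" by (rule ext) (simp add: T_def True)
      then show ?thesis by (simp only: Bochner_Integration.integrable_minus[OF E])
    next
      case False
      have "T t k = (\<lambda>x. - ?E i t k x + (real j *\<^sub>R ?E (i - 1) t k x - (\<Sum>l\<in>?I. pf ?I (i - 1) t x *\<^sub>R K (x k) (x l))))"
        by (rule ext) (simp only: T_def False if_False)
      moreover have "integrable (Om \<Omega> ?I) \<dots>"
        by (rule Bochner_Integration.integrable_add[OF Bochner_Integration.integrable_minus[OF E]
              Bochner_Integration.integrable_diff[OF integrable_scaleR_right[OF E] Bochner_Integration.integrable_sum[OF S]]])
      ultimately show ?thesis by simp
    qed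
  qed
  \<comment> \<open>\<open>Fl_eq\<close> yields integrals over the variable \<open>star\<close>;
    relabelling turns them into integrals over the variable \<open>j + 1\<close>.\<close>
  have aT: "AE x in Om \<Omega> ?I. Fl i ?I t k x = T t k x" if k: "k \<in> ?I" and t: "0 \<le> t" for t k
    using Fl_eq[OF I(1,2) k t, of i] H_flux_relabel(1)[OF I k t, of i] H_flux_relabel(1)[OF I k t, of "i - 1"]
    by eventually_elim (simp only: T_def card_atLeastAtMost diff_Suc_1 add_diff_cancel_right' Suc_eq_plus1)
  have hf: "f_family g i j = pf ?I i" by (intro ext) (rule f_family_eq)
  show ?thesis
    unfolding T hf mild_solution_iff
  proof (intro conjI allI impI ballI)
    show "integrable (Om \<Omega> ?I) (pf ?I i t)" if "0 \<le> t" for t by (rule cont_L1_integrable[OF cont_L1_pf[OF I(1)] that])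
    show "integrable (Om \<Omega> ?I) (T t k)" if "0 \<le> t" "k \<in> ?I" for t k by (rule iT[OF that(2,1)])
    fix t :: real assume t: "0 < t"
    have "AE x in Om \<Omega> ?I. duhamel_eq (Om \<Omega> ?I) (hk \<Omega> ?I) (ghk \<Omega> ?I) ?I (pf ?I i) (Fl i ?I) t x"
      by (rule H.evolution_imp_mild[OF cont_L1_Fl[OF I(1,2)] evol_pf[OF I(1,2)] t])
    then show "AE x in Om \<Omega> ?I. duhamel_eq (Om \<Omega> ?I) (hk \<Omega> ?I) (ghk \<Omega> ?I) ?I (pf ?I i) T t x"
      using AE_space
    proof eventually_elim
      case (elim x)
      show ?case
        by (rule H.duhamel_eq_cong_AE[OF _ _ _ elim(2,1)])
          (intro cont_L1_integrable[OF cont_L1_Fl[OF I(1,2)]] iT aT; assumption)+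
    qed
  qed
qed

lemma enum_singleton [simp]: "enum {k} (Suc 0) = k"
  by (simp add: enum_def)

text \<open>At time 0 the only nonzero blocks are singletons of order 0, so the power series of the
  blocks are constants and only the partition into singletons survives.\<close>

lemma pf_initial:
  assumes I: "finite I"
  shows "AE x in Om \<Omega> I. pf I i 0 x = (if i = 0 then (\<Prod>k\<in>I. f (x k)) else 0)"
proof -
  have fP: "finite (Pow I - {{}})" using I by simp
  have "AE x in Om \<Omega> I. \<forall>P\<in>Pow I - {{}}. \<forall>m. block g m P 0 x = (if m = 0 \<and> card P = 1 then f (x (enum P 1)) else 0)"
  proof (rule AE_finite_allI[OF fP], unfold AE_all_countable, rule allI)
    fix P m assume "P \<in> Pow I - {{}}"
    then have P: "P \<subseteq> I" "P \<noteq> {}" by auto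
    then have fP: "finite P" using I finite_subset by auto
    have "AE x in Om \<Omega> P. block g m P 0 x = (if m = 0 \<and> card P = 1 then f (reindex {1..card P} (enum P) x 1) else 0)"
      using block_AE[OF fP P(2), of "\<lambda>x v. v = (if m = 0 \<and> card P = 1 then f (x 1) else 0)" m 0] g_initial[OF card_pos[OF fP P(2)], of m]
      by blast
    from AE_Om_restrict[OF I P(1) this]
    show "AE x in Om \<Omega> I. block g m P 0 x = (if m = 0 \<and> card P = 1 then f (x (enum P 1)) else 0)"
    proof eventually_elim
      case (elim x)
      have "restrict x P (enum P 1) = x (enum P 1)" if "card P = 1"
        using bij_betwE[OF bij_enum[OF fP]] that by auto
      then show ?case using elim by (auto simp: block_restrict[OF fP order_refl])
    qed
  qed
  then show ?thesis
  proof eventually_elim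
    case (elim x)
    let ?\<gamma> = "\<lambda>Q. Abs_fps (\<lambda>m. block g m Q 0 x)"
    have z: "?\<gamma> P = 0" if "P \<subseteq> I" "2 \<le> card P" for P
    proof -
      have "P \<noteq> {}" using that by auto
      then show ?thesis using elim[rule_format, of P] that by (auto simp: fps_eq_iff)
    qed
    have s: "?\<gamma> {k} = fps_const (f (x k))" if "k \<in> I" for k
      using elim[rule_format, of "{k}"] that by (auto simp: fps_eq_iff)
    have "partsum ?\<gamma> I = (\<Prod>k\<in>I. ?\<gamma> {k})" by (rule partsum_singletons[OF I z])
    also have "\<dots> = (\<Prod>k\<in>I. fps_const (f (x k)))" by (rule prod.cong[OF refl s])
    also have "\<dots> = fps_const (\<Prod>k\<in>I. f (x k))"
      using I by (induction I rule: finite_induct) auto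
    finally show ?case by (simp add: pf_def)
  qed
qed

definition rho :: "real \<Rightarrow> real^'d \<Rightarrow> real" where
  "rho t y = g 0 1 t (\<lambda>n\<in>{1..1}. y)"

lemma block_singleton: "block g 0 {k} t x = rho t (x k)"
proof -
  have "reindex {1..1} (enum {k}) x = (\<lambda>n\<in>{1..1}. x k)" by (auto simp: fun_eq_iff)
  then show ?thesis by (simp add: block_eq rho_def)
qed

text \<open>Order 0 of a product involves only blocks of order 0, and those with two or more labels
  vanish.\<close>

lemma pf_zero_product:
  assumes I: "finite I" and t: "0 \<le> t"
  shows "AE x in Om \<Omega> I. pf I 0 t x = (\<Prod>k\<in>I. rho t (x k))"
proof -
  have f2: "finite {P. P \<subseteq> I \<and> 2 \<le> card P}" using I by simp
  have "AE x in Om \<Omega> I. \<forall>P\<in>{P. P \<subseteq> I \<and> 2 \<le> card P}. block g 0 P t x = 0"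
  proof (rule AE_finite_allI[OF f2])
    fix P assume P: "P \<in> {P. P \<subseteq> I \<and> 2 \<le> card P}"
    then have fP: "finite P" using I finite_subset by auto
    have "AE x in Om \<Omega> P. block g 0 P t x = 0" by (rule block_zero[OF fP _ t]) (use P in simp)
    from AE_Om_restrict[OF I _ this] P
    show "AE x in Om \<Omega> I. block g 0 P t x = 0" by (simp add: block_restrict[OF fP order_refl])
  qed
  then show ?thesis
  proof eventually_elim
    case (elim x)
    have "pf I 0 t x = partsum (\<lambda>Q. block g 0 Q t x) I" by (simp add: pf_def fps_nth_partsum_0)
    also have "\<dots> = (\<Prod>k\<in>I. block g 0 {k} t x)" by (rule partsum_singletons[OF I]) (use elim in auto)
    finally show ?case by (simp add: block_singleton)
  qed
qed

end

subsection \<open>The McKean--Vlasov equation\<close>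

text \<open>The argument advances by steps of fixed length: if \<open>\<phi>\<close> vanishes up to
  \<open>a\<close>, then its maximum on the next interval is at most half of itself, hence
  0.\<close>

lemma short_time_Gronwall:
  fixes \<phi> :: "real \<Rightarrow> real"
  assumes cont: "continuous_on {0..} \<phi>" and zero: "\<phi> 0 = 0" and pos: "\<And>t. 0 \<le> \<phi> t" and c: "0 \<le> c" and T: "0 \<le> T"
    and step: "\<And>a t m. 0 \<le> a \<Longrightarrow> a \<le> t \<Longrightarrow> 0 < t \<Longrightarrow> t \<le> T \<Longrightarrow> 0 \<le> m \<Longrightarrow>
      (\<And>s. s \<in> {0..<t} \<Longrightarrow> \<phi> s \<le> (if s < a then 0 else m)) \<Longrightarrow> \<phi> t \<le> c * m * sqrt (t - a)"
  shows "\<phi> T = 0"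
proof -
  \<comment> \<open>Chosen such that \<open>c * sqrt \<delta> \<le> 1 / 2\<close>; the summand 2
    keeps the denominator positive when \<open>c = 0\<close>.\<close>
  define \<delta> where "\<delta> = (1 / (2 * c + 2))\<^sup>2"
  have \<delta>: "0 < \<delta>" "c * sqrt \<delta> \<le> 1 / 2" using c by (auto simp: \<delta>_def real_sqrt_divide real_sqrt_abs divide_simps)
  have "\<forall>s\<in>{0..min (real n * \<delta>) T}. \<phi> s = 0" for n
  proof (induction n)
    case 0
    then show ?case using zero by auto
  next
    case (Suc n)
    define a where "a = min (real n * \<delta>) T"
    define b where "b = min (real (Suc n) * \<delta>) T"
    have ab: "0 \<le> a" "a \<le> b" "b \<le> T" "b - a \<le> \<delta>" using \<delta> T by (auto simp: a_def b_def algebra_simps min_def)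
    have z: "\<phi> s = 0" if "0 \<le> s" "s \<le> a" for s using Suc that by (auto simp: a_def)
    have "continuous_on {a..b} \<phi>" by (rule continuous_on_subset[OF cont]) (use ab in auto)
    \<comment> \<open>At the point \<open>u\<close> of the maximum, the bound \<open>m\<close> in
      \<open>step\<close> can be taken to be \<open>\<phi> u\<close> itself.\<close>
    then obtain u where u: "u \<in> {a..b}" "\<And>s. s \<in> {a..b} \<Longrightarrow> \<phi> s \<le> \<phi> u"
      using continuous_attains_sup[of "{a..b}" \<phi>] ab by auto
    have "\<phi> u = 0"
    proof (cases "u = 0")
      case False
      then have u0: "0 < u" using u(1) ab by auto
      have "\<phi> u \<le> c * \<phi> u * sqrt (u - a)"
      proof (rule step)
        show "\<phi> s \<le> (if s < a then 0 else \<phi> u)" if "s \<in> {0..<u}" for s using that u z[of s] by auto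
      qed (use u ab u0 pos in auto)
      also have "\<dots> \<le> c * \<phi> u * sqrt \<delta>" by (rule mult_left_mono) (use u ab c pos[of u] in auto)
      also have "\<dots> = \<phi> u * (c * sqrt \<delta>)" by simp
      also have "\<dots> \<le> \<phi> u * (1 / 2)" by (rule mult_left_mono[OF \<delta>(2) pos])
      finally show ?thesis using pos[of u] by simp
    qed (use zero in simp)
    show ?case
    proof
      fix s assume "s \<in> {0..min (real (Suc n) * \<delta>) T}"
      then have "0 \<le> s" "s \<le> b" by (auto simp: b_def)
      then show "\<phi> s = 0" using z[of s] u(2)[of s] \<open>\<phi> u = 0\<close> pos[of s] by (cases "s \<le> a") auto
    qed
  qed
  moreover obtain n where "T < real n * \<delta>" using reals_Archimedean3[OF \<delta>(1)] by blast
  ultimately show ?thesis using T by (metis atLeastAtMost_iff less_imp_le min.absorb2 order_refl)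
qed

lemma AE_Om_singleton:
  fixes \<phi> :: "real^'d \<Rightarrow> bool"
  assumes "AE x in Om \<Omega> {i}. \<phi> (x i)"
  shows "AE y in omega \<Omega>. \<phi> y"
proof -
  have m: "(\<lambda>y. \<lambda>i\<in>{i}. y) \<in> omega \<Omega> \<rightarrow>\<^sub>M (Om \<Omega> {i} :: (nat \<Rightarrow> real^'d) measure)"
    by (intro measurable_restrict) simp
  have "AE y in omega \<Omega>. \<phi> ((\<lambda>i\<in>{i}. y) i)"
    by (rule AE_distrD[OF m]) (simp only: product_sigma_finite.distr_component[OF product_sigma_finite_omega] assms)
  then show ?thesis by simp
qed

lemma cont_L1_shift_label:
  fixes \<rho> :: "real \<Rightarrow> real^'d \<Rightarrow> real"
  assumes "cont_L1 (Om \<Omega> {i}) (\<lambda>t x. \<rho> t (x i))"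
  shows "cont_L1 (Om \<Omega> {j}) (\<lambda>t x. \<rho> t (x j))"
  using cont_L1_reindex[OF _ _ assms, of "\<lambda>_. j" "{j}"] by (simp add: bij_betw_def)

lemma tensor_pair:
  fixes u v :: "real^'d \<Rightarrow> real"
  assumes u: "integrable (Om \<Omega> {i}) (\<lambda>x. u (x i))" and v: "integrable (Om \<Omega> {i}) (\<lambda>x. v (x i))" and ij: "i \<noteq> j"
  shows "integrable (Om \<Omega> (insert j {i})) (\<lambda>z. u (z i) * v (z j))"
    and "(\<integral>z. u (z i) * v (z j) \<partial>Om \<Omega> (insert j {i})) = (\<integral>x. u (x i) \<partial>Om \<Omega> {i}) * (\<integral>x. v (x i) \<partial>Om \<Omega> {i})"
proof -
  have b: "bij_betw (\<lambda>_. j) {i} {j}" by (simp add: bij_betw_def)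
  have v': "integrable (Om \<Omega> {j}) (\<lambda>x. v (x j))" "(\<integral>x. v (x j) \<partial>Om \<Omega> {j}) = (\<integral>x. v (x i) \<partial>Om \<Omega> {i})"
    using integrable_reindex[OF _ b v] by simp_all
  have e: "{i} \<union> {j} = insert j {i}" by auto
  have d: "{i} \<inter> {j} = {}" using ij by auto
  note tn = tensor[OF finite.insertI[OF finite.emptyI] finite.insertI[OF finite.emptyI] d u v'(1)]
  show "integrable (Om \<Omega> (insert j {i})) (\<lambda>z. u (z i) * v (z j))" using tn(1) unfolding e by simp
  show "(\<integral>z. u (z i) * v (z j) \<partial>Om \<Omega> (insert j {i})) = (\<integral>x. u (x i) \<partial>Om \<Omega> {i}) * (\<integral>x. v (x i) \<partial>Om \<Omega> {i})"
    using tn(2) unfolding e v'(2) by simp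
qed

section \<open>The McKean-Vlasov flux as a two-particle flux, and uniqueness\<close>

context bounded_interaction
begin

text \<open>The nonlinear flux of the McKean-Vlasov equation is, up to sign, the interaction flux of
  this tensor square, so \<open>H_flux\<close> and its estimates apply.\<close>

definition pair_density :: "(real \<Rightarrow> real^'d \<Rightarrow> real) \<Rightarrow> real \<Rightarrow> (nat \<Rightarrow> real^'d) \<Rightarrow> real" where
  "pair_density \<rho> t z = \<rho> t (z 1) * \<rho> t (z star)"

lemma H_flux_pair_density:
  "H_flux \<Omega> K 1 (pair_density \<rho> t) x = \<rho> t (x 1) *\<^sub>R (\<integral>y. \<rho> t y *\<^sub>R K (x 1) y \<partial>omega \<Omega>)"
  by (simp add: H_flux_def pair_density_def flip: scaleR_scaleR)

lemma cont_L1_pair_density: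
  assumes "cont_L1 (Om \<Omega> {1}) (\<lambda>t x. \<rho> t (x 1))"
  shows "cont_L1 (Om \<Omega> (insert star {1})) (pair_density \<rho>)"
proof -
  have "cont_L1 (Om \<Omega> (insert star {1})) (\<lambda>t z. \<rho> t (z 1) *\<^sub>R \<rho> t (z star))"
    by (rule cont_L1_tensor_local[OF _ _ _ assms cont_L1_shift_label[OF assms]]) auto
  then show ?thesis by (simp add: pair_density_def[abs_def])
qed

text \<open>The tensor square is locally Lipschitz in \<open>L1\<close>; one factor is changed at a
  time.\<close>

lemma pair_density_diff_L1:
  assumes \<rho>: "integrable (Om \<Omega> {1}) (\<lambda>x. \<rho> t (x 1))" and \<rho>': "integrable (Om \<Omega> {1}) (\<lambda>x. \<rho>' t (x 1))"
  shows "(\<integral>z. norm (pair_density \<rho> t z - pair_density \<rho>' t z) \<partial>Om \<Omega> (insert star {1}))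
    \<le> (\<integral>x. \<bar>\<rho> t (x 1) - \<rho>' t (x 1)\<bar> \<partial>Om \<Omega> {1}) * ((\<integral>x. norm (\<rho> t (x 1)) \<partial>Om \<Omega> {1}) + (\<integral>x. norm (\<rho>' t (x 1)) \<partial>Om \<Omega> {1}))"
proof -
  have n: "(1::nat) \<noteq> star" by simp
  have d: "integrable (Om \<Omega> {1}) (\<lambda>x. \<bar>\<rho> t (x 1) - \<rho>' t (x 1)\<bar>)"
    by (intro integrable_abs Bochner_Integration.integrable_diff \<rho> \<rho>')
  note A = tensor_pair[OF d integrable_norm[OF \<rho>] n]
  note A' = tensor_pair[OF integrable_norm[OF \<rho>'] d n]
  have p: "integrable (Om \<Omega> (insert star {1})) (pair_density \<rho> t)" "integrable (Om \<Omega> (insert star {1})) (pair_density \<rho>' t)"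
    unfolding pair_density_def[abs_def] by (rule tensor_pair(1)[OF \<rho> \<rho> n] tensor_pair(1)[OF \<rho>' \<rho>' n])+
  have "(\<integral>z. norm (pair_density \<rho> t z - pair_density \<rho>' t z) \<partial>Om \<Omega> (insert star {1}))
    \<le> (\<integral>z. \<bar>\<rho> t (z 1) - \<rho>' t (z 1)\<bar> * norm (\<rho> t (z star)) + norm (\<rho>' t (z 1)) * \<bar>\<rho> t (z star) - \<rho>' t (z star)\<bar> \<partial>Om \<Omega> (insert star {1}))"
  proof (rule integral_mono)
    show "norm (pair_density \<rho> t z - pair_density \<rho>' t z)
      \<le> \<bar>\<rho> t (z 1) - \<rho>' t (z 1)\<bar> * norm (\<rho> t (z star)) + norm (\<rho>' t (z 1)) * \<bar>\<rho> t (z star) - \<rho>' t (z star)\<bar>" for z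
    proof -
      have "pair_density \<rho> t z - pair_density \<rho>' t z = (\<rho> t (z 1) - \<rho>' t (z 1)) * \<rho> t (z star) + \<rho>' t (z 1) * (\<rho> t (z star) - \<rho>' t (z star))"
        by (simp add: pair_density_def algebra_simps)
      then show ?thesis using norm_triangle_ineq by (metis abs_mult real_norm_def)
    qed
    show "integrable (Om \<Omega> (insert star {1})) (\<lambda>z. norm (pair_density \<rho> t z - pair_density \<rho>' t z))"
      by (intro integrable_norm Bochner_Integration.integrable_diff p)
    show "integrable (Om \<Omega> (insert star {1})) (\<lambda>z. \<bar>\<rho> t (z 1) - \<rho>' t (z 1)\<bar> * norm (\<rho> t (z star)) + norm (\<rho>' t (z 1)) * \<bar>\<rho> t (z star) - \<rho>' t (z star)\<bar>)"
      by (rule Bochner_Integration.integrable_add[OF A(1) A'(1)])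
  qed
  also have "\<dots> = (\<integral>x. \<bar>\<rho> t (x 1) - \<rho>' t (x 1)\<bar> \<partial>Om \<Omega> {1}) * (\<integral>x. norm (\<rho> t (x 1)) \<partial>Om \<Omega> {1})
      + (\<integral>x. norm (\<rho>' t (x 1)) \<partial>Om \<Omega> {1}) * (\<integral>x. \<bar>\<rho> t (x 1) - \<rho>' t (x 1)\<bar> \<partial>Om \<Omega> {1})"
    unfolding Bochner_Integration.integral_add[OF A(1) A'(1)] A(2) A'(2) ..
  finally show ?thesis by (simp only: distrib_left mult.commute[of "\<integral>x. norm (\<rho>' t (x 1)) \<partial>Om \<Omega> {1}"])
qed

lemma McKean_Vlasov_iff:
  "McKean_Vlasov_solution \<Omega> K f \<rho> \<longleftrightarrow>
     cont_L1 (Om \<Omega> {1}) (\<lambda>t x. \<rho> t (x 1)) \<and> (AE x in omega \<Omega>. \<rho> 0 x = f x) \<and>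
     (\<forall>t>0. AE x in Om \<Omega> {1}. duhamel_eq (Om \<Omega> {1}) (hk \<Omega> {1}) (ghk \<Omega> {1}) {1} (\<lambda>t x. \<rho> t (x 1))
        (\<lambda>t k x. - H_flux \<Omega> K 1 (pair_density \<rho> t) x) t x)"
  (is "_ \<longleftrightarrow> ?c \<and> ?i \<and> ?m")
proof -
  have i: "integrable (Om \<Omega> {1}) (\<lambda>x. - H_flux \<Omega> K 1 (pair_density \<rho> t) x)" if ?c "0 \<le> t" for t
    by (intro Bochner_Integration.integrable_minus H_flux_L1(2) cont_L1_integrable[OF cont_L1_pair_density[OF that(1)] that(2)]) auto
  show ?thesis
    unfolding McKean_Vlasov_solution_def mild_solution_iff C0_L1_iff atLeastAtMost_singleton H_flux_pair_density[symmetric]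
    using i cont_L1_integrable by blast
qed

text \<open>The difference of the fluxes is at most \<open>B * R\<close> times the difference of the
  solutions. Inserted into \<open>mild_difference_bound\<close>, this is the step inequality of
  \<open>short_time_Gronwall\<close>.\<close>

theorem McKean_Vlasov_unique:
  assumes \<rho>: "McKean_Vlasov_solution \<Omega> K f \<rho>" and \<rho>': "McKean_Vlasov_solution \<Omega> K f \<rho>'" and T: "0 \<le> T"
  shows "AE x in omega \<Omega>. \<rho>' T x = \<rho> T x"
proof -
  let ?N = "Om \<Omega> {1} :: (nat \<Rightarrow> real^'d) measure" and ?C = "2 powr (real CARD('d) / 2)"
  note S = \<rho>[unfolded McKean_Vlasov_iff] and S' = \<rho>'[unfolded McKean_Vlasov_iff]
  have c: "cont_L1 ?N (\<lambda>t x. \<rho> t (x 1))" and c': "cont_L1 ?N (\<lambda>t x. \<rho>' t (x 1))" using S S' by blast+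
  interpret H: heat_kernels ?N "hk \<Omega> {1}" "ghk \<Omega> {1}" "{1}" ?C by (rule heat_kernels_Om) simp
  define \<phi> where "\<phi> t = (\<integral>x. \<bar>\<rho> t (x 1) - \<rho>' t (x 1)\<bar> \<partial>?N)" for t
  have di: "integrable ?N (\<lambda>x. \<rho> t (x 1) - \<rho>' t (x 1))" if "0 \<le> t" for t
    by (rule Bochner_Integration.integrable_diff[OF cont_L1_integrable[OF c that] cont_L1_integrable[OF c' that]])
  have init: "AE x in ?N. \<rho> 0 (x 1) = \<rho>' 0 (x 1)"
  proof -
    have "AE y in omega \<Omega>. \<rho> 0 y = \<rho>' 0 y" using S[THEN conjunct2, THEN conjunct1] S'[THEN conjunct2, THEN conjunct1] by eventually_elim simp
    moreover have "(\<lambda>x. x 1) \<in> ?N \<rightarrow>\<^sub>M omega \<Omega>" by (rule measurable_component_singleton) simp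
    ultimately show ?thesis
      by (intro AE_distrD[where f = "\<lambda>x. x 1" and M' = "omega \<Omega>"]) (simp_all only: product_sigma_finite.distr_singleton[OF product_sigma_finite_omega])
  qed
  \<comment> \<open>No bound on the masses of the two solutions is given in advance, but on
    \<open>{0..T}\<close> the continuous function \<open>?r\<close> attains a maximum
    \<open>R\<close>, which serves as Lipschitz constant of the tensor square.\<close>
  let ?r = "\<lambda>t. (\<integral>x. norm (\<rho> t (x 1)) \<partial>?N) + (\<integral>x. norm (\<rho>' t (x 1)) \<partial>?N)"
  have "continuous_on {0..T} ?r"
    by (intro continuous_on_add continuous_on_subset[OF cont_L1_norm_continuous[OF c]] continuous_on_subset[OF cont_L1_norm_continuous[OF c']]) auto
  then have "\<exists>u\<in>{0..T}. \<forall>s\<in>{0..T}. ?r s \<le> ?r u"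
    by (intro continuous_attains_sup) (use T in auto)
  then obtain u where u: "\<And>s. s \<in> {0..T} \<Longrightarrow> ?r s \<le> ?r u" by blast
  define R where "R = ?r u"
  have R: "0 \<le> R" by (simp add: R_def)
  let ?G = "\<lambda>\<rho> s k x. - H_flux \<Omega> K 1 (pair_density \<rho> s) x"
  have cG: "cont_L1 ?N (\<lambda>s. ?G \<rho> s k)" if "cont_L1 ?N (\<lambda>t x. \<rho> t (x 1))" for \<rho> :: "real \<Rightarrow> real^'d \<Rightarrow> real" and k :: nat
    by (rule cont_L1_minus[OF cont_L1_H_flux[OF _ _ _ cont_L1_pair_density[OF that]]]) auto
  have "\<phi> T = 0"
  proof (rule short_time_Gronwall[of \<phi> "2 * ?C * (B * R)"])
    show "continuous_on {0..} \<phi>" unfolding \<phi>_def using cont_L1_norm_continuous[OF cont_L1_diff[OF c c']] by simp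
    show "\<phi> 0 = 0" unfolding \<phi>_def
      by (rule integral_eq_zero_AE) (use init in eventually_elim, simp)
    show "0 \<le> \<phi> t" for t by (simp add: \<phi>_def)
    show "0 \<le> 2 * ?C * (B * R)" using B_nonneg R by simp
    fix a t m :: real
    assume a: "0 \<le> a" "a \<le> t" "0 < t" and tT: "t \<le> T" and m: "0 \<le> m"
      and le: "\<And>s. s \<in> {0..<t} \<Longrightarrow> \<phi> s \<le> (if s < a then 0 else m)"
    have "(\<integral>\<^sup>+x. ennreal \<bar>\<rho> t (x 1) - \<rho>' t (x 1)\<bar> \<partial>?N) \<le> ennreal (2 * ?C * (B * R * m) * sqrt (t - a))"
    proof (rule H.mild_difference_bound[where h = "\<lambda>t x. \<rho> t (x 1)" and h' = "\<lambda>t x. \<rho>' t (x 1)" and G = "?G \<rho>" and G' = "?G \<rho>'"])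
      show "AE x in ?N. \<rho> 0 (x 1) = \<rho>' 0 (x 1)" by (rule init)
      show "0 \<le> B * R * m" using B_nonneg R m by simp
      fix s assume s: "s \<in> {0..<t}"
      then have s0: "0 \<le> s" and sT: "s \<in> {0..T}" using tT by auto
      have "(\<Sum>k\<in>{1::nat}. \<integral>x. norm (?G \<rho> s k x - ?G \<rho>' s k x) \<partial>?N)
        = (\<integral>x. norm (H_flux \<Omega> K 1 (pair_density \<rho> s) x - H_flux \<Omega> K 1 (pair_density \<rho>' s) x) \<partial>?N)"
        by (simp add: norm_minus_commute)
      also have "\<dots> \<le> B * (\<integral>z. norm (pair_density \<rho> s z - pair_density \<rho>' s z) \<partial>Om \<Omega> (insert star {1}))"
        by (rule H_flux_diff_L1) (simp_all add: cont_L1_integrable[OF cont_L1_pair_density[OF c] s0, simplified] cont_L1_integrable[OF cont_L1_pair_density[OF c'] s0, simplified])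
      also have "\<dots> \<le> B * (\<phi> s * ?r s)" unfolding \<phi>_def
        by (intro mult_left_mono pair_density_diff_L1 B_nonneg cont_L1_integrable[OF c s0] cont_L1_integrable[OF c' s0])
      also have "\<dots> \<le> B * ((if s < a then 0 else m) * R)"
        by (intro mult_left_mono mult_mono le s B_nonneg u[OF sT, folded R_def] add_nonneg_nonneg integral_nonneg_AE) (use m in auto)
      finally show "(\<Sum>k\<in>{1::nat}. \<integral>x. norm (?G \<rho> s k x - ?G \<rho>' s k x) \<partial>?N) \<le> (if s < a then 0 else B * R * m)"
        by (simp add: mult_ac split: if_splits)
    qed (use S S' a cG[OF c] cG[OF c'] cont_L1_integrable[OF c] cont_L1_integrable[OF c'] in blast)+
    moreover have "(\<integral>\<^sup>+x. ennreal \<bar>\<rho> t (x 1) - \<rho>' t (x 1)\<bar> \<partial>?N) = ennreal (\<phi> t)"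
      unfolding \<phi>_def by (rule nn_integral_eq_integral) (use di[of t] a in auto)
    moreover have "0 \<le> 2 * ?C * (B * R * m) * sqrt (t - a)" using B_nonneg R m a by simp
    ultimately show "\<phi> t \<le> 2 * ?C * (B * R) * m * sqrt (t - a)" by (simp add: mult_ac)
  qed (rule T)
  then have "AE x in ?N. \<bar>\<rho> T (x 1) - \<rho>' T (x 1)\<bar> = 0"
    unfolding \<phi>_def by (subst (asm) integral_nonneg_eq_0_iff_AE) (use integrable_abs[OF di[OF T]] in auto)
  then have "AE x in ?N. \<rho>' T (x 1) = \<rho> T (x 1)" by eventually_elim simp
  then show ?thesis by (rule AE_Om_singleton)
qed

end

section \<open>The one-particle function of order 0 solves the McKean-Vlasov equation\<close>

context hierarchy
begin

lemma pf_singleton: "pf {1} 0 t x = rho t (x 1)"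
proof -
  have "pf {1} 0 t x = block g 0 {1} t x"
    using pf_insert[of "{}" 1 0 t x] by (simp add: pf_empty del: One_nat_def)
  then show ?thesis by (simp only: block_singleton)
qed

text \<open>This is the equation for partition sums with \<open>I = {1}\<close> and
  \<open>i = 0\<close>, in which the two-particle function factorises into
  \<open>pair_density rho\<close>.\<close>

lemma McKean_Vlasov_rho: "McKean_Vlasov_solution \<Omega> K f rho"
  unfolding McKean_Vlasov_iff
proof (intro conjI allI impI)
  let ?N = "Om \<Omega> {1} :: (nat \<Rightarrow> real^'d) measure"
  interpret H: heat_kernels ?N "hk \<Omega> {1}" "ghk \<Omega> {1}" "{1}" "2 powr (real CARD('d) / 2)" by (rule heat_kernels_Om) simp
  have I: "finite {1::nat}" "star \<notin> {1}" by auto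
  have h: "pf {1} 0 = (\<lambda>t x. rho t (x 1))" by (intro ext) (rule pf_singleton)
  show c: "cont_L1 ?N (\<lambda>t x. rho t (x 1))" using cont_L1_pf[OF I(1), of 0] unfolding h .
  have "AE x in ?N. rho 0 (x 1) = f (x 1)"
    using pf_initial[OF I(1), of 0] by eventually_elim (simp only: pf_singleton refl if_True, simp)
  then show "AE x in omega \<Omega>. rho 0 x = f x" by (rule AE_Om_singleton)
  note p = cont_L1_pair_density[OF c]
  have aT: "AE x in ?N. Fl 0 {1} s k x = - H_flux \<Omega> K 1 (pair_density rho s) x" if k: "k \<in> {1}" and s: "0 \<le> s" for s k
  proof -
    have k1: "k = 1" using k by simp
    have "AE z in Om \<Omega> (insert star {1}). pf (insert star {1}) 0 s z = pair_density rho s z"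
      using pf_zero_product[OF finite.insertI[OF I(1)] s, of star] by eventually_elim (simp add: pair_density_def)
    from H_flux_cong_AE[OF I k cont_L1_integrable[OF cont_L1_pf s] cont_L1_integrable[OF p s] this]
    have "AE x in ?N. H_flux \<Omega> K k (pf (insert star {1}) 0 s) x = H_flux \<Omega> K k (pair_density rho s) x" by simp
    with Fl_eq[OF I k s, of 0] show ?thesis
      by eventually_elim (simp add: k1)
  qed
  fix t :: real assume t: "0 < t"
  have "AE x in ?N. duhamel_eq ?N (hk \<Omega> {1}) (ghk \<Omega> {1}) {1} (\<lambda>t x. rho t (x 1)) (Fl 0 {1}) t x"
    by (rule H.evolution_imp_mild[OF cont_L1_Fl[OF I] evol_pf[OF I, of 0, unfolded h] t])
  then show "AE x in ?N. duhamel_eq ?N (hk \<Omega> {1}) (ghk \<Omega> {1}) {1} (\<lambda>t x. rho t (x 1)) (\<lambda>t k x. - H_flux \<Omega> K 1 (pair_density rho t) x) t x"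
    using AE_space
  proof eventually_elim
    case (elim x)
    show ?case
    proof (rule H.duhamel_eq_cong_AE[OF _ _ _ elim(2,1)])
      fix k s assume k: "k \<in> {1::nat}" and s: "0 \<le> (s :: real)"
      show "integrable ?N (Fl 0 {1} s k)" by (rule cont_L1_integrable[OF cont_L1_Fl[OF I k] s])
      show "integrable ?N (\<lambda>x. - H_flux \<Omega> K 1 (pair_density rho s) x)"
        by (intro Bochner_Integration.integrable_minus H_flux_L1(2) cont_L1_integrable[OF p s]) auto
      show "AE x in ?N. Fl 0 {1} s k x = - H_flux \<Omega> K 1 (pair_density rho s) x" by (rule aT[OF k s])
    qed
  qed
qed

end

theorem theorem1p3:
  fixes \<Omega> :: domain
    and K :: "real^'d \<Rightarrow> real^'d \<Rightarrow> real^'d"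
    and f :: "real^'d \<Rightarrow> real"
    and g :: "nat \<Rightarrow> nat \<Rightarrow> real \<Rightarrow> (nat \<Rightarrow> real^'d) \<Rightarrow> real"
  assumes f_L1: "integrable (omega \<Omega>) f"
    and f_nonneg: "AE x in omega \<Omega>. 0 \<le> f x"
    and f_mass: "(\<integral>x. f x \<partial>omega \<Omega>) = 1"
    and K: "Linf_delta \<Omega> K"
    and g: "hierarchy_family \<Omega> K f g"
  shows
    "(\<forall>i. \<forall>j\<ge>1. mild_solution \<Omega> j (f_family g i j)
        (\<lambda>t k x.
           - (\<integral>y. f_family g i (j + 1) t (x(j + 1 := y)) *\<^sub>R K (x k) y \<partial>omega \<Omega>)
           - (\<Sum>l\<in>{1..j}. f_pred g i j t x *\<^sub>R K (x k) (x l))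
           + real j *\<^sub>R (\<integral>y. f_pred g i (j + 1) t (x(j + 1 := y)) *\<^sub>R K (x k) y \<partial>omega \<Omega>)))
     \<and> (\<forall>j\<ge>1. AE x in omega_pow \<Omega> j. f_family g 0 j 0 x = (\<Prod>k\<in>{1..j}. f (x k)))
     \<and> (\<forall>i\<ge>1. \<forall>j\<ge>1. AE x in omega_pow \<Omega> j. f_family g i j 0 x = 0)
     \<and> (\<exists>\<rho>. McKean_Vlasov_solution \<Omega> K f \<rho>
          \<and> (\<forall>\<rho>'. McKean_Vlasov_solution \<Omega> K f \<rho>' \<longrightarrow>
                (\<forall>t\<ge>0. AE x in omega \<Omega>. \<rho>' t x = \<rho> t x))
          \<and> (\<forall>j\<ge>1. \<forall>t\<ge>0. AE x in omega_pow \<Omega> j.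
                f_family g 0 j t x = (\<Prod>k\<in>{1..j}. \<rho> t (x k))))"
proof -
  obtain B where "bounded_interaction \<Omega> K B" using Linf_delta_bounded_interaction[OF K] by blast
  then interpret hierarchy \<Omega> K B f g using g by (intro hierarchy.intro hierarchy_axioms.intro)
  have initial: "AE x in Om \<Omega> {1..j}. f_family g i j 0 x = (if i = 0 then (\<Prod>k\<in>{1..j}. f (x k)) else 0)" for i j
    unfolding f_family_eq by (rule pf_initial) simp
  show ?thesis
    unfolding omega_pow_def
  proof (intro conjI allI impI exI[of _ rho])
    fix i j :: nat
    show "AE x in Om \<Omega> {1..j}. f_family g 0 j 0 x = (\<Prod>k\<in>{1..j}. f (x k))" using initial[where i = 0] by simp
    show "AE x in Om \<Omega> {1..j}. f_family g i j 0 x = 0" if "1 \<le> i" using initial[where i = i] that by simp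
    show "AE x in Om \<Omega> {1..j}. f_family g 0 j t x = (\<Prod>k\<in>{1..j}. rho t (x k))" if "0 \<le> t" for t
      unfolding f_family_eq by (rule pf_zero_product) (use that in simp_all)
  qed (rule f_family_mild McKean_Vlasov_rho McKean_Vlasov_unique[OF McKean_Vlasov_rho]; assumption?)+
qed

end
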